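(* Let $n\ge1$, $T>0$, and let $M\in\mathbb{R}^{n\times n}$ be a matrix all of whose eigenvalues have strictly positive real part. Let $W$ be an $n$-dimensional standard Brownian motion and, for each $m>0$ ("mass"), let $(X,P)=(X^{(m)},P^{(m)})$ be the solution of the stochastic differential equations $$dX=\frac1m P\,dt,\qquad dP=-\frac1m MP\,dt+dW,$$ with zero initial position and momentum, $X_0=P_0=0$. Define $$C=\int_0^\infty e^{-Ms}e^{-M^*s}\,ds,$$ and for $0\le s<t\le T$ let $$\mathbb{W}_{s,t}=\int_s^t (W_r-W_s)\otimes\circ\, dW_r \ \text{ (Stratonovich)},\qquad \widehat{\mathbb{W}}_{s,t}=\mathbb{W}_{s,t}+(t-s)\,\tfrac12\left(MC-CM^*\right).$$ Then, as $m\to0$, $MX$ converges to $\widehat{\mathbf{W}}=(W,\widehat{\mathbb{W}})$ in $L^q$ and $\alpha$-Hölder rough path topology for every $q\ge1$ and every $\alpha\in(1/3,1/2)$; that is, $$\sup_{0\le s<t\le T}\frac{|MX_{s,t}-W_{s,t}|}{|t-s|^{\alpha}}+\sup_{0\le s<t\le T}\frac{\left|\int_s^t MX_{s,r}\otimes d(MX)_r-\widehat{\mathbb{W}}_{s,t}\right|}{|t-s|^{2\alpha}}\longrightarrow0\quad\text{in }L^q$$ as $m\to0$. Moreover this convergence is of rate arbitrarily close to $1/2-\alpha$: for all such $q,\alpha$ and every $\eta<1/2-\alpha$, the $L^q$ norm of the left-hand side is $O(m^{\eta})$ as $m\to0$.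
   Context: For a path $Z$ write $Z_{s,t}=Z_t-Z_s$. $M^*$ denotes the transpose of $M$. $\mathbb{R}^n\otimes\mathbb{R}^n$ is identified with $\mathbb{R}^{n\times n}$ via $a\otimes b=ab^{*}$, so $\int_s^t (W_r-W_s)\otimes\circ\,dW_r$ has $(i,j)$ entry $\int_s^t (W^i_r-W^i_s)\circ dW^j_r$. The path $X$ is continuously differentiable, so $\int_s^t MX_{s,r}\otimes d(MX)_r$ is a classical Riemann–Stieltjes integral. $|\cdot|$ is the Euclidean norm on vectors (resp. any fixed norm on matrices). $L^q$ is the $L^q$ space of the underlying probability space. *)

theory Defs
  imports "HOL-Probability.Probability"
begin

subsection \<open>Matrices\<close>

definition tensor :: "real^'n \<Rightarrow> real^'n \<Rightarrow> real^'n^'n" where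
  "tensor a b = (\<chi> i j. a $ i * b $ j)"

text \<open>All complex eigenvalues of the real matrix lie in the open right half plane.\<close>

definition eigenvalues_pos_real_part :: "real^'n^'n \<Rightarrow> bool" where
  "eigenvalues_pos_real_part A \<longleftrightarrow>
     (\<forall>(l::complex) (v::complex^'n).
        v \<noteq> 0 \<and> map_matrix complex_of_real A *v v = l *s v \<longrightarrow> Re l > 0)"

text \<open>
  Multiplication, and hence \<open>(^)\<close>, on \<^typ>\<open>real^'n^'n\<close> is entrywise, and the type is not an
  instance of \<^class>\<open>real_normed_algebra_1\<close>, so the library's \<open>exp\<close> is not available for matrices.
\<close>

definition mat_pow :: "real^'n^'n \<Rightarrow> nat \<Rightarrow> real^'n^'n" where
  "mat_pow A k = (((**) A) ^^ k) (mat 1)"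

definition mat_exp :: "real^'n^'n \<Rightarrow> real^'n^'n" where
  "mat_exp A = (\<Sum>k. (1 / fact k) *\<^sub>R mat_pow A k)"

definition cov_mat :: "real^'n^'n \<Rightarrow> real^'n^'n" where
  "cov_mat A = integral {0..} (\<lambda>s. mat_exp (- (s *\<^sub>R A)) ** mat_exp (- (s *\<^sub>R transpose A)))"

subsection \<open>Partitions and integrals\<close>

text \<open>The points \<open>\<tau> 0 \<le> \<dots> \<le> \<tau> k\<close> partition \<open>[a, b]\<close> with mesh less than \<open>\<delta>\<close>.\<close>

definition partition_mesh :: "real \<Rightarrow> real \<Rightarrow> real \<Rightarrow> nat \<Rightarrow> (nat \<Rightarrow> real) \<Rightarrow> bool" where
  "partition_mesh a b \<delta> k \<tau> \<longleftrightarrow>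
     \<tau> 0 = a \<and> \<tau> k = b \<and> (\<forall>i<k. \<tau> i \<le> \<tau> (Suc i) \<and> \<tau> (Suc i) - \<tau> i < \<delta>)"

definition has_rs_integral ::
    "(real \<Rightarrow> real^'n) \<Rightarrow> (real \<Rightarrow> real^'n) \<Rightarrow> real \<Rightarrow> real \<Rightarrow> real^'n^'n \<Rightarrow> bool" where
  "has_rs_integral f g a b I \<longleftrightarrow>
     (\<forall>\<epsilon>>0. \<exists>\<delta>>0. \<forall>k \<tau> \<xi>.
        partition_mesh a b \<delta> k \<tau> \<and> (\<forall>i<k. \<xi> i \<in> {\<tau> i..\<tau> (Suc i)}) \<longrightarrow>
        norm ((\<Sum>i<k. tensor (f (\<xi> i)) (g (\<tau> (Suc i)) - g (\<tau> i))) - I) < \<epsilon>)"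

text \<open>The Riemann--Stieltjes integral of \<open>f \<otimes> dg\<close> over \<open>[a, b]\<close>.\<close>

definition rs_integral ::
    "(real \<Rightarrow> real^'n) \<Rightarrow> (real \<Rightarrow> real^'n) \<Rightarrow> real \<Rightarrow> real \<Rightarrow> real^'n^'n" where
  "rs_integral f g a b = (THE I. has_rs_integral f g a b I)"

text \<open>
  \<open>I\<close> is a version of the Stratonovich integral of \<open>Y\<close> against \<open>Z\<close> over \<open>[a, b]\<close>: the limit in
  probability, as the mesh tends to 0, of the sums that evaluate the integrand by the average of
  its values at the two endpoints of each partition interval.
\<close>

definition has_stratonovich_integral ::
    "'w measure \<Rightarrow> (real \<Rightarrow> 'w \<Rightarrow> real) \<Rightarrow> (real \<Rightarrow> 'w \<Rightarrow> real) \<Rightarrow> real \<Rightarrow> real \<Rightarrow> ('w \<Rightarrow> real) \<Rightarrow> bool"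
  where
  "has_stratonovich_integral \<Omega> Y Z a b I \<longleftrightarrow>
     I \<in> borel_measurable \<Omega> \<and>
     (\<forall>\<epsilon>>0. \<exists>\<delta>>0. \<forall>k \<tau>. partition_mesh a b \<delta> k \<tau> \<longrightarrow>
        measure \<Omega> {\<omega> \<in> space \<Omega>.
          \<bar>(\<Sum>i<k. (Y (\<tau> i) \<omega> + Y (\<tau> (Suc i)) \<omega>) / 2 * (Z (\<tau> (Suc i)) \<omega> - Z (\<tau> i) \<omega>)) - I \<omega>\<bar> > \<epsilon>}
        < \<epsilon>)"

subsection \<open>Processes\<close>

text \<open>Standard \<open>n\<close>-dimensional Brownian motion on \<open>[0, \<infinity>)\<close>; the density is that of \<open>N(0, (t - s) Id)\<close>.\<close>

definition brownian_motion :: "'w measure \<Rightarrow> (real \<Rightarrow> 'w \<Rightarrow> real^'n) \<Rightarrow> bool" where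
  "brownian_motion \<Omega> W \<longleftrightarrow>
     (\<forall>t\<ge>0. W t \<in> borel_measurable \<Omega>) \<and>
     (AE \<omega> in \<Omega>. W 0 \<omega> = 0) \<and>
     (AE \<omega> in \<Omega>. continuous_on {0..} (\<lambda>t. W t \<omega>)) \<and>
     (\<forall>s t. 0 \<le> s \<and> s < t \<longrightarrow>
        distributed \<Omega> lborel (\<lambda>\<omega>. W t \<omega> - W s \<omega>)
          (\<lambda>x. ennreal (\<Prod>i\<in>UNIV. normal_density 0 (sqrt (t - s)) (x $ i)))) \<and>
     (\<forall>(k::nat) \<tau>. 0 \<le> \<tau> 0 \<and> (\<forall>i<k. \<tau> i < \<tau> (Suc i)) \<longrightarrow>
        prob_space.indep_vars \<Omega> (\<lambda>_. borel) (\<lambda>i \<omega>. W (\<tau> (Suc i)) \<omega> - W (\<tau> i) \<omega>) {..<k})"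

text \<open>
  Solution of \<open>dX = (1/m) P dt\<close>, \<open>dP = -(1/m) A P dt + dW\<close> with \<open>X 0 = P 0 = 0\<close>. The noise is
  additive, so the stochastic differential equation is its integral form along almost every path,
  the stochastic integral of the constant 1 being the increment of \<open>W\<close>.
\<close>

definition langevin_solution ::
    "'w measure \<Rightarrow> real^'n^'n \<Rightarrow> (real \<Rightarrow> 'w \<Rightarrow> real^'n) \<Rightarrow> real \<Rightarrow>
     (real \<Rightarrow> 'w \<Rightarrow> real^'n) \<Rightarrow> (real \<Rightarrow> 'w \<Rightarrow> real^'n) \<Rightarrow> bool" where
  "langevin_solution \<Omega> A W m X P \<longleftrightarrow>
     (\<forall>t\<ge>0. X t \<in> borel_measurable \<Omega> \<and> P t \<in> borel_measurable \<Omega>) \<and>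
     (AE \<omega> in \<Omega>.
        X 0 \<omega> = 0 \<and> P 0 \<omega> = 0 \<and>
        continuous_on {0..} (\<lambda>t. X t \<omega>) \<and> continuous_on {0..} (\<lambda>t. P t \<omega>) \<and>
        (\<forall>t\<ge>0.
          X t \<omega> = X 0 \<omega> + integral {0..t} (\<lambda>r. (1 / m) *\<^sub>R P r \<omega>) \<and>
          P t \<omega> = P 0 \<omega> + integral {0..t} (\<lambda>r. - ((1 / m) *\<^sub>R (A *v P r \<omega>))) + (W t \<omega> - W 0 \<omega>)))"

text \<open>
  The Stratonovich integrals of \<open>(W r - W s) \<otimes> dW r\<close> over \<open>[s, t]\<close>, which for fixed \<open>s\<close>, \<open>t\<close> are
  determined only almost surely, in a version with almost surely continuous paths in \<open>(s, t)\<close>.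
\<close>

definition stratonovich_area ::
    "'w measure \<Rightarrow> real \<Rightarrow> (real \<Rightarrow> 'w \<Rightarrow> real^'n) \<Rightarrow> (real \<Rightarrow> real \<Rightarrow> 'w \<Rightarrow> real^'n^'n) \<Rightarrow> bool" where
  "stratonovich_area \<Omega> T W WW \<longleftrightarrow>
     (\<forall>s t i j. 0 \<le> s \<and> s \<le> t \<and> t \<le> T \<longrightarrow>
        has_stratonovich_integral \<Omega> (\<lambda>r \<omega>. W r \<omega> $ i - W s \<omega> $ i) (\<lambda>r \<omega>. W r \<omega> $ j) s t
          (\<lambda>\<omega>. WW s t \<omega> $ i $ j)) \<and>
     (AE \<omega> in \<Omega>. continuous_on {(s, t). 0 \<le> s \<and> s \<le> t \<and> t \<le> T} (\<lambda>(s, t). WW s t \<omega>))"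

definition corrected_area ::
    "real^'n^'n \<Rightarrow> (real \<Rightarrow> real \<Rightarrow> 'w \<Rightarrow> real^'n^'n) \<Rightarrow> real \<Rightarrow> real \<Rightarrow> 'w \<Rightarrow> real^'n^'n" where
  "corrected_area A WW s t \<omega> =
     WW s t \<omega> + (t - s) *\<^sub>R ((1 / 2) *\<^sub>R (A ** cov_mat A - cov_mat A ** transpose A))"

subsection \<open>Hoelder distance and \<open>L\<^sup>q\<close> norm\<close>

definition hoelder_sup ::
    "real \<Rightarrow> real \<Rightarrow> (real \<Rightarrow> real \<Rightarrow> 'a::real_normed_vector) \<Rightarrow> ennreal" where
  "hoelder_sup T \<beta> R =
     (SUP (s, t)\<in>{(s, t). 0 \<le> s \<and> s < t \<and> t \<le> T}. ennreal (norm (R s t) / \<bar>t - s\<bar> powr \<beta>))"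

text \<open>
  The distance of the path \<open>Y\<close>, lifted by its Riemann--Stieltjes integrals, to the path \<open>Z\<close> with
  second level \<open>ZZ\<close>. The norm on matrices is the library's, i.e. the Frobenius norm.
\<close>

definition rough_dist ::
    "real \<Rightarrow> real \<Rightarrow> (real \<Rightarrow> real^'n) \<Rightarrow> (real \<Rightarrow> real^'n) \<Rightarrow> (real \<Rightarrow> real \<Rightarrow> real^'n^'n) \<Rightarrow> ennreal"
  where
  "rough_dist T \<alpha> Y Z ZZ =
     hoelder_sup T \<alpha> (\<lambda>s t. (Y t - Y s) - (Z t - Z s)) +
     hoelder_sup T (2 * \<alpha>) (\<lambda>s t. rs_integral (\<lambda>r. Y r - Y s) Y s t - ZZ s t)"

definition enn_powr :: "ennreal \<Rightarrow> real \<Rightarrow> ennreal" where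
  "enn_powr x p = (if x = \<infinity> then \<infinity> else ennreal (enn2real x powr p))"

text \<open>
  For \<open>f\<close> that is not measurable the nonnegative integral is a lower integral, but its value is
  invariant under changes of \<open>f\<close> on null sets. This matters for suprema over a continuum of times
  of almost surely continuous processes: these agree almost surely with countable suprema.
\<close>

definition Lq_norm :: "'w measure \<Rightarrow> real \<Rightarrow> ('w \<Rightarrow> ennreal) \<Rightarrow> ennreal" where
  "Lq_norm \<Omega> q f = enn_powr (\<integral>\<^sup>+ \<omega>. enn_powr (f \<omega>) q \<partial>\<Omega>) (1 / q)"

end

theory Submission
  imports Defs "HOL-Computational_Algebra.Fundamental_Theorem_Algebra"
begin

text \<open>
  Put \<open>Y = MX\<close>. The two equations give \<open>dY = (1/m) MP dt\<close> and \<open>Y = W - P\<close>, so the first level of the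
  distance is the Hoelder norm of the momentum \<open>P\<close>. This is an Ornstein--Uhlenbeck process with
  relaxation time of order \<open>m\<close>: its increments over a time \<open>h\<close> are of size \<open>sqrt (min m h)\<close> in every
  \<open>L\<^sup>q\<close>.

  For the second level, integration by parts turns \<open>\<integral> Y \<otimes> dY\<close> into
  \<open>\<integral> Y \<otimes> dW - Y \<otimes> P + M S\<close> with \<open>S = (1/m) \<integral> P \<otimes> P dr\<close>. The martingale \<open>\<integral> P \<otimes> dW\<close> and the boundary
  term are of size \<open>sqrt (m h)\<close>. Expanding \<open>d (P \<otimes> P)\<close> shows \<open>M S + S M\<^sup>* = h I + O (sqrt (m h))\<close>, while
  \<open>C\<close> solves the Lyapunov equation \<open>M C + C M\<^sup>* = I\<close>. The operator \<open>S \<mapsto> M S + S M\<^sup>*\<close> is invertible because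
  the spectrum of \<open>M\<close> lies in the right half plane, whence \<open>M S = h M C + O (sqrt (m h))\<close>. Passing from
  the Ito to the Stratonovich integral of \<open>W\<close> subtracts \<open>h I / 2\<close>, and \<open>M C - I / 2 = (M C - C M\<^sup>*) / 2\<close>
  is the asserted correction. The error is \<open>O (sqrt (m h))\<close> when \<open>h \<ge> m\<close>, and \<open>O (h)\<close> by direct
  estimation when \<open>h \<le> m\<close>.

  These computations are carried out for the Euler scheme on a dyadic grid, where \<open>P\<close> is a linear
  function of finitely many independent Gaussian increments. Every error term is then a sum of
  martingale differences, and one elementary inequality (\<open>martingale_moment\<close>) bounds its moments, with
  constants that do not depend on the grid (\<open>mom_incr_moment\<close>, \<open>defect_small\<close>, \<open>defect_large\<close>). Along
  almost every path the scheme converges to the solution (\<open>euler_converges\<close>, \<open>euler_area_tendsto\<close>), and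
  the trapezoidal sums of \<open>W\<close> converge to the Stratonovich integral along a subsequence, so that Fatou's
  lemma carries the bounds over to the processes (\<open>P_incr_moment\<close>, \<open>area_error_moment\<close>).

  It remains to pass from moments of increments between neighbouring dyadic points to the Hoelder
  suprema. As in Kolmogorov's criterion, \<open>dyadic_sup_moment\<close> finds one random constant that controls all
  these increments at the cost of any small part of the exponent; \<open>hoelder_bound\<close> then extends the control
  to all times by chaining, with Chen's relation accounting for the second level being not additive.
  Sacrificing the exponent \<open>1/2 - \<beta>\<close> of \<open>h\<close>, for \<open>\<alpha> < \<beta> < 1/2\<close>, is what yields the factor
  \<open>m powr (1/2 - \<beta>)\<close>, hence the rate.
\<close>

section \<open>Matrices whose spectrum lies in the right half plane\<close>

text \<open>
  The vector \<open>p(A) v\<close>. Horner's scheme makes multiplication of \<open>p\<close> by a linear factor accessible to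
  induction on \<open>p\<close>.
\<close>

definition poly_act :: "complex^'n^'n \<Rightarrow> complex poly \<Rightarrow> complex^'n \<Rightarrow> complex^'n" where
  "poly_act A p v = fold_coeffs (\<lambda>a w. a *s v + A *v w) p 0"

lemma poly_act_0 [simp]: "poly_act A 0 v = 0"
  by (simp add: poly_act_def)

lemma poly_act_pCons [simp]: "poly_act A (pCons a p) v = a *s v + A *v poly_act A p v"
  by (cases "p = 0 \<and> a = 0") (auto simp: poly_act_def)

lemma poly_act_add: "poly_act A (p + q) v = poly_act A p v + poly_act A q v"
  by (induction p q rule: poly_induct2)
     (auto simp: matrix_vector_right_distrib vector_sadd_rdistrib)

lemma poly_act_smult: "poly_act A (smult c p) v = c *s poly_act A p v"
  by (induction p)
     (auto simp: vec.scale_right_distrib vector_scalar_commute)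

lemma poly_act_sum: "finite I \<Longrightarrow> poly_act A (\<Sum>i\<in>I. f i) v = (\<Sum>i\<in>I. poly_act A (f i) v)"
  by (induction I rule: finite_induct) (auto simp: poly_act_add)

lemma poly_act_monom: "poly_act A (monom c k) v = c *s (((*v) A) ^^ k) v"
  by (induction k) (auto simp: monom_0 monom_Suc vector_scalar_commute)

lemma poly_act_linear_factor:
  "poly_act A ([:- l, 1:] * q) v = A *v poly_act A q v - l *s poly_act A q v"
proof -
  have "[:- l, 1:] * q = smult (- l) q + pCons 0 q" by simp
  then show ?thesis by (simp only: poly_act_add poly_act_smult poly_act_pCons) simp
qed

lemma poly_act_commute:
  "poly_act A q (A *v v - l *s v) = A *v poly_act A q v - l *s poly_act A q v"
proof (induction q)
  case 0 then show ?case by simp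
next
  case (pCons a q)
  have 1: "poly_act A (pCons a q) (A *v v - l *s v)
      = a *s (A *v v - l *s v) + A *v (A *v poly_act A q v - l *s poly_act A q v)"
    using pCons.IH by simp
  show ?case unfolding 1
    by (simp add: vec.scale_right_distrib vec.scale_right_diff_distrib matrix_vector_right_distrib
        matrix_vector_mult_diff_distrib vector_scalar_commute[symmetric])
qed

text \<open>
  The \<open>n + 1\<close> vectors \<open>v, A v, \<dots>, A\<^sup>n v\<close> are linearly dependent or not pairwise distinct.
\<close>

lemma ex_annihilating_poly:
  fixes A :: "complex^'n^'n"
  obtains p where "p \<noteq> 0" "poly_act A p v = 0"
proof -
  define f where "f i = (((*v) A) ^^ i) v" for i
  show ?thesis
  proof (cases "inj_on f {..CARD('n)}")
    case False
    then obtain i j where ij: "i \<noteq> j" "f i = f j" by (auto simp: inj_on_def)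
    let ?p = "monom 1 i + monom (-1) j :: complex poly"
    have "coeff ?p i = 1" using ij by simp
    then have "?p \<noteq> 0" by (metis coeff_0 zero_neq_one)
    moreover have "poly_act A ?p v = 0"
      using ij by (simp add: poly_act_add poly_act_monom f_def)
    ultimately show ?thesis by (rule that)
  next
    case True
    have "vec.dependent (f ` {..CARD('n)})"
    proof (rule ccontr)
      assume "\<not> vec.dependent (f ` {..CARD('n)})"
      then have "card (f ` {..CARD('n)}) \<le> vec.dim (UNIV :: (complex^'n) set)"
        by (intro vec.independent_card_le_dim) auto
      then show False unfolding card_image[OF True] vec_dim_card by simp
    qed
    then obtain u where u: "(\<Sum>x\<in>f ` {..CARD('n)}. u x *s x) = 0" "\<exists>x\<in>f ` {..CARD('n)}. u x \<noteq> 0"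
      using vec.dependent_finite[of "f ` {..CARD('n)}"] by auto
    then obtain i where i: "i \<le> CARD('n)" "u (f i) \<noteq> 0" by auto
    let ?p = "\<Sum>i\<le>CARD('n). monom (u (f i)) i"
    have "coeff ?p i = u (f i)" using i by (simp add: coeff_sum)
    then have "?p \<noteq> 0" using i by (metis coeff_0)
    moreover have "poly_act A ?p v = 0"
      using u(1) by (simp add: poly_act_sum poly_act_monom f_def[symmetric] sum.reindex[OF True])
    ultimately show ?thesis by (rule that)
  qed
qed

text \<open>
  A substitute for triangularisation. If \<open>p(A) v = 0\<close> and \<open>p = (z - l) q\<close>, then \<open>q(A)\<close> annihilates
  \<open>A v - l v\<close>, so that induction on the degree of \<open>p\<close> reaches \<open>A v - l v\<close>; and \<open>l\<close> is an eigenvalue with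
  eigenvector \<open>q(A) v\<close>, unless \<open>q\<close> already annihilates \<open>v\<close>. The two decay statements below need to
  be checked only for the passage from \<open>A v - l v\<close> to \<open>v\<close>, a scalar problem with inhomogeneity.
\<close>

lemma spectral_induction:
  fixes A :: "complex^'n^'n"
  assumes zero: "G 0"
    and step: "\<And>l v w. w \<noteq> 0 \<Longrightarrow> A *v w = l *s w \<Longrightarrow> G (A *v v - l *s v) \<Longrightarrow> G v"
  shows "G v"
proof -
  have "\<forall>v. p \<noteq> 0 \<longrightarrow> poly_act A p v = 0 \<longrightarrow> G v" for p
  proof (induction "degree p" arbitrary: p rule: less_induct)
    case less
    show ?case
    proof (intro allI impI)
      fix v assume p: "p \<noteq> 0" "poly_act A p v = 0"
      show "G v"
      proof (cases "degree p = 0")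
        case True
        then obtain a where "p = [:a:]" by (metis degree_eq_zeroE)
        then have "v = 0" using p by (auto simp: vec_eq_iff)
        then show ?thesis using zero by simp
      next
        case False
        then obtain l where "poly p l = 0"
          using fundamental_theorem_of_algebra[of p] by (auto simp: constant_degree)
        then obtain q where q: "p = [:- l, 1:] * q"
          by (metis dvdE poly_eq_0_iff_dvd)
        with p have q0: "q \<noteq> 0" by auto
        have dq: "degree q < degree p" unfolding q using q0 by (subst degree_mult_eq) auto
        have *: "A *v poly_act A q v = l *s poly_act A q v"
          using p(2) unfolding q poly_act_linear_factor by simp
        show ?thesis
        proof (cases "poly_act A q v = 0")
          case True
          then show ?thesis using less[OF dq] q0 by blast
        next
          case False
          have "poly_act A q (A *v v - l *s v) = 0" using * by (simp add: poly_act_commute)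
          then have "G (A *v v - l *s v)" using less[OF dq] q0 by blast
          from step[OF False * this] show ?thesis .
        qed
      qed
    qed
  qed
  then show ?thesis using ex_annihilating_poly[of A v] by metis
qed

subsection \<open>Discrete decay\<close>

lemma norm_vec_smult: "norm (a *s x) = norm a * norm (x :: complex^'n)"
  by (simp add: norm_vec_def L2_set_def norm_mult power_mult_distrib sum_distrib_left[symmetric] real_sqrt_mult)

text \<open>
  The vectors \<open>y\<^sub>k = (I - e A)\<^sup>k v\<close> satisfy \<open>y\<^sub>k\<^sub>+\<^sub>1 = (1 - e l) y\<^sub>k - e u\<^sub>k\<close>, where \<open>u\<^sub>k\<close> is the same sequence
  started at \<open>A v - l v\<close> and decays by induction. For small \<open>e\<close> the factor \<open>\<bar>1 - e l\<bar>\<close> is at most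
  \<open>1 - 2 c e\<close>, which leaves room to absorb \<open>e u\<^sub>k\<close>. The constants are uniform in the step \<open>e\<close>, as is
  required for a scheme whose step tends to 0.
\<close>

lemma euler_decay_complex:
  fixes A :: "complex^'n^'n"
  assumes ev: "\<And>l w. w \<noteq> 0 \<Longrightarrow> A *v w = l *s w \<Longrightarrow> Re l > 0"
  shows "\<exists>c>0. \<exists>K\<ge>0. \<exists>e0>0. \<forall>e k. 0 < e \<and> e \<le> e0 \<longrightarrow>
           c * e < 1 \<and> norm (((\<lambda>x. x - e *\<^sub>R (A *v x)) ^^ k) v) \<le> K * (1 - c * e) ^ k"
proof (induction v rule: spectral_induction[where A=A])
  case 1
  have "((\<lambda>x. x - e *\<^sub>R (A *v x)) ^^ k) 0 = 0" for e k by (induction k) auto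
  then show ?case by (intro exI[of _ 1] conjI exI[of _ 0] exI[of _ "1/2"]) auto
next
  case (2 l v w)
  define u where "u = A *v v - l *s v"
  obtain c K e0 where c: "c > 0" "K \<ge> 0" "e0 > 0"
    and dec: "\<And>e k. 0 < e \<Longrightarrow> e \<le> e0 \<Longrightarrow> c * e < 1 \<and>
         norm (((\<lambda>x. x - e *\<^sub>R (A *v x)) ^^ k) u) \<le> K * (1 - c * e) ^ k"
    using 2(3) unfolding u_def by blast
  have l: "Re l > 0" using ev 2 by blast
  \<comment> \<open>With this rate \<open>\<bar>1 - e l\<bar> \<le> 1 - 2 c' e\<close>: twice the claimed decay, for the steps \<open>e \<le> e1\<close>.\<close>
  define c' where "c' = min c (Re l / 4)"
  define e1 where "e1 = min e0 (min (Re l / (norm l)\<^sup>2) (1 / (4 * c')))"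
  have l0: "norm l > 0" using l by (metis complex_Re_le_cmod order_less_le_trans)
  have c': "c' > 0" "c' \<le> c" "4 * c' \<le> Re l" using c l by (auto simp: c'_def)
  have e1: "e1 > 0" using c c' l l0 by (auto simp: e1_def)
  \<comment> \<open>The smallest constant that starts the induction and for which \<open>e K\<close> is absorbed by \<open>e c' K'\<close>.\<close>
  define K' where "K' = max (norm v) (K / c')"
  have K': "K' \<ge> 0" "norm v \<le> K'" "K \<le> c' * K'"
    using c' c by (auto simp: K'_def le_max_iff_disj max_mult_distrib_left)
  have "c' * e < 1 \<and> norm (((\<lambda>x. x - e *\<^sub>R (A *v x)) ^^ k) v) \<le> K' * (1 - c' * e) ^ k"
    if e: "0 < e" "e \<le> e1" for e k
  proof -
    let ?B = "\<lambda>x. x - e *\<^sub>R (A *v x)"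
    have ee: "e \<le> e0" "e \<le> Re l / (norm l)\<^sup>2" "e \<le> 1 / (4 * c')" using e by (auto simp: e1_def)
    have ce: "4 * (c' * e) \<le> 1" using ee(3) c' by (simp add: field_simps)
    have el: "e * (norm l)\<^sup>2 \<le> Re l" using ee(2) l0 by (simp add: field_simps)
    have "(cmod (1 - of_real e * l))\<^sup>2 = 1 - 2 * e * Re l + e * (e * (norm l)\<^sup>2)"
      unfolding cmod_power2 by (simp add: power2_eq_square algebra_simps)
    also have "\<dots> \<le> 1 - 2 * e * Re l + e * Re l"
      using el e by (intro add_left_mono mult_left_mono) auto
    also have "\<dots> \<le> 1 - 4 * (c' * e)" using c'(3) e
      by (simp add: algebra_simps)
    also have "\<dots> \<le> (1 - 2 * (c' * e))\<^sup>2" using zero_le_square[of "c' * e"] by (simp add: power2_eq_square algebra_simps)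
    finally have le: "cmod (1 - of_real e * l) \<le> 1 - 2 * (c' * e)"
      by (rule power2_le_imp_le) (use ce in auto)
    have Ae: "A *v (e *\<^sub>R x) = e *\<^sub>R (A *v x)" for x
      by (simp add: vec_eq_iff matrix_vector_mult_def scaleR_sum_right)
    have lin: "?B (a *s x) = a *s ?B x" "?B (x - y) = ?B x - ?B y" "?B (e *\<^sub>R x) = e *\<^sub>R ?B x" for a x y
      by (auto simp: Ae scaleR_right_diff_distrib)
        (auto simp: vec_eq_iff matrix_vector_mult_def algebra_simps sum_distrib_left sum_subtractf)
    have com: "(?B ^^ k) (a *s x) = a *s (?B ^^ k) x" "(?B ^^ k) (x - y) = (?B ^^ k) x - (?B ^^ k) y"
       "(?B ^^ k) (e *\<^sub>R x) = e *\<^sub>R (?B ^^ k) x" for a k x y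
      by (induction k) (simp_all add: lin del: scaleR_right_diff_distrib)
    have bound: "norm ((?B ^^ k) v) \<le> K' * (1 - c' * e) ^ k"
    proof (induction k)
      case 0 then show ?case using K' by simp
    next
      case (Suc k)
      have Bv: "?B v = (1 - of_real e * l) *s v - e *\<^sub>R u"
        unfolding u_def by (simp add: vec_eq_iff algebra_simps scaleR_conv_of_real[where 'a=complex])
      have "(?B ^^ Suc k) v = (?B ^^ k) ((1 - of_real e * l) *s v - e *\<^sub>R u)"
        unfolding funpow_Suc_right o_def Bv ..
      also have "\<dots> = (1 - of_real e * l) *s (?B ^^ k) v - e *\<^sub>R (?B ^^ k) u"
        by (subst com(2), subst com(1), subst com(3), rule refl)
      finally have eq: "(?B ^^ Suc k) v = \<dots>" .
      have "norm ((?B ^^ Suc k) v) \<le> norm ((1 - of_real e * l) *s (?B ^^ k) v) + e * norm ((?B ^^ k) u)"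
        unfolding eq using e norm_triangle_ineq4[of "(1 - of_real e * l) *s (?B ^^ k) v" "e *\<^sub>R (?B ^^ k) u"]
        by simp
      also have "norm ((1 - of_real e * l) *s (?B ^^ k) v) = cmod (1 - of_real e * l) * norm ((?B ^^ k) v)"
        by (rule norm_vec_smult)
      also have "\<dots> \<le> (1 - 2 * (c' * e)) * (K' * (1 - c' * e) ^ k)"
        using le Suc ce c' e by (intro mult_mono) auto
      also have "e * norm ((?B ^^ k) u) \<le> e * (K * (1 - c' * e) ^ k)"
      proof -
        have d: "c * e < 1" "norm ((?B ^^ k) u) \<le> K * (1 - c * e) ^ k" using dec[of e k] ee e by auto
        have "(1 - c * e) ^ k \<le> (1 - c' * e) ^ k"
          using d c' e by (intro power_mono) (auto intro: mult_right_mono)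
        then show ?thesis using d(2) c(2) e
          by (meson less_imp_le mult_left_mono order_trans)
      qed
      also have "e * (K * (1 - c' * e) ^ k) \<le> e * (c' * K' * (1 - c' * e) ^ k)"
        using K' e ce by (intro mult_left_mono mult_right_mono) auto
      finally show ?case by (simp add: algebra_simps)
    qed
    show ?thesis using bound ce c' e by (simp add: field_simps)
  qed
  then show ?case using c' K' e1 by blast
qed

lemma complex_eigenvalue_iff:
  "eigenvalues_pos_real_part A \<Longrightarrow> w \<noteq> 0 \<Longrightarrow> map_matrix complex_of_real A *v w = l *s w \<Longrightarrow> Re l > 0"
  unfolding eigenvalues_pos_real_part_def by blast

abbreviation cvec :: "real^'n \<Rightarrow> complex^'n" where "cvec v \<equiv> (\<chi> i. complex_of_real (v $ i))"

lemma norm_cvec: "norm (cvec v) = norm v"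
  by (simp add: norm_vec_def L2_set_def)

lemma cvec_mult: "map_matrix complex_of_real A *v cvec v = cvec (A *v v)"
  by (simp add: vec_eq_iff matrix_vector_mult_def map_matrix_def)

text \<open>Linearity over the finite standard basis turns bounds for each vector into an operator bound.\<close>

lemma norm_linear_le_basis:
  fixes L :: "real^'n \<Rightarrow> 'a::real_normed_vector"
  assumes "linear L" "\<And>i. norm (L (axis i 1)) \<le> b"
  shows "norm (L x) \<le> real CARD('n) * b * norm x"
proof -
  have "L x = L (\<Sum>i\<in>UNIV. x $ i *\<^sub>R axis i 1)"
    by (metis basis_expansion scalar_mult_eq_scaleR)
  also have "\<dots> = (\<Sum>i\<in>UNIV. x $ i *\<^sub>R L (axis i 1))"
    using assms(1) by (simp add: linear_sum linear_cmul)
  also have "norm \<dots> \<le> (\<Sum>i\<in>(UNIV::'n set). norm x * b)"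
    using assms(2) by (intro sum_norm_le) (auto intro!: mult_mono component_le_norm_cart)
  finally show ?thesis by (simp add: mult_ac)
qed

lemma euler_decay:
  fixes M :: "real^'n^'n"
  assumes "eigenvalues_pos_real_part M"
  obtains c K e0 where "c > 0" "K > 0" "e0 > 0"
    "\<And>e. 0 < e \<Longrightarrow> e \<le> e0 \<Longrightarrow> c * e < 1"
    "\<And>e k x. 0 < e \<Longrightarrow> e \<le> e0 \<Longrightarrow>
        norm (((\<lambda>x. x - e *\<^sub>R (M *v x)) ^^ k) x) \<le> K * (1 - c * e) ^ k * norm x"
proof -
  let ?A = "map_matrix complex_of_real M"
  define Q where "Q i c K e0 \<longleftrightarrow> c > 0 \<and> K \<ge> 0 \<and> e0 > 0 \<and> (\<forall>e k. 0 < e \<and> e \<le> e0 \<longrightarrow>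
           c * e < 1 \<and> norm (((\<lambda>x. x - e *\<^sub>R (?A *v x)) ^^ k) (cvec (axis i 1))) \<le> K * (1 - c * e) ^ k)"
    for i c K e0
  have "\<exists>c K e0. Q i c K e0" for i
    using euler_decay_complex[of ?A "cvec (axis i 1)"] complex_eigenvalue_iff[OF assms]
    unfolding Q_def by blast
  then obtain c K e0 where Q: "\<And>i. Q i (c i) (K i) (e0 i)" by metis
  then have c: "\<And>i. c i > 0" "\<And>i. K i \<ge> 0" "\<And>i. e0 i > 0"
    and d: "\<And>i e k. 0 < e \<Longrightarrow> e \<le> e0 i \<Longrightarrow>
           c i * e < 1 \<and> norm (((\<lambda>x. x - e *\<^sub>R (?A *v x)) ^^ k) (cvec (axis i 1))) \<le> K i * (1 - c i * e) ^ k"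
    unfolding Q_def by blast+
  define c' where "c' = Min (range c)"
  define e' where "e' = Min (range e0)"
  define K' where "K' = (\<Sum>i\<in>UNIV. K i) + 1"
  have K'1: "1 \<le> K'" using c(2) by (auto simp: K'_def sum_nonneg)
  have K'2: "K i \<le> K'" for i using c(2) member_le_sum[of i UNIV K] by (force simp: K'_def)
  have pos: "c' > 0" "e' > 0" using c by (auto simp: c'_def e'_def)
  have le: "c' \<le> c i" "e' \<le> e0 i" for i by (auto simp: c'_def e'_def)
  have ce: "c' * e < 1" if "0 < e" "e \<le> e'" for e
  proof -
    have "c' * e \<le> c undefined * e" using le that by (intro mult_right_mono) auto
    moreover have "c undefined * e < 1" using d[of e undefined 0] that le(2)[of undefined] by simp
    ultimately show ?thesis by linarith
  qed
  have "norm (((\<lambda>x. x - e *\<^sub>R (M *v x)) ^^ k) x) \<le> real CARD('n) * K' * (1 - c' * e) ^ k * norm x"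
    if e: "0 < e" "e \<le> e'" for e k x
  proof -
    let ?B = "\<lambda>x. x - e *\<^sub>R (M *v x)"
    have lin: "linear (?B ^^ k)"
    proof (induction k)
      case (Suc k)
      have "linear ?B" by (intro linear_compose_sub linear_compose_scale_right) (auto simp: module_hom_iff linear_iff matrix_vector_right_distrib matrix_vector_mult_scaleR)
      from linear_compose[OF Suc this] show ?case by (simp add: o_def)
    qed (auto simp: linear_iff)
    have com: "((\<lambda>x. x - e *\<^sub>R (?A *v x)) ^^ k) (cvec y) = cvec ((?B ^^ k) y)" for y
    proof (induction k)
      case (Suc k)
      show ?case by (simp add: Suc cvec_mult) (simp add: vec_eq_iff scaleR_conv_of_real[where 'a=complex])
    qed simp
    have "norm ((?B ^^ k) (axis i 1)) \<le> K' * (1 - c' * e) ^ k" for i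
    proof -
      have ci: "c i * e < 1" and b1: "norm ((?B ^^ k) (axis i 1)) \<le> K i * (1 - c i * e) ^ k"
        using d[of e i k] e le(2)[of i] unfolding com norm_cvec by auto
      note b1
      also have "K i * (1 - c i * e) ^ k \<le> K' * (1 - c' * e) ^ k"
        using ci K'1 K'2 le e by (intro mult_mono power_mono) (auto intro: mult_right_mono)
      finally show ?thesis .
    qed
    from norm_linear_le_basis[OF lin this, of x] show ?thesis by (simp add: mult_ac)
  qed
  moreover have "real CARD('n) * K' > 0" using K'1 by simp
  ultimately show ?thesis using that[of c' "real CARD('n) * K'" e'] pos ce by blast
qed

subsection \<open>The matrix exponential\<close>

lemma mat_pow_0 [simp]: "mat_pow A 0 = mat 1" and mat_pow_Suc: "mat_pow A (Suc k) = A ** mat_pow A k"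
  by (simp_all add: mat_pow_def)

lemma mat_pow_commute: "mat_pow A k ** A = A ** mat_pow (A::real^'n^'n) k"
  by (induction k) (simp_all add: mat_pow_Suc matrix_mul_assoc[symmetric])

lemma mat_pow_scaleR: "mat_pow (t *\<^sub>R A) k = t ^ k *\<^sub>R mat_pow (A::real^'n^'n) k"
  by (induction k) (simp_all add: mat_pow_Suc scalar_matrix_assoc matrix_scalar_ac mult_ac)

lemma mat_pow_transpose: "mat_pow (transpose A) k = transpose (mat_pow (A::real^'n^'n) k)"
  by (induction k) (simp_all add: mat_pow_Suc matrix_transpose_mul[symmetric] mat_pow_commute)

lemma mat_pow_entry_le:
  fixes A :: "real^'n^'n"
  shows "\<bar>mat_pow A k $ i $ j\<bar> \<le> (CARD('n) * norm A) ^ k"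
proof (induction k arbitrary: i j)
  case (Suc k)
  have A: "\<bar>A $ i $ l\<bar> \<le> norm A" for l
    using component_le_norm_cart[of "A $ i" l] Finite_Cartesian_Product.norm_nth_le[of A i] by simp
  have "\<bar>mat_pow A (Suc k) $ i $ j\<bar> = \<bar>\<Sum>l\<in>UNIV. A $ i $ l * mat_pow A k $ l $ j\<bar>"
    by (simp add: mat_pow_Suc matrix_matrix_mult_def)
  also have "\<dots> \<le> (\<Sum>l\<in>(UNIV::'n set). norm A * (CARD('n) * norm A) ^ k)"
    by (rule order.trans[OF sum_abs], rule sum_mono) (use Suc A in \<open>auto simp: abs_mult intro!: mult_mono\<close>)
  finally show ?case by simp
qed (simp add: mat_def)

lemma summable_mat_exp_entry:
  fixes A :: "real^'n^'n"
  shows "summable (\<lambda>k. mat_pow A k $ i $ j / fact k * t ^ k)"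
proof (rule summable_comparison_test)
  let ?b = "CARD('n) * norm A * \<bar>t\<bar>"
  show "summable (\<lambda>k. ?b ^ k /\<^sub>R fact k)" by (rule summable_exp_generic)
  show "\<exists>N. \<forall>k\<ge>N. norm (mat_pow A k $ i $ j / fact k * t ^ k) \<le> ?b ^ k /\<^sub>R fact k"
    using mat_pow_entry_le[of A _ i j]
    by (auto simp: abs_mult power_abs power_mult_distrib divide_simps intro!: mult_right_mono)
qed

text \<open>
  Entrywise the exponential is a scalar power series in \<open>t\<close>, which can be differentiated termwise.
\<close>

lemma mat_exp_entry:
  fixes A :: "real^'n^'n"
  shows "mat_exp (t *\<^sub>R A) $ i $ j = (\<Sum>k. mat_pow A k $ i $ j / fact k * t ^ k)"
proof -
  have "(\<lambda>k. (1 / fact k) *\<^sub>R mat_pow (t *\<^sub>R A) k) sums (\<chi> i j. \<Sum>k. mat_pow A k $ i $ j / fact k * t ^ k)"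
    unfolding sums_def
  proof (intro vec_tendstoI)
    fix i j
    have "(\<lambda>n. \<Sum>k<n. mat_pow A k $ i $ j / fact k * t ^ k) \<longlonglongrightarrow> (\<Sum>k. mat_pow A k $ i $ j / fact k * t ^ k)"
      by (rule summable_LIMSEQ[OF summable_mat_exp_entry])
    then show "(\<lambda>n. (\<Sum>k<n. (1 / fact k) *\<^sub>R mat_pow (t *\<^sub>R A) k) $ i $ j)
       \<longlonglongrightarrow> (\<chi> i j. \<Sum>k. mat_pow A k $ i $ j / fact k * t ^ k) $ i $ j"
      by (simp add: mat_pow_scaleR mult_ac)
  qed
  from sums_unique[OF this, symmetric] show ?thesis unfolding mat_exp_def by simp
qed

lemma has_vector_derivative_matrix:
  fixes f :: "real \<Rightarrow> real^'n^'m"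
  assumes "\<And>i j. ((\<lambda>t. f t $ i $ j) has_real_derivative f' $ i $ j) (at t)"
  shows "(f has_vector_derivative f') (at t)"
proof -
  have "((\<lambda>t. f t $ i $ j) has_derivative (\<lambda>x. x * f' $ i $ j)) (at t)" for i j
    using assms[of i j] unfolding has_field_derivative_def by (simp add: mult_commute_abs)
  then show ?thesis
    unfolding has_vector_derivative_def
    by (subst has_derivative_componentwise_within) (auto simp: Basis_vec_def inner_axis)
qed

lemma mat_exp_commute:
  fixes A :: "real^'n^'n"
  shows "mat_exp (t *\<^sub>R A) ** A = A ** mat_exp (t *\<^sub>R A)"
proof -
  have "(mat_exp (t *\<^sub>R A) ** A) $ i $ j = (A ** mat_exp (t *\<^sub>R A)) $ i $ j" for i j
  proof -
    note sm = summable_mat_exp_entry[of A _ _ t]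
    have "(mat_exp (t *\<^sub>R A) ** A) $ i $ j = (\<Sum>l\<in>UNIV. \<Sum>k. mat_pow A k $ i $ l / fact k * t ^ k * A $ l $ j)"
      unfolding matrix_matrix_mult_def vec_lambda_beta mat_exp_entry suminf_mult2[OF sm] ..
    also have "\<dots> = (\<Sum>k. \<Sum>l\<in>UNIV. mat_pow A k $ i $ l / fact k * t ^ k * A $ l $ j)"
      by (rule suminf_sum[symmetric]) (intro summable_mult2 sm)
    also have "\<dots> = (\<Sum>k. (mat_pow A k ** A) $ i $ j / fact k * t ^ k)"
      by (simp add: matrix_matrix_mult_def sum_divide_distrib sum_distrib_left sum_distrib_right mult_ac)
    also have "\<dots> = (\<Sum>k. \<Sum>l\<in>UNIV. A $ i $ l * (mat_pow A k $ l $ j / fact k * t ^ k))"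
      unfolding mat_pow_commute
      by (simp add: matrix_matrix_mult_def sum_divide_distrib sum_distrib_left sum_distrib_right mult_ac)
    also have "\<dots> = (\<Sum>l\<in>UNIV. \<Sum>k. A $ i $ l * (mat_pow A k $ l $ j / fact k * t ^ k))"
      by (rule suminf_sum) (intro summable_mult sm)
    also have "\<dots> = (A ** mat_exp (t *\<^sub>R A)) $ i $ j"
      unfolding matrix_matrix_mult_def vec_lambda_beta mat_exp_entry suminf_mult[OF sm] ..
    finally show ?thesis .
  qed
  then show ?thesis by (simp add: vec_eq_iff)
qed

lemma mat_exp_has_derivative:
  fixes A :: "real^'n^'n"
  shows "((\<lambda>t. mat_exp (t *\<^sub>R A)) has_vector_derivative A ** mat_exp (t *\<^sub>R A)) (at t)"
proof (rule has_vector_derivative_matrix)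
  fix i j
  let ?c = "\<lambda>k. mat_pow A k $ i $ j / fact k"
  note sm = summable_mat_exp_entry[of A _ _ t]
  have "((\<lambda>t. \<Sum>k. ?c k * t ^ k) has_real_derivative (\<Sum>k. diffs ?c k * t ^ k)) (at t)"
    by (rule termdiffs_strong_converges_everywhere) (rule summable_mat_exp_entry)
  also have "(\<Sum>k. diffs ?c k * t ^ k) = (\<Sum>k. \<Sum>l\<in>UNIV. A $ i $ l * (mat_pow A k $ l $ j / fact k * t ^ k))"
  proof (rule suminf_cong)
    fix k
    have "diffs ?c k = mat_pow A (Suc k) $ i $ j / fact k"
      by (simp add: diffs_def divide_simps del: of_nat_Suc)
    then show "diffs ?c k * t ^ k = (\<Sum>l\<in>UNIV. A $ i $ l * (mat_pow A k $ l $ j / fact k * t ^ k))"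
      by (simp add: mat_pow_Suc matrix_matrix_mult_def sum_divide_distrib sum_distrib_right sum_distrib_left mult_ac)
  qed
  also have "\<dots> = (\<Sum>l\<in>UNIV. \<Sum>k. A $ i $ l * (mat_pow A k $ l $ j / fact k * t ^ k))"
    by (rule suminf_sum) (intro summable_mult sm)
  also have "\<dots> = (A ** mat_exp (t *\<^sub>R A)) $ i $ j"
    unfolding matrix_matrix_mult_def vec_lambda_beta mat_exp_entry suminf_mult[OF sm] ..
  finally show "((\<lambda>t. mat_exp (t *\<^sub>R A) $ i $ j) has_real_derivative (A ** mat_exp (t *\<^sub>R A)) $ i $ j) (at t)"
    by (simp add: mat_exp_entry)
qed

lemma mat_exp_0: "mat_exp (0 *\<^sub>R (A::real^'n^'n)) = mat 1"
proof -
  have "mat_exp (0 *\<^sub>R A) $ i $ j = mat 1 $ i $ j" for i j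
    unfolding mat_exp_entry using powser_zero[of "\<lambda>k. mat_pow A k $ i $ j / fact k"] by simp
  then show ?thesis by (simp add: vec_eq_iff)
qed

lemma mat_exp_transpose: "mat_exp (t *\<^sub>R transpose A) = transpose (mat_exp (t *\<^sub>R (A::real^'n^'n)))"
  by (simp add: vec_eq_iff mat_exp_entry transpose_def mat_pow_transpose[unfolded transpose_def])

subsection \<open>Exponential decay and the Lyapunov equation\<close>

lemma bounded_bilinear_matrix_mult:
  "bounded_bilinear ((**) :: real^'n^'m \<Rightarrow> real^'k^'n \<Rightarrow> real^'k^'m)"
  by (subst bilinear_conv_bounded_bilinear[symmetric])
     (auto simp: bilinear_def linear_iff matrix_add_ldistrib matrix_matrix_mult_def vec_eq_iff
        sum.distrib algebra_simps sum_distrib_left)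

text \<open>
  The continuous counterpart of \<open>euler_decay_complex\<close>: \<open>y(t) = exp(- t M) v\<close> solves
  \<open>y' = - l y - exp(- t M) u\<close> with \<open>u = M v - l v\<close>, hence the derivative of \<open>exp(l t) y(t)\<close> is bounded by
  \<open>K exp((Re l - c) t)\<close>, where \<open>c\<close> is the decay rate of \<open>exp(- t M) u\<close>.
\<close>

lemma mat_exp_decay_complex:
  fixes M :: "real^'n^'n"
  assumes ev: "eigenvalues_pos_real_part M"
  shows "\<exists>c>0. \<exists>K\<ge>0. \<forall>t\<ge>0. norm (map_matrix complex_of_real (mat_exp (t *\<^sub>R (- M))) *v v) \<le> K * exp (- (c * t))"
proof (induction v rule: spectral_induction[where A="map_matrix complex_of_real M"])
  case 1
  show ?case by (intro exI[of _ 1] conjI exI[of _ 0]) auto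
next
  case (2 l v w)
  let ?A = "map_matrix complex_of_real M" and ?E = "\<lambda>t. map_matrix complex_of_real (mat_exp (t *\<^sub>R (- M)))"
  define u where "u = ?A *v v - l *s v"
  obtain c K where c: "c > 0" "K \<ge> 0"
    and dec: "\<And>t. 0 \<le> t \<Longrightarrow> norm (?E t *v u) \<le> K * exp (- (c * t))"
    using 2(3) unfolding u_def by blast
  have l: "Re l > 0" using complex_eigenvalue_iff[OF ev] 2 by blast
  \<comment> \<open>A rate strictly below \<open>Re l\<close>, so that the bound on the derivative integrates to a multiple of itself.\<close>
  define c' where "c' = min c (Re l / 2)"
  have c': "c' > 0" "c' \<le> c" "c' < Re l" using c l by (auto simp: c'_def)
  define r where "r = Re l - c'"
  have r: "r > 0" using c' by (simp add: r_def)
  have blin: "bounded_linear (\<lambda>E::real^'n^'n. map_matrix complex_of_real E *v v)"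
    by (subst linear_conv_bounded_linear[symmetric])
       (auto simp: linear_iff vec_eq_iff matrix_vector_mult_def map_matrix_def algebra_simps sum.distrib
          scaleR_sum_right scaleR_conv_of_real[where 'a=complex] sum_distrib_left)
  have Eu: "map_matrix complex_of_real (- M ** mat_exp (t *\<^sub>R (- M))) *v v = - (l *s (?E t *v v)) - ?E t *v u" for t
  proof -
    have "map_matrix complex_of_real (- M ** mat_exp (t *\<^sub>R (- M))) *v v
        = map_matrix complex_of_real (mat_exp (t *\<^sub>R (- M)) ** (- M)) *v v"
      by (simp only: mat_exp_commute)
    also have "\<dots> = - (?E t *v (?A *v v))"
      by (simp add: vec_eq_iff matrix_vector_mult_def map_matrix_def matrix_matrix_mult_def
          sum_distrib_left sum_distrib_right sum_negf mult_ac) (intro allI, subst sum.swap, rule refl)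
    also have "?A *v v = l *s v + u" by (simp add: u_def)
    finally show ?thesis by (simp add: matrix_vector_right_distrib vector_scalar_commute)
  qed
  have dy: "((\<lambda>t. ?E t *v v) has_vector_derivative - (l *s (?E t *v v)) - ?E t *v u) (at t)" for t
    using bounded_linear.has_vector_derivative[OF blin mat_exp_has_derivative[of "- M" t]]
    unfolding Eu .
  note nrm = norm_vec_smult
  have bil: "bounded_bilinear ((*s) :: complex \<Rightarrow> complex^'n \<Rightarrow> complex^'n)"
    by (subst bilinear_conv_bounded_bilinear[symmetric])
       (auto simp: bilinear_def linear_iff vec_eq_iff algebra_simps)
  have dexp: "((\<lambda>t. exp (of_real t * l)) has_vector_derivative (exp (of_real t * l) * l)) (at t)" for t
    by (auto intro!: derivative_eq_intros has_vector_derivative_real_field)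
  define g where "g t = exp (of_real t * l) *s (?E t *v v)" for t
  have dg: "(g has_vector_derivative - (exp (of_real t * l) *s (?E t *v u))) (at t)" for t
    unfolding g_def
    by (rule has_vector_derivative_eq_rhs[OF bounded_bilinear.has_vector_derivative[OF bil dexp dy]])
       (simp add: vec_eq_iff algebra_simps)
  have "norm (?E t *v v) \<le> (norm v + K / r) * exp (- (c' * t))" if t: "t \<ge> 0" for t
  proof -
    have gt: "norm (g t - g 0) \<le> K * exp (r * t) / r - K * exp (r * 0) / r"
    proof (cases "t = 0")
      case False
      with t have "0 < t" by simp
      then show ?thesis
      proof (rule differentiable_bound_general)
        show "continuous_on {0..t} g"
          by (intro continuous_at_imp_continuous_on ballI has_vector_derivative_continuous[OF dg])
        show "continuous_on {0..t} (\<lambda>t. K * exp (r * t) / r)" using r by (intro continuous_intros) auto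
        show "((\<lambda>t. K * exp (r * t) / r) has_vector_derivative K * exp (r * x)) (at x)" for x
          using r unfolding has_real_derivative_iff_has_vector_derivative[symmetric]
          by (auto intro!: derivative_eq_intros)
        fix x assume x: "0 < x" "x < t"
        have "norm (- (exp (of_real x * l) *s (?E x *v u))) \<le> exp (x * Re l) * (K * exp (- (c * x)))"
          using dec[of x] x by (simp add: nrm norm_exp_eq_Re)
        also have "\<dots> \<le> exp (x * Re l) * (K * exp (- (c' * x)))"
          using c' c x by (intro mult_left_mono) auto
        also have "\<dots> = K * exp (r * x)" by (simp add: r_def exp_add[symmetric] algebra_simps)
        finally show "norm (- (exp (of_real x * l) *s (?E x *v u))) \<le> K * exp (r * x)" .
      qed (use dg in auto)
    qed simp
    have "?E 0 = mat 1" using mat_exp_0[of "- M"] by (simp add: vec_eq_iff map_matrix_def mat_def)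
    then have g0: "g 0 = v" by (simp add: g_def)
    have "norm (g t) \<le> norm v + K / r * exp (r * t)"
      using gt norm_triangle_sub[of "g t" "g 0"] divide_nonneg_pos[OF c(2) r] unfolding g0
      by simp
    also have "\<dots> \<le> norm v * exp (r * t) + K / r * exp (r * t)"
      using r t by (auto simp: mult_le_cancel_left1)
    finally have "exp (t * Re l) * norm (?E t *v v) \<le> (norm v + K / r) * exp (r * t)"
      by (simp add: g_def nrm norm_exp_eq_Re algebra_simps)
    then have "norm (?E t *v v) \<le> (norm v + K / r) * exp (r * t) / exp (t * Re l)"
      by (simp add: field_simps)
    also have "\<dots> = (norm v + K / r) * exp (- (c' * t))"
    proof -
      have "exp (r * t) = exp (t * Re l) * exp (- (c' * t))"
        by (simp add: r_def exp_add[symmetric] algebra_simps)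
      then show ?thesis by simp
    qed
    finally show ?thesis .
  qed
  moreover have "norm v + K / r \<ge> 0" using c r by auto
  ultimately show ?case using c' by blast
qed

lemma norm_matrix_le_sum: "norm (A :: real^'n^'m) \<le> (\<Sum>i\<in>UNIV. \<Sum>j\<in>UNIV. \<bar>A $ i $ j\<bar>)"
proof -
  have "norm A \<le> (\<Sum>i\<in>UNIV. norm (A $ i))"
    unfolding norm_vec_def by (rule L2_set_le_sum) simp
  also have "\<dots> \<le> (\<Sum>i\<in>UNIV. \<Sum>j\<in>UNIV. \<bar>A $ i $ j\<bar>)"
    by (rule sum_mono) (rule norm_le_l1_cart)
  finally show ?thesis .
qed

lemma mat_exp_decay:
  fixes M :: "real^'n^'n"
  assumes ev: "eigenvalues_pos_real_part M"
  obtains c K where "c > 0" "K \<ge> 0"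
    "\<And>t. 0 \<le> t \<Longrightarrow> norm (mat_exp (t *\<^sub>R (- M))) \<le> K * exp (- (c * t))"
proof -
  let ?E = "\<lambda>t. mat_exp (t *\<^sub>R (- M))"
  define Q where "Q i c K \<longleftrightarrow> c > 0 \<and> K \<ge> 0 \<and> (\<forall>t\<ge>0. norm (map_matrix complex_of_real (?E t) *v cvec (axis i 1)) \<le> K * exp (- (c * t)))"
    for i c K
  have "\<exists>c K. Q i c K" for i
    using mat_exp_decay_complex[OF ev, of "cvec (axis i 1)"] unfolding Q_def by blast
  then obtain c K where Q: "\<And>i. Q i (c i) (K i)" by metis
  then have c: "\<And>i. c i > 0" "\<And>i. K i \<ge> 0"
    and d: "\<And>i t. 0 \<le> t \<Longrightarrow> norm (?E t *v axis i 1) \<le> K i * exp (- (c i * t))"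
    unfolding Q_def cvec_mult norm_cvec by blast+
  define c' where "c' = Min (range c)"
  have c': "c' > 0" "\<And>i. c' \<le> c i" using c by (auto simp: c'_def)
  have entry: "\<bar>?E t $ i $ j\<bar> \<le> K j * exp (- (c' * t))" if "0 \<le> t" for t i j
  proof -
    have "\<bar>?E t $ i $ j\<bar> = \<bar>(?E t *v axis j 1) $ i\<bar>"
      by (simp add: matrix_vector_mult_def axis_def if_distrib cong: if_cong)
    also have "\<dots> \<le> norm (?E t *v axis j 1)" by (rule component_le_norm_cart)
    also have "\<dots> \<le> K j * exp (- (c j * t))" using d that by blast
    also have "\<dots> \<le> K j * exp (- (c' * t))"
      using c c'(2)[of j] that by (intro mult_left_mono) (auto intro: mult_right_mono)
    finally show ?thesis .
  qed
  have "norm (?E t) \<le> (\<Sum>i\<in>(UNIV::'n set). \<Sum>j\<in>UNIV. K j) * exp (- (c' * t))" if "0 \<le> t" for t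
    unfolding sum_distrib_right
    by (rule order_trans[OF norm_matrix_le_sum]) (intro sum_mono entry that)
  moreover have "0 \<le> (\<Sum>i\<in>(UNIV::'n set). \<Sum>j\<in>UNIV. K j)" using c by (intro sum_nonneg) auto
  ultimately show ?thesis using that c'(1) by blast
qed

definition lyap :: "real^'n^'n \<Rightarrow> real^'n^'n \<Rightarrow> real^'n^'n" where
  "lyap M X = M ** X + X ** transpose M"

lemma matrix_mult_minus_left: "(- A) ** B = - (A ** (B::real^'n^'n))"
  and matrix_mult_minus_right: "A ** (- B) = - (A ** (B::real^'n^'n))"
  by (simp_all add: matrix_matrix_mult_def vec_eq_iff sum_negf)

lemma transpose_uminus: "transpose (- A) = - transpose (A::real^'n^'n)"
  by (simp add: transpose_def vec_eq_iff)

lemma bounded_linear_lyap: "bounded_linear (lyap M)"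
  unfolding lyap_def
  using bounded_bilinear.bounded_linear_right[OF bounded_bilinear_matrix_mult, of M]
    bounded_bilinear.bounded_linear_left[OF bounded_bilinear_matrix_mult, of "transpose M"]
  by (rule bounded_linear_add)

lemma bounded_linear_transpose: "bounded_linear (transpose :: real^'n^'n \<Rightarrow> real^'n^'n)"
  by (subst linear_conv_bounded_linear[symmetric]) (auto simp: linear_iff transpose_def vec_eq_iff)

text \<open>
  Both forms of the derivative of \<open>exp(- t M) X exp(- t M\<^sup>*)\<close> are used: the first shows that this function is
  constant if \<open>M X + X M\<^sup>* = 0\<close>, the second integrates to the Lyapunov equation.
\<close>

lemma conjugation_derivative:
  fixes M X :: "real^'n^'n"
  defines "E \<equiv> \<lambda>t. mat_exp (t *\<^sub>R (- M))"
  shows "((\<lambda>t. E t ** X ** transpose (E t)) has_vector_derivative - (E t ** lyap M X ** transpose (E t))) (at t)"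
    and "((\<lambda>t. E t ** X ** transpose (E t)) has_vector_derivative - lyap M (E t ** X ** transpose (E t))) (at t)"
proof -
  note bil = bounded_bilinear_matrix_mult
  have dE: "(E has_vector_derivative - M ** E t) (at t)"
    unfolding E_def by (rule mat_exp_has_derivative)
  have EM: "E t ** M = M ** E t" using mat_exp_commute[of t "- M"]
    by (simp add: E_def matrix_mult_minus_left matrix_mult_minus_right)
  have dE1: "((\<lambda>t. E t ** X) has_vector_derivative - M ** E t ** X) (at t)"
    using bounded_linear.has_vector_derivative[OF bounded_bilinear.bounded_linear_left[OF bil] dE] .
  have dET: "((\<lambda>t. transpose (E t)) has_vector_derivative transpose (- M ** E t)) (at t)"
    using bounded_linear.has_vector_derivative[OF bounded_linear_transpose dE] .
  note d = bounded_bilinear.has_vector_derivative[OF bil dE1 dET]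
  show der: "((\<lambda>t. E t ** X ** transpose (E t)) has_vector_derivative - lyap M (E t ** X ** transpose (E t))) (at t)"
    by (rule has_vector_derivative_eq_rhs[OF d])
       (simp add: lyap_def matrix_mult_minus_left matrix_mult_minus_right transpose_uminus matrix_transpose_mul matrix_mul_assoc)
  have tr: "transpose M ** transpose (E t) = transpose (E t) ** transpose M"
    using arg_cong[OF EM, of transpose] by (simp add: matrix_transpose_mul)
  have eq: "lyap M (E t ** X ** transpose (E t)) = E t ** lyap M X ** transpose (E t)"
    unfolding lyap_def
    by (simp add: matrix_add_ldistrib bounded_bilinear.add_left[OF bounded_bilinear_matrix_mult] matrix_mul_assoc EM)
       (simp add: matrix_mul_assoc[symmetric] tr)
  show "((\<lambda>t. E t ** X ** transpose (E t)) has_vector_derivative - (E t ** lyap M X ** transpose (E t))) (at t)"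
    using der unfolding eq .
qed

lemma conjugation_decay:
  fixes M X :: "real^'n^'n"
  assumes ev: "eigenvalues_pos_real_part M"
  obtains c K where "c > 0" "K \<ge> 0"
    "\<And>t. 0 \<le> t \<Longrightarrow> norm (mat_exp (t *\<^sub>R (- M)) ** X ** transpose (mat_exp (t *\<^sub>R (- M)))) \<le> K * exp (- (c * t))"
proof -
  let ?E = "\<lambda>t. mat_exp (t *\<^sub>R (- M))"
  obtain c K where c: "c > 0" "K \<ge> 0"
    and d: "\<And>t. 0 \<le> t \<Longrightarrow> norm (?E t) \<le> K * exp (- (c * t))" using mat_exp_decay[OF ev] by blast
  obtain b where b: "b > 0" "\<And>(A::real^'n^'n) (B::real^'n^'n). norm (A ** B) \<le> norm A * norm B * b"
    using bounded_bilinear.pos_bounded[OF bounded_bilinear_matrix_mult] by blast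
  obtain b' where b': "b' > 0" "\<And>A::real^'n^'n. norm (transpose A) \<le> norm A * b'"
    using bounded_linear.pos_bounded[OF bounded_linear_transpose] by blast
  have "norm (?E t ** X ** transpose (?E t)) \<le> (K * norm X * b * (K * b') * b) * exp (- (c * t))" if t: "t \<ge> 0" for t
  proof -
    have "norm (?E t ** X ** transpose (?E t)) \<le> (norm (?E t) * norm X * b) * (norm (?E t) * b') * b"
      by (rule order_trans[OF b(2)], intro mult_right_mono mult_mono b(2) b'(2)) (use b(1) b'(1) in auto)
    also have "\<dots> \<le> (K * exp (- (c * t)) * norm X * b) * ((K * 1) * b') * b"
    proof -
      have "norm (?E t) \<le> K * 1" using d[OF t] c t
        by (meson mult_left_mono order_trans exp_le_one_iff mult_nonneg_nonneg neg_le_0_iff_le less_imp_le)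
      then show ?thesis using d[OF t] b b' c by (intro mult_right_mono mult_mono) auto
    qed
    finally show ?thesis by (simp add: mult_ac)
  qed
  then show ?thesis using that[of c "K * norm X * b * (K * b') * b"] c b b' by auto
qed

text \<open>
  The conjugates \<open>exp(- t M) X exp(- t M\<^sup>*)\<close> are constant in \<open>t\<close> and tend to 0.
\<close>

lemma lyap_eq_0:
  assumes ev: "eigenvalues_pos_real_part M" and 0: "lyap M X = 0"
  shows "X = 0"
proof -
  let ?E = "\<lambda>t. mat_exp (t *\<^sub>R (- M))" and ?H = "\<lambda>t. mat_exp (t *\<^sub>R (- M)) ** X ** transpose (mat_exp (t *\<^sub>R (- M)))"
  have "(?H has_vector_derivative 0) (at t within UNIV)" for t
    using conjugation_derivative(1)[of M X t] 0
    by (simp add: bounded_bilinear.zero_right[OF bounded_bilinear_matrix_mult]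
        bounded_bilinear.zero_left[OF bounded_bilinear_matrix_mult])
  then obtain h where h: "\<And>t. ?H t = h"
    using has_vector_derivative_zero_constant[of UNIV ?H] by auto
  have "h = X" using h[of 0] mat_exp_0[of "- M"] by (simp add: transpose_mat)
  obtain c K where c: "c > 0" "K \<ge> 0" and d: "\<And>t. 0 \<le> t \<Longrightarrow> norm (?H t) \<le> K * exp (- (c * t))"
    using conjugation_decay[OF ev] by blast
  have "norm X \<le> K * exp (- (c * t))" if "t \<ge> 0" for t using d[OF that] h[of t] \<open>h = X\<close> by simp
  then have "\<forall>\<^sub>F t in at_top. norm X \<le> K * exp (- (c * t))"
    by (rule eventually_mono[OF eventually_ge_at_top[of 0]])
  moreover have "((\<lambda>t. K * exp (- (c * t))) \<longlongrightarrow> K * 0) at_top"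
    using c(1)
    by (intro tendsto_mult tendsto_const filterlim_compose[OF exp_at_bot]
        filterlim_compose[OF filterlim_uminus_at_bot_at_top] filterlim_tendsto_pos_mult_at_top[OF tendsto_const] filterlim_ident)
  ultimately have "norm X \<le> K * 0" by (intro tendsto_lowerbound) auto
  then show ?thesis by simp
qed

lemma lyap_bounded_below:
  assumes ev: "eigenvalues_pos_real_part (M :: real^'n^'n)"
  obtains \<kappa> where "\<kappa> > 0" "\<And>X. norm X \<le> \<kappa> * norm (lyap M X)"
proof -
  have lin: "linear (lyap M)" using bounded_linear_lyap by (rule bounded_linear.linear)
  then have "inj (lyap M)" using lyap_eq_0[OF ev] by (simp add: linear_injective_0)
  then obtain B where "B > 0" "\<And>x. B * norm x \<le> norm (lyap M x)"
    using linear_inj_bounded_below_pos[OF lin] by metis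
  then show ?thesis by (intro that[of "1 / B"]) (auto simp: field_simps)
qed

text \<open>
  Integrating the derivative of \<open>exp(- t M) exp(- t M\<^sup>*)\<close> over \<open>[0, b]\<close> and letting \<open>b\<close> tend to infinity.
\<close>

lemma lyap_cov_mat:
  assumes ev: "eigenvalues_pos_real_part (M :: real^'n^'n)"
  shows "lyap M (cov_mat M) = mat 1"
proof -
  define E where "E t = mat_exp (t *\<^sub>R (- M))" for t
  define F where "F t = E t ** mat 1 ** transpose (E t)" for t
  have cov: "cov_mat M = integral {0..} F"
    unfolding cov_mat_def F_def E_def mat_exp_transpose[symmetric] by (simp add: transpose_uminus)
  have dF: "(F has_vector_derivative - lyap M (F t)) (at t)" for t
    unfolding F_def E_def by (rule conjugation_derivative(2))
  have F0: "F 0 = mat 1" using mat_exp_0[of "- M"] by (simp add: F_def E_def transpose_mat)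
  have contF: "continuous_on S F" for S
    by (intro continuous_at_imp_continuous_on ballI has_vector_derivative_continuous[OF dF])
  obtain c K where c: "c > 0" "K \<ge> 0" and d: "\<And>t. 0 \<le> t \<Longrightarrow> norm (F t) \<le> K * exp (- (c * t))"
    using conjugation_decay[OF ev, of "mat 1"] unfolding F_def E_def by blast
  have abs: "F absolutely_integrable_on {0..}"
  proof (rule measurable_bounded_by_integrable_imp_absolutely_integrable)
    show "F \<in> borel_measurable (lebesgue_on {0..})"
      by (rule continuous_imp_measurable_on_sets_lebesgue[OF contF]) auto
    have "(\<lambda>t. K * exp (- c * t)) integrable_on {0..}"
      by (intro integrable_on_mult_right integrable_on_exp_minus_to_infinity c(1))
    then show "(\<lambda>t. K * exp (- (c * t))) integrable_on {0..}" by simp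
  qed (use d in auto)
  have lim: "((\<lambda>b. integral {0..b} F) \<longlongrightarrow> integral {0..} F) at_top"
  proof -
    have "((\<lambda>b. set_lebesgue_integral lebesgue {0..b} F) \<longlongrightarrow> set_lebesgue_integral lebesgue {0..} F) at_top"
      by (rule tendsto_set_lebesgue_integral_at_top[OF _ abs]) auto
    moreover have "set_lebesgue_integral lebesgue {0..b} F = integral {0..b} F" for b
      by (intro set_lebesgue_integral_eq_integral set_integrable_subset[OF abs]) auto
    ultimately show ?thesis using set_lebesgue_integral_eq_integral(2)[OF abs] by simp
  qed
  have lyi: "lyap M (integral {0..b} F) = mat 1 - F b" if "b \<ge> 0" for b
  proof -
    have h: "((\<lambda>t. - lyap M (F t)) has_integral (F b - F 0)) {0..b}"
      by (rule fundamental_theorem_of_calculus[OF that]) (rule has_vector_derivative_at_within[OF dF])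
    have "((\<lambda>t. lyap M (F t)) has_integral (mat 1 - F b)) {0..b}"
      using has_integral_neg[OF h] by (simp add: F0)
    moreover have "((\<lambda>t. lyap M (F t)) has_integral lyap M (integral {0..b} F)) {0..b}"
      using has_integral_linear[OF integrable_integral bounded_linear_lyap, OF integrable_continuous_interval[OF contF]]
      by (simp add: o_def)
    ultimately show ?thesis by (rule has_integral_unique[symmetric])
  qed
  have "((\<lambda>t. K * exp (- (c * t))) \<longlongrightarrow> K * 0) at_top"
    using c(1)
    by (intro tendsto_mult tendsto_const filterlim_compose[OF exp_at_bot]
        filterlim_compose[OF filterlim_uminus_at_bot_at_top] filterlim_tendsto_pos_mult_at_top[OF tendsto_const] filterlim_ident)
  then have "(F \<longlongrightarrow> 0) at_top"
    using d by (intro Lim_null_comparison[of F "\<lambda>t. K * exp (- (c * t))"] eventually_mono[OF eventually_ge_at_top[of 0]]) auto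
  then have "((\<lambda>b. mat 1 - F b) \<longlongrightarrow> mat 1 - 0) at_top" by (intro tendsto_intros)
  moreover have "\<forall>\<^sub>F b in at_top. mat 1 - F b = lyap M (integral {0..b} F)"
    by (rule eventually_mono[OF eventually_ge_at_top[of 0]]) (simp add: lyi)
  ultimately have "((\<lambda>b. lyap M (integral {0..b} F)) \<longlongrightarrow> mat 1 - 0) at_top"
    by (rule Lim_transform_eventually)
  moreover have "((\<lambda>b. lyap M (integral {0..b} F)) \<longlongrightarrow> lyap M (integral {0..} F)) at_top"
    by (rule bounded_linear.tendsto[OF bounded_linear_lyap lim])
  ultimately show ?thesis unfolding cov using tendsto_unique[OF trivial_limit_at_top_linorder] by (metis diff_zero)
qed

section \<open>Moment bounds\<close>

text \<open>
  The \<open>L\<^sup>2\<^sup>p\<close> norm of \<open>Z\<close> is at most \<open>x\<close>. The measurable majorant \<open>U\<close> makes the notion meaningful, and stable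
  under sums and products, for functions such as Riemann--Stieltjes integrals along paths, which are
  known only up to null sets and whose measurability would have to be established separately.
  Even exponents suffice, since bounds for all of them control every \<open>L\<^sup>q\<close>.
\<close>

definition moment_bound :: "'w measure \<Rightarrow> nat \<Rightarrow> ('w \<Rightarrow> 'a::real_normed_vector) \<Rightarrow> real \<Rightarrow> bool" where
  "moment_bound \<Omega> p Z x \<longleftrightarrow> 0 \<le> x \<and>
     (\<exists>U\<in>borel_measurable \<Omega>. (\<forall>\<omega>. 0 \<le> U \<omega>) \<and> (AE \<omega> in \<Omega>. norm (Z \<omega>) \<le> U \<omega>) \<and>
        (\<integral>\<^sup>+ \<omega>. ennreal (U \<omega> ^ (2 * p)) \<partial>\<Omega>) \<le> ennreal (x ^ (2 * p)))"

lemma moment_boundI: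
  assumes "0 \<le> x" "U \<in> borel_measurable \<Omega>" "\<And>\<omega>. 0 \<le> U \<omega>" "AE \<omega> in \<Omega>. norm (Z \<omega>) \<le> U \<omega>"
    "(\<integral>\<^sup>+ \<omega>. ennreal (U \<omega> ^ (2 * p)) \<partial>\<Omega>) \<le> ennreal (x ^ (2 * p))"
  shows "moment_bound \<Omega> p Z x"
  using assms unfolding moment_bound_def by blast

lemma moment_bound_nonneg: "moment_bound \<Omega> p Z x \<Longrightarrow> 0 \<le> x"
  by (simp add: moment_bound_def)

lemma moment_bound_mono:
  assumes "moment_bound \<Omega> p Z x" "AE \<omega> in \<Omega>. norm (Z' \<omega>) \<le> norm (Z \<omega>)" "x \<le> y"
  shows "moment_bound \<Omega> p Z' y"
proof -
  obtain U where U: "0 \<le> x" "U \<in> borel_measurable \<Omega>" "\<And>\<omega>. 0 \<le> U \<omega>" "AE \<omega> in \<Omega>. norm (Z \<omega>) \<le> U \<omega>"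
    "(\<integral>\<^sup>+ \<omega>. ennreal (U \<omega> ^ (2 * p)) \<partial>\<Omega>) \<le> ennreal (x ^ (2 * p))"
    using assms(1) unfolding moment_bound_def by blast
  show ?thesis
  proof (rule moment_boundI[OF _ U(2,3)])
    show "AE \<omega> in \<Omega>. norm (Z' \<omega>) \<le> U \<omega>" using U(4) assms(2) by eventually_elim simp
    show "(\<integral>\<^sup>+ \<omega>. ennreal (U \<omega> ^ (2 * p)) \<partial>\<Omega>) \<le> ennreal (y ^ (2 * p))"
      using U(1) assms(3) by (intro order_trans[OF U(5)] ennreal_leI power_mono) auto
  qed (use U(1) assms(3) in auto)
qed

lemma moment_bound_le: "moment_bound \<Omega> p Z x \<Longrightarrow> x \<le> y \<Longrightarrow> moment_bound \<Omega> p Z y"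
  by (rule moment_bound_mono) auto

lemma moment_bound_norm: "moment_bound \<Omega> p Z x \<Longrightarrow> moment_bound \<Omega> p (\<lambda>\<omega>. norm (Z \<omega>)) x"
  by (erule moment_bound_mono) auto

lemma moment_bound_scaleR:
  assumes "moment_bound \<Omega> p Z x"
  shows "moment_bound \<Omega> p (\<lambda>\<omega>. c *\<^sub>R Z \<omega>) (\<bar>c\<bar> * x)"
proof -
  obtain U where U: "0 \<le> x" and [measurable]: "U \<in> borel_measurable \<Omega>" and U2: "\<And>\<omega>. 0 \<le> U \<omega>" "AE \<omega> in \<Omega>. norm (Z \<omega>) \<le> U \<omega>"
    "(\<integral>\<^sup>+ \<omega>. ennreal (U \<omega> ^ (2 * p)) \<partial>\<Omega>) \<le> ennreal (x ^ (2 * p))"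
    using assms unfolding moment_bound_def by blast
  have "(\<integral>\<^sup>+ \<omega>. ennreal ((\<bar>c\<bar> * U \<omega>) ^ (2 * p)) \<partial>\<Omega>) = ennreal (\<bar>c\<bar> ^ (2 * p)) * (\<integral>\<^sup>+ \<omega>. ennreal (U \<omega> ^ (2 * p)) \<partial>\<Omega>)"
    by (subst nn_integral_cmult[symmetric]) (auto simp: power_mult_distrib ennreal_mult)
  also have "\<dots> \<le> ennreal (\<bar>c\<bar> ^ (2 * p)) * ennreal (x ^ (2 * p))" by (intro mult_left_mono U2) auto
  also have "\<dots> = ennreal ((\<bar>c\<bar> * x) ^ (2 * p))"
    using U by (simp add: power_mult_distrib ennreal_mult)
  finally have "(\<integral>\<^sup>+ \<omega>. ennreal ((\<bar>c\<bar> * U \<omega>) ^ (2 * p)) \<partial>\<Omega>) \<le> ennreal ((\<bar>c\<bar> * x) ^ (2 * p))" .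
  moreover have "AE \<omega> in \<Omega>. norm (c *\<^sub>R Z \<omega>) \<le> \<bar>c\<bar> * U \<omega>"
    using U2(2) by eventually_elim (simp add: mult_left_mono)
  ultimately show ?thesis
    using U U2(1) by (intro moment_boundI[where U="\<lambda>\<omega>. \<bar>c\<bar> * U \<omega>"]) auto
qed

lemma moment_bound_lipschitz:
  assumes "moment_bound \<Omega> p Z x" "AE \<omega> in \<Omega>. norm (Z' \<omega>) \<le> c * norm (Z \<omega>)" "0 \<le> c"
  shows "moment_bound \<Omega> p Z' (c * x)"
proof -
  have "moment_bound \<Omega> p (\<lambda>\<omega>. c *\<^sub>R norm (Z \<omega>)) (\<bar>c\<bar> * x)"
    using assms by (intro moment_bound_scaleR moment_bound_norm)
  then show ?thesis
    by (rule moment_bound_mono) (use assms in auto)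
qed

text \<open>
  Jensen's inequality with the weights \<open>x / (x + y)\<close> and \<open>y / (x + y)\<close>, for which integration gives
  Minkowski's inequality.
\<close>

lemma convex_pow_combination:
  fixes a b x y :: real
  assumes "a \<ge> 0" "b \<ge> 0" "x > 0" "y > 0" "n \<ge> 1"
  shows "(a + b) ^ n \<le> (x + y) ^ n * (x / (x + y) * (a / x) ^ n + y / (x + y) * (b / y) ^ n)"
proof -
  have "convex_on {0..} (\<lambda>t::real. t ^ n)" using convex_power_even convex_on_realI
    by (intro convex_on_realI[where f'="\<lambda>t. of_nat n * t ^ (n - 1)"])
      (auto intro!: derivative_eq_intros mult_left_mono power_mono)
  moreover have eq: "1 - y / (x + y) = x / (x + y)" using assms by (simp add: field_simps)
  ultimately have "((x / (x + y)) *\<^sub>R (a / x) + (y / (x + y)) *\<^sub>R (b / y)) ^ n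
      \<le> x / (x + y) * (a / x) ^ n + y / (x + y) * (b / y) ^ n"
    using convex_onD[of "{0..}" "\<lambda>t::real. t ^ n" "y / (x + y)" "a / x" "b / y"] assms unfolding eq
    by (auto simp: field_simps)
  moreover have "(x / (x + y)) *\<^sub>R (a / x) + (y / (x + y)) *\<^sub>R (b / y) = (a + b) / (x + y)"
    using assms by (simp add: add_divide_distrib)
  ultimately have "((a + b) / (x + y)) ^ n \<le> x / (x + y) * (a / x) ^ n + y / (x + y) * (b / y) ^ n"
    by simp
  then have "(x + y) ^ n * ((a + b) / (x + y)) ^ n \<le> (x + y) ^ n * (x / (x + y) * (a / x) ^ n + y / (x + y) * (b / y) ^ n)"
    using assms by (intro mult_left_mono) auto
  then show ?thesis using assms by (simp add: power_mult_distrib[symmetric])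
qed

text \<open>
  Minkowski's inequality. It is important that the constant is 1, because sums over a whole grid are
  estimated with it.
\<close>

lemma moment_bound_add:
  assumes "moment_bound \<Omega> p Z x" "moment_bound \<Omega> p Z' y" and p: "p \<ge> 1"
  shows "moment_bound \<Omega> p (\<lambda>\<omega>. Z \<omega> + Z' \<omega>) (x + y)"
proof -
  obtain U where U: "0 \<le> x" and [measurable]: "U \<in> borel_measurable \<Omega>" and U2: "\<And>\<omega>. 0 \<le> U \<omega>" "AE \<omega> in \<Omega>. norm (Z \<omega>) \<le> U \<omega>"
    "(\<integral>\<^sup>+ \<omega>. ennreal (U \<omega> ^ (2 * p)) \<partial>\<Omega>) \<le> ennreal (x ^ (2 * p))"
    using assms(1) unfolding moment_bound_def by blast
  obtain V where V: "0 \<le> y" and [measurable]: "V \<in> borel_measurable \<Omega>" and V2: "\<And>\<omega>. 0 \<le> V \<omega>" "AE \<omega> in \<Omega>. norm (Z' \<omega>) \<le> V \<omega>"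
    "(\<integral>\<^sup>+ \<omega>. ennreal (V \<omega> ^ (2 * p)) \<partial>\<Omega>) \<le> ennreal (y ^ (2 * p))"
    using assms(2) unfolding moment_bound_def by blast
  let ?I = "\<integral>\<^sup>+ \<omega>. ennreal ((U \<omega> + V \<omega>) ^ (2 * p)) \<partial>\<Omega>"
  \<comment> \<open>The weights require positive bounds, hence the detour through \<open>x + e\<close> and \<open>y + e\<close>.\<close>
  have le: "?I \<le> ennreal ((x + y + 2 * e) ^ (2 * p))" if e: "e > 0" for e
  proof -
    define a where "a = x + e"
    define b where "b = y + e"
    have ab: "a > 0" "b > 0" using U V e by (auto simp: a_def b_def)
    define A where "A = (a + b) ^ (2 * p) * (a / (a + b) * (1 / a) ^ (2 * p))"
    define B where "B = (a + b) ^ (2 * p) * (b / (a + b) * (1 / b) ^ (2 * p))"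
    have AB0: "A \<ge> 0" "B \<ge> 0" using ab by (auto simp: A_def B_def)
    have pt: "(U \<omega> + V \<omega>) ^ (2 * p) \<le> A * U \<omega> ^ (2 * p) + B * V \<omega> ^ (2 * p)" for \<omega>
      using convex_pow_combination[OF U2(1)[of \<omega>] V2(1)[of \<omega>] ab, of "2 * p"] p
      by (simp add: A_def B_def power_divide algebra_simps)
    have "?I \<le> (\<integral>\<^sup>+ \<omega>. ennreal A * ennreal (U \<omega> ^ (2 * p)) + ennreal B * ennreal (V \<omega> ^ (2 * p)) \<partial>\<Omega>)"
      using pt AB0 U2(1) V2(1) by (intro nn_integral_mono) (simp add: ennreal_mult[symmetric] ennreal_plus[symmetric] del: ennreal_plus)
    also have "\<dots> = ennreal A * (\<integral>\<^sup>+ \<omega>. ennreal (U \<omega> ^ (2 * p)) \<partial>\<Omega>) + ennreal B * (\<integral>\<^sup>+ \<omega>. ennreal (V \<omega> ^ (2 * p)) \<partial>\<Omega>)"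
      by (subst nn_integral_add) (auto simp: nn_integral_cmult)
    also have "\<dots> \<le> ennreal A * ennreal (a ^ (2 * p)) + ennreal B * ennreal (b ^ (2 * p))"
      using U V e by (intro add_mono mult_left_mono order_trans[OF U2(3)] order_trans[OF V2(3)] ennreal_leI power_mono) (auto simp: a_def b_def)
    also have "\<dots> = ennreal (A * a ^ (2 * p) + B * b ^ (2 * p))"
      using AB0 ab by (simp add: ennreal_mult ennreal_plus)
    also have "A * a ^ (2 * p) + B * b ^ (2 * p) = (a + b) ^ (2 * p) * (a / (a + b) + b / (a + b))"
    proof -
      have "A * a ^ (2 * p) = (a + b) ^ (2 * p) * (a / (a + b))"
        using ab by (simp add: A_def power_divide)
      moreover have "B * b ^ (2 * p) = (a + b) ^ (2 * p) * (b / (a + b))"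
        using ab by (simp add: B_def power_divide)
      ultimately show ?thesis by (simp only: distrib_left)
    qed
    also have "\<dots> = (x + y + 2 * e) ^ (2 * p)"
      using ab by (simp add: add_divide_distrib[symmetric]) (simp add: a_def b_def algebra_simps)
    finally show ?thesis .
  qed
  have "((\<lambda>e. ennreal ((x + y + 2 * e) ^ (2 * p))) \<longlongrightarrow> ennreal ((x + y + 2 * 0) ^ (2 * p))) (at_right 0)"
    by (intro tendsto_intros)
  moreover have "\<forall>\<^sub>F e in at_right 0. ?I \<le> ennreal ((x + y + 2 * e) ^ (2 * p))"
    using le by (auto simp: eventually_at_filter)
  ultimately have "?I \<le> ennreal ((x + y + 2 * 0) ^ (2 * p))"
    by (intro tendsto_lowerbound) auto
  moreover have "AE \<omega> in \<Omega>. norm (Z \<omega> + Z' \<omega>) \<le> U \<omega> + V \<omega>"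
    using U2(2) V2(2) by eventually_elim (rule norm_triangle_le, simp)
  ultimately show ?thesis
    using U V U2 V2 by (intro moment_boundI[where U="\<lambda>\<omega>. U \<omega> + V \<omega>"]) auto
qed

lemma moment_bound_zero: "p \<ge> 1 \<Longrightarrow> moment_bound \<Omega> p (\<lambda>\<omega>. 0) 0"
  by (rule moment_boundI[where U="\<lambda>_. 0"]) (auto simp: zero_power)

lemma moment_bound_minus: "moment_bound \<Omega> p Z x \<Longrightarrow> moment_bound \<Omega> p (\<lambda>\<omega>. - Z \<omega>) x"
  by (erule moment_bound_mono) auto

lemma moment_bound_diff:
  assumes "moment_bound \<Omega> p Z x" "moment_bound \<Omega> p Z' y" "p \<ge> 1"
  shows "moment_bound \<Omega> p (\<lambda>\<omega>. Z \<omega> - Z' \<omega>) (x + y)"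
  using moment_bound_add[OF assms(1) moment_bound_minus[OF assms(2)] assms(3)] by simp

lemma moment_bound_sum:
  assumes "finite I" "\<And>i. i \<in> I \<Longrightarrow> moment_bound \<Omega> p (Z i) (x i)" "p \<ge> 1"
  shows "moment_bound \<Omega> p (\<lambda>\<omega>. \<Sum>i\<in>I. Z i \<omega>) (\<Sum>i\<in>I. x i)"
  using assms by (induction I rule: finite_induct) (auto simp: moment_bound_zero intro!: moment_bound_add)

text \<open>
  The Cauchy--Schwarz inequality, from \<open>u v \<le> (b/a) u\<^sup>2 / 2 + (a/b) v\<^sup>2 / 2\<close> with the optimal \<open>a\<close> and \<open>b\<close>.
\<close>

lemma moment_bound_prod:
  assumes Z: "moment_bound \<Omega> (2 * p) Z x" and Z': "moment_bound \<Omega> (2 * p) Z' y"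
    and Y: "AE \<omega> in \<Omega>. norm (Y \<omega>) \<le> norm (Z \<omega>) * norm (Z' \<omega>)"
  shows "moment_bound \<Omega> p Y (x * y)"
proof -
  obtain U where U: "0 \<le> x" and [measurable]: "U \<in> borel_measurable \<Omega>" and U2: "\<And>\<omega>. 0 \<le> U \<omega>" "AE \<omega> in \<Omega>. norm (Z \<omega>) \<le> U \<omega>"
    "(\<integral>\<^sup>+ \<omega>. ennreal (U \<omega> ^ (2 * (2 * p))) \<partial>\<Omega>) \<le> ennreal (x ^ (2 * (2 * p)))"
    using Z unfolding moment_bound_def by blast
  obtain V where V: "0 \<le> y" and [measurable]: "V \<in> borel_measurable \<Omega>" and V2: "\<And>\<omega>. 0 \<le> V \<omega>" "AE \<omega> in \<Omega>. norm (Z' \<omega>) \<le> V \<omega>"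
    "(\<integral>\<^sup>+ \<omega>. ennreal (V \<omega> ^ (2 * (2 * p))) \<partial>\<Omega>) \<le> ennreal (y ^ (2 * (2 * p)))"
    using Z' unfolding moment_bound_def by blast
  let ?I = "\<integral>\<^sup>+ \<omega>. ennreal ((U \<omega> * V \<omega>) ^ (2 * p)) \<partial>\<Omega>"
  have le: "?I \<le> ennreal (((x + e) * (y + e)) ^ (2 * p))" if e: "e > 0" for e
  proof -
    define a where "a = (x + e) ^ (2 * p)"
    define b where "b = (y + e) ^ (2 * p)"
    have ab: "a > 0" "b > 0" using U V e by (auto simp: a_def b_def)
    have pt: "(U \<omega> * V \<omega>) ^ (2 * p) \<le> b / (2 * a) * U \<omega> ^ (2 * (2 * p)) + a / (2 * b) * V \<omega> ^ (2 * (2 * p))" for \<omega>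
    proof -
      define u where "u = U \<omega> ^ (2 * p)"
      define v where "v = V \<omega> ^ (2 * p)"
      have "0 \<le> (b * u - a * v)\<^sup>2" by simp
      then have "2 * (a * b) * (u * v) \<le> b\<^sup>2 * u\<^sup>2 + a\<^sup>2 * v\<^sup>2" by (simp add: power2_eq_square algebra_simps)
      then have "u * v \<le> b / (2 * a) * u\<^sup>2 + a / (2 * b) * v\<^sup>2" using ab by (simp add: field_simps power2_eq_square)
      then show ?thesis unfolding u_def v_def by (simp add: power_mult_distrib power_mult[symmetric] mult_ac)
    qed
    have "?I \<le> (\<integral>\<^sup>+ \<omega>. ennreal (b / (2 * a)) * ennreal (U \<omega> ^ (2 * (2 * p))) + ennreal (a / (2 * b)) * ennreal (V \<omega> ^ (2 * (2 * p))) \<partial>\<Omega>)"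
      using pt ab U2(1) V2(1) by (intro nn_integral_mono) (simp add: ennreal_mult[symmetric] ennreal_plus[symmetric] del: ennreal_plus)
    also have "\<dots> = ennreal (b / (2 * a)) * (\<integral>\<^sup>+ \<omega>. ennreal (U \<omega> ^ (2 * (2 * p))) \<partial>\<Omega>) + ennreal (a / (2 * b)) * (\<integral>\<^sup>+ \<omega>. ennreal (V \<omega> ^ (2 * (2 * p))) \<partial>\<Omega>)"
      by (subst nn_integral_add) (auto simp: nn_integral_cmult)
    also have "\<dots> \<le> ennreal (b / (2 * a)) * ennreal ((x + e) ^ (2 * (2 * p))) + ennreal (a / (2 * b)) * ennreal ((y + e) ^ (2 * (2 * p)))"
      using U V e by (intro add_mono mult_left_mono order_trans[OF U2(3)] order_trans[OF V2(3)] ennreal_leI power_mono) auto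
    also have "\<dots> = ennreal (b / (2 * a) * a\<^sup>2 + a / (2 * b) * b\<^sup>2)"
    proof -
      have "(x + e) ^ (2 * (2 * p)) = a\<^sup>2" "(y + e) ^ (2 * (2 * p)) = b\<^sup>2"
        by (simp_all add: a_def b_def power_mult[symmetric] mult_ac)
      then show ?thesis using ab by (simp add: ennreal_mult[symmetric] ennreal_plus[symmetric] del: ennreal_plus)
    qed
    also have "b / (2 * a) * a\<^sup>2 + a / (2 * b) * b\<^sup>2 = a * b" using ab by (simp add: power2_eq_square field_simps)
    finally show ?thesis by (simp add: a_def b_def power_mult_distrib)
  qed
  have "((\<lambda>e. ennreal (((x + e) * (y + e)) ^ (2 * p))) \<longlongrightarrow> ennreal (((x + 0) * (y + 0)) ^ (2 * p))) (at_right 0)"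
    by (intro tendsto_intros)
  moreover have "\<forall>\<^sub>F e in at_right 0. ?I \<le> ennreal (((x + e) * (y + e)) ^ (2 * p))"
    using le by (auto simp: eventually_at_filter)
  ultimately have "?I \<le> ennreal (((x + 0) * (y + 0)) ^ (2 * p))"
    by (intro tendsto_lowerbound) auto
  moreover have "AE \<omega> in \<Omega>. norm (Y \<omega>) \<le> U \<omega> * V \<omega>"
    using U2(2) V2(2) Y
  proof eventually_elim
    case (elim \<omega>)
    then show ?case using U2(1)[of \<omega>] by (meson mult_mono norm_ge_zero order_trans)
  qed
  ultimately show ?thesis
    using U V U2(1) V2(1) by (intro moment_boundI[where U="\<lambda>\<omega>. U \<omega> * V \<omega>"]) auto
qed

lemma moment_bound_measurable:
  fixes Z :: "'w \<Rightarrow> 'a::{real_normed_vector, second_countable_topology}"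
  assumes "Z \<in> borel_measurable \<Omega>"
  shows "moment_bound \<Omega> p Z x \<longleftrightarrow> 0 \<le> x \<and> (\<integral>\<^sup>+ \<omega>. ennreal (norm (Z \<omega>) ^ (2 * p)) \<partial>\<Omega>) \<le> ennreal (x ^ (2 * p))"
proof (intro iffI conjI; (elim conjE)?)
  assume "moment_bound \<Omega> p Z x"
  then obtain U where U: "0 \<le> x" "U \<in> borel_measurable \<Omega>" "\<And>\<omega>. 0 \<le> U \<omega>" "AE \<omega> in \<Omega>. norm (Z \<omega>) \<le> U \<omega>"
    "(\<integral>\<^sup>+ \<omega>. ennreal (U \<omega> ^ (2 * p)) \<partial>\<Omega>) \<le> ennreal (x ^ (2 * p))" unfolding moment_bound_def by blast
  show "0 \<le> x" by fact
  have "(\<integral>\<^sup>+ \<omega>. ennreal (norm (Z \<omega>) ^ (2 * p)) \<partial>\<Omega>) \<le> (\<integral>\<^sup>+ \<omega>. ennreal (U \<omega> ^ (2 * p)) \<partial>\<Omega>)"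
    using U(4) by (intro nn_integral_mono_AE) (auto elim!: eventually_mono intro!: ennreal_leI power_mono)
  then show "(\<integral>\<^sup>+ \<omega>. ennreal (norm (Z \<omega>) ^ (2 * p)) \<partial>\<Omega>) \<le> ennreal (x ^ (2 * p))" using U(5) by simp
next
  assume "0 \<le> x" "(\<integral>\<^sup>+ \<omega>. ennreal (norm (Z \<omega>) ^ (2 * p)) \<partial>\<Omega>) \<le> ennreal (x ^ (2 * p))"
  then show "moment_bound \<Omega> p Z x" using assms by (intro moment_boundI[where U="\<lambda>\<omega>. norm (Z \<omega>)"]) auto
qed

lemma moment_bound_fatou:
  fixes Z :: "nat \<Rightarrow> 'w \<Rightarrow> 'a::{real_normed_vector, second_countable_topology}"
  assumes meas[measurable]: "\<And>k. Z k \<in> borel_measurable \<Omega>"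
    and mb: "\<forall>\<^sub>F k in sequentially. moment_bound \<Omega> p (Z k) x" and p: "p \<ge> 1"
    and lim: "AE \<omega> in \<Omega>. (\<lambda>k. Z k \<omega>) \<longlonglongrightarrow> Y \<omega>"
  shows "moment_bound \<Omega> p Y x"
proof -
  have x: "0 \<le> x" using mb eventually_happens'[OF sequentially_bot] moment_bound_nonneg by blast
  define G where "G \<omega> = liminf (\<lambda>k. ennreal (norm (Z k \<omega>) ^ (2 * p)))" for \<omega>
  have Gm[measurable]: "G \<in> borel_measurable \<Omega>" unfolding G_def by measurable
  have "(\<integral>\<^sup>+ \<omega>. G \<omega> \<partial>\<Omega>) \<le> liminf (\<lambda>k. \<integral>\<^sup>+ \<omega>. ennreal (norm (Z k \<omega>) ^ (2 * p)) \<partial>\<Omega>)"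
    unfolding G_def by (rule nn_integral_liminf) measurable
  also have "\<dots> \<le> liminf (\<lambda>k. ennreal (x ^ (2 * p)))"
    using mb by (intro Liminf_mono) (auto elim!: eventually_mono simp: moment_bound_measurable)
  also have "\<dots> = ennreal (x ^ (2 * p))" by (simp add: Liminf_const)
  finally have GI: "(\<integral>\<^sup>+ \<omega>. G \<omega> \<partial>\<Omega>) \<le> ennreal (x ^ (2 * p))" .
  have YG: "AE \<omega> in \<Omega>. G \<omega> = ennreal (norm (Y \<omega>) ^ (2 * p))"
    using lim
  proof eventually_elim
    case (elim \<omega>)
    have "(\<lambda>k. ennreal (norm (Z k \<omega>) ^ (2 * p))) \<longlonglongrightarrow> ennreal (norm (Y \<omega>) ^ (2 * p))"
      using elim by (intro tendsto_intros)
    then show ?case unfolding G_def by (intro lim_imp_Liminf) auto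
  qed
  define U where "U \<omega> = root (2 * p) (enn2real (G \<omega>))" for \<omega>
  have [measurable]: "U \<in> borel_measurable \<Omega>"
    unfolding U_def by (intro measurable_compose[OF _ borel_measurable_root]) measurable
  have Upow: "U \<omega> ^ (2 * p) = enn2real (G \<omega>)" for \<omega>
    unfolding U_def using p by (intro real_root_pow_pos2) auto
  show ?thesis
  proof (rule moment_boundI[where U=U])
    show "0 \<le> U \<omega>" for \<omega> using p by (simp add: U_def)
    show "AE \<omega> in \<Omega>. norm (Y \<omega>) \<le> U \<omega>"
      using YG by eventually_elim (use p in \<open>simp add: U_def real_root_power_cancel\<close>)
    have "(\<integral>\<^sup>+ \<omega>. ennreal (U \<omega> ^ (2 * p)) \<partial>\<Omega>) \<le> (\<integral>\<^sup>+ \<omega>. G \<omega> \<partial>\<Omega>)"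
      unfolding Upow using YG by (intro nn_integral_mono_AE) (auto elim!: eventually_mono)
    then show "(\<integral>\<^sup>+ \<omega>. ennreal (U \<omega> ^ (2 * p)) \<partial>\<Omega>) \<le> ennreal (x ^ (2 * p))" using GI by simp
  qed (use x in auto)
qed

lemma (in prob_space) moment_bound_const: "moment_bound M p (\<lambda>\<omega>. c) (norm c)"
  by (rule moment_boundI[where U="\<lambda>_. norm c"]) (auto simp: emeasure_space_1)

lemma (in prob_space) moment_bound_lower:
  assumes "moment_bound M (2 * p) Z x"
  shows "moment_bound M p Z x"
  using moment_bound_prod[OF assms moment_bound_const[of "2 * p" "1::real"], of Z] by simp

section \<open>Sums of martingale differences\<close>

lemma power_add_ge:
  fixes a b :: real
  assumes "a \<ge> 0" "b \<ge> 0" "p \<ge> 1"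
  shows "a ^ p + a ^ (p - 1) * b \<le> (a + b) ^ p" and "a ^ p + b ^ p \<le> (a + b) ^ p"
proof -
  obtain k where k: "p = Suc k" using assms by (metis Suc_pred' less_eq_Suc_le One_nat_def)
  have "(a + b) * a ^ k \<le> (a + b) * (a + b) ^ k" using assms by (intro mult_left_mono power_mono) auto
  then show "a ^ p + a ^ (p - 1) * b \<le> (a + b) ^ p" by (simp add: k algebra_simps)
  have "a * a ^ k + b * b ^ k \<le> a * (a + b) ^ k + b * (a + b) ^ k"
    using assms by (intro add_mono mult_left_mono power_mono) auto
  then show "a ^ p + b ^ p \<le> (a + b) ^ p" by (simp add: k algebra_simps)
qed

lemma mixed_power_le:
  fixes u v :: real
  assumes "u \<ge> 0" "v \<ge> 0" "j \<le> n"
  shows "u ^ j * v ^ (n - j) \<le> u ^ n + v ^ n"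
proof (cases "u \<le> v")
  case True
  have "u ^ j * v ^ (n - j) \<le> v ^ j * v ^ (n - j)" using True assms by (intro mult_right_mono power_mono) auto
  also have "\<dots> = v ^ n" using assms by (simp add: power_add[symmetric])
  finally show ?thesis using assms by (simp add: add_increasing)
next
  case False
  have "u ^ j * v ^ (n - j) \<le> u ^ j * u ^ (n - j)" using False assms by (intro mult_left_mono power_mono) auto
  also have "\<dots> = u ^ n" using assms by (simp add: power_add[symmetric])
  finally show ?thesis using assms by (simp add: add_increasing2)
qed

text \<open>
  The terms of order at least 2 in \<open>x\<close> of \<open>(s + x)\<^sup>2\<^sup>p\<close>.
\<close>

definition binomial_tail :: "nat \<Rightarrow> real \<Rightarrow> real \<Rightarrow> real" where
  "binomial_tail p s x = (\<Sum>j=2..2*p. real (2 * p choose j) * (x ^ j * s ^ (2 * p - j)))"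

text \<open>
  A term \<open>x\<^sup>j s\<^sup>2\<^sup>p\<^sup>-\<^sup>j\<close> with \<open>2 \<le> j \<le> 2 p\<close> lies below the sum of the two extreme ones, \<open>j = 2\<close> and \<open>j = 2 p\<close>, and
  the binomial coefficients add up to at most \<open>4\<^sup>p\<close>. Both extreme terms also occur, with a larger
  coefficient, in \<open>(s\<^sup>2 + 4\<^sup>p\<^sup>+\<^sup>1 x\<^sup>2)\<^sup>p\<close>.
\<close>

lemma binomial_tail_bound:
  fixes s x :: real
  assumes "s > 0" "x > 0" "p \<ge> 1"
  shows "s ^ (2 * p) + 2 * binomial_tail p s x \<le> (s\<^sup>2 + 4 ^ (p + 1) * x\<^sup>2) ^ p"
proof -
  have t: "x ^ j * s ^ (2 * p - j) \<le> s ^ (2 * p - 2) * x\<^sup>2 + x ^ (2 * p)" if "2 \<le> j" "j \<le> 2 * p" for j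
  proof -
    have "x ^ (j - 2) * s ^ (2 * p - 2 - (j - 2)) \<le> x ^ (2 * p - 2) + s ^ (2 * p - 2)"
      using assms that by (intro mixed_power_le) auto
    then have m1: "x\<^sup>2 * (x ^ (j - 2) * s ^ (2 * p - j)) \<le> x\<^sup>2 * (x ^ (2 * p - 2) + s ^ (2 * p - 2))"
    proof (intro mult_left_mono)
      have "2 * p - 2 - (j - 2) = 2 * p - j" using that by simp
      then show "x ^ (j - 2) * s ^ (2 * p - j) \<le> x ^ (2 * p - 2) + s ^ (2 * p - 2)"
        using \<open>x ^ (j - 2) * s ^ (2 * p - 2 - (j - 2)) \<le> x ^ (2 * p - 2) + s ^ (2 * p - 2)\<close> by simp
    qed auto
    have e: "x\<^sup>2 * x ^ (j - 2) = x ^ j" "x\<^sup>2 * x ^ (2 * p - 2) = x ^ (2 * p)"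
      using that assms by (metis power_add le_add_diff_inverse order_trans)+
    have m2: "x\<^sup>2 * (x ^ (j - 2) * s ^ (2 * p - j)) = x ^ j * s ^ (2 * p - j)"
      by (simp only: e(1) mult.assoc[symmetric])
    have m3: "x\<^sup>2 * (x ^ (2 * p - 2) + s ^ (2 * p - 2)) = x ^ (2 * p) + s ^ (2 * p - 2) * x\<^sup>2"
      unfolding distrib_left e(2) by (subst mult.commute[of "s ^ (2 * p - 2)"]) (rule refl)
    show ?thesis using m1 unfolding m2 m3 by (simp only: add.commute)
  qed
  have "binomial_tail p s x \<le> (\<Sum>j=2..2*p. real (2 * p choose j) * (s ^ (2 * p - 2) * x\<^sup>2 + x ^ (2 * p)))"
    unfolding binomial_tail_def using t by (intro sum_mono mult_left_mono) auto
  also have "\<dots> = (\<Sum>j=2..2*p. real (2 * p choose j)) * (s ^ (2 * p - 2) * x\<^sup>2 + x ^ (2 * p))"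
    by (simp add: sum_distrib_right)
  also have "\<dots> \<le> 4 ^ p * (s ^ (2 * p - 2) * x\<^sup>2 + x ^ (2 * p))"
  proof (rule mult_right_mono)
    have "(\<Sum>j=2..2*p. real (2 * p choose j)) \<le> (\<Sum>j\<le>2*p. real (2 * p choose j))"
      by (intro sum_mono2) auto
    also have "\<dots> = 4 ^ p" using choose_row_sum[of "2 * p"]
      by (metis of_nat_sum of_nat_power of_nat_numeral power_mult power2_eq_square num_double numeral_times_numeral)
    finally show "(\<Sum>j=2..2*p. real (2 * p choose j)) \<le> 4 ^ p" .
  qed (use assms in auto)
  finally have b: "binomial_tail p s x \<le> 4 ^ p * (s ^ (2 * p - 2) * x\<^sup>2 + x ^ (2 * p))" .
  define a where "a = s\<^sup>2"
  define c where "c = (4::real) ^ (p + 1)"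
  have c1: "c \<ge> 1" unfolding c_def by (rule one_le_power) simp
  have "c ^ 1 \<le> c ^ p" using assms c1 by (intro power_increasing) auto
  then have "c * x ^ (2 * p) \<le> c ^ p * x ^ (2 * p)" using assms by (intro mult_right_mono) auto
  then have cx: "c * x ^ (2 * p) \<le> (c * x\<^sup>2) ^ p" by (simp add: power_mult_distrib power_mult)
  have ap: "a ^ p = s ^ (2 * p)" "a ^ (p - 1) = s ^ (2 * p - 2)"
    by (simp_all add: a_def power_mult[symmetric] diff_mult_distrib2)
  have a0: "a \<ge> 0" "c * x\<^sup>2 \<ge> 0" using c1 by (auto simp: a_def)
  have "a ^ p + (a ^ (p - 1) * (c * x\<^sup>2) + c * x ^ (2 * p)) / 2 \<le> (a + c * x\<^sup>2) ^ p"
  proof -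
    have "u + (v + y) / 2 \<le> w" if "u + v \<le> w" "u + z \<le> w" "y \<le> z" for u v w y z :: real
      using that by argo
    from this[OF power_add_ge[OF a0 assms(3)] cx] show ?thesis .
  qed
  moreover have "(a ^ (p - 1) * (c * x\<^sup>2) + c * x ^ (2 * p)) / 2 = 2 * (4 ^ p * (s ^ (2 * p - 2) * x\<^sup>2 + x ^ (2 * p)))"
    unfolding ap by (simp add: c_def algebra_simps)
  ultimately show ?thesis using b unfolding ap(1) a_def[symmetric] c_def by linarith
qed

text \<open>
  The term of order 1 is kept apart because its expectation vanishes for a martingale difference \<open>X\<close>.
  After integration, the last factor is at most 2 when \<open>s\<close> and \<open>x\<close> bound the \<open>L\<^sup>2\<^sup>p\<close> norms of \<open>S\<close> and \<open>X\<close>.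
\<close>

lemma binomial_step:
  fixes S X s x :: real
  assumes "s > 0" "x > 0" "p \<ge> 1"
  shows "(S + X) ^ (2 * p) \<le> S ^ (2 * p) + real (2 * p) * (S ^ (2 * p - 1) * X)
      + binomial_tail p s x * (S ^ (2 * p) / s ^ (2 * p) + X ^ (2 * p) / x ^ (2 * p))"
proof -
  let ?f = "\<lambda>j. real (2 * p choose j) * X ^ j * S ^ (2 * p - j)"
  have "(S + X) ^ (2 * p) = (\<Sum>j\<le>2*p. ?f j)"
    using binomial_ring[of X S "2 * p"] by (simp add: add.commute)
  also have "{..2*p} = {0, 1} \<union> {2..2*p}" using assms by auto
  also have "sum ?f ({0, 1} \<union> {2..2*p}) = S ^ (2 * p) + real (2 * p) * (S ^ (2 * p - 1) * X) + (\<Sum>j=2..2*p. ?f j)"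
    by (subst sum.union_disjoint) auto
  also have "(\<Sum>j=2..2*p. ?f j) \<le> binomial_tail p s x * (S ^ (2 * p) / s ^ (2 * p) + X ^ (2 * p) / x ^ (2 * p))"
    unfolding binomial_tail_def sum_distrib_right
  proof (rule sum_mono)
    fix j assume j: "j \<in> {2..2*p}"
    have "X ^ j * S ^ (2 * p - j) \<le> \<bar>X ^ j * S ^ (2 * p - j)\<bar>" by (rule abs_ge_self)
    also have "\<dots> = x ^ j * s ^ (2 * p - j) * ((\<bar>X\<bar> / x) ^ j * (\<bar>S\<bar> / s) ^ (2 * p - j))"
      using assms by (simp add: abs_mult power_abs power_divide)
    also have "\<dots> \<le> x ^ j * s ^ (2 * p - j) * ((\<bar>X\<bar> / x) ^ (2 * p) + (\<bar>S\<bar> / s) ^ (2 * p))"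
      using assms j by (intro mult_left_mono mixed_power_le) auto
    also have "\<dots> = x ^ j * s ^ (2 * p - j) * (S ^ (2 * p) / s ^ (2 * p) + X ^ (2 * p) / x ^ (2 * p))"
      by (simp add: power_divide power_even_abs add.commute)
    finally have "real (2 * p choose j) * (X ^ j * S ^ (2 * p - j))
      \<le> real (2 * p choose j) * (x ^ j * s ^ (2 * p - j) * (S ^ (2 * p) / s ^ (2 * p) + X ^ (2 * p) / x ^ (2 * p)))"
      by (intro mult_left_mono) auto
    then show "?f j \<le> real (2 * p choose j) * (x ^ j * s ^ (2 * p - j)) * (S ^ (2 * p) / s ^ (2 * p) + X ^ (2 * p) / x ^ (2 * p))"
      by (simp add: mult_ac)
  qed
  finally show ?thesis by simp
qed

context prob_space
begin

lemma moment_bound_integral: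
  fixes Z :: "'a \<Rightarrow> real"
  assumes [measurable]: "Z \<in> borel_measurable M"
  shows "moment_bound M p Z x \<longleftrightarrow>
      0 \<le> x \<and> integrable M (\<lambda>\<omega>. Z \<omega> ^ (2 * p)) \<and> expectation (\<lambda>\<omega>. Z \<omega> ^ (2 * p)) \<le> x ^ (2 * p)"
proof -
  have eq: "norm (Z \<omega>) ^ (2 * p) = Z \<omega> ^ (2 * p)" for \<omega> by (simp add: power_even_abs)
  show ?thesis
  proof (cases "integrable M (\<lambda>\<omega>. Z \<omega> ^ (2 * p))")
    case True
    then have "(\<integral>\<^sup>+ \<omega>. ennreal (Z \<omega> ^ (2 * p)) \<partial>M) = ennreal (expectation (\<lambda>\<omega>. Z \<omega> ^ (2 * p)))"
      by (intro nn_integral_eq_integral) auto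
    then show ?thesis using True unfolding moment_bound_measurable[OF assms] eq
      by (auto simp: ennreal_le_iff)
  next
    case False
    have "\<not> (\<integral>\<^sup>+ \<omega>. ennreal (Z \<omega> ^ (2 * p)) \<partial>M) \<le> ennreal (x ^ (2 * p))"
    proof
      assume "(\<integral>\<^sup>+ \<omega>. ennreal (Z \<omega> ^ (2 * p)) \<partial>M) \<le> ennreal (x ^ (2 * p))"
      then have "integrable M (\<lambda>\<omega>. Z \<omega> ^ (2 * p))"
        by (intro integrableI_nonneg) (auto simp: le_less_trans[OF _ ennreal_less_top])
      with False show False ..
    qed
    then show ?thesis using False unfolding moment_bound_measurable[OF assms] eq by blast
  qed
qed

lemma integrable_mixed_power:
  fixes S X :: "'a \<Rightarrow> real"
  assumes [measurable]: "S \<in> borel_measurable M" "X \<in> borel_measurable M"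
    and "integrable M (\<lambda>\<omega>. S \<omega> ^ (2 * p))" "integrable M (\<lambda>\<omega>. X \<omega> ^ (2 * p))" and p: "p \<ge> 1"
  shows "integrable M (\<lambda>\<omega>. S \<omega> ^ (2 * p - 1) * X \<omega>)"
proof (rule Bochner_Integration.integrable_bound)
  show "integrable M (\<lambda>\<omega>. X \<omega> ^ (2 * p) + S \<omega> ^ (2 * p))" using assms by auto
  show "AE \<omega> in M. norm (S \<omega> ^ (2 * p - 1) * X \<omega>) \<le> norm (X \<omega> ^ (2 * p) + S \<omega> ^ (2 * p))"
  proof (rule AE_I2)
    fix \<omega>
    show "norm (S \<omega> ^ (2 * p - 1) * X \<omega>) \<le> norm (X \<omega> ^ (2 * p) + S \<omega> ^ (2 * p))"
      using mixed_power_le[of "\<bar>X \<omega>\<bar>" "\<bar>S \<omega>\<bar>" 1 "2 * p"] p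
      by (simp add: abs_mult power_abs power_even_abs mult.commute)
  qed
qed measurable

text \<open>
  An inequality of Burkholder type with deterministic bounds on the differences. The square of the bound
  grows by \<open>4\<^sup>p\<^sup>+\<^sup>1 x\<^sub>j\<^sup>2\<close> in each step, by \<open>binomial_step\<close> and \<open>binomial_tail_bound\<close>. The martingale property
  enters as \<open>E (S\<^sub>j\<^sup>2\<^sup>p\<^sup>-\<^sup>1 X\<^sub>j) = 0\<close>.
\<close>

lemma martingale_moment:
  fixes X :: "nat \<Rightarrow> 'a \<Rightarrow> real"
  assumes p: "p \<ge> 1"
    and Xm: "\<And>j. j < k \<Longrightarrow> X j \<in> borel_measurable M"
    and Xb: "\<And>j. j < k \<Longrightarrow> moment_bound M p (X j) (x j)"
    and x0: "\<And>j. j < k \<Longrightarrow> x j > 0"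
    and orth: "\<And>j. j < k \<Longrightarrow> expectation (\<lambda>\<omega>. (\<Sum>i<j. X i \<omega>) ^ (2 * p - 1) * X j \<omega>) = 0"
  shows "moment_bound M p (\<lambda>\<omega>. \<Sum>j<k. X j \<omega>) (sqrt (4 ^ (p + 1) * (\<Sum>j<k. (x j)\<^sup>2)))"
proof -
  let ?S = "\<lambda>j \<omega>. \<Sum>i<j. X i \<omega>"
  define V where "V d j = d + 4 ^ (p + 1) * (\<Sum>i<j. (x i)\<^sup>2)" for d :: real and j
  have Sm: "?S j \<in> borel_measurable M" if "j \<le> k" for j
    using that Xm by (intro borel_measurable_sum) auto
  \<comment> \<open>The summand \<open>d\<close> keeps the bound for \<open>S\<close> positive, also for the empty sum; it tends to 0 in the end.\<close>
  have main: "moment_bound M p (?S j) (sqrt (V d j))" if d: "d > 0" and "j \<le> k" for d j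
    using \<open>j \<le> k\<close>
  proof (induction j)
    case 0
    then show ?case using moment_bound_le[OF moment_bound_zero[OF p], of "sqrt d"] d by (simp add: V_def)
  next
    case (Suc j)
    then have j: "j < k" "j \<le> k" by auto
    note [measurable] = Sm[OF j(2)] Xm[OF j(1)]
    define s where "s = sqrt (V d j)"
    have V0: "V d j > 0" using d by (simp add: V_def add_pos_nonneg sum_nonneg)
    then have s: "s > 0" by (simp add: s_def)
    have "moment_bound M p (?S j) s" unfolding s_def by (rule Suc.IH[OF j(2)])
    then have S: "integrable M (\<lambda>\<omega>. ?S j \<omega> ^ (2 * p))" "expectation (\<lambda>\<omega>. ?S j \<omega> ^ (2 * p)) \<le> s ^ (2 * p)"
      by (simp_all add: moment_bound_integral)
    have X: "integrable M (\<lambda>\<omega>. X j \<omega> ^ (2 * p))" "expectation (\<lambda>\<omega>. X j \<omega> ^ (2 * p)) \<le> x j ^ (2 * p)"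
      using Xb[OF j(1)] by (simp_all add: moment_bound_integral)
    note xj = x0[OF j(1)]
    let ?R = "binomial_tail p s (x j)"
    have R0: "?R \<ge> 0" unfolding binomial_tail_def using s xj by (intro sum_nonneg) auto
    let ?B = "\<lambda>\<omega>. ?S j \<omega> ^ (2 * p) + real (2 * p) * (?S j \<omega> ^ (2 * p - 1) * X j \<omega>)
        + ?R * (?S j \<omega> ^ (2 * p) / s ^ (2 * p) + X j \<omega> ^ (2 * p) / x j ^ (2 * p))"
    have iSX: "integrable M (\<lambda>\<omega>. ?S j \<omega> ^ (2 * p - 1) * X j \<omega>)"
      by (rule integrable_mixed_power[OF _ _ S(1) X(1) p]) measurable
    have iB: "integrable M ?B" using S(1) X(1) iSX by (intro Bochner_Integration.integrable_add integrable_mult_right integrable_divide) auto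
    have pt: "(?S j \<omega> + X j \<omega>) ^ (2 * p) \<le> ?B \<omega>" for \<omega> by (rule binomial_step[OF s xj p])
    have i1: "integrable M (\<lambda>\<omega>. (?S j \<omega> + X j \<omega>) ^ (2 * p))"
      by (rule Bochner_Integration.integrable_bound[OF iB])
        (use pt in \<open>auto intro!: AE_I2 order_trans[OF _ abs_ge_self] simp: power_even_abs power_abs\<close>)
    have "expectation (\<lambda>\<omega>. (?S j \<omega> + X j \<omega>) ^ (2 * p)) \<le> expectation ?B"
      by (rule integral_mono[OF i1 iB pt])
    also have "expectation ?B = expectation (\<lambda>\<omega>. ?S j \<omega> ^ (2 * p)) + real (2 * p) * expectation (\<lambda>\<omega>. ?S j \<omega> ^ (2 * p - 1) * X j \<omega>)
        + ?R * (expectation (\<lambda>\<omega>. ?S j \<omega> ^ (2 * p)) / s ^ (2 * p) + expectation (\<lambda>\<omega>. X j \<omega> ^ (2 * p)) / x j ^ (2 * p))"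
      using S(1) X(1) iSX by simp
    also have "\<dots> \<le> s ^ (2 * p) + real (2 * p) * 0 + ?R * (1 + 1)"
      using S(2) X(2) s xj R0 orth[OF j(1)] by (intro add_mono mult_left_mono) (auto simp: divide_le_eq_1)
    also have "\<dots> \<le> (s\<^sup>2 + 4 ^ (p + 1) * (x j)\<^sup>2) ^ p"
      using binomial_tail_bound[OF s xj p] by simp
    also have "s\<^sup>2 + 4 ^ (p + 1) * (x j)\<^sup>2 = V d (Suc j)"
      unfolding s_def using V0 by (simp add: V_def algebra_simps)
    also have "V d (Suc j) ^ p = sqrt (V d (Suc j)) ^ (2 * p)"
    proof -
      have "V d (Suc j) \<ge> 0" using d unfolding V_def by (intro add_nonneg_nonneg mult_nonneg_nonneg sum_nonneg) auto
      then show ?thesis by (simp add: power_mult)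
    qed
    finally have "expectation (\<lambda>\<omega>. (?S j \<omega> + X j \<omega>) ^ (2 * p)) \<le> sqrt (V d (Suc j)) ^ (2 * p)" .
    moreover have "0 \<le> sqrt (V d (Suc j))"
      using d unfolding V_def by (intro real_sqrt_ge_zero add_nonneg_nonneg mult_nonneg_nonneg sum_nonneg) auto
    ultimately show ?case using i1 Sm[OF Suc.prems] by (simp add: moment_bound_integral)
  qed
  have le: "(\<integral>\<^sup>+ \<omega>. ennreal (norm (?S k \<omega>) ^ (2 * p)) \<partial>M) \<le> ennreal (sqrt (V d k) ^ (2 * p))" if "d > 0" for d
    using main[OF that order_refl] unfolding moment_bound_measurable[OF Sm[OF order_refl]] by blast
  have "((\<lambda>d. ennreal (sqrt (V d k) ^ (2 * p))) \<longlongrightarrow> ennreal (sqrt (V 0 k) ^ (2 * p))) (at_right 0)"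
    unfolding V_def by (intro tendsto_intros)
  moreover have "\<forall>\<^sub>F d in at_right 0. (\<integral>\<^sup>+ \<omega>. ennreal (norm (?S k \<omega>) ^ (2 * p)) \<partial>M) \<le> ennreal (sqrt (V d k) ^ (2 * p))"
    using le by (auto simp: eventually_at_filter)
  ultimately have "(\<integral>\<^sup>+ \<omega>. ennreal (norm (?S k \<omega>) ^ (2 * p)) \<partial>M) \<le> ennreal (sqrt (V 0 k) ^ (2 * p))"
    by (intro tendsto_lowerbound) auto
  then show ?thesis unfolding moment_bound_measurable[OF Sm[OF order_refl]]
    by (simp add: V_def sum_nonneg)
qed

end

subsection \<open>The past of a sequence of random variables\<close>

text \<open>
  The \<sigma>-algebra generated by \<open>\<xi>\<^sub>0, \<dots>, \<xi>\<^sub>i\<^sub>-\<^sub>1\<close>, as a measurable space on the points of \<open>\<Omega>\<close>. Measurability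
  with respect to it replaces explicit representations as functions of the increments.
\<close>

definition past :: "'w measure \<Rightarrow> (nat \<Rightarrow> 'w \<Rightarrow> 'b::topological_space) \<Rightarrow> nat \<Rightarrow> 'w measure" where
  "past \<Omega> \<xi> i = vimage_algebra (space \<Omega>) (\<lambda>\<omega>. restrict (\<lambda>j. \<xi> j \<omega>) {..<i}) (PiM {..<i} (\<lambda>_. borel))"

lemma space_past [simp]: "space (past \<Omega> \<xi> i) = space \<Omega>"
  by (simp add: past_def)

lemma past_history: "(\<lambda>\<omega>. restrict (\<lambda>j. \<xi> j \<omega>) {..<i}) \<in> measurable (past \<Omega> \<xi> i) (PiM {..<i} (\<lambda>_. borel))"
  unfolding past_def by (rule measurable_vimage_algebra1) (auto simp: space_PiM)

lemma measurable_past_step: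
  assumes "j < i"
  shows "\<xi> j \<in> borel_measurable (past \<Omega> \<xi> i)"
proof -
  have "(\<lambda>\<omega>. (restrict (\<lambda>j. \<xi> j \<omega>) {..<i}) j) \<in> borel_measurable (past \<Omega> \<xi> i)"
    using assms by (intro measurable_compose[OF past_history measurable_component_singleton]) auto
  then show ?thesis using assms by simp
qed

lemma measurable_past_mono:
  assumes "f \<in> borel_measurable (past \<Omega> \<xi> i)" "i \<le> i'"
  shows "f \<in> borel_measurable (past \<Omega> \<xi> i')"
proof -
  have "(\<lambda>\<omega>. \<omega>) \<in> measurable (past \<Omega> \<xi> i') (past \<Omega> \<xi> i)"
    unfolding past_def[of \<Omega> \<xi> i]
    by (rule measurable_vimage_algebra2) (use assms(2) in \<open>auto intro!: measurable_restrict measurable_past_step\<close>)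
  from measurable_compose[OF this assms(1)] show ?thesis .
qed

lemma measurable_past_imp:
  assumes "f \<in> borel_measurable (past \<Omega> \<xi> i)" "\<And>j. j < i \<Longrightarrow> \<xi> j \<in> borel_measurable \<Omega>"
  shows "f \<in> borel_measurable \<Omega>"
proof -
  have "(\<lambda>\<omega>. \<omega>) \<in> measurable \<Omega> (past \<Omega> \<xi> i)"
    unfolding past_def
    by (rule measurable_vimage_algebra2) (use assms(2) in \<open>auto intro!: measurable_restrict\<close>)
  from measurable_compose[OF this assms(1)] show ?thesis .
qed

lemma (in prob_space) indep_var_past:
  assumes ind: "indep_vars (\<lambda>_. borel) \<xi> {..<n}" and i: "i < n"
    and A: "A \<in> borel_measurable (past M \<xi> i)" and g: "g \<in> borel_measurable borel"
  shows "indep_var borel A borel (\<lambda>\<omega>. g (\<xi> i \<omega>))"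
proof -
  let ?R = "\<lambda>K \<omega>. restrict (\<lambda>j. \<xi> j \<omega>) K"
  have rv: "\<xi> j \<in> borel_measurable M" if "j < n" for j using ind that by (auto simp: indep_vars_def)
  have Am: "A \<in> borel_measurable M" using measurable_past_imp[OF A] rv i by auto
  have "indep_var (PiM {..<i} (\<lambda>_. borel)) (?R {..<i}) (PiM {i} (\<lambda>_. borel)) (?R {i})"
    by (rule indep_var_restrict[OF ind]) (use i in auto)
  then have ind2: "indep_set
      (sigma_sets (space M) {?R {..<i} -` B \<inter> space M |B. B \<in> sets (PiM {..<i} (\<lambda>_. borel))})
      (sigma_sets (space M) {?R {i} -` B \<inter> space M |B. B \<in> sets (PiM {i} (\<lambda>_. borel))})"
    unfolding indep_var_eq by blast
  have 1: "A -` B \<inter> space M \<in> {?R {..<i} -` B \<inter> space M |B. B \<in> sets (PiM {..<i} (\<lambda>_. borel))}"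
    if "B \<in> sets borel" for B
  proof -
    have "A -` B \<inter> space M \<in> sets (past M \<xi> i)" using measurable_sets[OF A that] by simp
    then show ?thesis unfolding past_def by (subst (asm) sets_vimage_algebra2) (auto simp: space_PiM)
  qed
  have 2: "(\<lambda>\<omega>. g (\<xi> i \<omega>)) -` B \<inter> space M \<in> {?R {i} -` B \<inter> space M |B. B \<in> sets (PiM {i} (\<lambda>_. borel))}"
    if "B \<in> sets borel" for B
  proof -
    have m: "(\<lambda>x. g (x i)) \<in> borel_measurable (PiM {i} (\<lambda>_. borel))"
      by (rule measurable_compose[OF _ g], rule measurable_component_singleton) simp
    have "(\<lambda>\<omega>. g (\<xi> i \<omega>)) -` B \<inter> space M = ?R {i} -` ((\<lambda>x. g (x i)) -` B \<inter> space (PiM {i} (\<lambda>_. borel))) \<inter> space M"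
      by (auto simp: space_PiM)
    then show ?thesis using measurable_sets[OF m that] by blast
  qed
  have "indep_set (sigma_sets (space M) {A -` B \<inter> space M |B. B \<in> sets borel})
      (sigma_sets (space M) {(\<lambda>\<omega>. g (\<xi> i \<omega>)) -` B \<inter> space M |B. B \<in> sets borel})"
    using ind2 unfolding indep_set_def
    by (rule indep_sets_mono_sets) (auto split: bool.split intro!: sigma_sets_subseteq[THEN subsetD] dest: 1 2
        elim!: sigma_sets_mono'[THEN subsetD, rotated] simp del: vimage_Int)
  then show ?thesis unfolding indep_var_eq
    using Am measurable_compose[OF rv[OF i] g] by auto
qed

subsection \<open>Sums driven by independent centred steps\<close>

text \<open>
  The properties of the increments of Brownian motion over time steps of length \<open>h\<close> that the moment
  estimates use. The moment constants \<open>\<gamma>\<close> are a parameter so that they are shared by all grids.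
\<close>

definition noise_steps ::
    "'w measure \<Rightarrow> (nat \<Rightarrow> real) \<Rightarrow> nat \<Rightarrow> real \<Rightarrow> (nat \<Rightarrow> 'w \<Rightarrow> real^'n) \<Rightarrow> bool" where
  "noise_steps \<Omega> \<gamma> n h \<xi> \<longleftrightarrow> 0 < h \<and> (\<forall>p. 0 < \<gamma> p) \<and>
     prob_space.indep_vars \<Omega> (\<lambda>_. borel) \<xi> {..<n} \<and>
     (\<forall>j<n. (\<forall>p\<ge>1. moment_bound \<Omega> p (\<xi> j) (\<gamma> p * sqrt h)) \<and>
        (\<forall>a. integral\<^sup>L \<Omega> (\<lambda>\<omega>. \<xi> j \<omega> $ a) = 0) \<and>
        (\<forall>a b. integral\<^sup>L \<Omega> (\<lambda>\<omega>. \<xi> j \<omega> $ a * \<xi> j \<omega> $ b) = (if a = b then h else 0)))"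

lemma (in prob_space) integrable_moment_bound:
  fixes Z :: "'a \<Rightarrow> real"
  assumes [measurable]: "Z \<in> borel_measurable M" and "moment_bound M p Z x" "p \<ge> 1"
  shows "integrable M Z"
proof (rule Bochner_Integration.integrable_bound)
  have "integrable M (\<lambda>\<omega>. Z \<omega> ^ (2 * p))" using assms by (simp add: moment_bound_integral)
  then show "integrable M (\<lambda>\<omega>. 1 + Z \<omega> ^ (2 * p))" by simp
  show "AE \<omega> in M. norm (Z \<omega>) \<le> norm (1 + Z \<omega> ^ (2 * p))"
  proof (rule AE_I2)
    fix \<omega>
    have "\<bar>Z \<omega>\<bar> \<le> 1 + \<bar>Z \<omega>\<bar> ^ (2 * p)"
      using mixed_power_le[of "\<bar>Z \<omega>\<bar>" 1 1 "2 * p"] assms(3) by simp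
    then show "norm (Z \<omega>) \<le> norm (1 + Z \<omega> ^ (2 * p))" by (simp add: power_even_abs)
  qed
qed measurable

lemma moment_bound_component: "moment_bound \<Omega> p Z x \<Longrightarrow> moment_bound \<Omega> p (\<lambda>\<omega>. Z \<omega> $ a) x"
  for Z :: "'w \<Rightarrow> ('b::real_normed_vector)^'n"
  by (erule moment_bound_mono) (auto intro: Finite_Cartesian_Product.norm_nth_le)

lemma moment_bound_from_components:
  fixes Z :: "'w \<Rightarrow> ('b::real_normed_vector)^'n" and x :: real
  assumes "\<And>a. moment_bound \<Omega> p (\<lambda>\<omega>. Z \<omega> $ a) x" "p \<ge> 1"
  shows "moment_bound \<Omega> p Z (CARD('n) * x)"
proof -
  have m: "moment_bound \<Omega> p (\<lambda>\<omega>. \<Sum>a\<in>UNIV. norm (Z \<omega> $ a)) (\<Sum>a\<in>(UNIV::'n set). x)"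
    by (intro moment_bound_sum moment_bound_norm assms) auto
  have le: "norm (Z \<omega>) \<le> norm (\<Sum>a\<in>UNIV. norm (Z \<omega> $ a))" for \<omega>
    using L2_set_le_sum[of UNIV "\<lambda>a. norm (Z \<omega> $ a)"] by (simp add: norm_vec_def sum_nonneg)
  show ?thesis by (rule moment_bound_mono[OF m]) (use le in auto)
qed

context prob_space
begin

lemma noise_stepsD:
  assumes "noise_steps M \<gamma> n h \<xi>"
  shows "0 < h" "\<And>p. 0 < \<gamma> p" "indep_vars (\<lambda>_. borel) \<xi> {..<n}"
    "\<And>j. j < n \<Longrightarrow> \<xi> j \<in> borel_measurable M"
    "\<And>j p. j < n \<Longrightarrow> p \<ge> 1 \<Longrightarrow> moment_bound M p (\<xi> j) (\<gamma> p * sqrt h)"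
    "\<And>j a. j < n \<Longrightarrow> expectation (\<lambda>\<omega>. \<xi> j \<omega> $ a) = 0"
    "\<And>j a b. j < n \<Longrightarrow> expectation (\<lambda>\<omega>. \<xi> j \<omega> $ a * \<xi> j \<omega> $ b) = (if a = b then h else 0)"
  using assms unfolding noise_steps_def by (auto simp: indep_vars_def)

lemma noise_sum_moment:
  fixes \<gamma> x :: "nat \<Rightarrow> real" and A :: "nat \<Rightarrow> 'a \<Rightarrow> real" and g :: "nat \<Rightarrow> real^'n \<Rightarrow> real"
  assumes ns: "noise_steps M \<gamma> n h \<xi>" and p: "p \<ge> 1" and j: "j0 \<le> j1" "j1 \<le> n"
    and Am: "\<And>j. j0 \<le> j \<Longrightarrow> j < j1 \<Longrightarrow> A j \<in> borel_measurable (past M \<xi> j)"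
    and gm: "\<And>j. j0 \<le> j \<Longrightarrow> j < j1 \<Longrightarrow> g j \<in> borel_measurable borel"
    and g0: "\<And>j. j0 \<le> j \<Longrightarrow> j < j1 \<Longrightarrow> expectation (\<lambda>\<omega>. g j (\<xi> j \<omega>)) = 0"
    and Ab: "\<And>j. j0 \<le> j \<Longrightarrow> j < j1 \<Longrightarrow> \<exists>y. moment_bound M p (A j) y"
    and gb: "\<And>j. j0 \<le> j \<Longrightarrow> j < j1 \<Longrightarrow> \<exists>y. moment_bound M p (\<lambda>\<omega>. g j (\<xi> j \<omega>)) y"
    and b: "\<And>j. j0 \<le> j \<Longrightarrow> j < j1 \<Longrightarrow> moment_bound M p (\<lambda>\<omega>. A j \<omega> * g j (\<xi> j \<omega>)) (x j)"
    and x: "\<And>j. j0 \<le> j \<Longrightarrow> j < j1 \<Longrightarrow> x j > 0"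
  shows "moment_bound M p (\<lambda>\<omega>. \<Sum>j=j0..<j1. A j \<omega> * g j (\<xi> j \<omega>)) (sqrt (4 ^ (p + 1) * (\<Sum>j=j0..<j1. (x j)\<^sup>2)))"
proof -
  define k where "k = j1 - j0"
  define X where "X i \<omega> = A (i + j0) \<omega> * g (i + j0) (\<xi> (i + j0) \<omega>)" for i \<omega>
  note nd = noise_stepsD[OF ns]
  have gxi: "(\<lambda>\<omega>. g j (\<xi> j \<omega>)) \<in> borel_measurable M" if "j0 \<le> j" "j < j1" for j
    using measurable_compose[OF nd(4) gm] that j by auto
  have gpast: "(\<lambda>\<omega>. g i (\<xi> i \<omega>)) \<in> borel_measurable (past M \<xi> j)" if "i < j" "j0 \<le> i" "i < j1" for i j
    by (rule measurable_compose[OF measurable_past_step[OF that(1)] gm[OF that(2,3)]])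
  have AM: "A i \<in> borel_measurable M" if "j0 \<le> i" "i < j1" for i
    by (rule measurable_past_imp[OF Am]) (use that nd(4) j in auto)
  have Xp: "X i \<in> borel_measurable (past M \<xi> j)" if "i + j0 < j" "i < k" for i j
    unfolding X_def using that measurable_past_mono[OF Am, of "i + j0" j] gpast[of "i + j0" j]
    by (intro borel_measurable_times) (auto simp: k_def)
  have Xm: "X i \<in> borel_measurable M" if "i < k" for i
    unfolding X_def using that gxi AM by (intro borel_measurable_times) (auto simp: k_def)
  have Xb: "moment_bound M p (X i) (x (i + j0))" if "i < k" for i
    unfolding X_def using b that by (auto simp: k_def)
  have "moment_bound M p (\<lambda>\<omega>. \<Sum>i<k. X i \<omega>) (sqrt (4 ^ (p + 1) * (\<Sum>i<k. (x (i + j0))\<^sup>2)))"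
  proof (rule martingale_moment[OF p Xm Xb])
    fix i assume i: "i < k"
    then have ij: "j0 \<le> i + j0" "i + j0 < j1" by (auto simp: k_def)
    show "0 < x (i + j0)" using x ij by blast
    let ?S = "\<lambda>\<omega>. \<Sum>l<i. X l \<omega>"
    have Sp: "?S \<in> borel_measurable (past M \<xi> (i + j0))"
      using i by (intro borel_measurable_sum Xp) auto
    have Sm: "?S \<in> borel_measurable M" using i by (intro borel_measurable_sum Xm) auto
    let ?B = "\<lambda>\<omega>. ?S \<omega> ^ (2 * p - 1) * A (i + j0) \<omega>"
    have Bp: "?B \<in> borel_measurable (past M \<xi> (i + j0))"
      using Sp Am[OF ij] by (intro borel_measurable_times borel_measurable_power)
    have iv: "indep_var borel ?B borel (\<lambda>\<omega>. g (i + j0) (\<xi> (i + j0) \<omega>))"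
      by (rule indep_var_past[OF nd(3) _ Bp gm[OF ij]]) (use ij j in auto)
    have Sb: "moment_bound M p ?S (\<Sum>l<i. x (l + j0))"
      using i by (intro moment_bound_sum Xb p) auto
    obtain y where y: "moment_bound M p (A (i + j0)) y" using Ab[OF ij] by blast
    obtain z where z: "moment_bound M p (\<lambda>\<omega>. g (i + j0) (\<xi> (i + j0) \<omega>)) z" using gb[OF ij] by blast
    have iB: "integrable M ?B"
      by (rule integrable_mixed_power[OF Sm AM[OF ij] _ _ p])
        (use Sb y Sm AM[OF ij] in \<open>simp_all add: moment_bound_integral\<close>)
    have ig: "integrable M (\<lambda>\<omega>. g (i + j0) (\<xi> (i + j0) \<omega>))"
      by (rule integrable_moment_bound[OF gxi[OF ij] z p])
    have "expectation (\<lambda>\<omega>. ?S \<omega> ^ (2 * p - 1) * X i \<omega>) = expectation (\<lambda>\<omega>. ?B \<omega> * g (i + j0) (\<xi> (i + j0) \<omega>))"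
      by (simp add: X_def mult.assoc)
    also have "\<dots> = expectation ?B * expectation (\<lambda>\<omega>. g (i + j0) (\<xi> (i + j0) \<omega>))"
      by (rule indep_var_lebesgue_integral[OF iv iB ig])
    also have "\<dots> = 0" using g0[OF ij] by simp
    finally show "expectation (\<lambda>\<omega>. ?S \<omega> ^ (2 * p - 1) * X i \<omega>) = 0" .
  qed
  moreover have shift: "(\<Sum>i<k. f (i + j0)) = (\<Sum>j=j0..<j1. f j)" for f :: "nat \<Rightarrow> real"
    using sum.shift_bounds_nat_ivl[of f 0 j0 k] j by (simp add: k_def atLeast0LessThan)
  moreover have "(\<Sum>i<k. X i \<omega>) = (\<Sum>j=j0..<j1. A j \<omega> * g j (\<xi> j \<omega>))" for \<omega>
    unfolding X_def by (rule shift[of "\<lambda>j. A j \<omega> * g j (\<xi> j \<omega>)"])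
  ultimately show ?thesis using shift[of "\<lambda>j. (x j)\<^sup>2"] by simp
qed

text \<open>
  Sums that are linear in the noise: increments of \<open>W\<close>, and the Euler scheme in its closed form.
\<close>

lemma noise_linear_moment:
  fixes \<gamma> l :: "nat \<Rightarrow> real" and L :: "nat \<Rightarrow> real^'n \<Rightarrow> real^'n" and \<xi> :: "nat \<Rightarrow> 'a \<Rightarrow> real^'n"
  assumes ns: "noise_steps M \<gamma> n h \<xi>" and p: "p \<ge> 1" and j: "j0 \<le> j1" "j1 \<le> n"
    and L: "\<And>j. j0 \<le> j \<Longrightarrow> j < j1 \<Longrightarrow> linear (L j)"
    and Lb: "\<And>j x. j0 \<le> j \<Longrightarrow> j < j1 \<Longrightarrow> norm (L j x) \<le> l j * norm x"
    and l: "\<And>j. j0 \<le> j \<Longrightarrow> j < j1 \<Longrightarrow> l j > 0"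
  shows "moment_bound M p (\<lambda>\<omega>. \<Sum>j=j0..<j1. L j (\<xi> j \<omega>))
     (CARD('n) * 2 ^ (p + 1) * \<gamma> p * sqrt (h * (\<Sum>j=j0..<j1. (l j)\<^sup>2)))"
proof -
  note nd = noise_stepsD[OF ns]
  have "moment_bound M p (\<lambda>\<omega>. \<Sum>j=j0..<j1. 1 * (L j (\<xi> j \<omega>) $ a))
      (sqrt (4 ^ (p + 1) * (\<Sum>j=j0..<j1. (l j * (\<gamma> p * sqrt h))\<^sup>2)))" for a
  proof (rule noise_sum_moment[where A="\<lambda>_ _. 1" and g="\<lambda>j x. L j x $ a", OF ns p j])
    fix j assume jj: "j0 \<le> j" "j < j1"
    then have jn: "j < n" using j by simp
    have lin: "bounded_linear (\<lambda>x. L j x $ a)"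
      using L[OF jj] by (intro bounded_linear_compose[OF bounded_linear_vec_nth]) (simp add: linear_conv_bounded_linear)
    show "(\<lambda>x. L j x $ a) \<in> borel_measurable borel"
      by (intro borel_measurable_continuous_onI linear_continuous_on lin)
    have comp: "(\<lambda>\<omega>. \<xi> j \<omega> $ b) \<in> borel_measurable M" for b
      by (rule measurable_compose[OF nd(4)[OF jn]]) (intro borel_measurable_continuous_onI continuous_intros)
    have i: "integrable M (\<lambda>\<omega>. \<xi> j \<omega> $ b)" for b
      using moment_bound_component[OF nd(5)[OF jn p]] by (intro integrable_moment_bound[OF comp _ p])
    have eq: "L j x $ a = (\<Sum>b\<in>UNIV. x $ b * L j (axis b 1) $ a)" for x
    proof -
      have "L j x $ a = L j (\<Sum>b\<in>UNIV. x $ b *\<^sub>R axis b 1) $ a"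
        by (metis basis_expansion scalar_mult_eq_scaleR)
      then show ?thesis using L[OF jj] by (simp add: linear_sum linear_cmul)
    qed
    show "expectation (\<lambda>\<omega>. L j (\<xi> j \<omega>) $ a) = 0"
    proof -
      have "expectation (\<lambda>\<omega>. L j (\<xi> j \<omega>) $ a) = expectation (\<lambda>\<omega>. \<Sum>b\<in>UNIV. \<xi> j \<omega> $ b * L j (axis b 1) $ a)"
        by (rule Bochner_Integration.integral_cong[OF refl]) (rule eq)
      then show ?thesis using i nd(6)[OF jn] by simp
    qed
    show "\<exists>y. moment_bound M p (\<lambda>\<omega>. 1::real) y" using moment_bound_const by blast
    have b: "moment_bound M p (\<lambda>\<omega>. L j (\<xi> j \<omega>) $ a) (l j * (\<gamma> p * sqrt h))"
      using Lb[OF jj] l[OF jj]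
      by (intro moment_bound_component moment_bound_lipschitz[OF nd(5)[OF jn p]]) auto
    then show "\<exists>y. moment_bound M p (\<lambda>\<omega>. L j (\<xi> j \<omega>) $ a) y" by blast
    show "moment_bound M p (\<lambda>\<omega>. 1 * L j (\<xi> j \<omega>) $ a) (l j * (\<gamma> p * sqrt h))" using b by simp
    show "0 < l j * (\<gamma> p * sqrt h)" using l[OF jj] nd by simp
  qed auto
  moreover have "sqrt (4 ^ (p + 1) * (\<Sum>j=j0..<j1. (l j * (\<gamma> p * sqrt h))\<^sup>2)) = 2 ^ (p + 1) * \<gamma> p * sqrt (h * (\<Sum>j=j0..<j1. (l j)\<^sup>2))"
  proof -
    have "(4::real) ^ (p + 1) = (2 ^ (p + 1))\<^sup>2" by (simp add: power2_eq_square flip: power_mult_distrib)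
    moreover have "(\<Sum>j=j0..<j1. (l j * (\<gamma> p * sqrt h))\<^sup>2) = (\<gamma> p)\<^sup>2 * (h * (\<Sum>j=j0..<j1. (l j)\<^sup>2))"
      using nd(1) by (simp add: power_mult_distrib sum_distrib_left mult_ac)
    ultimately show ?thesis using nd(2)[of p] by (simp add: real_sqrt_mult)
  qed
  ultimately have "moment_bound M p (\<lambda>\<omega>. (\<Sum>j=j0..<j1. L j (\<xi> j \<omega>)) $ a) (2 ^ (p + 1) * \<gamma> p * sqrt (h * (\<Sum>j=j0..<j1. (l j)\<^sup>2)))" for a
    by (simp add: sum_component)
  from moment_bound_from_components[OF this p] show ?thesis by (simp add: mult_ac)
qed

text \<open>
  Discrete Ito integrals \<open>\<Sum> A\<^sub>j \<otimes> \<xi>\<^sub>j\<close> of predictable integrands.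
\<close>

lemma noise_tensor_moment:
  fixes A :: "nat \<Rightarrow> 'a \<Rightarrow> real^'n" and \<gamma> :: "nat \<Rightarrow> real" and x :: real and \<xi> :: "nat \<Rightarrow> 'a \<Rightarrow> real^'n"
  assumes ns: "noise_steps M \<gamma> n h \<xi>" and p: "p \<ge> 1" and j: "j0 \<le> j1" "j1 \<le> n"
    and Am: "\<And>j. j0 \<le> j \<Longrightarrow> j < j1 \<Longrightarrow> A j \<in> borel_measurable (past M \<xi> j)"
    and Ab: "\<And>j. j0 \<le> j \<Longrightarrow> j < j1 \<Longrightarrow> moment_bound M (2 * p) (A j) x" and x: "x > 0"
  shows "moment_bound M p (\<lambda>\<omega>. \<Sum>j=j0..<j1. tensor (A j \<omega>) (\<xi> j \<omega>))
     (CARD('n) * CARD('n) * 2 ^ (p + 1) * \<gamma> (2 * p) * x * sqrt (real (j1 - j0) * h))"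
proof -
  note nd = noise_stepsD[OF ns]
  have "moment_bound M p (\<lambda>\<omega>. \<Sum>j=j0..<j1. A j \<omega> $ a * (\<xi> j \<omega> $ b))
      (sqrt (4 ^ (p + 1) * (\<Sum>j=j0..<j1. (x * (\<gamma> (2 * p) * sqrt h))\<^sup>2)))" for a b
  proof (rule noise_sum_moment[where g="\<lambda>j x. x $ b", OF ns p j])
    fix j assume jj: "j0 \<le> j" "j < j1"
    then have jn: "j < n" using j by simp
    have nthm: "(\<lambda>x. x $ c) \<in> borel_measurable (borel :: (real^'n) measure)" for c
      by (intro borel_measurable_continuous_onI continuous_intros)
    show "(\<lambda>\<omega>. A j \<omega> $ a) \<in> borel_measurable (past M \<xi> j)"
      by (rule measurable_compose[OF Am[OF jj] nthm])
    show "(\<lambda>x. x $ b) \<in> borel_measurable (borel :: (real^'n) measure)" by (rule nthm)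
    show "expectation (\<lambda>\<omega>. \<xi> j \<omega> $ b) = 0" by (rule nd(6)[OF jn])
    note 1 = moment_bound_component[OF Ab[OF jj], of a]
    show "\<exists>y. moment_bound M p (\<lambda>\<omega>. A j \<omega> $ a) y" using moment_bound_lower[OF 1] by blast
    have 2: "moment_bound M q (\<lambda>\<omega>. \<xi> j \<omega> $ b) (\<gamma> q * sqrt h)" if "q \<ge> 1" for q
      by (intro moment_bound_component nd(5)[OF jn that])
    show "\<exists>y. moment_bound M p (\<lambda>\<omega>. \<xi> j \<omega> $ b) y" using 2[OF p] by blast
    show "moment_bound M p (\<lambda>\<omega>. A j \<omega> $ a * \<xi> j \<omega> $ b) (x * (\<gamma> (2 * p) * sqrt h))"
      by (rule moment_bound_prod[OF 1 2]) (use p in \<open>auto simp: abs_mult\<close>)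
    show "0 < x * (\<gamma> (2 * p) * sqrt h)" using x nd by simp
  qed
  moreover have "sqrt (4 ^ (p + 1) * (\<Sum>j=j0..<j1. (x * (\<gamma> (2 * p) * sqrt h))\<^sup>2)) = 2 ^ (p + 1) * \<gamma> (2 * p) * x * sqrt (real (j1 - j0) * h)"
  proof -
    have "(4::real) ^ (p + 1) = (2 ^ (p + 1))\<^sup>2" by (simp add: power2_eq_square flip: power_mult_distrib)
    moreover have "(x * (\<gamma> (2 * p) * sqrt h))\<^sup>2 = (x * \<gamma> (2 * p))\<^sup>2 * h"
      using nd(1) by (simp add: power_mult_distrib)
    then have "(\<Sum>j=j0..<j1. (x * (\<gamma> (2 * p) * sqrt h))\<^sup>2) = (x * \<gamma> (2 * p))\<^sup>2 * (real (j1 - j0) * h)"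
      by simp
    ultimately show ?thesis using nd(1) nd(2)[of "2 * p"] x by (simp add: real_sqrt_mult abs_mult)
  qed
  ultimately have "moment_bound M p (\<lambda>\<omega>. (\<Sum>j=j0..<j1. tensor (A j \<omega>) (\<xi> j \<omega>)) $ a $ b)
      (2 ^ (p + 1) * \<gamma> (2 * p) * x * sqrt (real (j1 - j0) * h))" for a b
    by (simp add: sum_component tensor_def)
  from moment_bound_from_components[OF moment_bound_from_components[OF this p] p] show ?thesis by (simp add: mult_ac)
qed

text \<open>
  The quadratic variation of the noise over \<open>k\<close> steps deviates from \<open>k h I\<close> by \<open>O (h sqrt k)\<close> only, which tends
  to 0 as the grid is refined with \<open>k h\<close> fixed.
\<close>

lemma noise_square_moment:
  fixes \<xi> :: "nat \<Rightarrow> 'a \<Rightarrow> real^'n" and \<gamma> :: "nat \<Rightarrow> real"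
  assumes ns: "noise_steps M \<gamma> n h \<xi>" and p: "p \<ge> 1" and j: "j0 \<le> j1" "j1 \<le> n"
  shows "moment_bound M p (\<lambda>\<omega>. (\<Sum>j=j0..<j1. tensor (\<xi> j \<omega>) (\<xi> j \<omega>)) - (real (j1 - j0) * h) *\<^sub>R mat 1)
     (CARD('n) * CARD('n) * 2 ^ (p + 1) * ((\<gamma> (2 * p))\<^sup>2 + 1) * (h * sqrt (real (j1 - j0))))"
proof -
  note nd = noise_stepsD[OF ns]
  define y where "y = ((\<gamma> (2 * p))\<^sup>2 + 1) * h"
  have y: "y > 0" using nd by (simp add: y_def add_nonneg_pos)
  let ?d = "\<lambda>a b. if a = b then h else 0"
  have "moment_bound M p (\<lambda>\<omega>. \<Sum>j=j0..<j1. 1 * (\<xi> j \<omega> $ a * \<xi> j \<omega> $ b - ?d a b))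
      (sqrt (4 ^ (p + 1) * (\<Sum>j=j0..<j1. y\<^sup>2)))" for a b
  proof (rule noise_sum_moment[where A="\<lambda>_ _. 1" and g="\<lambda>j x. x $ a * x $ b - ?d a b", OF ns p j])
    fix j assume jj: "j0 \<le> j" "j < j1"
    then have jn: "j < n" using j by simp
    show "(\<lambda>x. x $ a * x $ b - ?d a b) \<in> borel_measurable (borel :: (real^'n) measure)"
      by (intro borel_measurable_continuous_onI continuous_intros)
    have comp: "(\<lambda>\<omega>. \<xi> j \<omega> $ b) \<in> borel_measurable M" for b
      by (rule measurable_compose[OF nd(4)[OF jn]]) (intro borel_measurable_continuous_onI continuous_intros)
    have 2: "moment_bound M q (\<lambda>\<omega>. \<xi> j \<omega> $ b) (\<gamma> q * sqrt h)" if "q \<ge> 1" for q b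
      by (intro moment_bound_component nd(5)[OF jn that])
    have pr: "moment_bound M p (\<lambda>\<omega>. \<xi> j \<omega> $ a * \<xi> j \<omega> $ b) (\<gamma> (2 * p) * sqrt h * (\<gamma> (2 * p) * sqrt h))"
      by (rule moment_bound_prod[OF 2 2]) (use p in \<open>auto simp: abs_mult\<close>)
    have i: "integrable M (\<lambda>\<omega>. \<xi> j \<omega> $ a * \<xi> j \<omega> $ b)"
      by (rule integrable_moment_bound[OF _ pr p]) (use comp in measurable)
    show "expectation (\<lambda>\<omega>. \<xi> j \<omega> $ a * \<xi> j \<omega> $ b - ?d a b) = 0"
      using i nd(7)[OF jn, of a b] by (simp add: prob_space)
    show "\<exists>y. moment_bound M p (\<lambda>\<omega>. 1::real) y" using moment_bound_const by blast
    have b: "moment_bound M p (\<lambda>\<omega>. \<xi> j \<omega> $ a * \<xi> j \<omega> $ b - ?d a b) y"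
    proof (rule moment_bound_le[OF moment_bound_diff[OF pr moment_bound_const[of p "?d a b"] p]])
      show "\<gamma> (2 * p) * sqrt h * (\<gamma> (2 * p) * sqrt h) + norm (?d a b) \<le> y"
      proof -
        have "\<gamma> (2 * p) * sqrt h * (\<gamma> (2 * p) * sqrt h) = (\<gamma> (2 * p))\<^sup>2 * (sqrt h)\<^sup>2"
          by (simp only: power2_eq_square mult_ac)
        then show ?thesis using nd(1) by (auto simp: y_def distrib_right)
      qed
    qed
    then show "\<exists>y. moment_bound M p (\<lambda>\<omega>. \<xi> j \<omega> $ a * \<xi> j \<omega> $ b - ?d a b) y" by blast
    show "moment_bound M p (\<lambda>\<omega>. 1 * (\<xi> j \<omega> $ a * \<xi> j \<omega> $ b - ?d a b)) y" using b by simp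
    show "0 < y" by (rule y)
  qed auto
  moreover have "sqrt (4 ^ (p + 1) * (\<Sum>j=j0..<j1. y\<^sup>2)) = 2 ^ (p + 1) * y * sqrt (real (j1 - j0))"
  proof -
    have "(4::real) ^ (p + 1) = (2 ^ (p + 1))\<^sup>2" by (simp add: power2_eq_square flip: power_mult_distrib)
    then show ?thesis using y by (simp add: real_sqrt_mult)
  qed
  moreover have "((\<Sum>j=j0..<j1. tensor (\<xi> j \<omega>) (\<xi> j \<omega>)) - (real (j1 - j0) * h) *\<^sub>R mat 1) $ a $ b
      = (\<Sum>j=j0..<j1. 1 * (\<xi> j \<omega> $ a * \<xi> j \<omega> $ b - ?d a b))" for a b \<omega>
    using j by (simp add: sum_component tensor_def sum_subtractf mat_def)
  ultimately have "moment_bound M p (\<lambda>\<omega>. ((\<Sum>j=j0..<j1. tensor (\<xi> j \<omega>) (\<xi> j \<omega>)) - (real (j1 - j0) * h) *\<^sub>R mat 1) $ a $ b)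
      (2 ^ (p + 1) * y * sqrt (real (j1 - j0)))" for a b
    by simp
  from moment_bound_from_components[OF moment_bound_from_components[OF this p] p] show ?thesis by (simp add: y_def mult_ac)
qed

end

section \<open>The Euler scheme for the momentum\<close>

lemma tensor_bilinear: "bounded_bilinear (tensor :: real^'n \<Rightarrow> real^'n \<Rightarrow> real^'n^'n)"
  by (subst bilinear_conv_bounded_bilinear[symmetric])
     (auto simp: bilinear_def linear_iff tensor_def vec_eq_iff algebra_simps)

lemma norm_tensor: "norm (tensor a b) = norm a * norm (b :: real^'n)"
proof -
  have "(norm (tensor a b))\<^sup>2 = (\<Sum>i\<in>UNIV. \<Sum>j\<in>UNIV. (a $ i * b $ j)\<^sup>2)"
    by (simp add: norm_vec_def L2_set_def tensor_def sum_nonneg)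
  also have "\<dots> = (\<Sum>i\<in>UNIV. (a $ i)\<^sup>2) * (\<Sum>j\<in>UNIV. (b $ j)\<^sup>2)"
    by (simp add: sum_product power_mult_distrib)
  also have "\<dots> = (norm a * norm b)\<^sup>2"
    by (simp add: norm_vec_def L2_set_def sum_nonneg power_mult_distrib)
  finally show ?thesis by (simp add: power2_eq_iff_nonneg)
qed

lemmas tensor_simps = bounded_bilinear.add_left[OF tensor_bilinear] bounded_bilinear.add_right[OF tensor_bilinear]
  bounded_bilinear.diff_left[OF tensor_bilinear] bounded_bilinear.diff_right[OF tensor_bilinear]
  bounded_bilinear.minus_left[OF tensor_bilinear] bounded_bilinear.minus_right[OF tensor_bilinear]
  bounded_bilinear.scaleR_left[OF tensor_bilinear] bounded_bilinear.scaleR_right[OF tensor_bilinear]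
  bounded_bilinear.zero_left[OF tensor_bilinear] bounded_bilinear.zero_right[OF tensor_bilinear]

lemmas matrix_mult_simps = bounded_bilinear.add_left[OF bounded_bilinear_matrix_mult] bounded_bilinear.add_right[OF bounded_bilinear_matrix_mult]
  bounded_bilinear.diff_left[OF bounded_bilinear_matrix_mult] bounded_bilinear.diff_right[OF bounded_bilinear_matrix_mult]
  bounded_bilinear.scaleR_left[OF bounded_bilinear_matrix_mult] bounded_bilinear.scaleR_right[OF bounded_bilinear_matrix_mult]
  bounded_bilinear.zero_left[OF bounded_bilinear_matrix_mult] bounded_bilinear.zero_right[OF bounded_bilinear_matrix_mult]

lemma matrix_mult_tensor: "A ** tensor a b = tensor (A *v a) b"
  by (simp add: tensor_def matrix_matrix_mult_def matrix_vector_mult_def vec_eq_iff sum_distrib_left sum_distrib_right mult_ac)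

lemma tensor_mult_transpose: "tensor a b ** transpose A = tensor a (A *v b)"
  by (simp add: tensor_def matrix_matrix_mult_def matrix_vector_mult_def vec_eq_iff transpose_def sum_distrib_left sum_distrib_right mult_ac)

text \<open>
  The Euler scheme for \<open>dP = - (1/m) A P dt + dW\<close> with \<open>e = h/m\<close> and noise increments \<open>x\<close>.
\<close>

primrec euler :: "real^'n^'n \<Rightarrow> real \<Rightarrow> (nat \<Rightarrow> real^'n) \<Rightarrow> nat \<Rightarrow> real^'n" where
  "euler A e x 0 = 0"
| "euler A e x (Suc i) = euler A e x i - e *\<^sub>R (A *v euler A e x i) + x i"

text \<open>
  The discrete version of \<open>A X = W - P\<close>.
\<close>

definition euler_pos :: "real^'n^'n \<Rightarrow> real \<Rightarrow> (nat \<Rightarrow> real^'n) \<Rightarrow> nat \<Rightarrow> real^'n" where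
  "euler_pos A e x i = (\<Sum>j<i. x j) - euler A e x i"

text \<open>
  The increment of \<open>A X\<close> in step \<open>i\<close> is \<open>e A P\<^sub>i\<close>. The integrand is evaluated at the right
  endpoint of the step. It is predictable nevertheless, because this value of \<open>A X\<close> is determined by the noise
  before step \<open>i\<close>, and the summation by parts below then produces no second order terms.
\<close>

definition euler_area :: "real^'n^'n \<Rightarrow> real \<Rightarrow> (nat \<Rightarrow> real^'n) \<Rightarrow> nat \<Rightarrow> nat \<Rightarrow> real^'n^'n" where
  "euler_area A e x i0 i1 =
     (\<Sum>i=i0..<i1. tensor (euler_pos A e x (Suc i) - euler_pos A e x i0) (e *\<^sub>R (A *v euler A e x i)))"

definition euler_second_moment :: "real^'n^'n \<Rightarrow> real \<Rightarrow> (nat \<Rightarrow> real^'n) \<Rightarrow> nat \<Rightarrow> nat \<Rightarrow> real^'n^'n" where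
  "euler_second_moment A e x i0 i1 = e *\<^sub>R (\<Sum>i=i0..<i1. tensor (euler A e x i) (euler A e x i))"

lemma euler_pos_Suc: "euler_pos A e x (Suc i) = euler_pos A e x i + e *\<^sub>R (A *v euler A e x i)"
  by (simp add: euler_pos_def)

lemma euler_pos_diff:
  "i0 \<le> i1 \<Longrightarrow> euler_pos A e x i1 - euler_pos A e x i0 = (\<Sum>i=i0..<i1. e *\<^sub>R (A *v euler A e x i))"
  by (induction i1 rule: dec_induct) (auto simp: euler_pos_Suc algebra_simps)

lemma noise_diff:
  fixes x :: "nat \<Rightarrow> 'b::ab_group_add"
  shows "i0 \<le> i1 \<Longrightarrow> (\<Sum>j<i1. x j) - (\<Sum>j<i0. x j) = (\<Sum>j=i0..<i1. x j)"
  by (induction i1 rule: dec_induct) auto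

lemma euler_closed: "euler A e x i = (\<Sum>j=0..<i. ((\<lambda>y. y - e *\<^sub>R (A *v y)) ^^ (i - 1 - j)) (x j))"
proof (induction i)
  case (Suc i)
  let ?B = "\<lambda>y. y - e *\<^sub>R (A *v y)"
  have lin: "linear ?B"
    by (auto simp: linear_iff matrix_vector_right_distrib matrix_vector_mult_scaleR algebra_simps)
  have "euler A e x (Suc i) = ?B (\<Sum>j=0..<i. (?B ^^ (i - 1 - j)) (x j)) + x i"
    by (simp only: euler.simps Suc)
  also have "?B (\<Sum>j=0..<i. (?B ^^ (i - 1 - j)) (x j)) = (\<Sum>j=0..<i. ?B ((?B ^^ (i - 1 - j)) (x j)))"
    by (rule linear_sum[OF lin])
  also have "\<dots> = (\<Sum>j=0..<i. (?B ^^ (Suc i - 1 - j)) (x j))"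
  proof (rule sum.cong[OF refl])
    fix j assume "j \<in> {0..<i}"
    then have "Suc i - 1 - j = Suc (i - 1 - j)" by auto
    then show "?B ((?B ^^ (i - 1 - j)) (x j)) = (?B ^^ (Suc i - 1 - j)) (x j)" by simp
  qed
  finally show ?case by simp
qed simp

text \<open>
  Since \<open>A X\<close> has increments \<open>x\<^sub>i - (P\<^sub>i\<^sub>+\<^sub>1 - P\<^sub>i)\<close>, the area is a discrete Ito integral against the noise minus a sum
  against the increments of \<open>P\<close>; the latter is summed by parts, which moves the difference to \<open>A X\<close>, where
  it is \<open>e A P\<^sub>i\<close> again.
\<close>

lemma euler_area_by_parts:
  assumes "i0 \<le> i1"
  shows "euler_area A e x i0 i1 =
      (\<Sum>i=i0..<i1. tensor (euler_pos A e x (Suc i) - euler_pos A e x i0) (x i))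
      - tensor (euler_pos A e x i1 - euler_pos A e x i0) (euler A e x i1)
      + A ** euler_second_moment A e x i0 i1"
  using assms
proof (induction i1 rule: dec_induct)
  case base
  then show ?case by (simp add: euler_area_def euler_second_moment_def tensor_simps matrix_mult_simps)
next
  case (step i)
  then show ?case
    by (simp add: euler_area_def euler_second_moment_def euler_pos_Suc scaleR_add_right)
       (simp add: tensor_simps matrix_mult_simps matrix_mult_tensor algebra_simps)
qed

text \<open>
  The telescoping sum of the increments of \<open>P\<^sub>i \<otimes> P\<^sub>i\<close>, the discrete analogue of Ito's formula for \<open>P \<otimes> P\<close>.
\<close>

lemma euler_second_moment_lyap:
  assumes "i0 \<le> i1"
  shows "lyap A (euler_second_moment A e x i0 i1) =
      tensor (euler A e x i0) (euler A e x i0) - tensor (euler A e x i1) (euler A e x i1)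
      + (\<Sum>i=i0..<i1. tensor (x i) (x i))
      + (\<Sum>i=i0..<i1. tensor (euler A e x i - e *\<^sub>R (A *v euler A e x i)) (x i))
      + transpose (\<Sum>i=i0..<i1. tensor (euler A e x i - e *\<^sub>R (A *v euler A e x i)) (x i))
      + e *\<^sub>R (A ** euler_second_moment A e x i0 i1 ** transpose A)"
  using assms
proof (induction i1 rule: dec_induct)
  case base
  then show ?case by (simp add: euler_second_moment_def lyap_def matrix_mult_simps transpose_def vec_eq_iff)
next
  case (step i)
  have tr: "transpose (P + Q) = transpose P + transpose Q" "transpose (tensor a b) = tensor b a"
    for P Q :: "real^'n^'n" and a b :: "real^'n"
    by (auto simp: transpose_def tensor_def vec_eq_iff)
  let ?p = "euler A e x i"
  have S: "euler_second_moment A e x i0 (Suc i) = euler_second_moment A e x i0 i + e *\<^sub>R tensor ?p ?p"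
    using step by (simp add: euler_second_moment_def scaleR_add_right)
  have L: "lyap A (X + e *\<^sub>R tensor ?p ?p) = lyap A X + e *\<^sub>R (tensor (A *v ?p) ?p + tensor ?p (A *v ?p))" for X
    by (simp add: lyap_def matrix_mult_simps matrix_mult_tensor tensor_mult_transpose algebra_simps)
  have C: "e *\<^sub>R (A ** (X + e *\<^sub>R tensor ?p ?p) ** transpose A) = e *\<^sub>R (A ** X ** transpose A) + (e * e) *\<^sub>R tensor (A *v ?p) (A *v ?p)" for X
    by (simp add: matrix_mult_simps matrix_mult_tensor tensor_mult_transpose algebra_simps)
  show ?case unfolding S L C step.IH using step(1)
    by (simp add: tr) (simp add: tensor_simps algebra_simps)
qed

text \<open>
  All constants that enter the estimates are fixed before the grid, the mass and the noise. The
  existential quantifiers below therefore provide constants that are uniform in these.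
\<close>

locale euler_noise = prob_space +
  fixes A C :: "real^'n^'n" and c K e0 \<kappa> a :: real and \<gamma> :: "nat \<Rightarrow> real"
  assumes pos: "c > 0" "K > 0" "e0 > 0" "e0 \<le> 1" "\<kappa> > 0" "a > 0"
    and e0: "\<And>e. 0 < e \<Longrightarrow> e \<le> e0 \<Longrightarrow> c * e < 1"
    and decay: "\<And>e k x. 0 < e \<Longrightarrow> e \<le> e0 \<Longrightarrow>
        norm (((\<lambda>x. x - e *\<^sub>R (A *v x)) ^^ k) x) \<le> K * (1 - c * e) ^ k * norm x"
    and lyap_below: "\<And>X. norm X \<le> \<kappa> * norm (lyap A X)"
    and lyap_C: "lyap A C = mat 1"
    and A_vec: "\<And>x. norm (A *v x) \<le> a * norm x"
    and A_mat: "\<And>X::real^'n^'n. norm (A ** X) \<le> a * norm X"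
    and A_conj: "\<And>X. norm (A ** X ** transpose A) \<le> a * norm X"
begin

text \<open>
  Steps that are short compared to the relaxation time \<open>m\<close>, so that the scheme is stable.
\<close>

definition regime :: "nat \<Rightarrow> real \<Rightarrow> real \<Rightarrow> (nat \<Rightarrow> 'a \<Rightarrow> real^'n) \<Rightarrow> bool" where
  "regime n h m \<xi> \<longleftrightarrow> noise_steps M \<gamma> n h \<xi> \<and> 0 < m \<and> h \<le> e0 * m"

abbreviation mom :: "real \<Rightarrow> (nat \<Rightarrow> 'a \<Rightarrow> real^'n) \<Rightarrow> nat \<Rightarrow> 'a \<Rightarrow> real^'n" where
  "mom e \<xi> i \<omega> \<equiv> euler A e (\<lambda>j. \<xi> j \<omega>) i"

abbreviation pos :: "real \<Rightarrow> (nat \<Rightarrow> 'a \<Rightarrow> real^'n) \<Rightarrow> nat \<Rightarrow> 'a \<Rightarrow> real^'n" where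
  "pos e \<xi> i \<omega> \<equiv> euler_pos A e (\<lambda>j. \<xi> j \<omega>) i"

lemma regimeD:
  assumes "regime n h m \<xi>"
  shows "noise_steps M \<gamma> n h \<xi>" "0 < m" "0 < h" "0 < h / m" "h / m \<le> e0" "h \<le> m" "h / m \<le> 1"
proof -
  show 1: "noise_steps M \<gamma> n h \<xi>" "0 < m" using assms by (auto simp: regime_def)
  then show 2: "0 < h" using noise_stepsD(1) by blast
  then show "0 < h / m" using 1 by simp
  show 3: "h / m \<le> e0" using assms 1 by (simp add: regime_def field_simps)
  then show 4: "h / m \<le> 1" using pos by simp
  then show "h \<le> m" using 1 by simp
qed

lemma noise_incr_moment:
  assumes "regime n h m \<xi>" "p \<ge> 1" "i0 \<le> i1" "i1 \<le> n"
  shows "moment_bound M p (\<lambda>\<omega>. \<Sum>j=i0..<i1. \<xi> j \<omega>) (CARD('n) * 2 ^ (p + 1) * \<gamma> p * sqrt (real (i1 - i0) * h))"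
  using noise_linear_moment[OF regimeD(1)[OF assms(1)] assms(2-4), of "\<lambda>_ x. x" "\<lambda>_. 1"]
  by (simp add: linear_id[unfolded id_def] mult_ac)

text \<open>
  The closed form of the scheme is a sum of independent terms of size \<open>K (1 - c e)\<^sup>i\<^sup>-\<^sup>1\<^sup>-\<^sup>j sqrt h\<close>, whose squares add
  up to at most \<open>K\<^sup>2 h / (c e) = K\<^sup>2 m / c\<close>.
\<close>

lemma mom_moment:
  assumes p: "p \<ge> 1"
  shows "\<exists>B>0. \<forall>n h m \<xi> i. regime n h m \<xi> \<longrightarrow> i \<le> n \<longrightarrow> moment_bound M p (mom (h / m) \<xi> i) (B * sqrt m)"
proof (cases "\<gamma> p > 0")
  case True
  define B where "B = CARD('n) * 2 ^ (p + 1) * \<gamma> p * (K / sqrt c)"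
  have "moment_bound M p (mom (h / m) \<xi> i) (B * sqrt m)" if R: "regime n h m \<xi>" and i: "i \<le> n" for n h m \<xi> i
  proof -
    note r = regimeD[OF R]
    define e where "e = h / m"
    define q where "q = 1 - c * e"
    have ce: "c * e < 1" using e0 r unfolding e_def by blast
    have q: "0 < q" "q < 1" using ce r pos by (auto simp: q_def e_def)
    let ?B = "\<lambda>y. y - e *\<^sub>R (A *v y)"
    have lin: "linear (?B ^^ k)" for k
    proof (induction k)
      case (Suc k)
      have "linear ?B"
        by (auto simp: linear_iff matrix_vector_right_distrib matrix_vector_mult_scaleR algebra_simps)
      from linear_compose[OF Suc this] show ?case by (simp add: o_def)
    qed (auto simp: linear_iff)
    have "moment_bound M p (\<lambda>\<omega>. \<Sum>j=0..<i. (?B ^^ (i - 1 - j)) (\<xi> j \<omega>))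
       (CARD('n) * 2 ^ (p + 1) * \<gamma> p * sqrt (h * (\<Sum>j=0..<i. (K * q ^ (i - 1 - j))\<^sup>2)))"
    proof (rule noise_linear_moment[OF r(1) p])
      show "norm ((?B ^^ (i - 1 - j)) x) \<le> K * q ^ (i - 1 - j) * norm x" for j x
        using decay[of e "i - 1 - j" x] r by (simp add: q_def e_def)
    qed (use i lin q pos in auto)
    moreover have "CARD('n) * 2 ^ (p + 1) * \<gamma> p * sqrt (h * (\<Sum>j=0..<i. (K * q ^ (i - 1 - j))\<^sup>2)) \<le> B * sqrt m"
    proof -
      have "(\<Sum>j=0..<i. (K * q ^ (i - 1 - j))\<^sup>2) \<le> (\<Sum>j=0..<i. K\<^sup>2 * q ^ (i - 1 - j))"
      proof (rule sum_mono)
        fix j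
        have "(q ^ (i - 1 - j))\<^sup>2 \<le> q ^ (i - 1 - j)"
          using q by (simp add: power2_eq_square mult_left_le power_le_one)
        then show "(K * q ^ (i - 1 - j))\<^sup>2 \<le> K\<^sup>2 * q ^ (i - 1 - j)"
          by (simp add: power_mult_distrib mult_left_mono)
      qed
      also have "\<dots> = K\<^sup>2 * (\<Sum>j<i. q ^ j)"
        unfolding sum_distrib_left atLeast0LessThan by (subst sum.nat_diff_reindex[symmetric]) simp
      also have "(\<Sum>j<i. q ^ j) \<le> 1 / (1 - q)"
        using sum_le_suminf[of "\<lambda>j. q ^ j" "{..<i}"] q by (simp add: summable_geometric suminf_geometric)
      finally have g: "(\<Sum>j=0..<i. (K * q ^ (i - 1 - j))\<^sup>2) \<le> K\<^sup>2 * (1 / (1 - q))"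
        by (simp add: mult_left_mono)
      have "h * (\<Sum>j=0..<i. (K * q ^ (i - 1 - j))\<^sup>2) \<le> h * (K\<^sup>2 * (1 / (1 - q)))"
        by (rule mult_left_mono[OF g less_imp_le[OF r(3)]])
      also have "\<dots> = (K / sqrt c)\<^sup>2 * m"
        using r pos by (simp add: q_def e_def power_divide field_simps)
      finally have "sqrt (h * (\<Sum>j=0..<i. (K * q ^ (i - 1 - j))\<^sup>2)) \<le> sqrt ((K / sqrt c)\<^sup>2 * m)"
        by (rule real_sqrt_le_mono)
      also have "\<dots> = K / sqrt c * sqrt m" using pos r by (simp add: real_sqrt_mult)
      finally have sq: "sqrt (h * (\<Sum>j=0..<i. (K * q ^ (i - 1 - j))\<^sup>2)) \<le> K / sqrt c * sqrt m" .
      have "CARD('n) * 2 ^ (p + 1) * \<gamma> p * sqrt (h * (\<Sum>j=0..<i. (K * q ^ (i - 1 - j))\<^sup>2))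
          \<le> CARD('n) * 2 ^ (p + 1) * \<gamma> p * (K / sqrt c * sqrt m)"
        by (rule mult_left_mono[OF sq]) (use True in simp)
      then show ?thesis by (simp only: B_def mult.assoc)
    qed
    ultimately show ?thesis unfolding euler_closed e_def[symmetric] by (rule moment_bound_le)
  qed
  moreover have "B > 0" using True pos by (simp add: B_def)
  ultimately show ?thesis by blast
next
  case False
  then have "\<not> regime n h m \<xi>" for n h m \<xi> using noise_stepsD(2)[of \<gamma>] unfolding regime_def by blast
  then show ?thesis by (intro exI[of _ 1]) auto
qed

text \<open>
  The velocity \<open>A P / m\<close> has size \<open>1 / sqrt m\<close>.
\<close>

lemma pos_incr_moment:
  assumes p: "p \<ge> 1"
  shows "\<exists>B>0. \<forall>n h m \<xi> i0 i1. regime n h m \<xi> \<longrightarrow> i0 \<le> i1 \<longrightarrow> i1 \<le> n \<longrightarrow>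
      moment_bound M p (\<lambda>\<omega>. pos (h / m) \<xi> i1 \<omega> - pos (h / m) \<xi> i0 \<omega>) (B * (real (i1 - i0) * h / sqrt m))"
proof -
  obtain B where B: "B > 0" "\<And>n h m \<xi> i. regime n h m \<xi> \<Longrightarrow> i \<le> n \<Longrightarrow> moment_bound M p (mom (h / m) \<xi> i) (B * sqrt m)"
    using mom_moment[OF p] by blast
  have "moment_bound M p (\<lambda>\<omega>. pos (h / m) \<xi> i1 \<omega> - pos (h / m) \<xi> i0 \<omega>) (a * B * (real (i1 - i0) * h / sqrt m))"
    if R: "regime n h m \<xi>" and i: "i0 \<le> i1" "i1 \<le> n" for n h m \<xi> i0 i1
  proof -
    note r = regimeD[OF R]
    have "moment_bound M p (\<lambda>\<omega>. (h / m) *\<^sub>R (A *v mom (h / m) \<xi> i \<omega>)) (\<bar>h / m\<bar> * (a * (B * sqrt m)))" if "i \<in> {i0..<i1}" for i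
      by (intro moment_bound_scaleR moment_bound_lipschitz[OF B(2)[OF R, of i]]) (use that i pos A_vec in auto)
    from moment_bound_sum[OF finite_atLeastLessThan this p]
    have "moment_bound M p (\<lambda>\<omega>. \<Sum>i=i0..<i1. (h / m) *\<^sub>R (A *v mom (h / m) \<xi> i \<omega>)) (\<Sum>i=i0..<i1. \<bar>h / m\<bar> * (a * (B * sqrt m)))"
      by simp
    moreover have "(\<Sum>i=i0..<i1. \<bar>h / m\<bar> * (a * (B * sqrt m))) = a * B * (real (i1 - i0) * h / sqrt m)"
    proof -
      have "sqrt m / m = 1 / sqrt m" using r by (simp add: real_div_sqrt field_simps)
      moreover have "(\<Sum>i=i0..<i1. \<bar>h / m\<bar> * (a * (B * sqrt m))) = a * B * (real (i1 - i0) * h) * (sqrt m / m)"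
        using r by simp
      ultimately show ?thesis by simp
    qed
    ultimately show ?thesis using i by (simp add: euler_pos_diff)
  qed
  moreover have "a * B > 0" using pos B by simp
  ultimately show ?thesis by blast
qed

text \<open>
  Over times \<open>t \<le> m\<close> the increment of \<open>P\<close> is that of \<open>W\<close> up to a displacement of \<open>A X\<close> of size
  \<open>t / sqrt m \<le> sqrt t\<close>; over longer times \<open>sqrt m \<le> sqrt t\<close> holds anyway.
\<close>

lemma mom_incr_moment:
  assumes p: "p \<ge> 1"
  shows "\<exists>B>0. \<forall>n h m \<xi> i0 i1. regime n h m \<xi> \<longrightarrow> i0 \<le> i1 \<longrightarrow> i1 \<le> n \<longrightarrow>
      moment_bound M p (\<lambda>\<omega>. mom (h / m) \<xi> i1 \<omega> - mom (h / m) \<xi> i0 \<omega>) (B * sqrt (real (i1 - i0) * h)) \<and>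
      moment_bound M p (\<lambda>\<omega>. mom (h / m) \<xi> i1 \<omega> - mom (h / m) \<xi> i0 \<omega>) (B * sqrt m)"
proof -
  obtain B where B: "B > 0" "\<And>n h m \<xi> i. regime n h m \<xi> \<Longrightarrow> i \<le> n \<Longrightarrow> moment_bound M p (mom (h / m) \<xi> i) (B * sqrt m)"
    using mom_moment[OF p] by blast
  obtain B' where B': "B' > 0" "\<And>n h m \<xi> i0 i1. regime n h m \<xi> \<Longrightarrow> i0 \<le> i1 \<Longrightarrow> i1 \<le> n \<Longrightarrow>
      moment_bound M p (\<lambda>\<omega>. pos (h / m) \<xi> i1 \<omega> - pos (h / m) \<xi> i0 \<omega>) (B' * (real (i1 - i0) * h / sqrt m))"
    using pos_incr_moment[OF p] by blast
  define G where "G = CARD('n) * 2 ^ (p + 1) * \<bar>\<gamma> p\<bar>"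
  define B1 where "B1 = G + B' + 2 * B"
  have G: "G \<ge> 0" by (simp add: G_def)
  have "moment_bound M p (\<lambda>\<omega>. mom (h / m) \<xi> i1 \<omega> - mom (h / m) \<xi> i0 \<omega>) (B1 * sqrt (real (i1 - i0) * h)) \<and>
      moment_bound M p (\<lambda>\<omega>. mom (h / m) \<xi> i1 \<omega> - mom (h / m) \<xi> i0 \<omega>) (B1 * sqrt m)"
    if R: "regime n h m \<xi>" and i: "i0 \<le> i1" "i1 \<le> n" for n h m \<xi> i0 i1
  proof -
    note r = regimeD[OF R]
    define t where "t = real (i1 - i0) * h"
    have t: "t \<ge> 0" using r by (simp add: t_def)
    have "moment_bound M p (\<lambda>\<omega>. mom (h / m) \<xi> i1 \<omega> - mom (h / m) \<xi> i0 \<omega>) (B * sqrt m + B * sqrt m)"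
      using i by (intro moment_bound_diff B(2)[OF R] p) auto
    then have 1: "moment_bound M p (\<lambda>\<omega>. mom (h / m) \<xi> i1 \<omega> - mom (h / m) \<xi> i0 \<omega>) (2 * B * sqrt m)"
      by (simp add: mult.assoc)
    have le: "2 * B * sqrt m \<le> B1 * sqrt m" using G B B' r by (intro mult_right_mono) (auto simp: B1_def)
    have "moment_bound M p (\<lambda>\<omega>. mom (h / m) \<xi> i1 \<omega> - mom (h / m) \<xi> i0 \<omega>) (B1 * sqrt t)"
    proof (cases "t \<le> m")
      case True
      have eq: "mom (h / m) \<xi> i1 \<omega> - mom (h / m) \<xi> i0 \<omega>
          = (\<Sum>j=i0..<i1. \<xi> j \<omega>) - (pos (h / m) \<xi> i1 \<omega> - pos (h / m) \<xi> i0 \<omega>)" for \<omega>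
        unfolding noise_diff[OF i(1), symmetric] by (simp add: euler_pos_def)
      have "moment_bound M p (\<lambda>\<omega>. mom (h / m) \<xi> i1 \<omega> - mom (h / m) \<xi> i0 \<omega>)
          (CARD('n) * 2 ^ (p + 1) * \<gamma> p * sqrt (real (i1 - i0) * h) + B' * (real (i1 - i0) * h / sqrt m))"
        unfolding eq by (intro moment_bound_diff noise_incr_moment[OF R p i] B'(2)[OF R i] p)
      moreover have "CARD('n) * 2 ^ (p + 1) * \<gamma> p * sqrt (real (i1 - i0) * h) \<le> G * sqrt t"
        unfolding G_def t_def[symmetric] using t by (intro mult_right_mono mult_left_mono) auto
      moreover have "B' * (real (i1 - i0) * h / sqrt m) \<le> B' * sqrt t"
      proof -
        have "t / sqrt m = sqrt t * (sqrt t / sqrt m)" using t by simp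
        also have "\<dots> \<le> sqrt t * 1" using True t r by (intro mult_left_mono) (auto simp: divide_le_eq_1)
        finally have f: "t / sqrt m \<le> sqrt t * 1" .
        show ?thesis using mult_left_mono[OF f less_imp_le[OF B'(1)]] by (simp add: t_def)
      qed
      moreover have "G * sqrt t + B' * sqrt t \<le> B1 * sqrt t" using B t by (simp add: B1_def algebra_simps)
      ultimately show ?thesis by (elim moment_bound_le) linarith
    next
      case False
      then have "2 * B * sqrt m \<le> B1 * sqrt t" using G B B' r by (intro mult_mono) (auto simp: B1_def)
      with 1 show ?thesis by (rule moment_bound_le)
    qed
    then show ?thesis using moment_bound_le[OF 1 le] by (simp add: t_def)
  qed
  moreover have "B1 > 0" using B B' G by (simp add: B1_def)
  ultimately show ?thesis by blast
qed

end

text \<open>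
  The second level of the scheme minus the trapezoidal, that is Stratonovich, sum of the noise and the
  drift \<open>\<Gamma>\<close>.
\<close>

definition euler_defect :: "real^'n^'n \<Rightarrow> real^'n^'n \<Rightarrow> real \<Rightarrow> real \<Rightarrow> (nat \<Rightarrow> real^'n) \<Rightarrow> nat \<Rightarrow> nat \<Rightarrow> real^'n^'n" where
  "euler_defect A \<Gamma> e h x i0 i1 =
     euler_area A e x i0 i1
     - ((\<Sum>i=i0..<i1. tensor (\<Sum>j=i0..<i. x j) (x i)) + (1 / 2) *\<^sub>R (\<Sum>i=i0..<i1. tensor (x i) (x i)))
     - (real (i1 - i0) * h) *\<^sub>R \<Gamma>"

text \<open>
  With \<open>\<Gamma> = A C - I/2\<close> the defect splits into the deviation of \<open>S\<close> from its ergodic limit \<open>t C\<close>, a discrete Ito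
  integral of momenta, a boundary term, and the fluctuation of the quadratic variation. Each of
  them is small separately.
\<close>

lemma euler_defect_by_parts:
  assumes "i0 \<le> i1"
  shows "euler_defect A (A ** C - (1 / 2) *\<^sub>R mat 1) e h x i0 i1 =
      A ** (euler_second_moment A e x i0 i1 - (real (i1 - i0) * h) *\<^sub>R C)
      - (\<Sum>i=i0..<i1. tensor (euler A e x i - e *\<^sub>R (A *v euler A e x i) - euler A e x i0) (x i))
      - tensor (euler_pos A e x i1 - euler_pos A e x i0) (euler A e x i1)
      - (1 / 2) *\<^sub>R ((\<Sum>i=i0..<i1. tensor (x i) (x i)) - (real (i1 - i0) * h) *\<^sub>R mat 1)"
proof -
  have "(\<Sum>i=i0..<i1. tensor (euler_pos A e x (Suc i) - euler_pos A e x i0) (x i))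
      = (\<Sum>i=i0..<i1. tensor (\<Sum>j=i0..<i. x j) (x i)
          - tensor (euler A e x i - e *\<^sub>R (A *v euler A e x i) - euler A e x i0) (x i))"
  proof (rule sum.cong[OF refl])
    fix i assume "i \<in> {i0..<i1}"
    then have "(\<Sum>j=i0..<i. x j) = (\<Sum>j<i. x j) - (\<Sum>j<i0. x j)" by (simp add: noise_diff)
    then have "euler_pos A e x (Suc i) - euler_pos A e x i0
        = (\<Sum>j=i0..<i. x j) - (euler A e x i - e *\<^sub>R (A *v euler A e x i) - euler A e x i0)"
      by (simp add: euler_pos_def algebra_simps)
    then show "tensor (euler_pos A e x (Suc i) - euler_pos A e x i0) (x i) = tensor (\<Sum>j=i0..<i. x j) (x i)
          - tensor (euler A e x i - e *\<^sub>R (A *v euler A e x i) - euler A e x i0) (x i)"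
      by (simp only: bounded_bilinear.diff_left[OF tensor_bilinear])
  qed
  then show ?thesis
    unfolding euler_defect_def euler_area_by_parts[OF assms]
    by (simp add: sum_subtractf matrix_mult_simps scaleR_right_diff_distrib algebra_simps)
qed

lemma norm_transpose: "norm (transpose X) = norm (X :: real^'n^'n)"
proof -
  have "(\<Sum>i\<in>UNIV. \<Sum>j\<in>UNIV. (X $ j $ i)\<^sup>2) = (\<Sum>i\<in>UNIV. \<Sum>j\<in>UNIV. (X $ i $ j)\<^sup>2)" by (rule sum.swap)
  then show ?thesis by (simp add: norm_vec_def L2_set_def transpose_def sum_nonneg)
qed

context euler_noise
begin

lemma mom_past: "mom e \<xi> i \<in> borel_measurable (past M \<xi> i)"
proof (induction i)
  case (Suc i)
  have Pm: "mom e \<xi> i \<in> borel_measurable (past M \<xi> (Suc i))" by (rule measurable_past_mono[OF Suc]) simp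
  have [measurable]: "(*v) A \<in> borel_measurable borel"
    by (intro borel_measurable_continuous_onI linear_continuous_on matrix_vector_mul_bounded_linear)
  show ?case unfolding euler.simps
    by (intro borel_measurable_add borel_measurable_diff borel_measurable_scaleR borel_measurable_const Pm
        measurable_compose[OF Pm] measurable_past_step) auto
qed simp

lemma noise_past: "i0 \<le> i \<Longrightarrow> (\<lambda>\<omega>. \<Sum>j=i0..<i. \<xi> j \<omega>) \<in> borel_measurable (past M \<xi> i)"
  for \<xi> :: "nat \<Rightarrow> 'a \<Rightarrow> real^'n"
  by (intro borel_measurable_sum measurable_past_step) auto

lemma gamma_pos: "regime n h m \<xi> \<Longrightarrow> \<gamma> p > 0"
  unfolding regime_def using noise_stepsD(2) by blast

text \<open>
  Below the relaxation time the four terms in the definition of the defect need not cancel.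
\<close>

lemma defect_small:
  assumes p: "p \<ge> 1"
  shows "\<exists>B>0. \<forall>n h m \<xi> i0 i1. regime n h m \<xi> \<longrightarrow> i0 < i1 \<longrightarrow> i1 \<le> n \<longrightarrow> real (i1 - i0) * h \<le> m \<longrightarrow>
      moment_bound M p (\<lambda>\<omega>. euler_defect A \<Gamma> (h / m) h (\<lambda>j. \<xi> j \<omega>) i0 i1) (B * (real (i1 - i0) * h))"
proof -
  have p2: "2 * p \<ge> 1" using p by simp
  obtain B where B: "B > 0" "\<And>n h m \<xi> i. regime n h m \<xi> \<Longrightarrow> i \<le> n \<Longrightarrow> moment_bound M (2 * p) (mom (h / m) \<xi> i) (B * sqrt m)"
    using mom_moment[OF p2] by blast
  obtain B' where B': "B' > 0" "\<And>n h m \<xi> i0 i1. regime n h m \<xi> \<Longrightarrow> i0 \<le> i1 \<Longrightarrow> i1 \<le> n \<Longrightarrow>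
      moment_bound M (2 * p) (\<lambda>\<omega>. pos (h / m) \<xi> i1 \<omega> - pos (h / m) \<xi> i0 \<omega>) (B' * (real (i1 - i0) * h / sqrt m))"
    using pos_incr_moment[OF p2] by blast
  define G where "G = CARD('n) * 2 ^ (2 * p + 1) * \<bar>\<gamma> (2 * p)\<bar> + 1"
  define G' where "G' = CARD('n) * CARD('n) * 2 ^ (p + 1) * \<bar>\<gamma> (2 * p)\<bar> * G"
  define D where "D = B' * a * B + G' + (\<gamma> (2 * p))\<^sup>2 + norm \<Gamma>"
  have G: "G > 0" "G' \<ge> 0" by (auto simp: G_def G'_def add_nonneg_pos)
  have "moment_bound M p (\<lambda>\<omega>. euler_defect A \<Gamma> (h / m) h (\<lambda>j. \<xi> j \<omega>) i0 i1) (D * (real (i1 - i0) * h))"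
    if R: "regime n h m \<xi>" and i: "i0 < i1" "i1 \<le> n" and tm: "real (i1 - i0) * h \<le> m" for n h m \<xi> i0 i1
  proof -
    note r = regimeD[OF R] and gp = gamma_pos[OF R]
    define k where "k = real (i1 - i0)"
    define t where "t = k * h"
    have kt: "k > 0" "t > 0" using i r by (auto simp: k_def t_def)
    have "moment_bound M p (\<lambda>\<omega>. tensor (pos (h / m) \<xi> (Suc i) \<omega> - pos (h / m) \<xi> i0 \<omega>) ((h / m) *\<^sub>R (A *v mom (h / m) \<xi> i \<omega>)))
       ((B' * (t / sqrt m)) * ((h / m) * (a * (B * sqrt m))))" if ii: "i \<in> {i0..<i1}" for i
    proof (rule moment_bound_prod)
      have "real (Suc i - i0) * h \<le> t" using ii r by (simp add: t_def k_def)
      then have "B' * (real (Suc i - i0) * h / sqrt m) \<le> B' * (t / sqrt m)"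
        using B' r by (intro mult_left_mono divide_right_mono) auto
      then show "moment_bound M (2 * p) (\<lambda>\<omega>. pos (h / m) \<xi> (Suc i) \<omega> - pos (h / m) \<xi> i0 \<omega>) (B' * (t / sqrt m))"
        by (rule moment_bound_le[rotated]) (rule B'(2)[OF R]; use ii i in auto)
      have "moment_bound M (2 * p) (\<lambda>\<omega>. (h / m) *\<^sub>R (A *v mom (h / m) \<xi> i \<omega>)) (\<bar>h / m\<bar> * (a * (B * sqrt m)))"
        by (intro moment_bound_scaleR moment_bound_lipschitz[OF B(2)[OF R, of i]]) (use ii i pos A_vec in auto)
      then show "moment_bound M (2 * p) (\<lambda>\<omega>. (h / m) *\<^sub>R (A *v mom (h / m) \<xi> i \<omega>)) ((h / m) * (a * (B * sqrt m)))"
        using r by simp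
    qed (auto simp: norm_tensor)
    from moment_bound_sum[OF finite_atLeastLessThan this p]
    have "moment_bound M p (\<lambda>\<omega>. euler_area A (h / m) (\<lambda>j. \<xi> j \<omega>) i0 i1)
       (\<Sum>i=i0..<i1. (B' * (t / sqrt m)) * ((h / m) * (a * (B * sqrt m))))"
      by (simp add: euler_area_def)
    then have 1: "moment_bound M p (\<lambda>\<omega>. euler_area A (h / m) (\<lambda>j. \<xi> j \<omega>) i0 i1) (B' * a * B * t)"
    proof (rule moment_bound_le)
      have "(\<Sum>i=i0..<i1. (B' * (t / sqrt m)) * ((h / m) * (a * (B * sqrt m)))) = B' * a * B * t * (t / m)"
        using r i by (simp add: t_def k_def)
      also have "\<dots> \<le> B' * a * B * t * 1"
        using tm r kt B B' pos by (intro mult_left_mono) (auto simp: t_def k_def)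
      finally show "(\<Sum>i=i0..<i1. (B' * (t / sqrt m)) * ((h / m) * (a * (B * sqrt m)))) \<le> B' * a * B * t" by simp
    qed
    have "moment_bound M p (\<lambda>\<omega>. \<Sum>i=i0..<i1. tensor (\<Sum>j=i0..<i. \<xi> j \<omega>) (\<xi> i \<omega>))
       (CARD('n) * CARD('n) * 2 ^ (p + 1) * \<gamma> (2 * p) * (G * sqrt t) * sqrt (real (i1 - i0) * h))"
    proof (rule noise_tensor_moment[OF r(1) p])
      fix j assume jj: "i0 \<le> j" "j < i1"
      show "(\<lambda>\<omega>. \<Sum>j=i0..<j. \<xi> j \<omega>) \<in> borel_measurable (past M \<xi> j)" using jj by (intro noise_past)
      have "moment_bound M (2 * p) (\<lambda>\<omega>. \<Sum>j=i0..<j. \<xi> j \<omega>) (CARD('n) * 2 ^ (2 * p + 1) * \<gamma> (2 * p) * sqrt (real (j - i0) * h))"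
        using jj i by (intro noise_incr_moment[OF R p2]) auto
      then show "moment_bound M (2 * p) (\<lambda>\<omega>. \<Sum>j=i0..<j. \<xi> j \<omega>) (G * sqrt t)"
      proof (rule moment_bound_le)
        have "real (j - i0) * h \<le> t" using jj r by (simp add: t_def k_def)
        then show "CARD('n) * 2 ^ (2 * p + 1) * \<gamma> (2 * p) * sqrt (real (j - i0) * h) \<le> G * sqrt t"
          using gp[of "2 * p"] r by (intro mult_mono real_sqrt_le_mono) (auto simp: G_def)
      qed
    qed (use i G kt in auto)
    then have 2: "moment_bound M p (\<lambda>\<omega>. \<Sum>i=i0..<i1. tensor (\<Sum>j=i0..<i. \<xi> j \<omega>) (\<xi> i \<omega>)) (G' * t)"
      using gp[of "2 * p"] kt by (simp add: G'_def t_def[symmetric] k_def[symmetric] mult.assoc)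
    have "moment_bound M p (\<lambda>\<omega>. tensor (\<xi> j \<omega>) (\<xi> j \<omega>)) (\<gamma> (2 * p) * sqrt h * (\<gamma> (2 * p) * sqrt h))" if "j \<in> {i0..<i1}" for j
      using noise_stepsD(5)[OF r(1) _ p2, of j] that i
      by (intro moment_bound_prod[of M p "\<xi> j" _ "\<xi> j"]) (auto simp: norm_tensor)
    from moment_bound_sum[OF finite_atLeastLessThan this p]
    have "moment_bound M p (\<lambda>\<omega>. \<Sum>j=i0..<i1. tensor (\<xi> j \<omega>) (\<xi> j \<omega>)) (real (i1 - i0) * (\<gamma> (2 * p) * sqrt h * (\<gamma> (2 * p) * sqrt h)))"
      by simp
    also have "real (i1 - i0) * (\<gamma> (2 * p) * sqrt h * (\<gamma> (2 * p) * sqrt h)) = (\<gamma> (2 * p))\<^sup>2 * t"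
    proof -
      have "\<gamma> (2 * p) * sqrt h * (\<gamma> (2 * p) * sqrt h) = (\<gamma> (2 * p))\<^sup>2 * (sqrt h)\<^sup>2"
        by (simp only: power2_eq_square mult_ac)
      then show ?thesis using r by (simp add: t_def k_def)
    qed
    finally have "moment_bound M p (\<lambda>\<omega>. (1 / 2) *\<^sub>R (\<Sum>j=i0..<i1. tensor (\<xi> j \<omega>) (\<xi> j \<omega>))) (\<bar>1 / 2\<bar> * ((\<gamma> (2 * p))\<^sup>2 * t))"
      by (rule moment_bound_scaleR)
    then have 3: "moment_bound M p (\<lambda>\<omega>. (1 / 2) *\<^sub>R (\<Sum>j=i0..<i1. tensor (\<xi> j \<omega>) (\<xi> j \<omega>))) ((\<gamma> (2 * p))\<^sup>2 * t)"
      by (rule moment_bound_le) (use kt in auto)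
    have 4: "moment_bound M p (\<lambda>\<omega>. (real (i1 - i0) * h) *\<^sub>R \<Gamma>) (t * norm \<Gamma>)"
      using moment_bound_const[of p "(real (i1 - i0) * h) *\<^sub>R \<Gamma>"] kt by (simp add: t_def k_def)
    have "moment_bound M p (\<lambda>\<omega>. euler_defect A \<Gamma> (h / m) h (\<lambda>j. \<xi> j \<omega>) i0 i1)
        ((B' * a * B * t + (G' * t + (\<gamma> (2 * p))\<^sup>2 * t)) + t * norm \<Gamma>)"
      unfolding euler_defect_def by (intro moment_bound_diff moment_bound_add 1 2 3 4 p)
    moreover have "(B' * a * B * t + (G' * t + (\<gamma> (2 * p))\<^sup>2 * t)) + t * norm \<Gamma> = D * (real (i1 - i0) * h)"
      by (simp add: D_def t_def k_def algebra_simps)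
    ultimately show ?thesis by simp
  qed
  moreover have "D > 0" using B B' pos G by (simp add: D_def add_pos_nonneg)
  ultimately show ?thesis by blast
qed

text \<open>
  The deviation \<open>S - t C\<close> is controlled through its image under the Lyapunov operator, which by
  \<open>euler_second_moment_lyap\<close> consists of boundary terms of size \<open>m \<le> sqrt (m t)\<close>, martingales of size
  \<open>sqrt (m t)\<close> and the discretisation error \<open>e A S A\<^sup>*\<close> of size \<open>e t\<close>. The hypothesis on \<open>h / m\<close> makes
  the latter at most \<open>sqrt (m t)\<close>; it holds on every sufficiently fine grid.
\<close>

lemma defect_large:
  assumes p: "p \<ge> 1"
  shows "\<exists>B>0. \<forall>n h m \<xi> i0 i1. regime n h m \<xi> \<longrightarrow> i0 < i1 \<longrightarrow> i1 \<le> n \<longrightarrow> m \<le> real (i1 - i0) * h \<longrightarrow>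
      (h / m)\<^sup>2 * (real (i1 - i0) * h) \<le> m \<longrightarrow>
      moment_bound M p (\<lambda>\<omega>. euler_defect A (A ** C - (1 / 2) *\<^sub>R mat 1) (h / m) h (\<lambda>j. \<xi> j \<omega>) i0 i1)
        (B * (sqrt m * sqrt (real (i1 - i0) * h)))"
proof -
  have p2: "2 * p \<ge> 1" using p by simp
  obtain B where B: "B > 0" "\<And>n h m \<xi> i. regime n h m \<xi> \<Longrightarrow> i \<le> n \<Longrightarrow> moment_bound M (2 * p) (mom (h / m) \<xi> i) (B * sqrt m)"
    using mom_moment[OF p2] by blast
  obtain B' where B': "B' > 0" "\<And>n h m \<xi> i0 i1. regime n h m \<xi> \<Longrightarrow> i0 \<le> i1 \<Longrightarrow> i1 \<le> n \<Longrightarrow>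
      moment_bound M (2 * p) (\<lambda>\<omega>. mom (h / m) \<xi> i1 \<omega> - mom (h / m) \<xi> i0 \<omega>) (B' * sqrt (real (i1 - i0) * h))"
    using mom_incr_moment[OF p2] by blast
  define G where "G = CARD('n) * 2 ^ (2 * p + 1) * \<bar>\<gamma> (2 * p)\<bar>"
  define N where "N = CARD('n) * CARD('n) * 2 ^ (p + 1) * \<bar>\<gamma> (2 * p)\<bar>"
  define N' where "N' = CARD('n) * CARD('n) * 2 ^ (p + 1) * ((\<gamma> (2 * p))\<^sup>2 + 1)"
  define D1 where "D1 = 2 * B\<^sup>2 + N' + 2 * (N * ((1 + a) * B)) + a * B\<^sup>2"
  define D where "D = a * (\<kappa> * D1) + N * ((2 + a) * B) + (G + B') * B + N'"
  have G: "G \<ge> 0" "N \<ge> 0" "N' > 0" by (auto simp: G_def N_def N'_def intro!: mult_pos_pos add_nonneg_pos)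
  have D1: "D1 \<ge> 0" using B pos G by (simp add: D1_def)
  have "moment_bound M p (\<lambda>\<omega>. euler_defect A (A ** C - (1 / 2) *\<^sub>R mat 1) (h / m) h (\<lambda>j. \<xi> j \<omega>) i0 i1)
        (D * (sqrt m * sqrt (real (i1 - i0) * h)))"
    if R: "regime n h m \<xi>" and i: "i0 < i1" "i1 \<le> n" and tm: "m \<le> real (i1 - i0) * h"
      and small: "(h / m)\<^sup>2 * (real (i1 - i0) * h) \<le> m" for n h m \<xi> i0 i1
  proof -
    note r = regimeD[OF R] and gp = gamma_pos[OF R]
    define e where "e = h / m"
    define t where "t = real (i1 - i0) * h"
    define s where "s = sqrt m * sqrt t"
    have e: "0 < e" "e \<le> 1" using r by (auto simp: e_def)
    have t: "t > 0" "m \<le> t" using i r tm by (auto simp: t_def)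
    have s: "s > 0" using r t by (simp add: s_def)
    have ms: "m \<le> s"
    proof -
      have "m = sqrt m * sqrt m" using r by simp
      also have "\<dots> \<le> s" unfolding s_def using t r by (intro mult_left_mono) auto
      finally show ?thesis .
    qed
    have ets: "e * t \<le> s"
    proof -
      have "e * sqrt t = sqrt (e\<^sup>2 * t)" using e by (simp add: real_sqrt_mult)
      also have "\<dots> \<le> sqrt m" using small by (simp add: e_def t_def)
      finally have "e * sqrt t * sqrt t \<le> sqrt m * sqrt t" using t by (intro mult_right_mono) auto
      then show ?thesis using t by (simp add: s_def mult.assoc)
    qed
    let ?P = "mom e \<xi>" and ?Y = "pos e \<xi>"
    have P: "moment_bound M (2 * p) (?P i) (B * sqrt m)" if "i \<le> n" for i
      using B(2)[OF R that] by (simp add: e_def)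
    have PP: "moment_bound M p (\<lambda>\<omega>. tensor (?P i \<omega>) (?P i \<omega>)) (B\<^sup>2 * m)" if "i \<le> n" for i
    proof -
      have "moment_bound M p (\<lambda>\<omega>. tensor (?P i \<omega>) (?P i \<omega>)) (B * sqrt m * (B * sqrt m))"
        by (rule moment_bound_prod[OF P P]) (use that in \<open>auto simp: norm_tensor\<close>)
      moreover have "B * sqrt m * (B * sqrt m) = B\<^sup>2 * (sqrt m)\<^sup>2" by (simp only: power2_eq_square mult_ac)
      ultimately show ?thesis using r by simp
    qed
    have eAP: "norm (e *\<^sub>R (A *v x)) \<le> a * norm x" for x
    proof -
      have "norm (e *\<^sub>R (A *v x)) = e * norm (A *v x)" using e by simp
      also have "\<dots> \<le> 1 * (a * norm x)" using e A_vec by (intro mult_mono) auto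
      finally show ?thesis by simp
    qed
    have BP: "moment_bound M (2 * p) (\<lambda>\<omega>. ?P i \<omega> - e *\<^sub>R (A *v ?P i \<omega>)) ((1 + a) * B * sqrt m)" if "i \<le> n" for i
    proof -
      have "norm (x - e *\<^sub>R (A *v x)) \<le> (1 + a) * norm x" for x
        using norm_triangle_ineq4[of x "e *\<^sub>R (A *v x)"] eAP[of x] by (simp add: algebra_simps)
      then show ?thesis unfolding mult.assoc using pos
        by (intro moment_bound_lipschitz[OF P[OF that]]) auto
    qed
    have Avec[measurable]: "(*v) A \<in> borel_measurable borel"
      by (intro borel_measurable_continuous_onI linear_continuous_on matrix_vector_mul_bounded_linear)
    have BPm: "(\<lambda>\<omega>. ?P j \<omega> - e *\<^sub>R (A *v ?P j \<omega>)) \<in> borel_measurable (past M \<xi> j)" for j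
      by (intro borel_measurable_diff borel_measurable_scaleR borel_measurable_const mom_past measurable_compose[OF mom_past Avec])
    have tens: "moment_bound M p (\<lambda>\<omega>. \<Sum>j=i0..<i1. tensor (X j \<omega>) (\<xi> j \<omega>)) (N * b * s)"
      if "\<And>j. i0 \<le> j \<Longrightarrow> j < i1 \<Longrightarrow> X j \<in> borel_measurable (past M \<xi> j)"
        "\<And>j. i0 \<le> j \<Longrightarrow> j < i1 \<Longrightarrow> moment_bound M (2 * p) (X j) (b * sqrt m)" "b > 0"
      for X :: "nat \<Rightarrow> 'a \<Rightarrow> real^'n" and b
    proof -
      have "moment_bound M p (\<lambda>\<omega>. \<Sum>j=i0..<i1. tensor (X j \<omega>) (\<xi> j \<omega>))
        (CARD('n) * CARD('n) * 2 ^ (p + 1) * \<gamma> (2 * p) * (b * sqrt m) * sqrt (real (i1 - i0) * h))"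
        using i that r by (intro noise_tensor_moment[OF r(1) p]) auto
      then show ?thesis using gp[of "2 * p"] by (simp add: N_def s_def t_def mult.assoc)
    qed
    define Q where "Q \<omega> = (\<Sum>j=i0..<i1. tensor (?P j \<omega> - e *\<^sub>R (A *v ?P j \<omega>)) (\<xi> j \<omega>))" for \<omega>
    have Q: "moment_bound M p Q (N * ((1 + a) * B) * s)"
      unfolding Q_def using BP BPm i pos B by (intro tens) auto
    have Qt: "moment_bound M p (\<lambda>\<omega>. transpose (Q \<omega>)) (N * ((1 + a) * B) * s)"
      by (rule moment_bound_mono[OF Q]) (auto simp: norm_transpose)
    have Q0: "moment_bound M p (\<lambda>\<omega>. \<Sum>j=i0..<i1. tensor (?P j \<omega> - e *\<^sub>R (A *v ?P j \<omega>) - ?P i0 \<omega>) (\<xi> j \<omega>)) (N * ((2 + a) * B) * s)"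
    proof (rule tens)
      fix j assume jj: "i0 \<le> j" "j < i1"
      show "(\<lambda>\<omega>. ?P j \<omega> - e *\<^sub>R (A *v ?P j \<omega>) - ?P i0 \<omega>) \<in> borel_measurable (past M \<xi> j)"
        by (rule borel_measurable_diff[OF BPm measurable_past_mono[OF mom_past jj(1)]])
      have "moment_bound M (2 * p) (\<lambda>\<omega>. ?P j \<omega> - e *\<^sub>R (A *v ?P j \<omega>) - ?P i0 \<omega>) ((1 + a) * B * sqrt m + B * sqrt m)"
        using jj i by (intro moment_bound_diff BP P p2) auto
      then show "moment_bound M (2 * p) (\<lambda>\<omega>. ?P j \<omega> - e *\<^sub>R (A *v ?P j \<omega>) - ?P i0 \<omega>) ((2 + a) * B * sqrt m)"
        by (simp add: algebra_simps)
    qed (use pos B in auto)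
    define V where "V \<omega> = (\<Sum>j=i0..<i1. tensor (\<xi> j \<omega>) (\<xi> j \<omega>)) - t *\<^sub>R mat 1" for \<omega>
    have V: "moment_bound M p V (N' * s)"
    proof -
      have "moment_bound M p V (N' * (h * sqrt (real (i1 - i0))))"
        using noise_square_moment[OF r(1) p, of i0 i1] i unfolding V_def t_def N'_def by simp
      moreover have "N' * (h * sqrt (real (i1 - i0))) \<le> N' * s"
      proof (rule mult_left_mono)
        have "h * sqrt (real (i1 - i0)) = sqrt h * sqrt t" using r by (simp add: t_def real_sqrt_mult)
        also have "\<dots> \<le> s" unfolding s_def using r t by (intro mult_right_mono) auto
        finally show "h * sqrt (real (i1 - i0)) \<le> s" .
      qed (use G in simp)
      ultimately show ?thesis by (rule moment_bound_le)
    qed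
    define S where "S \<omega> = euler_second_moment A e (\<lambda>j. \<xi> j \<omega>) i0 i1" for \<omega>
    have S: "moment_bound M p S (B\<^sup>2 * t)"
    proof -
      have "moment_bound M p (\<lambda>\<omega>. e *\<^sub>R (\<Sum>j=i0..<i1. tensor (?P j \<omega>) (?P j \<omega>))) (\<bar>e\<bar> * (\<Sum>j=i0..<i1. B\<^sup>2 * m))"
        using i by (intro moment_bound_scaleR moment_bound_sum PP p) auto
      moreover have "\<bar>e\<bar> * (\<Sum>j=i0..<i1. B\<^sup>2 * m) = B\<^sup>2 * t" using r by (simp add: e_def t_def)
      ultimately have "moment_bound M p (\<lambda>\<omega>. e *\<^sub>R (\<Sum>j=i0..<i1. tensor (?P j \<omega>) (?P j \<omega>))) (B\<^sup>2 * t)"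
        by (simp only:)
      then show ?thesis by (simp add: S_def[abs_def] euler_second_moment_def)
    qed
    have SA: "moment_bound M p (\<lambda>\<omega>. e *\<^sub>R (A ** S \<omega> ** transpose A)) (a * B\<^sup>2 * s)"
    proof -
      have "moment_bound M p (\<lambda>\<omega>. e *\<^sub>R (A ** S \<omega> ** transpose A)) (\<bar>e\<bar> * (a * (B\<^sup>2 * t)))"
        using pos A_conj by (intro moment_bound_scaleR moment_bound_lipschitz[OF S]) auto
      moreover have "\<bar>e\<bar> * (a * (B\<^sup>2 * t)) \<le> a * B\<^sup>2 * s"
        using mult_left_mono[OF ets, of "a * B\<^sup>2"] pos e by (simp add: mult_ac)
      ultimately show ?thesis by (rule moment_bound_le)
    qed
    have T: "moment_bound M p (\<lambda>\<omega>. tensor (?P i \<omega>) (?P i \<omega>)) (B\<^sup>2 * s)" if "i \<le> n" for i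
      by (rule moment_bound_le[OF PP[OF that]]) (use ms in \<open>auto intro: mult_left_mono\<close>)
    have leq: "lyap A (S \<omega> - t *\<^sub>R C) = tensor (?P i0 \<omega>) (?P i0 \<omega>) - tensor (?P i1 \<omega>) (?P i1 \<omega>) + V \<omega>
        + Q \<omega> + transpose (Q \<omega>) + e *\<^sub>R (A ** S \<omega> ** transpose A)" for \<omega>
    proof -
      have lin: "linear (lyap A)" using bounded_linear_lyap by (rule bounded_linear.linear)
      have "lyap A (S \<omega> - t *\<^sub>R C) = lyap A (S \<omega>) - t *\<^sub>R mat 1"
        by (simp add: linear_diff[OF lin] linear_cmul[OF lin] lyap_C)
      also have "lyap A (S \<omega>) = tensor (?P i0 \<omega>) (?P i0 \<omega>) - tensor (?P i1 \<omega>) (?P i1 \<omega>)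
         + (\<Sum>j=i0..<i1. tensor (\<xi> j \<omega>) (\<xi> j \<omega>)) + Q \<omega> + transpose (Q \<omega>) + e *\<^sub>R (A ** S \<omega> ** transpose A)"
        unfolding S_def Q_def by (rule euler_second_moment_lyap) (use i in simp)
      finally show ?thesis by (simp add: V_def algebra_simps)
    qed
    have "moment_bound M p (\<lambda>\<omega>. lyap A (S \<omega> - t *\<^sub>R C))
       (B\<^sup>2 * s + B\<^sup>2 * s + N' * s + N * ((1 + a) * B) * s + N * ((1 + a) * B) * s + a * B\<^sup>2 * s)"
      unfolding leq using i by (intro moment_bound_add moment_bound_diff T V Q Qt SA p) auto
    also have "B\<^sup>2 * s + B\<^sup>2 * s + N' * s + N * ((1 + a) * B) * s + N * ((1 + a) * B) * s + a * B\<^sup>2 * s = D1 * s"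
      by (simp add: D1_def algebra_simps)
    finally have L: "moment_bound M p (\<lambda>\<omega>. lyap A (S \<omega> - t *\<^sub>R C)) (D1 * s)" .
    have L1: "moment_bound M p (\<lambda>\<omega>. S \<omega> - t *\<^sub>R C) (\<kappa> * (D1 * s))"
      by (rule moment_bound_lipschitz[OF L]) (use pos lyap_below in auto)
    have "moment_bound M p (\<lambda>\<omega>. A ** (S \<omega> - t *\<^sub>R C)) (a * (\<kappa> * (D1 * s)))"
      by (rule moment_bound_lipschitz[OF L1]) (use pos A_mat in auto)
    then have 1: "moment_bound M p (\<lambda>\<omega>. A ** (S \<omega> - t *\<^sub>R C)) (a * (\<kappa> * D1) * s)" by (simp add: mult.assoc)
    have 2: "moment_bound M p (\<lambda>\<omega>. tensor (?Y i1 \<omega> - ?Y i0 \<omega>) (?P i1 \<omega>)) ((G + B') * B * s)"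
    proof -
      have i': "i0 \<le> i1" using i by simp
      have eq: "?Y i1 \<omega> - ?Y i0 \<omega> = (\<Sum>j=i0..<i1. \<xi> j \<omega>) - (?P i1 \<omega> - ?P i0 \<omega>)" for \<omega>
        unfolding noise_diff[OF i', symmetric] by (simp add: euler_pos_def)
      have g: "moment_bound M (2 * p) (\<lambda>\<omega>. \<Sum>j=i0..<i1. \<xi> j \<omega>) (G * sqrt t)"
        using noise_incr_moment[OF R p2 i' i(2)] gp[of "2 * p"] by (simp add: G_def t_def)
      have "moment_bound M (2 * p) (\<lambda>\<omega>. ?Y i1 \<omega> - ?Y i0 \<omega>) (G * sqrt t + B' * sqrt t)"
        unfolding eq by (rule moment_bound_diff[OF g B'(2)[OF R i' i(2), folded e_def t_def] p2])
      then have "moment_bound M p (\<lambda>\<omega>. tensor (?Y i1 \<omega> - ?Y i0 \<omega>) (?P i1 \<omega>)) ((G * sqrt t + B' * sqrt t) * (B * sqrt m))"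
        by (rule moment_bound_prod[OF _ P[OF i(2)]]) (auto simp: norm_tensor)
      then show ?thesis by (simp add: s_def algebra_simps)
    qed
    have 3: "moment_bound M p (\<lambda>\<omega>. (1 / 2) *\<^sub>R V \<omega>) (N' * s)"
      by (rule moment_bound_mono[OF V]) auto
    have "moment_bound M p (\<lambda>\<omega>. A ** (S \<omega> - t *\<^sub>R C)
        - (\<Sum>j=i0..<i1. tensor (?P j \<omega> - e *\<^sub>R (A *v ?P j \<omega>) - ?P i0 \<omega>) (\<xi> j \<omega>))
        - tensor (?Y i1 \<omega> - ?Y i0 \<omega>) (?P i1 \<omega>) - (1 / 2) *\<^sub>R V \<omega>)
      (a * (\<kappa> * D1) * s + N * ((2 + a) * B) * s + (G + B') * B * s + N' * s)"
      by (intro moment_bound_diff 1 2 3 Q0 p)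
    moreover have "a * (\<kappa> * D1) * s + N * ((2 + a) * B) * s + (G + B') * B * s + N' * s = D * s"
      by (simp add: D_def algebra_simps)
    ultimately show ?thesis
      using i unfolding euler_defect_by_parts[OF less_imp_le[OF i(1)]]
      unfolding S_def V_def e_def[symmetric] t_def[symmetric] s_def by simp
  qed
  moreover have "D > 0" using B B' pos G D1 by (simp add: D_def add_nonneg_pos)
  ultimately show ?thesis by blast
qed

end

section \<open>Increments of Brownian motion\<close>

text \<open>
  Fubini's theorem for products over the coordinates; \<open>ax\<close> translates between indices and the standard basis, in
  terms of which Lebesgue measure is a product measure.
\<close>

lemma integrable_lborel_prod:
  fixes f :: "'n::finite \<Rightarrow> real \<Rightarrow> real"
  assumes "\<And>i. integrable lborel (f i)"
  shows "integrable lborel (\<lambda>x::real^'n. \<Prod>i\<in>UNIV. f i (x $ i))"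
    and "integral\<^sup>L lborel (\<lambda>x::real^'n. \<Prod>i\<in>UNIV. f i (x $ i)) = (\<Prod>i\<in>UNIV. integral\<^sup>L lborel (f i))"
proof -
  define ax where "ax i = axis i (1::real)" for i :: 'n
  have axi: "inj ax" by (auto simp: inj_on_def ax_def axis_eq_axis)
  have B: "(Basis :: (real^'n) set) = range ax" by (auto simp: Basis_vec_def ax_def)
  define F where "F b = f (inv ax b)" for b
  interpret product_sigma_finite "\<lambda>b::real^'n. lborel :: real measure" ..
  have prodF: "(\<Prod>i\<in>UNIV. g i) = (\<Prod>b\<in>Basis. g (inv ax b))" for g :: "'n \<Rightarrow> real"
    unfolding B by (subst prod.reindex[OF axi]) (simp add: inv_f_f[OF axi])
  have comp: "(\<Sum>b\<in>Basis. y b *\<^sub>R b) $ i = y (ax i)" for y :: "real^'n \<Rightarrow> real" and i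
    unfolding B sum.reindex[OF axi] by (simp add: ax_def axis_def if_distrib cong: if_cong)
  have eq: "(\<Prod>i\<in>UNIV. f i ((\<Sum>b\<in>Basis. y b *\<^sub>R b) $ i)) = (\<Prod>b\<in>Basis. F b (y b))" for y :: "real^'n \<Rightarrow> real"
  proof -
    have "(\<Prod>i\<in>UNIV. f i ((\<Sum>b\<in>Basis. y b *\<^sub>R b) $ i)) = (\<Prod>i\<in>UNIV. f i (y (ax i)))" by (simp only: comp)
    also have "\<dots> = (\<Prod>b\<in>Basis. f (inv ax b) (y (ax (inv ax b))))" by (rule prodF)
    also have "\<dots> = (\<Prod>b\<in>Basis. F b (y b))" unfolding B F_def by (auto intro!: prod.cong simp: inv_f_f[OF axi])
    finally show ?thesis .
  qed
  have fm: "f i \<in> borel_measurable borel" for i using assms[of i] by (auto dest: borel_measurable_integrable)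
  have m: "(\<lambda>x::real^'n. \<Prod>i\<in>UNIV. f i (x $ i)) \<in> borel_measurable borel"
    by (intro borel_measurable_prod measurable_compose[OF _ fm] borel_measurable_continuous_onI continuous_intros)
  have d: "(\<lambda>y. \<Sum>b\<in>Basis. y b *\<^sub>R b) \<in> measurable (Pi\<^sub>M Basis (\<lambda>b::real^'n. lborel)) borel"
    by measurable
  have iF: "integrable lborel (F b)" for b by (simp add: F_def assms)
  have 1: "integrable (Pi\<^sub>M Basis (\<lambda>b::real^'n. lborel)) (\<lambda>y. \<Prod>b\<in>Basis. F b (y b))"
    by (rule product_integrable_prod) (auto intro: iF)
  have 2: "(\<integral>y. (\<Prod>b\<in>Basis. F b (y b)) \<partial>Pi\<^sub>M Basis (\<lambda>b::real^'n. lborel)) = (\<Prod>b\<in>Basis. integral\<^sup>L lborel (F b))"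
    by (rule product_integral_prod) (auto intro: iF)
  show "integrable lborel (\<lambda>x::real^'n. \<Prod>i\<in>UNIV. f i (x $ i))"
    unfolding lborel_eq[where 'a="real^'n"] by (subst integrable_distr_eq[OF d m]) (unfold eq, rule 1)
  show "integral\<^sup>L lborel (\<lambda>x::real^'n. \<Prod>i\<in>UNIV. f i (x $ i)) = (\<Prod>i\<in>UNIV. integral\<^sup>L lborel (f i))"
    unfolding lborel_eq[where 'a="real^'n"] by (subst integral_distr[OF d m]) (simp only: eq 2, simp only: F_def prodF[of "\<lambda>i. integral\<^sup>L lborel (f i)"])
qed

text \<open>
  \<open>fact (2 p) / (2\<^sup>p fact p)\<close> is the \<open>2p\<close>-th moment of the standard normal distribution; the dimension comes
  from estimating a vector by its components. The last summand keeps the constant positive for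
  all arguments, including \<open>p = 0\<close>, where \<open>root 0\<close> vanishes.
\<close>

definition gauss_const :: "nat \<Rightarrow> nat \<Rightarrow> real" where
  "gauss_const N p = real N * root (2 * p) (1 + fact (2 * p) / (2 ^ p * fact p)) + 1"

context prob_space
begin

context
  fixes Z :: "'a \<Rightarrow> real^'n" and h :: real
  assumes h: "h > 0"
    and Zd: "distributed M lborel Z (\<lambda>x. ennreal (\<Prod>i\<in>UNIV. normal_density 0 (sqrt h) (x $ i)))"
begin

lemma gaussian_vector_prod:
  assumes g: "\<And>i. integrable lborel (\<lambda>x. normal_density 0 (sqrt h) x * g i x)" "\<And>i. g i \<in> borel_measurable borel"
  shows "integrable M (\<lambda>\<omega>. \<Prod>i\<in>UNIV. g i (Z \<omega> $ i))"
    and "expectation (\<lambda>\<omega>. \<Prod>i\<in>UNIV. g i (Z \<omega> $ i)) = (\<Prod>i\<in>UNIV. \<integral>x. normal_density 0 (sqrt h) x * g i x \<partial>lborel)"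
proof -
  have "(\<lambda>x::real^'n. \<Prod>i\<in>UNIV. g i (x $ i)) \<in> borel_measurable borel"
    by (intro borel_measurable_prod measurable_compose[OF _ g(2)] borel_measurable_continuous_onI continuous_intros)
  then have gm: "(\<lambda>x::real^'n. \<Prod>i\<in>UNIV. g i (x $ i)) \<in> borel_measurable lborel" by simp
  have nn: "0 \<le> (\<Prod>i\<in>UNIV. normal_density 0 (sqrt h) ((x::real^'n) $ i))" for x by (intro prod_nonneg) auto
  note pr = integrable_lborel_prod[where f="\<lambda>i x. normal_density 0 (sqrt h) x * g i x", OF g(1)]
  have eq: "(\<Prod>i\<in>UNIV. normal_density 0 (sqrt h) ((x::real^'n) $ i)) * (\<Prod>i\<in>UNIV. g i (x $ i))
     = (\<Prod>i\<in>UNIV. normal_density 0 (sqrt h) (x $ i) * g i (x $ i))" for x by (simp add: prod.distrib)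
  show "integrable M (\<lambda>\<omega>. \<Prod>i\<in>UNIV. g i (Z \<omega> $ i))"
    using distributed_integrable[OF Zd gm nn] pr(1) by (simp add: eq)
  show "expectation (\<lambda>\<omega>. \<Prod>i\<in>UNIV. g i (Z \<omega> $ i)) = (\<Prod>i\<in>UNIV. \<integral>x. normal_density 0 (sqrt h) x * g i x \<partial>lborel)"
    using distributed_integral[OF Zd gm nn] pr(2) by (simp add: eq)
qed

lemma gaussian_vector_pair:
  fixes g1 g2 :: "real \<Rightarrow> real"
  assumes g: "integrable lborel (\<lambda>x. normal_density 0 (sqrt h) x * g1 x)" "g1 \<in> borel_measurable borel"
    "integrable lborel (\<lambda>x. normal_density 0 (sqrt h) x * g2 x)" "g2 \<in> borel_measurable borel" and ab: "a \<noteq> b"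
  shows "expectation (\<lambda>\<omega>. g1 (Z \<omega> $ a) * g2 (Z \<omega> $ b)) =
    (\<integral>x. normal_density 0 (sqrt h) x * g1 x \<partial>lborel) * (\<integral>x. normal_density 0 (sqrt h) x * g2 x \<partial>lborel)"
proof -
  have i1: "integral\<^sup>L lborel (normal_density 0 (sqrt h)) = 1" "integrable lborel (normal_density 0 (sqrt h))"
    using h by (auto intro: integral_normal_density integrable_normal_density)
  let ?g = "\<lambda>i. if i = a then g1 else if i = b then g2 else (\<lambda>_. 1)"
  have "expectation (\<lambda>\<omega>. \<Prod>i\<in>UNIV. ?g i (Z \<omega> $ i)) = (\<Prod>i\<in>UNIV. \<integral>x. normal_density 0 (sqrt h) x * ?g i x \<partial>lborel)"
    by (rule gaussian_vector_prod) (use g i1 in auto)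
  moreover have "(\<Prod>i\<in>UNIV. f i) = f a * f b" if "\<And>i. i \<noteq> a \<Longrightarrow> i \<noteq> b \<Longrightarrow> f i = 1" for f :: "'n \<Rightarrow> real"
  proof -
    have "(\<Prod>i\<in>UNIV. f i) = (\<Prod>i\<in>{a, b}. f i)" using that by (intro prod.mono_neutral_right) auto
    then show ?thesis using ab by simp
  qed
  from this[of "\<lambda>i. \<integral>x. normal_density 0 (sqrt h) x * ?g i x \<partial>lborel"] this[of "\<lambda>i. ?g i (Z \<omega> $ i)" for \<omega>]
  have "(\<Prod>i\<in>UNIV. \<integral>x. normal_density 0 (sqrt h) x * ?g i x \<partial>lborel) =
     (\<integral>x. normal_density 0 (sqrt h) x * g1 x \<partial>lborel) * (\<integral>x. normal_density 0 (sqrt h) x * g2 x \<partial>lborel)"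
    "(\<Prod>i\<in>UNIV. ?g i (Z \<omega> $ i)) = g1 (Z \<omega> $ a) * g2 (Z \<omega> $ b)" for \<omega>
    using ab i1 by auto
  ultimately show ?thesis by simp
qed

lemma gaussian_vector_component:
  fixes g :: "real \<Rightarrow> real"
  assumes g: "integrable lborel (\<lambda>x. normal_density 0 (sqrt h) x * g x)" "g \<in> borel_measurable borel"
  shows "integrable M (\<lambda>\<omega>. g (Z \<omega> $ a))"
    and "expectation (\<lambda>\<omega>. g (Z \<omega> $ a)) = (\<integral>x. normal_density 0 (sqrt h) x * g x \<partial>lborel)"
proof -
  have i1: "integral\<^sup>L lborel (normal_density 0 (sqrt h)) = 1" "integrable lborel (normal_density 0 (sqrt h))"
    using h by (auto intro: integral_normal_density integrable_normal_density)
  let ?g = "\<lambda>i. if i = a then g else (\<lambda>_. 1)"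
  have s: "(\<Prod>i\<in>UNIV. f i) = f a" if "\<And>i. i \<noteq> a \<Longrightarrow> f i = 1" for f :: "'n \<Rightarrow> real"
  proof -
    have "(\<Prod>i\<in>UNIV. f i) = (\<Prod>i\<in>{a}. f i)" using that by (intro prod.mono_neutral_right) auto
    then show ?thesis by simp
  qed
  have gi: "integrable lborel (\<lambda>x. normal_density 0 (sqrt h) x * ?g i x)" "?g i \<in> borel_measurable borel" for i
    using g i1 by auto
  note pr = gaussian_vector_prod[of ?g, OF gi]
  have 1: "(\<Prod>i\<in>UNIV. ?g i (Z \<omega> $ i)) = g (Z \<omega> $ a)" for \<omega>
    by (subst s) auto
  have 2: "(\<Prod>i\<in>UNIV. \<integral>x. normal_density 0 (sqrt h) x * ?g i x \<partial>lborel) = (\<integral>x. normal_density 0 (sqrt h) x * g x \<partial>lborel)"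
    by (subst s) (auto simp: i1)
  show "integrable M (\<lambda>\<omega>. g (Z \<omega> $ a))" using pr(1) unfolding 1 .
  show "expectation (\<lambda>\<omega>. g (Z \<omega> $ a)) = (\<integral>x. normal_density 0 (sqrt h) x * g x \<partial>lborel)"
    using pr(2) unfolding 1 2 .
qed

lemma gaussian_vector_moments:
  shows "p \<ge> 1 \<Longrightarrow> moment_bound M p Z (gauss_const CARD('n) p * sqrt h)"
    and "expectation (\<lambda>\<omega>. Z \<omega> $ a) = 0"
    and "expectation (\<lambda>\<omega>. Z \<omega> $ a * Z \<omega> $ b) = (if a = b then h else 0)"
proof -
  have sh: "sqrt h > 0" using h by simp
  have ev: "integrable lborel (\<lambda>x. normal_density 0 (sqrt h) x * x ^ (2 * k))"
      "(\<integral>x. normal_density 0 (sqrt h) x * x ^ (2 * k) \<partial>lborel) = fact (2 * k) / (2 ^ k * fact k) * h ^ k" for k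
    using normal_moment_even[OF sh, of 0 k] h
    by (auto simp: has_bochner_integral_iff power_divide)
  have od: "integrable lborel (\<lambda>x. normal_density 0 (sqrt h) x * x)"
      "(\<integral>x. normal_density 0 (sqrt h) x * x \<partial>lborel) = 0"
    using normal_moment_nz_1[OF sh, of 0] by (auto simp: has_bochner_integral_iff)
  show "expectation (\<lambda>\<omega>. Z \<omega> $ a) = 0"
    using gaussian_vector_component(2)[of "\<lambda>x. x" a] od by simp
  show "expectation (\<lambda>\<omega>. Z \<omega> $ a * Z \<omega> $ b) = (if a = b then h else 0)"
  proof (cases "a = b")
    case True
    then show ?thesis using gaussian_vector_component(2)[of "\<lambda>x. x ^ (2 * 1)" a] ev[of 1] by (simp add: power2_eq_square)
  next
    case False
    then show ?thesis using gaussian_vector_pair[of "\<lambda>x. x" "\<lambda>x. x" a b] od by simp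
  qed
  have Zm: "Z \<in> borel_measurable M" using distributed_measurable[OF Zd] by simp
  show "moment_bound M p Z (gauss_const CARD('n) p * sqrt h)" if p: "p \<ge> 1"
  proof -
    let ?r = "root (2 * p) (1 + fact (2 * p) / (2 ^ p * fact p)) :: real"
    have r: "?r > 0" using p by (intro real_root_gt_zero) (auto intro!: add_pos_nonneg)
    have "moment_bound M p (\<lambda>\<omega>. Z \<omega> $ a) (?r * sqrt h)" for a
    proof -
      have c: "(\<lambda>\<omega>. Z \<omega> $ a) \<in> borel_measurable M"
        by (rule measurable_compose[OF Zm]) (intro borel_measurable_continuous_onI continuous_intros)
      have "?r ^ (2 * p) = 1 + fact (2 * p) / (2 ^ p * fact p)"
        using p by (intro real_root_pow_pos2) auto
      then have "(?r * sqrt h) ^ (2 * p) = (1 + fact (2 * p) / (2 ^ p * fact p)) * h ^ p"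
        using h by (simp add: power_mult_distrib power_mult[of "sqrt h"])
      moreover have "fact (2 * p) / (2 ^ p * fact p) * h ^ p \<le> (1 + fact (2 * p) / (2 ^ p * fact p)) * h ^ p"
        using h by (intro mult_right_mono) auto
      ultimately show ?thesis
        using gaussian_vector_component[of "\<lambda>x. x ^ (2 * p)" a] ev[of p] r h
        by (simp add: moment_bound_integral[OF c])
    qed
    from moment_bound_from_components[OF this p] show ?thesis
      by (rule moment_bound_le) (use h in \<open>simp add: gauss_const_def algebra_simps\<close>)
  qed
qed

end

lemma brownian_noise_steps:
  fixes W :: "real \<Rightarrow> 'a \<Rightarrow> real^'n"
  assumes bm: "brownian_motion M W" and h: "h > 0"
  shows "noise_steps M (gauss_const CARD('n)) n h (\<lambda>j \<omega>. W (real (Suc j) * h) \<omega> - W (real j * h) \<omega>)"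
proof -
  have ind: "indep_vars (\<lambda>_. borel) (\<lambda>i \<omega>. W (\<tau> (Suc i)) \<omega> - W (\<tau> i) \<omega>) {..<n}"
    if "0 \<le> \<tau> 0" "\<forall>i<n. \<tau> i < \<tau> (Suc i)" for \<tau> :: "nat \<Rightarrow> real"
    using bm that unfolding brownian_motion_def by blast
  have d: "distributed M lborel (\<lambda>\<omega>. W (real (Suc j) * h) \<omega> - W (real j * h) \<omega>)
      (\<lambda>x. ennreal (\<Prod>i\<in>UNIV. normal_density 0 (sqrt h) (x $ i)))" for j
  proof -
    have "0 \<le> real j * h \<and> real j * h < real (Suc j) * h" using h by auto
    then have "distributed M lborel (\<lambda>\<omega>. W (real (Suc j) * h) \<omega> - W (real j * h) \<omega>)
      (\<lambda>x. ennreal (\<Prod>i\<in>UNIV. normal_density 0 (sqrt (real (Suc j) * h - real j * h)) (x $ i)))"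
      using bm unfolding brownian_motion_def by blast
    moreover have "real (Suc j) * h - real j * h = h" by (simp add: algebra_simps)
    ultimately show ?thesis by simp
  qed
  have g: "gauss_const CARD('n) p > 0" for p
    unfolding gauss_const_def by (intro add_nonneg_pos mult_nonneg_nonneg real_root_ge_zero) auto
  show ?thesis unfolding noise_steps_def
    using h g ind[of "\<lambda>j. real j * h"] gaussian_vector_moments[OF h d] by simp
qed

end

section \<open>Dyadic chaining\<close>

definition dyadic :: "real \<Rightarrow> nat \<Rightarrow> nat \<Rightarrow> real" where
  "dyadic T N k = real k * (T / 2 ^ N)"

lemma dyadic_double: "dyadic T (Suc N) (2 * k) = dyadic T N k"
  by (simp add: dyadic_def)

lemma dyadic_le: "T > 0 \<Longrightarrow> k \<le> l \<Longrightarrow> dyadic T N k \<le> dyadic T N l"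
  by (simp add: dyadic_def divide_right_mono mult_right_mono)

lemma dyadic_bounds: "T > 0 \<Longrightarrow> k \<le> 2 ^ N \<Longrightarrow> 0 \<le> dyadic T N k \<and> dyadic T N k \<le> T"
proof -
  assume a: "T > 0" "k \<le> 2 ^ N"
  then have "real k \<le> 2 ^ N" by (metis of_nat_le_iff of_nat_numeral of_nat_power)
  then have "real k * (T / 2 ^ N) \<le> 2 ^ N * (T / 2 ^ N)" using a by (intro mult_right_mono) auto
  then show ?thesis using a by (simp add: dyadic_def)
qed

lemma dyadic_mesh_tendsto: "(\<lambda>N. T / 2 ^ N) \<longlonglongrightarrow> (0::real)"
  using tendsto_mult[OF tendsto_const[of T] LIMSEQ_realpow_zero[of "1/2"]] by (simp add: power_one_over)

lemma dyadic_Suc: "dyadic T N (Suc k) - dyadic T N k = T / 2 ^ N"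
  by (simp add: dyadic_def distrib_right del: times_divide_eq_right)

text \<open>
  A two-parameter function that is additive up to a defect, known only at dyadic times. For increments
  of a path, \<open>G = 0\<close>; for a second level, the defect is given by Chen's relation.
\<close>

locale dyadic_chain =
  fixes R :: "real \<Rightarrow> real \<Rightarrow> 'a::real_normed_vector" and T \<theta> F G :: real
  assumes T: "T > 0" and \<theta>: "\<theta> > 0" and F: "F \<ge> 0" and G: "G \<ge> 0"
    and diag: "\<And>N k. k \<le> 2 ^ N \<Longrightarrow> R (dyadic T N k) (dyadic T N k) = 0"
    and defect: "\<And>N i j k. i \<le> j \<Longrightarrow> j \<le> k \<Longrightarrow> k \<le> 2 ^ N \<Longrightarrow>
        norm (R (dyadic T N i) (dyadic T N k) - R (dyadic T N i) (dyadic T N j) - R (dyadic T N j) (dyadic T N k))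
        \<le> G * (dyadic T N j - dyadic T N i) powr \<theta> * (dyadic T N k - dyadic T N j) powr \<theta>"
    and step: "\<And>n k. k < 2 ^ n \<Longrightarrow> norm (R (dyadic T n k) (dyadic T n (Suc k))) \<le> F * (T / 2 ^ n) powr (2 * \<theta>)"
begin

lemma grid_step:
  assumes "k \<le> l" "l \<le> Suc k" "l \<le> 2 ^ N"
  shows "norm (R (dyadic T N k) (dyadic T N l)) \<le> F * (T / 2 ^ N) powr (2 * \<theta>)"
proof (cases "k = l")
  case True
  then show ?thesis using diag[OF assms(3)] F by simp
next
  case False
  then have "l = Suc k" using assms by simp
  then show ?thesis using step[of k N] assms by simp
qed

text \<open>
  Induction on the level of the grid. Rounding the endpoints of an interval of level \<open>N + 1\<close> inwards to level
  \<open>N\<close> splits off at most one interval of length \<open>T / 2\<^sup>N\<^sup>+\<^sup>1\<close> on either side. The two defects of additivity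
  carry a power of this small length, not only of the total length, which makes the errors of all
  levels summable.
\<close>

lemma grid_bound:
  assumes "n \<le> N" "k \<le> l" "l \<le> 2 ^ N" "dyadic T N l - dyadic T N k \<le> T / 2 ^ n"
  shows "norm (R (dyadic T N k) (dyadic T N l))
    \<le> (\<Sum>i=n..N. 2 * (F + G) * ((T / 2 ^ n) powr \<theta> * (T / 2 ^ i) powr \<theta>))"
  using assms
proof (induction N arbitrary: k l rule: dec_induct)
  case base
  have "real (l - k) * (T / 2 ^ n) \<le> 1 * (T / 2 ^ n)"
    using base by (simp add: dyadic_def of_nat_diff left_diff_distrib del: times_divide_eq_right)
  then have "real (l - k) \<le> 1" by (rule mult_right_le_imp_le) (use T in simp)
  then have "norm (R (dyadic T n k) (dyadic T n l)) \<le> F * (T / 2 ^ n) powr (2 * \<theta>)"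
    using base by (intro grid_step) auto
  also have "\<dots> \<le> 2 * (F + G) * ((T / 2 ^ n) powr \<theta> * (T / 2 ^ n) powr \<theta>)"
    using F G by (simp add: powr_add[symmetric] mult_right_mono)
  finally show ?case by simp
next
  case (step N)
  define h where "h = T / 2 ^ n"
  define e where "e = T / 2 ^ Suc N"
  have he: "h > 0" "e > 0" "e \<le> h" using T step(1)
    by (auto simp: h_def e_def intro!: divide_left_mono simp del: power_Suc)
  define c where "c = 2 * (F + G) * (h powr \<theta> * e powr \<theta>)"
  have c0: "c \<ge> 0" using F G by (simp add: c_def)
  have sum: "(\<Sum>i=n..Suc N. 2 * (F + G) * ((T / 2 ^ n) powr \<theta> * (T / 2 ^ i) powr \<theta>))
     = (\<Sum>i=n..N. 2 * (F + G) * ((T / 2 ^ n) powr \<theta> * (T / 2 ^ i) powr \<theta>)) + c"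
    using step(1) by (simp add: c_def h_def e_def)
  have sum0: "(\<Sum>i=n..N. 2 * (F + G) * ((T / 2 ^ n) powr \<theta> * (T / 2 ^ i) powr \<theta>)) \<ge> 0"
    using F G by (intro sum_nonneg) auto
  define k' where "k' = Suc k div 2"
  define l' where "l' = l div 2"
  have kk: "k \<le> 2 * k'" "2 * k' \<le> Suc k" "2 * l' \<le> l" "l \<le> Suc (2 * l')" by (auto simp: k'_def l'_def)
  show ?case
  proof (cases "k' \<le> l'")
    case False
    then have "k = l" using step(4) kk by linarith
    then show ?thesis using diag[OF step(5)] sum sum0 c0 by simp
  next
    case True
    let ?d = "dyadic T (Suc N)"
    have l2: "l' \<le> 2 ^ N" "2 * l' \<le> 2 ^ Suc N" "2 * k' \<le> 2 ^ Suc N" using step(5) kk True by auto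
    have ord: "?d k \<le> ?d (2 * k')" "?d (2 * k') \<le> ?d (2 * l')" "?d (2 * l') \<le> ?d l" "?d (2 * k') \<le> ?d l"
      using kk True by (auto intro!: dyadic_le[OF T])
    have len: "?d l - ?d k \<le> h" using step(6) by (simp add: h_def)
    have IH: "norm (R (?d (2 * k')) (?d (2 * l'))) \<le> (\<Sum>i=n..N. 2 * (F + G) * ((T / 2 ^ n) powr \<theta> * (T / 2 ^ i) powr \<theta>))"
      unfolding dyadic_double
      by (rule step.IH[OF True l2(1)]) (use ord len in \<open>simp add: dyadic_double h_def\<close>)
    have ee: "e powr (2 * \<theta>) \<le> h powr \<theta> * e powr \<theta>"
    proof -
      have "e powr (2 * \<theta>) = e powr \<theta> * e powr \<theta>" by (simp add: powr_add[symmetric])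
      also have "\<dots> \<le> h powr \<theta> * e powr \<theta>" using he \<theta> by (intro mult_right_mono powr_mono2) auto
      finally show ?thesis .
    qed
    have r1: "norm (R (?d k) (?d (2 * k'))) \<le> F * (h powr \<theta> * e powr \<theta>)"
      using grid_step[OF kk(1,2) l2(3)] mult_left_mono[OF ee F] unfolding e_def by linarith
    have r2: "norm (R (?d (2 * l')) (?d l)) \<le> F * (h powr \<theta> * e powr \<theta>)"
      using grid_step[OF kk(3,4) step(5)] mult_left_mono[OF ee F] unfolding e_def by linarith
    have small: "?d (2 * k') - ?d k \<le> e" "?d l - ?d (2 * l') \<le> e"
    proof -
      have "?d (2 * k') \<le> ?d (Suc k)" "?d l \<le> ?d (Suc (2 * l'))" using kk by (auto intro: dyadic_le[OF T])
      then show "?d (2 * k') - ?d k \<le> e" "?d l - ?d (2 * l') \<le> e"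
        using dyadic_Suc[of T "Suc N" k] dyadic_Suc[of T "Suc N" "2 * l'"] unfolding e_def by linarith+
    qed
    have d1: "norm (R (?d k) (?d l) - R (?d k) (?d (2 * k')) - R (?d (2 * k')) (?d l)) \<le> G * (h powr \<theta> * e powr \<theta>)"
    proof -
      have "norm (R (?d k) (?d l) - R (?d k) (?d (2 * k')) - R (?d (2 * k')) (?d l))
          \<le> G * (?d (2 * k') - ?d k) powr \<theta> * (?d l - ?d (2 * k')) powr \<theta>"
        using kk True step(5) by (intro defect) auto
      also have "\<dots> \<le> G * e powr \<theta> * h powr \<theta>"
        using ord small len G \<theta> by (intro mult_mono mult_left_mono powr_mono2) auto
      finally show ?thesis by (simp add: mult_ac)
    qed
    have d2: "norm (R (?d (2 * k')) (?d l) - R (?d (2 * k')) (?d (2 * l')) - R (?d (2 * l')) (?d l)) \<le> G * (h powr \<theta> * e powr \<theta>)"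
    proof -
      have "norm (R (?d (2 * k')) (?d l) - R (?d (2 * k')) (?d (2 * l')) - R (?d (2 * l')) (?d l))
          \<le> G * (?d (2 * l') - ?d (2 * k')) powr \<theta> * (?d l - ?d (2 * l')) powr \<theta>"
        using kk True step(5) by (intro defect) auto
      also have "\<dots> \<le> G * h powr \<theta> * e powr \<theta>"
        using ord small len G \<theta> by (intro mult_mono mult_left_mono powr_mono2) auto
      finally show ?thesis by (simp add: mult_ac)
    qed
    have tri: "norm x \<le> norm a1 + norm b1 + norm c1 + norm (x - a1 - y) + norm (y - b1 - c1)" for x y a1 b1 c1 :: 'a
    proof -
      have eq: "x = a1 + b1 + c1 + (x - a1 - y) + (y - b1 - c1)" by simp
      show ?thesis by (subst eq) (intro norm_triangle_le add_mono order_refl)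
    qed
    have "norm (R (?d k) (?d l)) \<le> F * (h powr \<theta> * e powr \<theta>)
       + (\<Sum>i=n..N. 2 * (F + G) * ((T / 2 ^ n) powr \<theta> * (T / 2 ^ i) powr \<theta>))
       + F * (h powr \<theta> * e powr \<theta>) + G * (h powr \<theta> * e powr \<theta>) + G * (h powr \<theta> * e powr \<theta>)"
      by (rule order_trans[OF tri add_mono[OF add_mono[OF add_mono[OF add_mono[OF r1 IH] r2] d1] d2]])
    then show ?thesis unfolding sum by (simp add: c_def algebra_simps)
  qed
qed

lemma grid_hoelder:
  assumes "n \<le> N" "k \<le> l" "l \<le> 2 ^ N" "dyadic T N l - dyadic T N k \<le> T / 2 ^ n"
  shows "norm (R (dyadic T N k) (dyadic T N l)) \<le> 2 / (1 - 2 powr (- \<theta>)) * (F + G) * (T / 2 ^ n) powr (2 * \<theta>)"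
proof -
  define q where "q = (2::real) powr (- \<theta>)"
  have q: "0 < q" "q < 1" using \<theta> powr_less_mono[of "-\<theta>" 0 2] by (auto simp: q_def)
  have qi: "(T / 2 ^ i) powr \<theta> = (T / 2 ^ n) powr \<theta> * q ^ (i - n)" if "n \<le> i" for i
  proof -
    have "T / 2 ^ i = T / 2 ^ n * (1 / 2 ^ (i - n))" using that by (simp add: power_add[symmetric])
    then have "(T / 2 ^ i) powr \<theta> = (T / 2 ^ n) powr \<theta> * (1 / 2 ^ (i - n)) powr \<theta>" using T by (metis powr_mult)
    also have "(1 / 2 ^ (i - n)) powr \<theta> = q ^ (i - n)"
      by (simp add: q_def powr_realpow[symmetric] powr_powr powr_minus_divide[symmetric] mult.commute
          powr_minus[symmetric] inverse_eq_divide[symmetric])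
    finally show ?thesis .
  qed
  have "(\<Sum>i=n..N. (T / 2 ^ i) powr \<theta>) = (T / 2 ^ n) powr \<theta> * (\<Sum>i=n..N. q ^ (i - n))"
    unfolding sum_distrib_left by (rule sum.cong[OF refl], rule qi) simp
  also have "(\<Sum>i=n..N. q ^ (i - n)) = (\<Sum>j\<le>N - n. q ^ j)"
    using assms(1) by (intro sum.reindex_bij_witness[of _ "\<lambda>j. j + n" "\<lambda>i. i - n"]) auto
  also have "\<dots> \<le> 1 / (1 - q)"
    using sum_le_suminf[of "\<lambda>j. q ^ j" "{..N - n}"] q by (simp add: summable_geometric suminf_geometric)
  finally have s: "(\<Sum>i=n..N. (T / 2 ^ i) powr \<theta>) \<le> (T / 2 ^ n) powr \<theta> * (1 / (1 - q))"
    by (simp add: mult_left_mono)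
  have "(\<Sum>i=n..N. 2 * (F + G) * ((T / 2 ^ n) powr \<theta> * (T / 2 ^ i) powr \<theta>))
      = 2 * (F + G) * (T / 2 ^ n) powr \<theta> * (\<Sum>i=n..N. (T / 2 ^ i) powr \<theta>)"
    by (simp add: sum_distrib_left mult.assoc)
  also have "\<dots> \<le> 2 * (F + G) * (T / 2 ^ n) powr \<theta> * ((T / 2 ^ n) powr \<theta> * (1 / (1 - q)))"
    using F G by (intro mult_left_mono[OF s]) auto
  also have "\<dots> = 2 / (1 - q) * (F + G) * (T / 2 ^ n) powr (2 * \<theta>)"
    using powr_add[of "T / 2 ^ n" \<theta> \<theta>] by (simp add: mult_ac)
  finally show ?thesis using grid_bound[OF assms] unfolding q_def by linarith
qed

text \<open>
  The endpoints are approximated by dyadic points from inside the interval, so that the distances to be bounded do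
  not exceed \<open>t - s\<close>.
\<close>

lemma hoelder_bound:
  assumes cont: "continuous_on {(s, t). 0 \<le> s \<and> s \<le> t \<and> t \<le> T} (\<lambda>(s, t). R s t)"
    and st: "0 \<le> s" "s < t" "t \<le> T"
  shows "norm (R s t) \<le> 2 * 2 powr (2 * \<theta>) / (1 - 2 powr (- \<theta>)) * (F + G) * (t - s) powr (2 * \<theta>)"
proof -
  define x where "x = (t - s) / T"
  have x: "0 < x" "x \<le> 1" using st T by (auto simp: x_def)
  have "\<exists>n. (1/2) ^ Suc n < x"
  proof -
    obtain n where "(1/2::real) ^ n < x" using real_arch_pow_inv[of x "1/2"] x by auto
    then have "(1/2::real) ^ Suc n < x" by (rule le_less_trans[rotated]) simp
    then show ?thesis ..
  qed
  \<comment> \<open>The dyadic scale of the interval: \<open>T / 2\<^sup>n\<^sup>+\<^sup>1 < t - s \<le> T / 2\<^sup>n\<close>.\<close>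
  define n where "n = (LEAST n. (1/2) ^ Suc n < x)"
  have n1: "(1/2) ^ Suc n < x" unfolding n_def using \<open>\<exists>n. (1/2) ^ Suc n < x\<close> by (rule LeastI_ex)
  have n2: "x \<le> (1/2) ^ n"
  proof (cases n)
    case (Suc j)
    then have "\<not> (1/2) ^ Suc j < x" using not_less_Least[of j "\<lambda>n. (1/2) ^ Suc n < x"] by (simp add: n_def)
    then show ?thesis using Suc by simp
  qed (use x in simp)
  have len: "t - s \<le> T / 2 ^ n" "T / 2 ^ n \<le> 2 * (t - s)"
    using n1 n2 T by (simp_all add: x_def field_simps power_one_over)
  define k where "k N = nat \<lceil>s * 2 ^ N / T\<rceil>" for N :: nat
  define l where "l N = nat \<lfloor>t * 2 ^ N / T\<rfloor>" for N :: nat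
  have kb: "s \<le> dyadic T N (k N)" "dyadic T N (k N) \<le> s + T / 2 ^ N" for N
  proof -
    have nn: "0 \<le> s * 2 ^ N / T" using st T by simp
    then have "real (k N) = of_int \<lceil>s * 2 ^ N / T\<rceil>" by (simp add: k_def)
    then have "s * 2 ^ N / T \<le> real (k N)" "real (k N) \<le> s * 2 ^ N / T + 1"
      by (simp_all add: of_int_ceiling_le_add_one)
    then show "s \<le> dyadic T N (k N)" "dyadic T N (k N) \<le> s + T / 2 ^ N"
      using T by (simp_all add: dyadic_def field_simps)
  qed
  have lb: "dyadic T N (l N) \<le> t" "t - T / 2 ^ N \<le> dyadic T N (l N)" for N
  proof -
    have nn: "0 \<le> t * 2 ^ N / T" using st T by simp
    then have "real (l N) = of_int \<lfloor>t * 2 ^ N / T\<rfloor>" by (simp add: l_def)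
    then have "real (l N) \<le> t * 2 ^ N / T" "t * 2 ^ N / T \<le> real (l N) + 1"
      by (simp_all add: real_of_int_floor_add_one_ge)
    then have "real (l N) * (T / 2 ^ N) \<le> (t * 2 ^ N / T) * (T / 2 ^ N)"
      "(t * 2 ^ N / T) * (T / 2 ^ N) \<le> (real (l N) + 1) * (T / 2 ^ N)"
      using T by (auto intro!: mult_right_mono simp del: times_divide_eq_right times_divide_eq_left)
    moreover have "(t * 2 ^ N / T) * (T / 2 ^ N) = t" using T by simp
    ultimately show "dyadic T N (l N) \<le> t" "t - T / 2 ^ N \<le> dyadic T N (l N)"
      by (simp_all add: dyadic_def distrib_right del: times_divide_eq_right)
  qed
  have z: "(\<lambda>N. T / 2 ^ N) \<longlonglongrightarrow> 0"
    by (rule dyadic_mesh_tendsto)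
  have ls: "(\<lambda>N. dyadic T N (k N)) \<longlonglongrightarrow> s"
  proof (rule tendsto_sandwich[of "\<lambda>_. s" _ _ "\<lambda>N. s + T / 2 ^ N"])
    show "(\<lambda>N. s + T / 2 ^ N) \<longlonglongrightarrow> s" using tendsto_add[OF tendsto_const[of s] z] by simp
  qed (use kb in auto)
  have lt: "(\<lambda>N. dyadic T N (l N)) \<longlonglongrightarrow> t"
  proof (rule tendsto_sandwich[of "\<lambda>N. t - T / 2 ^ N" _ _ "\<lambda>_. t"])
    show "(\<lambda>N. t - T / 2 ^ N) \<longlonglongrightarrow> t" using tendsto_diff[OF tendsto_const[of t] z] by simp
  qed (use lb in auto)
  let ?m = "(s + t) / 2"
  have m: "s < ?m" "?m < t" using st by (auto simp: field_simps)
  have ev: "\<forall>\<^sub>F N in sequentially. k N \<le> l N"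
    using order_tendstoD(2)[OF ls m(1)] order_tendstoD(1)[OF lt m(2)]
  proof eventually_elim
    case (elim N)
    then have "dyadic T N (k N) < dyadic T N (l N)" by (rule less_trans)
    then show ?case using dyadic_le[OF T, of "l N" "k N" N] by linarith
  qed
  have lN: "l N \<le> 2 ^ N" for N
  proof -
    have "t * 2 ^ N / T \<le> 2 ^ N" using st T by (simp add: field_simps)
    then have "\<lfloor>t * 2 ^ N / T\<rfloor> \<le> \<lfloor>(2::real) ^ N\<rfloor>" by (rule floor_mono)
    also have "\<lfloor>(2::real) ^ N\<rfloor> = 2 ^ N" by (metis floor_of_nat of_nat_numeral of_nat_power)
    finally show ?thesis unfolding l_def by (simp add: nat_le_iff)
  qed
  have "((\<lambda>N. (\<lambda>(s, t). R s t) (dyadic T N (k N), dyadic T N (l N))) \<longlongrightarrow> (\<lambda>(s, t). R s t) (s, t)) sequentially"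
  proof (rule continuous_on_tendsto_compose[OF cont tendsto_Pair[OF ls lt]])
    show "\<forall>\<^sub>F N in sequentially. (dyadic T N (k N), dyadic T N (l N)) \<in> {(s, t). 0 \<le> s \<and> s \<le> t \<and> t \<le> T}"
      using ev
    proof eventually_elim
      case (elim N)
      then show ?case using dyadic_le[OF T elim, of N] kb(1)[of N] lb(1)[of N] st by auto
    qed
  qed (use st in auto)
  then have lim: "(\<lambda>N. norm (R (dyadic T N (k N)) (dyadic T N (l N)))) \<longlonglongrightarrow> norm (R s t)"
    by (intro tendsto_norm) simp
  have "norm (R s t) \<le> 2 / (1 - 2 powr (- \<theta>)) * (F + G) * (T / 2 ^ n) powr (2 * \<theta>)"
  proof (rule tendsto_upperbound[OF lim])
    show "\<forall>\<^sub>F N in sequentially. norm (R (dyadic T N (k N)) (dyadic T N (l N)))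
        \<le> 2 / (1 - 2 powr (- \<theta>)) * (F + G) * (T / 2 ^ n) powr (2 * \<theta>)"
      using ev eventually_ge_at_top[of n]
    proof eventually_elim
      case (elim N)
      show ?case
        by (rule grid_hoelder[OF elim(2,1) lN]) (use kb(1)[of N] lb(1)[of N] len in linarith)
    qed
  qed simp
  also have "\<dots> \<le> 2 / (1 - 2 powr (- \<theta>)) * (F + G) * (2 * (t - s)) powr (2 * \<theta>)"
  proof (rule mult_left_mono)
    show "(T / 2 ^ n) powr (2 * \<theta>) \<le> (2 * (t - s)) powr (2 * \<theta>)"
      using len T \<theta> by (intro powr_mono2) auto
    have "2 powr (- \<theta>) < (1::real)" using \<theta> powr_less_mono[of "-\<theta>" 0 2] by simp
    then show "0 \<le> 2 / (1 - 2 powr (- \<theta>)) * (F + G)" using F G by simp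
  qed
  also have "\<dots> = 2 * 2 powr (2 * \<theta>) / (1 - 2 powr (- \<theta>)) * (F + G) * (t - s) powr (2 * \<theta>)"
  proof -
    have e: "(2 * (t - s)) powr (2 * \<theta>) = 2 powr (2 * \<theta>) * (t - s) powr (2 * \<theta>)"
      by (subst powr_mult) (use st in auto)
    show ?thesis unfolding e by simp
  qed
  finally show ?thesis .
qed

end

context prob_space
begin

text \<open>
  The supremum over all \<open>n\<close> and \<open>k\<close> of \<open>\<bar>R\<^sub>n\<^sub>k\<bar>\<^sup>2\<^sup>p\<close>, rescaled with the exponent \<open>a\<close>, is replaced by the sum \<open>V\<close>. Level \<open>n\<close> contributes
  \<open>2\<^sup>n\<close> terms of size \<open>(T / 2\<^sup>n) powr (2 p (b - a))\<close> to its expectation, a convergent geometric series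
  once \<open>p\<close> is large.
\<close>

lemma dyadic_sup_moment:
  fixes T a b :: real
  assumes T: "T > 0" and p: "p \<ge> 1" and ab: "1 < 2 * real p * (b - a)"
  shows "\<exists>D>0. \<forall>(R :: nat \<Rightarrow> nat \<Rightarrow> 'a \<Rightarrow> 'b::real_normed_vector) c.
      0 \<le> c \<longrightarrow> (\<forall>n k. k < 2 ^ n \<longrightarrow> moment_bound M p (R n k) (c * (T / 2 ^ n) powr b)) \<longrightarrow>
      (\<exists>U. (\<forall>\<omega>. 0 \<le> U \<omega>) \<and> moment_bound M p U (D * c) \<and>
         (AE \<omega> in M. \<forall>n k. k < 2 ^ n \<longrightarrow> norm (R n k \<omega>) \<le> U \<omega> * (T / 2 ^ n) powr a))"
proof -
  define r where "r = 2 powr (1 - 2 * real p * (b - a))"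
  have r: "0 < r" "r < 1" using ab powr_less_mono[of "1 - 2 * real p * (b - a)" 0 2] by (auto simp: r_def)
  define D where "D = T powr (b - a) * root (2 * p) (1 / (1 - r))"
  have D: "D > 0" using T r p by (simp add: D_def real_root_gt_zero)
  have D2p: "D ^ (2 * p) = (T powr (b - a)) ^ (2 * p) * (1 / (1 - r))"
    unfolding D_def power_mult_distrib using p r by (simp add: real_root_pow_pos2)
  have "\<exists>U. (\<forall>\<omega>. 0 \<le> U \<omega>) \<and> moment_bound M p U (D * c) \<and>
         (AE \<omega> in M. \<forall>n k. k < 2 ^ n \<longrightarrow> norm (R n k \<omega>) \<le> U \<omega> * (T / 2 ^ n) powr a)"
    if c: "0 \<le> c" and mb: "\<And>n k. k < 2 ^ n \<Longrightarrow> moment_bound M p (R n k) (c * (T / 2 ^ n) powr b)"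
    for R :: "nat \<Rightarrow> nat \<Rightarrow> 'a \<Rightarrow> 'b" and c
  proof -
    define Q where "Q n k U \<longleftrightarrow> U \<in> borel_measurable M \<and> (\<forall>\<omega>. 0 \<le> U \<omega>) \<and> (k < 2 ^ n \<longrightarrow> (AE \<omega> in M. norm (R n k \<omega>) \<le> U \<omega>) \<and>
      (\<integral>\<^sup>+ \<omega>. ennreal (U \<omega> ^ (2 * p)) \<partial>M) \<le> ennreal ((c * (T / 2 ^ n) powr b) ^ (2 * p)))" for n k U
    have "\<exists>U. Q n k U" for n k
    proof (cases "k < 2 ^ n")
      case True
      then show ?thesis using mb[OF True] unfolding Q_def moment_bound_def by blast
    next
      case False
      then show ?thesis unfolding Q_def by (intro exI[of _ "\<lambda>_. 0"]) auto
    qed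
    then obtain u where u: "\<And>n k. Q n k (u n k)" by metis
    have [measurable]: "u n k \<in> borel_measurable M" for n k using u unfolding Q_def by blast
    have u0: "0 \<le> u n k \<omega>" for n k \<omega> using u unfolding Q_def by blast
    define d where "d n = (T / 2 ^ n) powr a" for n :: nat
    have d: "d n > 0" for n using T by (simp add: d_def)
    define v where "v n \<omega> = (\<Sum>k<2^n. ennreal ((u n k \<omega> / d n) ^ (2 * p)))" for n \<omega>
    define V where "V \<omega> = (\<Sum>n. v n \<omega>)" for \<omega>
    have vm[measurable]: "v n \<in> borel_measurable M" for n unfolding v_def by measurable
    have Vm[measurable]: "V \<in> borel_measurable M" unfolding V_def by measurable
    have vI: "(\<integral>\<^sup>+ \<omega>. v n \<omega> \<partial>M) \<le> ennreal ((c * T powr (b - a)) ^ (2 * p) * r ^ n)" for n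
    proof -
      have "(\<integral>\<^sup>+ \<omega>. v n \<omega> \<partial>M) = (\<Sum>k<2^n. \<integral>\<^sup>+ \<omega>. ennreal ((u n k \<omega> / d n) ^ (2 * p)) \<partial>M)"
        unfolding v_def by (rule nn_integral_sum) measurable
      also have "\<dots> \<le> (\<Sum>k<2^n::nat. ennreal ((c * (T / 2 ^ n) powr (b - a)) ^ (2 * p)))"
      proof (rule sum_mono)
        fix k :: nat assume k: "k \<in> {..<2^n}"
        have "(\<integral>\<^sup>+ \<omega>. ennreal ((u n k \<omega> / d n) ^ (2 * p)) \<partial>M) = (\<integral>\<^sup>+ \<omega>. ennreal (1 / d n ^ (2 * p)) * ennreal (u n k \<omega> ^ (2 * p)) \<partial>M)"
          using d[of n] u0 by (intro nn_integral_cong) (simp add: ennreal_mult[symmetric] power_divide)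
        also have "\<dots> = ennreal (1 / d n ^ (2 * p)) * (\<integral>\<^sup>+ \<omega>. ennreal (u n k \<omega> ^ (2 * p)) \<partial>M)"
          by (rule nn_integral_cmult) measurable
        also have "\<dots> \<le> ennreal (1 / d n ^ (2 * p)) * ennreal ((c * (T / 2 ^ n) powr b) ^ (2 * p))"
          using u[of n k] k unfolding Q_def by (intro mult_left_mono) auto
        also have "\<dots> = ennreal ((c * (T / 2 ^ n) powr b / d n) ^ (2 * p))"
          using d[of n] c by (simp add: ennreal_mult[symmetric] power_divide)
        also have "c * (T / 2 ^ n) powr b / d n = c * (T / 2 ^ n) powr (b - a)"
          using T by (simp add: d_def powr_diff)
        finally show "(\<integral>\<^sup>+ \<omega>. ennreal ((u n k \<omega> / d n) ^ (2 * p)) \<partial>M) \<le> ennreal ((c * (T / 2 ^ n) powr (b - a)) ^ (2 * p))" .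
      qed
      also have "\<dots> = ennreal (2 ^ n * (c * (T / 2 ^ n) powr (b - a)) ^ (2 * p))"
        using c by (simp add: ennreal_mult ennreal_of_nat_eq_real_of_nat)
      also have "2 ^ n * (c * (T / 2 ^ n) powr (b - a)) ^ (2 * p) = (c * T powr (b - a)) ^ (2 * p) * r ^ n"
      proof -
        have "(T / 2 ^ n) powr (b - a) = T powr (b - a) * 2 powr (- (real n * (b - a)))"
          using T by (simp add: powr_divide powr_realpow[symmetric] powr_powr powr_minus_divide)
        then have "(c * (T / 2 ^ n) powr (b - a)) ^ (2 * p) = (c * T powr (b - a)) ^ (2 * p) * (2 powr (- (real n * (b - a)))) ^ (2 * p)"
          by (simp add: power_mult_distrib)
        moreover have "(2 powr (- (real n * (b - a)))) ^ (2 * p) = 2 powr (- (2 * real p * real n * (b - a)))"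
          by (simp add: powr_realpow[symmetric] powr_powr mult_ac)
        moreover have "(2::real) ^ n * 2 powr (- (2 * real p * real n * (b - a))) = r ^ n"
          by (simp add: r_def powr_realpow[symmetric] powr_powr powr_add[symmetric] algebra_simps)
        ultimately show ?thesis by (simp add: mult_ac)
      qed
      finally show ?thesis .
    qed
    have VI: "(\<integral>\<^sup>+ \<omega>. V \<omega> \<partial>M) \<le> ennreal ((D * c) ^ (2 * p))"
    proof -
      have "(\<integral>\<^sup>+ \<omega>. V \<omega> \<partial>M) = (\<Sum>n. \<integral>\<^sup>+ \<omega>. v n \<omega> \<partial>M)"
        unfolding V_def by (rule nn_integral_suminf) measurable
      also have "\<dots> \<le> (\<Sum>n. ennreal ((c * T powr (b - a)) ^ (2 * p) * r ^ n))"
        by (intro suminf_le vI) auto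
      also have "\<dots> = ennreal (\<Sum>n. (c * T powr (b - a)) ^ (2 * p) * r ^ n)"
        using r c by (intro suminf_ennreal2) (auto intro!: summable_mult summable_geometric)
      also have "(\<Sum>n. (c * T powr (b - a)) ^ (2 * p) * r ^ n) = (D * c) ^ (2 * p)"
        using r by (simp add: suminf_mult summable_geometric suminf_geometric power_mult_distrib D2p)
      finally show ?thesis .
    qed
    define U where "U \<omega> = root (2 * p) (enn2real (V \<omega>))" for \<omega>
    have [measurable]: "U \<in> borel_measurable M"
      unfolding U_def by (intro measurable_compose[OF _ borel_measurable_root]) measurable
    have U0: "0 \<le> U \<omega>" for \<omega> using p by (simp add: U_def)
    have Up: "U \<omega> ^ (2 * p) = enn2real (V \<omega>)" for \<omega> unfolding U_def using p by (intro real_root_pow_pos2) auto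
    have fin: "AE \<omega> in M. V \<omega> \<noteq> \<infinity>"
      using VI by (intro nn_integral_PInf_AE) (auto simp: top_unique)
    have mU: "moment_bound M p U (D * c)"
    proof (rule moment_boundI[where U=U])
      have "(\<integral>\<^sup>+ \<omega>. ennreal (U \<omega> ^ (2 * p)) \<partial>M) \<le> (\<integral>\<^sup>+ \<omega>. V \<omega> \<partial>M)"
        unfolding Up by (intro nn_integral_mono) (simp add: ennreal_enn2real_if)
      then show "(\<integral>\<^sup>+ \<omega>. ennreal (U \<omega> ^ (2 * p)) \<partial>M) \<le> ennreal ((D * c) ^ (2 * p))" using VI by simp
    qed (use D c U0 in auto)
    have "AE \<omega> in M. \<forall>n k. k < 2 ^ n \<longrightarrow> norm (R n k \<omega>) \<le> u n k \<omega>"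
    proof -
      have "AE \<omega> in M. k < 2 ^ n \<longrightarrow> norm (R n k \<omega>) \<le> u n k \<omega>" for n k
        using u[of n k] unfolding Q_def by (cases "k < 2 ^ n") auto
      then show ?thesis by (simp add: AE_all_countable)
    qed
    then have "AE \<omega> in M. \<forall>n k. k < 2 ^ n \<longrightarrow> norm (R n k \<omega>) \<le> U \<omega> * d n"
      using fin
    proof eventually_elim
      case (elim \<omega>)
      show ?case
      proof (intro allI impI)
        fix n k :: nat assume k: "k < 2 ^ n"
        have "ennreal ((u n k \<omega> / d n) ^ (2 * p)) \<le> v n \<omega>"
          unfolding v_def using k by (intro member_le_sum) auto
        also have "\<dots> \<le> V \<omega>" unfolding V_def
          using sum_le_suminf[of "\<lambda>n. v n \<omega>" "{n}"] by simp
        finally have "enn2real (ennreal ((u n k \<omega> / d n) ^ (2 * p))) \<le> enn2real (V \<omega>)"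
          using elim(2) by (intro enn2real_mono) (auto simp: less_top)
        then have "(u n k \<omega> / d n) ^ (2 * p) \<le> U \<omega> ^ (2 * p)" using u0 d[of n] unfolding Up by simp
        then have "u n k \<omega> / d n \<le> U \<omega>" using U0 p by (simp add: power_mono_iff[symmetric] u0 d less_imp_le)
        then have "u n k \<omega> \<le> U \<omega> * d n" using d[of n] by (simp add: field_simps)
        moreover have "norm (R n k \<omega>) \<le> u n k \<omega>" using elim(1) k by blast
        ultimately show "norm (R n k \<omega>) \<le> U \<omega> * d n" by (rule order_trans[rotated])
      qed
    qed
    then show ?thesis using U0 mU unfolding d_def by blast
  qed
  then show ?thesis using D by blast
qed

end

section \<open>The path of a Langevin solution\<close>

text \<open>
  Errors that are small relative to the length of each piece add up to an error relative to the total length.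
\<close>

lemma sum_integral_pieces:
  fixes f :: "real \<Rightarrow> 'a::euclidean_space"
  assumes f: "continuous_on {\<tau> 0..\<tau> k} f" and mono: "\<And>i. i < k \<Longrightarrow> \<tau> i \<le> \<tau> (Suc i)"
    and b: "\<And>i. i < k \<Longrightarrow> norm (I i - integral {\<tau> i..\<tau> (Suc i)} f) \<le> c * (\<tau> (Suc i) - \<tau> i)"
  shows "norm ((\<Sum>i<k. I i) - integral {\<tau> 0..\<tau> k} f) \<le> c * (\<tau> k - \<tau> 0)"
proof -
  have "\<tau> 0 \<le> \<tau> j \<and> integral {\<tau> 0..\<tau> j} f = (\<Sum>i<j. integral {\<tau> i..\<tau> (Suc i)} f) \<and> \<tau> j \<le> \<tau> k" if "j \<le> k" for j
  proof -
    have up: "\<tau> i \<le> \<tau> j" if "i \<le> j" "j \<le> k" for i j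
      using that by (induction j rule: dec_induct) (auto intro: order_trans[OF _ mono])
    show ?thesis using that
    proof (induction j)
      case (Suc j)
      have "integral {\<tau> 0..\<tau> (Suc j)} f = integral {\<tau> 0..\<tau> j} f + integral {\<tau> j..\<tau> (Suc j)} f"
        using Suc.prems up[of 0 j] up[of "Suc j" k] mono[of j]
        by (intro Henstock_Kurzweil_Integration.integral_combine[symmetric] integrable_continuous_interval continuous_on_subset[OF f]) auto
      then show ?case using Suc up[of 0 "Suc j"] up[of "Suc j" k] by auto
    qed (use up[of 0 k] in auto)
  qed
  then have "(\<Sum>i<k. I i) - integral {\<tau> 0..\<tau> k} f = (\<Sum>i<k. I i - integral {\<tau> i..\<tau> (Suc i)} f)"
    by (simp add: sum_subtractf)
  also have "norm \<dots> \<le> (\<Sum>i<k. c * (\<tau> (Suc i) - \<tau> i))"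
    by (rule sum_norm_le) (use b in auto)
  also have "\<dots> = c * (\<tau> k - \<tau> 0)"
    by (simp add: sum_distrib_left[symmetric] sum_lessThan_telescope)
  finally show ?thesis .
qed

lemma norm_const_minus_integral_le:
  fixes f :: "real \<Rightarrow> 'a::euclidean_space"
  assumes "continuous_on {a..b} f" "a \<le> b" "\<And>r. r \<in> {a..b} \<Longrightarrow> norm (c - f r) \<le> e"
  shows "norm ((b - a) *\<^sub>R c - integral {a..b} f) \<le> e * (b - a)"
proof -
  have i: "f integrable_on {a..b}" by (intro integrable_continuous_interval assms)
  have "integral {a..b} (\<lambda>r. c - f r) = integral {a..b} (\<lambda>_. c) - integral {a..b} f"
    by (rule Henstock_Kurzweil_Integration.integral_diff) (auto intro: i)
  then have "(b - a) *\<^sub>R c - integral {a..b} f = integral {a..b} (\<lambda>r. c - f r)"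
    using assms(2) by simp
  also have "norm \<dots> \<le> e * (b - a)"
    using assms by (intro integral_bound continuous_intros) auto
  finally show ?thesis .
qed

lemma has_rs_integral_unique:
  assumes I: "has_rs_integral f g a b I" and I': "has_rs_integral f g a b I'" and ab: "a \<le> b"
  shows "I = I'"
proof -
  have "norm (I - I') \<le> 0 + e" if e: "e > 0" for e
  proof -
    obtain d1 where d1: "d1 > 0" "\<And>k \<tau> \<xi>. partition_mesh a b d1 k \<tau> \<Longrightarrow> (\<forall>i<k. \<xi> i \<in> {\<tau> i..\<tau> (Suc i)}) \<Longrightarrow>
        norm ((\<Sum>i<k. tensor (f (\<xi> i)) (g (\<tau> (Suc i)) - g (\<tau> i))) - I) < e / 2"
      using I e unfolding has_rs_integral_def by (meson half_gt_zero)
    obtain d2 where d2: "d2 > 0" "\<And>k \<tau> \<xi>. partition_mesh a b d2 k \<tau> \<Longrightarrow> (\<forall>i<k. \<xi> i \<in> {\<tau> i..\<tau> (Suc i)}) \<Longrightarrow>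
        norm ((\<Sum>i<k. tensor (f (\<xi> i)) (g (\<tau> (Suc i)) - g (\<tau> i))) - I') < e / 2"
      using I' e unfolding has_rs_integral_def by (meson half_gt_zero)
    define d where "d = min d1 d2"
    have d: "d > 0" using d1 d2 by (simp add: d_def)
    obtain k :: nat where k: "(b - a) / d < real k" using reals_Archimedean2 by blast
    then have k0: "k > 0" using ab d by (metis divide_nonneg_pos diff_ge_0_iff_ge less_le_trans not_gr_zero of_nat_0 not_le)
    define \<tau> where "\<tau> i = a + real i * ((b - a) / real k)" for i
    have step: "\<tau> (Suc i) - \<tau> i = (b - a) / real k" for i
      by (simp add: \<tau>_def distrib_right del: times_divide_eq_right)
    have "(b - a) / real k < d" using k k0 d by (simp add: field_simps)
    moreover have "0 \<le> (b - a) / real k" using ab by simp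
    ultimately have pm: "\<tau> 0 = a" "\<tau> k = b" "\<forall>i<k. \<tau> i \<le> \<tau> (Suc i) \<and> \<tau> (Suc i) - \<tau> i < d"
      using k0 step by (auto simp: \<tau>_def[of 0] \<tau>_def[of k]) (metis diff_ge_0_iff_ge)
    then have 1: "partition_mesh a b d1 k \<tau>" "partition_mesh a b d2 k \<tau>"
      unfolding partition_mesh_def d_def by auto
    have tag: "\<forall>i<k. \<tau> i \<in> {\<tau> i..\<tau> (Suc i)}" using pm by auto
    let ?S = "\<Sum>i<k. tensor (f (\<tau> i)) (g (\<tau> (Suc i)) - g (\<tau> i))"
    have "norm (I - I') \<le> norm (?S - I') + norm (?S - I)"
      using norm_triangle_ineq4[of "?S - I'" "?S - I"] by simp
    also have "\<dots> < e / 2 + e / 2" using d1(2)[OF 1(1) tag] d2(2)[OF 1(2) tag] by (intro add_strict_mono)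
    finally show ?thesis by simp
  qed
  then have "norm (I - I') \<le> 0" by (rule field_le_epsilon)
  then show ?thesis by simp
qed

lemma dyadic_refine: "n \<le> N \<Longrightarrow> dyadic T N (k * 2 ^ (N - n)) = dyadic T n k"
proof -
  assume "n \<le> N"
  then have "(2::real) ^ N = 2 ^ n * 2 ^ (N - n)" by (simp add: power_add[symmetric])
  then show ?thesis by (simp add: dyadic_def)
qed

text \<open>
  One trajectory for which the integral equations hold, with \<open>Y = A X\<close> and \<open>v\<close> its velocity. Everything that follows
  from the equations alone, without probability, is proved for it.
\<close>

locale langevin_path =
  fixes A :: "real^'n^'n" and m a :: real and w P Y v :: "real \<Rightarrow> real^'n"
  assumes m: "m > 0" and a: "a > 0" "\<And>x. norm (A *v x) \<le> a * norm x"
    and contP: "continuous_on {0..} P" and contw: "continuous_on {0..} w"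
    and v_def: "\<And>r. v r = (1 / m) *\<^sub>R (A *v P r)"
    and Y: "\<And>t. 0 \<le> t \<Longrightarrow> Y t = integral {0..t} v"
    and P: "\<And>t. 0 \<le> t \<Longrightarrow> P t = (w t - w 0) - Y t"
    and P0: "P 0 = 0"
begin

lemma contv: "continuous_on {0..} v"
  unfolding v_def
  by (intro continuous_intros linear_continuous_on_compose[OF contP] matrix_vector_mul_linear)

lemma contv': "0 \<le> s \<Longrightarrow> continuous_on {s..t} v"
  by (rule continuous_on_subset[OF contv]) auto

lemma Y_diff: "0 \<le> s \<Longrightarrow> s \<le> t \<Longrightarrow> Y t - Y s = integral {s..t} v"
  using Henstock_Kurzweil_Integration.integral_combine[of 0 s t v] contv'[of 0 t]
  by (simp add: Y integrable_continuous_interval algebra_simps)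

lemma contY: "continuous_on {0..} Y"
proof -
  have "continuous_on {0..} (\<lambda>t. w t - w 0 - P t)" by (intro continuous_intros contw contP)
  then show ?thesis by (rule continuous_on_eq) (use P in auto)
qed

lemma contY': "0 \<le> s \<Longrightarrow> continuous_on {s..t} Y"
  by (rule continuous_on_subset[OF contY]) auto

definition H :: "real \<Rightarrow> real^'n^'n" where "H t = integral {0..t} (\<lambda>r. tensor (Y r) (v r))"

text \<open>
  The iterated integral \<open>\<integral> (Y\<^sub>r - Y\<^sub>s) \<otimes> dY\<^sub>r\<close> over \<open>[s, t]\<close>, expressed by increments of one-parameter functions: Chen's
  relation and continuity in \<open>(s, t)\<close> are immediate in this form.
\<close>

definition J :: "real \<Rightarrow> real \<Rightarrow> real^'n^'n" where "J s t = H t - H s - tensor (Y s) (Y t - Y s)"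

lemma cont_tensor: "continuous_on S f \<Longrightarrow> continuous_on S g \<Longrightarrow> continuous_on S (\<lambda>x. tensor (f x) (g x))"
  for f g :: "'z::topological_space \<Rightarrow> real^'n"
  by (rule bounded_bilinear.continuous_on[OF tensor_bilinear])

lemma J_integral:
  assumes "0 \<le> s" "s \<le> t"
  shows "J s t = integral {s..t} (\<lambda>r. tensor (Y r - Y s) (v r))"
proof -
  have c: "continuous_on {0..t} (\<lambda>r. tensor (Y r) (v r))" "continuous_on {s..t} (\<lambda>r. tensor (Y r) (v r))"
    using assms contv' contY' by (auto intro!: cont_tensor)
  have "H t - H s = integral {s..t} (\<lambda>r. tensor (Y r) (v r))"
    using Henstock_Kurzweil_Integration.integral_combine[of 0 s t "\<lambda>r. tensor (Y r) (v r)"] c assms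
    by (simp add: H_def integrable_continuous_interval algebra_simps)
  moreover have "tensor (Y s) (Y t - Y s) = integral {s..t} (\<lambda>r. tensor (Y s) (v r))"
    using integral_linear[OF integrable_continuous_interval[OF contv'[OF assms(1)]]
        bounded_bilinear.bounded_linear_right[OF tensor_bilinear, of "Y s"], of t] assms
    by (simp add: Y_diff o_def)
  moreover have "(\<lambda>r. tensor (Y s) (v r)) integrable_on {s..t}"
    using assms contv' by (intro integrable_continuous_interval cont_tensor continuous_on_const) auto
  ultimately show ?thesis
    using c by (simp add: J_def tensor_simps Henstock_Kurzweil_Integration.integral_diff integrable_continuous_interval)
qed

lemma J_chen: "J s t - J s u - J u t = tensor (Y u - Y s) (Y t - Y u)"
  by (simp add: J_def tensor_simps)

lemma J_cont: "continuous_on {(s, t). 0 \<le> s \<and> s \<le> t \<and> t \<le> T} (\<lambda>(s, t). J s t)"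
proof -
  have "continuous_on {0..T} (\<lambda>r. tensor (Y r) (v r))"
    using contv' contY' by (auto intro!: cont_tensor)
  then have H: "continuous_on {0..T} H"
    unfolding H_def by (intro indefinite_integral_continuous_1 integrable_continuous_interval)
  have YT: "continuous_on {0..T} Y" by (rule contY') simp
  let ?S = "{p :: real \<times> real. 0 \<le> fst p \<and> fst p \<le> snd p \<and> snd p \<le> T}"
  have f: "continuous_on ?S (\<lambda>p. g (fst p))" "continuous_on ?S (\<lambda>p. g (snd p))" if "continuous_on {0..T} g"
    for g :: "real \<Rightarrow> 'z::topological_space"
    by (rule continuous_on_compose2[OF that]; force intro: continuous_intros)+
  show ?thesis unfolding J_def case_prod_unfold
    by (intro continuous_intros cont_tensor f H YT)
qed

text \<open>
  On each piece of a partition \<open>Y\<close> differs little from its tag, by uniform continuity, and the velocity is bounded.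
\<close>

lemma has_rs_integral_J:
  assumes st: "0 \<le> s" "s \<le> t"
  shows "has_rs_integral (\<lambda>r. Y r - Y s) Y s t (J s t)"
  unfolding has_rs_integral_def
proof (intro allI impI)
  fix \<epsilon> :: real assume \<epsilon>: "\<epsilon> > 0"
  obtain B where B: "B > 0" "\<And>r. r \<in> {s..t} \<Longrightarrow> norm (v r) \<le> B"
    using compact_imp_bounded[OF compact_continuous_image[OF contv'[OF st(1)] compact_Icc[of s t]]]
    unfolding bounded_pos by auto
  define e where "e = \<epsilon> / (2 * B * (t - s + 1))"
  have e: "e > 0" using \<epsilon> B st by (simp add: e_def)
  have "uniformly_continuous_on {s..t} Y"
    by (intro compact_uniformly_continuous contY' st) auto
  then obtain d where d: "d > 0" "\<And>x y. x \<in> {s..t} \<Longrightarrow> y \<in> {s..t} \<Longrightarrow> dist y x < d \<Longrightarrow> dist (Y y) (Y x) < e"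
    using e unfolding uniformly_continuous_on_def by metis
  show "\<exists>\<delta>>0. \<forall>k \<tau> \<xi>. partition_mesh s t \<delta> k \<tau> \<and> (\<forall>i<k. \<xi> i \<in> {\<tau> i..\<tau> (Suc i)}) \<longrightarrow>
        norm ((\<Sum>i<k. tensor (Y (\<xi> i) - Y s) (Y (\<tau> (Suc i)) - Y (\<tau> i))) - J s t) < \<epsilon>"
  proof (intro exI[of _ d] conjI allI impI d(1))
    fix k :: nat and \<tau> \<xi> :: "nat \<Rightarrow> real"
    assume pm: "partition_mesh s t d k \<tau> \<and> (\<forall>i<k. \<xi> i \<in> {\<tau> i..\<tau> (Suc i)})"
    then have \<tau>: "\<tau> 0 = s" "\<tau> k = t" "\<And>i. i < k \<Longrightarrow> \<tau> i \<le> \<tau> (Suc i)" "\<And>i. i < k \<Longrightarrow> \<tau> (Suc i) - \<tau> i < d"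
      and \<xi>: "\<And>i. i < k \<Longrightarrow> \<tau> i \<le> \<xi> i \<and> \<xi> i \<le> \<tau> (Suc i)"
      unfolding partition_mesh_def by auto
    have up: "\<tau> i \<le> \<tau> j" if "i \<le> j" "j \<le> k" for i j
      using that by (induction j rule: dec_induct) (auto intro: order_trans[OF _ \<tau>(3)])
    let ?f = "\<lambda>r. tensor (Y r - Y s) (v r)"
    have "norm (tensor (Y (\<xi> i) - Y s) (Y (\<tau> (Suc i)) - Y (\<tau> i)) - integral {\<tau> i..\<tau> (Suc i)} ?f) \<le> (e * B) * (\<tau> (Suc i) - \<tau> i)"
      if i: "i < k" for i
    proof -
      have b: "s \<le> \<tau> i" "\<tau> (Suc i) \<le> t" using up[of 0 i] up[of "Suc i" k] i \<tau>(1,2) by auto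
      let ?I = "{\<tau> i..\<tau> (Suc i)}"
      have cv: "continuous_on ?I v" and cY: "continuous_on ?I Y" using b st by (auto intro: contv' contY')
      have "tensor (Y (\<xi> i) - Y s) (Y (\<tau> (Suc i)) - Y (\<tau> i)) = integral ?I (\<lambda>r. tensor (Y (\<xi> i) - Y s) (v r))"
        using integral_linear[OF integrable_continuous_interval[OF cv]
            bounded_bilinear.bounded_linear_right[OF tensor_bilinear, of "Y (\<xi> i) - Y s"]] b st \<tau>(3)[OF i]
        by (simp add: Y_diff o_def)
      then have "tensor (Y (\<xi> i) - Y s) (Y (\<tau> (Suc i)) - Y (\<tau> i)) - integral ?I ?f
          = integral ?I (\<lambda>r. tensor (Y (\<xi> i) - Y s) (v r) - ?f r)"
        by (subst Henstock_Kurzweil_Integration.integral_diff)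
          (auto intro!: integrable_continuous_interval cont_tensor continuous_intros cv cY)
      also have "norm \<dots> \<le> (e * B) * (\<tau> (Suc i) - \<tau> i)"
      proof (rule integral_bound[OF \<tau>(3)[OF i]])
        show "continuous_on ?I (\<lambda>r. tensor (Y (\<xi> i) - Y s) (v r) - ?f r)"
          by (intro continuous_intros cont_tensor cv cY)
        fix r assume r: "r \<in> ?I"
        have "dist (\<xi> i) r < d" using \<xi>[OF i] \<tau>(4)[OF i] r by (auto simp: dist_real_def)
        then have "norm (Y (\<xi> i) - Y r) \<le> e" using d(2)[of r "\<xi> i"] r b \<xi>[OF i] by (auto simp: dist_norm)
        then have "norm (Y (\<xi> i) - Y r) * norm (v r) \<le> e * B" using B(2)[of r] r b e by (intro mult_mono) auto
        moreover have "tensor (Y (\<xi> i) - Y s) (v r) - ?f r = tensor (Y (\<xi> i) - Y r) (v r)"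
          by (simp add: tensor_simps)
        ultimately show "norm (tensor (Y (\<xi> i) - Y s) (v r) - ?f r) \<le> e * B"
          by (simp add: norm_tensor)
      qed
      finally show ?thesis .
    qed
    then have "norm ((\<Sum>i<k. tensor (Y (\<xi> i) - Y s) (Y (\<tau> (Suc i)) - Y (\<tau> i))) - integral {\<tau> 0..\<tau> k} ?f) \<le> (e * B) * (\<tau> k - \<tau> 0)"
      using st \<tau> by (intro sum_integral_pieces) (auto intro!: cont_tensor continuous_intros contv' contY')
    also have "\<dots> < \<epsilon>"
    proof -
      have "\<epsilon> / (2 * b * l) * b * l = \<epsilon> / 2" if "b > 0" "l > 0" for b l :: real using that by simp
      from this[of B "t - s + 1"] have "e * B * (t - s + 1) = \<epsilon> / 2" using B st unfolding e_def by simp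
      moreover have "e * B * (t - s) \<le> e * B * (t - s + 1)" using e B by (intro mult_left_mono) auto
      ultimately show ?thesis using \<epsilon> \<tau> by simp
    qed
    finally show "norm ((\<Sum>i<k. tensor (Y (\<xi> i) - Y s) (Y (\<tau> (Suc i)) - Y (\<tau> i))) - J s t) < \<epsilon>"
      using \<tau> by (simp add: J_integral[OF st])
  qed
qed

lemma rs_integral_J:
  assumes "0 \<le> s" "s \<le> t"
  shows "rs_integral (\<lambda>r. Y r - Y s) Y s t = J s t"
  unfolding rs_integral_def
  using has_rs_integral_J[OF assms] has_rs_integral_unique assms by (intro the_equality) blast+

subsection \<open>Convergence of the Euler scheme\<close>

context
  fixes T :: real
  assumes T: "T > 0"
begin

definition grid_noise :: "nat \<Rightarrow> nat \<Rightarrow> real^'n" where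
  "grid_noise N j = w (dyadic T N (Suc j)) - w (dyadic T N j)"

lemma grid_noise_sum: "(\<Sum>j<i. grid_noise N j) = w (dyadic T N i) - w 0"
  unfolding grid_noise_def by (subst sum_lessThan_telescope) (simp add: dyadic_def)

abbreviation scheme :: "nat \<Rightarrow> nat \<Rightarrow> real^'n" where
  "scheme N i \<equiv> euler A (T / 2 ^ N / m) (grid_noise N) i"

text \<open>
  A discrete Gronwall argument: the local error of one step of length \<open>h\<close> is \<open>h\<close> times the oscillation of the velocity,
  and the errors are amplified by at most \<open>(1 + a h / m)\<^sup>i \<le> exp (a T / m)\<close>. The mass is fixed here, so the
  size of this factor does not matter.
\<close>

lemma euler_converges:
  assumes \<epsilon>: "\<epsilon> > 0"
  shows "\<forall>\<^sub>F N in sequentially. \<forall>i\<le>2 ^ N. norm (scheme N i - P (dyadic T N i)) \<le> \<epsilon>"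
proof -
  define c where "c = exp (a * T / m) * T"
  have c: "c > 0" using T by (simp add: c_def)
  define e where "e = \<epsilon> / c"
  have e: "e > 0" using \<epsilon> c by (simp add: e_def)
  have "uniformly_continuous_on {0..T} v" by (intro compact_uniformly_continuous contv') auto
  then obtain d where d: "d > 0" "\<And>x y. x \<in> {0..T} \<Longrightarrow> y \<in> {0..T} \<Longrightarrow> dist y x < d \<Longrightarrow> dist (v y) (v x) < e"
    using e unfolding uniformly_continuous_on_def by metis
  have "(\<lambda>N. T / 2 ^ N) \<longlonglongrightarrow> 0"
    by (rule dyadic_mesh_tendsto)
  then have "\<forall>\<^sub>F N in sequentially. T / 2 ^ N < d" using d(1) by (rule order_tendstoD)
  then show ?thesis
  proof eventually_elim
    case (elim N)
    define h where "h = T / 2 ^ N"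
    have h: "h > 0" "h < d" using T elim by (auto simp: h_def)
    let ?t = "dyadic T N"
    let ?q = "1 + h / m * a"
    have q: "?q \<ge> 1" using h m a by simp
    have main: "norm (scheme N i - P (?t i)) \<le> ?q ^ i * (real i * (h * e))" if "i \<le> 2 ^ N" for i
      using that
    proof (induction i)
      case 0 then show ?case by (simp add: dyadic_def P0)
    next
      case (Suc i)
      have b: "0 \<le> ?t i" "?t i \<le> ?t (Suc i)" "?t (Suc i) \<le> T" "?t (Suc i) - ?t i = h"
        using dyadic_bounds[OF T, of i N] dyadic_bounds[OF T, of "Suc i" N] Suc.prems dyadic_le[OF T, of i "Suc i" N] dyadic_Suc[of T N i]
        by (auto simp: h_def)
      define D where "D = scheme N i - P (?t i)"
      define r where "r = (?t (Suc i) - ?t i) *\<^sub>R v (?t i) - integral {?t i..?t (Suc i)} v"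
      have r: "norm r \<le> e * h"
        unfolding r_def b(4)[symmetric]
      proof (rule norm_const_minus_integral_le)
        fix x assume x: "x \<in> {?t i..?t (Suc i)}"
        then have "dist (?t i) x < d" using b h by (auto simp: dist_real_def)
        then show "norm (v (?t i) - v x) \<le> e" using d(2)[of x "?t i"] x b by (auto simp: dist_norm)
      qed (use b contv' in auto)
      have ev: "(h / m) *\<^sub>R (A *v P (?t i)) = h *\<^sub>R v (?t i)" by (simp add: v_def)
      have "P (?t (Suc i)) = P (?t i) + grid_noise N i - integral {?t i..?t (Suc i)} v"
        unfolding grid_noise_def Y_diff[OF b(1,2), symmetric] P[OF b(1)] P[OF order_trans[OF b(1,2)]] by simp
      then have "scheme N (Suc i) - P (?t (Suc i)) = (D - (h / m) *\<^sub>R (A *v D)) - r"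
        unfolding D_def r_def b(4) by (simp add: h_def[symmetric] matrix_vector_mult_diff_distrib scaleR_right_diff_distrib ev)
      also have "norm \<dots> \<le> (norm D + norm ((h / m) *\<^sub>R (A *v D))) + norm r"
        by (intro order_trans[OF norm_triangle_ineq4] add_mono norm_triangle_ineq4 order_refl)
      also have "\<dots> \<le> (norm D + h / m * (a * norm D)) + e * h"
      proof -
        have "norm ((h / m) *\<^sub>R (A *v D)) = h / m * norm (A *v D)" using h m by simp
        also have "\<dots> \<le> h / m * (a * norm D)" using a h m by (intro mult_left_mono) auto
        finally show ?thesis using r by simp
      qed
      also have "\<dots> = ?q * norm D + e * h" by (simp add: algebra_simps)
      also have "\<dots> \<le> ?q * (?q ^ i * (real i * (h * e))) + ?q ^ Suc i * (e * h)"
      proof (intro add_mono mult_left_mono)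
        have "1 * (e * h) \<le> ?q ^ Suc i * (e * h)"
          using e h q by (intro mult_right_mono one_le_power) auto
        then show "e * h \<le> ?q ^ Suc i * (e * h)" by simp
      qed (use Suc q in \<open>auto simp: D_def\<close>)
      also have "\<dots> = ?q ^ Suc i * (real (Suc i) * (h * e))"
      proof -
        have "x * (x ^ i * (real i * (h * e))) + x ^ Suc i * (e * h) = x ^ Suc i * (real (Suc i) * (h * e))" for x :: real
          by (simp add: algebra_simps)
        then show ?thesis .
      qed
      finally show ?case .
    qed
    show ?case
    proof (intro allI impI)
      fix i :: nat assume i: "i \<le> 2 ^ N"
      have ih: "real i * h \<le> T" using dyadic_bounds[OF T i] by (simp add: dyadic_def h_def)
      have "?q ^ i \<le> exp (h / m * a) ^ i" using q by (intro power_mono exp_ge_add_one_self) auto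
      also have "\<dots> = exp (real i * (h / m * a))" by (rule exp_of_nat_mult[symmetric])
      also have "\<dots> \<le> exp (a * T / m)"
        using mult_right_mono[OF ih, of "a / m"] m a by (simp add: mult_ac)
      finally have qi: "?q ^ i \<le> exp (a * T / m)" .
      have "?q ^ i * (real i * (h * e)) \<le> exp (a * T / m) * (T * e)"
        unfolding mult.assoc[of "real i" h e, symmetric]
        by (intro mult_mono qi mult_right_mono[OF ih]) (use e h in auto)
      also have "\<dots> = \<epsilon>" using T by (simp add: e_def c_def)
      finally show "norm (scheme N i - P (?t i)) \<le> \<epsilon>" using main[OF i] by linarith
    qed
  qed
qed

lemma euler_tendsto:
  assumes k: "k \<le> 2 ^ n"
  shows "(\<lambda>N. scheme N (k * 2 ^ (N - n))) \<longlonglongrightarrow> P (dyadic T n k)"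
  unfolding tendsto_iff
proof (intro allI impI)
  fix \<epsilon> :: real assume "\<epsilon> > 0"
  then have "\<forall>\<^sub>F N in sequentially. \<forall>i\<le>2 ^ N. norm (scheme N i - P (dyadic T N i)) \<le> \<epsilon> / 2"
    by (intro euler_converges) simp
  then show "\<forall>\<^sub>F N in sequentially. dist (scheme N (k * 2 ^ (N - n))) (P (dyadic T n k)) < \<epsilon>"
    using eventually_ge_at_top[of n]
  proof eventually_elim
    case (elim N)
    have "k * 2 ^ (N - n) \<le> 2 ^ n * 2 ^ (N - n)" using k by simp
    also have "\<dots> = 2 ^ N" using elim(2) by (simp add: power_add[symmetric])
    finally have "norm (scheme N (k * 2 ^ (N - n)) - P (dyadic T N (k * 2 ^ (N - n)))) \<le> \<epsilon> / 2" using elim(1) by blast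
    then show ?case using \<open>\<epsilon> > 0\<close> by (simp add: dist_norm dyadic_refine[OF elim(2)])
  qed
qed

text \<open>
  Each summand of the discrete area is the length of the step times a value that is uniformly close to the integrand
  of \<open>J_integral\<close> on that step.
\<close>

lemma euler_area_tendsto:
  assumes k: "k \<le> l" "l \<le> 2 ^ n"
  shows "(\<lambda>N. euler_area A (T / 2 ^ N / m) (grid_noise N) (k * 2 ^ (N - n)) (l * 2 ^ (N - n)))
    \<longlonglongrightarrow> J (dyadic T n k) (dyadic T n l)"
  unfolding tendsto_iff
proof (intro allI impI)
  fix \<epsilon> :: real assume \<epsilon>: "\<epsilon> > 0"
  define s where "s = dyadic T n k"
  define t where "t = dyadic T n l"
  have st: "0 \<le> s" "s \<le> t" "t \<le> T"
    using dyadic_bounds[OF T, of k n] dyadic_bounds[OF T, of l n] k dyadic_le[OF T, of k l n] by (auto simp: s_def t_def)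
  obtain B where B: "B > 0" "\<And>r. r \<in> {0..T} \<Longrightarrow> norm (v r) \<le> B"
    using compact_imp_bounded[OF compact_continuous_image[OF contv'[of 0 T] compact_Icc[of 0 T]]]
    unfolding bounded_pos by auto
  obtain B' where B': "B' > 0" "\<And>r. r \<in> {0..T} \<Longrightarrow> norm (Y r) \<le> B'"
    using compact_imp_bounded[OF compact_continuous_image[OF contY'[of 0 T] compact_Icc[of 0 T]]]
    unfolding bounded_pos by auto
  define b where "b = a / m + 1"
  have b: "b > 0" using a m by (simp add: b_def add_pos_pos)
  \<comment> \<open>Integrand and approximation differ by at most \<open>K e\<close> when paths and scheme differ by at most \<open>e \<le> 1\<close>.\<close>
  define K where "K = 3 * (B + b) + 2 * B' * b"
  have K: "K > 0" using B B' b by (simp add: K_def add_pos_pos)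
  define e where "e = min 1 (\<epsilon> / (2 * (K * (T + 1))))"
  have e: "e > 0" "e \<le> 1" "e * K * T < \<epsilon>"
  proof -
    have "0 < \<epsilon> / (2 * (K * (T + 1)))" using \<epsilon> K T by simp
    then show "e > 0" "e \<le> 1" by (auto simp: e_def)
    have "e * (K * (T + 1)) \<le> \<epsilon> / (2 * (K * (T + 1))) * (K * (T + 1))"
      using K T by (intro mult_right_mono) (auto simp: e_def)
    also have "\<dots> = \<epsilon> / 2"
    proof -
      have "\<epsilon> / (2 * L) * L = \<epsilon> / 2" if "L > 0" for L :: real using that by simp
      from this[of "K * (T + 1)"] show ?thesis using K T by simp
    qed
    finally have "e * (K * (T + 1)) \<le> \<epsilon> / 2" .
    moreover have "e * K * T \<le> e * (K * (T + 1))" using \<open>e > 0\<close> K by (simp add: algebra_simps)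
    ultimately show "e * K * T < \<epsilon>" using \<epsilon> by linarith
  qed
  have "uniformly_continuous_on {0..T} v" by (intro compact_uniformly_continuous contv') auto
  then obtain d1 where d1: "d1 > 0" "\<And>x y. x \<in> {0..T} \<Longrightarrow> y \<in> {0..T} \<Longrightarrow> dist y x < d1 \<Longrightarrow> dist (v y) (v x) < e"
    using e unfolding uniformly_continuous_on_def by metis
  have "uniformly_continuous_on {0..T} Y" by (intro compact_uniformly_continuous contY') auto
  then obtain d2 where d2: "d2 > 0" "\<And>x y. x \<in> {0..T} \<Longrightarrow> y \<in> {0..T} \<Longrightarrow> dist y x < d2 \<Longrightarrow> dist (Y y) (Y x) < e"
    using e unfolding uniformly_continuous_on_def by metis
  have z: "(\<lambda>N. T / 2 ^ N) \<longlonglongrightarrow> 0"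
    by (rule dyadic_mesh_tendsto)
  have "\<forall>\<^sub>F N in sequentially. T / 2 ^ N < min d1 d2" using d1(1) d2(1) by (intro order_tendstoD(2)[OF z]) simp
  then show "\<forall>\<^sub>F N in sequentially. dist (euler_area A (T / 2 ^ N / m) (grid_noise N) (k * 2 ^ (N - n)) (l * 2 ^ (N - n)))
      (J (dyadic T n k) (dyadic T n l)) < \<epsilon>"
    using euler_converges[OF e(1)] eventually_ge_at_top[of n]
  proof eventually_elim
    case (elim N)
    define h where "h = T / 2 ^ N"
    have h: "h > 0" "h < d1" "h < d2" using T elim by (auto simp: h_def)
    define i0 where "i0 = k * 2 ^ (N - n)"
    define i1 where "i1 = l * 2 ^ (N - n)"
    have i01: "i0 \<le> i1" using k by (simp add: i0_def i1_def)
    have i1N: "i1 \<le> 2 ^ N"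
    proof -
      have "i1 \<le> 2 ^ n * 2 ^ (N - n)" using k by (simp add: i1_def)
      also have "\<dots> = 2 ^ N" using elim(3) by (simp add: power_add[symmetric])
      finally show ?thesis .
    qed
    let ?t = "dyadic T N"
    have ts: "?t i0 = s" "?t i1 = t" using dyadic_refine[OF elim(3)] by (auto simp: i0_def i1_def s_def t_def)
    let ?y = "euler_pos A (T / 2 ^ N / m) (grid_noise N)"
    have y: "norm (?y i - Y (?t i)) \<le> e" if i: "i \<le> 2 ^ N" for i
    proof -
      have "?y i - Y (?t i) = - (scheme N i - P (?t i))"
        using P[of "?t i"] dyadic_bounds[OF T i] by (simp add: euler_pos_def grid_noise_sum)
      then have "norm (?y i - Y (?t i)) = norm (scheme N i - P (?t i))" by (simp only: norm_minus_cancel)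
      then show ?thesis using elim(2) i by simp
    qed
    let ?f = "\<lambda>r. tensor (Y r - Y s) (v r)"
    have piece: "norm (tensor (?y (Suc (i0 + i)) - ?y i0) ((h / m) *\<^sub>R (A *v scheme N (i0 + i))) - integral {?t (i0 + i)..?t (i0 + Suc i)} ?f)
        \<le> (e * K) * (?t (i0 + Suc i) - ?t (i0 + i))" if i: "i < i1 - i0" for i
    proof -
      let ?a = "?t (i0 + i)" and ?b = "?t (Suc (i0 + i))"
      have ii: "Suc (i0 + i) \<le> i1" using i by simp
      have bb: "s \<le> ?a" "?a \<le> ?b" "?b \<le> t" "?b - ?a = h" "0 \<le> ?a" "?b \<le> T"
        using dyadic_le[OF T, of i0 "i0 + i" N] dyadic_le[OF T, of "i0 + i" "Suc (i0 + i)" N] dyadic_le[OF T ii, of N]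
          dyadic_Suc[of T N "i0 + i"] st unfolding ts by (auto simp: h_def)
      let ?p = "?y (Suc (i0 + i)) - ?y i0" and ?q = "(1 / m) *\<^sub>R (A *v scheme N (i0 + i))"
      have qv: "norm (?q - v r) \<le> b * e" if r: "r \<in> {?a..?b}" for r
      proof -
        have "norm (?q - v ?a) = 1 / m * norm (A *v (scheme N (i0 + i) - P ?a))"
          using m by (simp add: v_def scaleR_right_diff_distrib[symmetric] matrix_vector_mult_diff_distrib[symmetric])
        also have "\<dots> \<le> 1 / m * (a * norm (scheme N (i0 + i) - P ?a))" using m a by (intro mult_left_mono) auto
        also have "\<dots> \<le> 1 / m * (a * e)"
          using elim(2) ii i1N m a by (intro mult_left_mono) auto
        finally have 1: "norm (?q - v ?a) \<le> a / m * e" by simp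
        have "dist ?a r < d1" using r bb h by (auto simp: dist_real_def)
        then have 2: "norm (v ?a - v r) \<le> e" using d1(2)[of r ?a] r bb by (auto simp: dist_norm)
        have "norm (?q - v r) \<le> norm (?q - v ?a) + norm (v ?a - v r)"
          using norm_triangle_ineq[of "?q - v ?a" "v ?a - v r"] by simp
        then show ?thesis using 1 2 by (simp add: b_def algebra_simps)
      qed
      have pY: "norm (?p - (Y r - Y s)) \<le> 3 * e" if r: "r \<in> {?a..?b}" for r
      proof -
        have 1: "norm (?y (Suc (i0 + i)) - Y ?b) \<le> e" "norm (?y i0 - Y s) \<le> e"
          using y[of "Suc (i0 + i)"] y[of i0] ii i1N i01 ts by auto
        have "dist ?b r < d2" using r bb h by (auto simp: dist_real_def)
        then have 2: "norm (Y ?b - Y r) \<le> e" using d2(2)[of r ?b] r bb by (auto simp: dist_norm)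
        have "?p - (Y r - Y s) = (?y (Suc (i0 + i)) - Y ?b) + (Y ?b - Y r) - (?y i0 - Y s)" by simp
        also have "norm \<dots> \<le> (e + e) + e"
          by (intro order_trans[OF norm_triangle_ineq4] add_mono order_trans[OF norm_triangle_ineq] 1 2)
        finally show ?thesis by simp
      qed
      have pt: "norm (tensor ?p ?q - ?f r) \<le> e * K" if r: "r \<in> {?a..?b}" for r
      proof -
        have rT: "r \<in> {0..T}" using r bb by auto
        have q: "norm ?q \<le> B + b"
        proof -
          have "norm ?q \<le> norm (?q - v r) + norm (v r)" using norm_triangle_sub[of ?q "v r"] by simp
          also have "\<dots> \<le> b * 1 + B" using qv[OF r] B(2)[OF rT] mult_left_mono[OF e(2), of b] b by linarith
          finally show ?thesis by simp
        qed
        have "norm (Y r - Y s) \<le> norm (Y r) + norm (Y s)" by (rule norm_triangle_ineq4)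
        also have "\<dots> \<le> 2 * B'" using B'(2)[OF rT] B'(2)[of s] st by auto
        finally have YY: "norm (Y r - Y s) \<le> 2 * B'" .
        have "tensor ?p ?q - ?f r = tensor (?p - (Y r - Y s)) ?q + tensor (Y r - Y s) (?q - v r)"
        proof -
          have "tensor p q - tensor p' q' = tensor (p - p') q + tensor p' (q - q')" for p q p' q' :: "real^'n"
            by (simp add: tensor_simps)
          then show ?thesis .
        qed
        also have "norm \<dots> \<le> norm (?p - (Y r - Y s)) * norm ?q + norm (Y r - Y s) * norm (?q - v r)"
          by (metis norm_tensor norm_triangle_ineq)
        also have "\<dots> \<le> (3 * e) * (B + b) + (2 * B') * (b * e)"
          using pY[OF r] qv[OF r] q YY e B B' b by (intro add_mono mult_mono) auto
        finally show ?thesis by (simp add: K_def algebra_simps)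
      qed
      have "continuous_on {?a..?b} ?f"
        using bb by (intro cont_tensor continuous_intros contv' contY') auto
      from norm_const_minus_integral_le[OF this bb(2) pt]
      have "norm ((?b - ?a) *\<^sub>R tensor ?p ?q - integral {?a..?b} ?f) \<le> (e * K) * (?b - ?a)" .
      moreover have "(?b - ?a) *\<^sub>R tensor ?p ?q = tensor ?p ((h / m) *\<^sub>R (A *v scheme N (i0 + i)))"
        by (simp add: bb(4) tensor_simps)
      ultimately show ?thesis by simp
    qed
    have "norm ((\<Sum>i<i1 - i0. tensor (?y (Suc (i0 + i)) - ?y i0) ((h / m) *\<^sub>R (A *v scheme N (i0 + i))))
        - integral {?t (i0 + 0)..?t (i0 + (i1 - i0))} ?f) \<le> (e * K) * (?t (i0 + (i1 - i0)) - ?t (i0 + 0))"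
    proof (rule sum_integral_pieces[where \<tau>="\<lambda>i. ?t (i0 + i)"])
      show "continuous_on {?t (i0 + 0)..?t (i0 + (i1 - i0))} ?f"
        using st i01 ts by (intro cont_tensor continuous_intros contv' contY') auto
      show "?t (i0 + i) \<le> ?t (i0 + Suc i)" for i by (rule dyadic_le[OF T]) simp
    qed (use piece in simp)
    moreover have "(\<Sum>i<i1 - i0. tensor (?y (Suc (i0 + i)) - ?y i0) ((h / m) *\<^sub>R (A *v scheme N (i0 + i))))
        = euler_area A (T / 2 ^ N / m) (grid_noise N) i0 i1"
    proof -
      have "(\<Sum>i<i1 - i0. g (i0 + i)) = (\<Sum>i=i0..<i1. g i)" for g :: "nat \<Rightarrow> real^'n^'n"
        using i01 by (intro sum.reindex_bij_witness[of _ "\<lambda>i. i - i0" "\<lambda>i. i0 + i"]) auto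
      from this[of "\<lambda>i. tensor (?y (Suc i) - ?y i0) ((h / m) *\<^sub>R (A *v scheme N i))"]
      show ?thesis unfolding euler_area_def h_def .
    qed
    ultimately have "norm (euler_area A (T / 2 ^ N / m) (grid_noise N) i0 i1 - J s t) \<le> e * K * (t - s)"
      using i01 ts st by (simp add: J_integral)
    also have "\<dots> \<le> e * K * T" using st e K by (intro mult_left_mono) auto
    also have "\<dots> < \<epsilon>" by (rule e(3))
    finally show ?case by (simp add: dist_norm i0_def i1_def s_def t_def)
  qed
qed

end

end

section \<open>Passage to the limit\<close>

lemma langevin_path_AE:
  fixes A :: "real^'n^'n"
  assumes sol: "langevin_solution \<Omega> A W m X P" and bm: "brownian_motion \<Omega> W" and m: "m > 0"
    and a: "a > 0" "\<And>x. norm (A *v x) \<le> a * norm x"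
  shows "AE \<omega> in \<Omega>. langevin_path A m a (\<lambda>t. W t \<omega>) (\<lambda>t. P t \<omega>) (\<lambda>t. A *v X t \<omega>) (\<lambda>r. (1 / m) *\<^sub>R (A *v P r \<omega>))"
proof -
  have "AE \<omega> in \<Omega>. continuous_on {0..} (\<lambda>t. W t \<omega>)" using bm unfolding brownian_motion_def by blast
  moreover have "AE \<omega> in \<Omega>. X 0 \<omega> = 0 \<and> P 0 \<omega> = 0 \<and>
        continuous_on {0..} (\<lambda>t. X t \<omega>) \<and> continuous_on {0..} (\<lambda>t. P t \<omega>) \<and>
        (\<forall>t\<ge>0.
          X t \<omega> = X 0 \<omega> + integral {0..t} (\<lambda>r. (1 / m) *\<^sub>R P r \<omega>) \<and>
          P t \<omega> = P 0 \<omega> + integral {0..t} (\<lambda>r. - ((1 / m) *\<^sub>R (A *v P r \<omega>))) + (W t \<omega> - W 0 \<omega>))"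
    using sol unfolding langevin_solution_def by blast
  ultimately show ?thesis
  proof eventually_elim
    case (elim \<omega>)
    have cP: "continuous_on {0..t} (\<lambda>r. (1 / m) *\<^sub>R P r \<omega>)" for t
    proof -
      have "continuous_on {0..t} (\<lambda>r. P r \<omega>)" by (rule continuous_on_subset[of "{0..}"]) (use elim in auto)
      then show ?thesis by (intro continuous_intros)
    qed
    have Y: "A *v X t \<omega> = integral {0..t} (\<lambda>r. (1 / m) *\<^sub>R (A *v P r \<omega>))" if "0 \<le> t" for t
    proof -
      have "X t \<omega> = integral {0..t} (\<lambda>r. (1 / m) *\<^sub>R P r \<omega>)" using elim(2) that by simp
      then show ?thesis
        using integral_linear[OF integrable_continuous_interval[OF cP] matrix_vector_mul_bounded_linear[of A], of t]
        using m by (auto simp: o_def matrix_vector_mult_scaleR)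
    qed
    have "P t \<omega> = (W t \<omega> - W 0 \<omega>) - A *v X t \<omega>" if "0 \<le> t" for t
    proof -
      have "P t \<omega> = integral {0..t} (\<lambda>r. - ((1 / m) *\<^sub>R (A *v P r \<omega>))) + (W t \<omega> - W 0 \<omega>)"
        using elim(2) that by simp
      then show ?thesis unfolding Y[OF that] by (simp add: Henstock_Kurzweil_Integration.integral_neg)
    qed
    then show ?case using elim m a Y by unfold_locales auto
  qed
qed

text \<open>
  Finitely many sequences that converge in probability have a common subsequence that converges almost surely, by the
  Borel--Cantelli lemma. Several sequences at once are needed to compare the limits in Chen's relation.
\<close>

lemma (in prob_space) in_probability_subseq:
  fixes S :: "'j \<Rightarrow> nat \<Rightarrow> 'a \<Rightarrow> real"
  assumes Q: "finite Q"
    and meas: "\<And>j N. j \<in> Q \<Longrightarrow> S j N \<in> borel_measurable M" "\<And>j. j \<in> Q \<Longrightarrow> I j \<in> borel_measurable M"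
    and conv: "\<And>j \<epsilon>. j \<in> Q \<Longrightarrow> \<epsilon> > 0 \<Longrightarrow> \<exists>N0. \<forall>N\<ge>N0. measure M {\<omega> \<in> space M. \<bar>S j N \<omega> - I j \<omega>\<bar> > \<epsilon>} < \<epsilon>"
  shows "\<exists>r. (\<forall>k. k \<le> r k) \<and> (AE \<omega> in M. \<forall>j\<in>Q. (\<lambda>k. S j (r k) \<omega>) \<longlonglongrightarrow> I j \<omega>)"
proof -
  let ?A = "\<lambda>j N e. {\<omega> \<in> space M. \<bar>S j N \<omega> - I j \<omega>\<bar> > e}"
  have "\<exists>N\<ge>k. \<forall>j\<in>Q. measure M (?A j N ((1/2)^k)) < (1/2)^k" for k :: nat
  proof -
    have "\<forall>j. \<exists>N0. j \<in> Q \<longrightarrow> (\<forall>N\<ge>N0. measure M (?A j N ((1/2)^k)) < (1/2)^k)"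
      using conv[of _ "(1/2)^k"] by auto
    then obtain N0 where N0: "\<And>j N. j \<in> Q \<Longrightarrow> N \<ge> N0 j \<Longrightarrow> measure M (?A j N ((1/2)^k)) < (1/2)^k" by metis
    define N where "N = k + (\<Sum>j\<in>Q. N0 j)"
    have "N \<ge> N0 j" if "j \<in> Q" for j using member_le_sum[of j Q N0] that Q by (simp add: N_def)
    then show ?thesis using N0 by (intro exI[of _ N]) (auto simp: N_def)
  qed
  then obtain r where r: "\<And>k. k \<le> r k" "\<And>k j. j \<in> Q \<Longrightarrow> measure M (?A j (r k) ((1/2)^k)) < (1/2)^k"
    by metis
  have "AE \<omega> in M. (\<lambda>k. S j (r k) \<omega>) \<longlonglongrightarrow> I j \<omega>" if j: "j \<in> Q" for j
  proof -
    note [measurable] = meas(1)[OF j] meas(2)[OF j]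
    have "AE \<omega> in M. \<forall>\<^sub>F k in sequentially. \<omega> \<in> space M - ?A j (r k) ((1/2)^k)"
    proof (rule borel_cantelli_AE1)
      show "summable (\<lambda>k. measure M (?A j (r k) ((1/2)^k)))"
        by (rule summable_comparison_test'[where g="\<lambda>k. (1/2)^k" and N=0])
          (use r(2)[OF j] in \<open>auto intro: less_imp_le\<close>)
    qed (auto simp: emeasure_eq_measure)
    then show ?thesis
    proof eventually_elim
      case (elim \<omega>)
      have "(\<lambda>k. S j (r k) \<omega> - I j \<omega>) \<longlonglongrightarrow> 0"
      proof (rule Lim_null_comparison)
        show "\<forall>\<^sub>F k in sequentially. norm (S j (r k) \<omega> - I j \<omega>) \<le> (1/2)^k"
          using elim by eventually_elim auto
        show "(\<lambda>k. (1/2::real)^k) \<longlonglongrightarrow> 0" by (rule LIMSEQ_realpow_zero) auto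
      qed
      then show ?case by (rule LIM_zero_cancel)
    qed
  qed
  then have "AE \<omega> in M. \<forall>j\<in>Q. (\<lambda>k. S j (r k) \<omega>) \<longlonglongrightarrow> I j \<omega>" using Q by (simp add: AE_finite_all)
  then show ?thesis using r(1) by blast
qed

definition trapezoid_area :: "(nat \<Rightarrow> real^'n) \<Rightarrow> nat \<Rightarrow> nat \<Rightarrow> real^'n^'n" where
  "trapezoid_area x i0 i1 =
     (\<Sum>i=i0..<i1. tensor (\<Sum>j=i0..<i. x j) (x i)) + (1 / 2) *\<^sub>R (\<Sum>i=i0..<i1. tensor (x i) (x i))"

lemma trapezoid_area_chen:
  assumes "i0 \<le> i1" "i1 \<le> i2"
  shows "trapezoid_area x i0 i2 = trapezoid_area x i0 i1 + trapezoid_area x i1 i2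
    + tensor (\<Sum>j=i0..<i1. x j) (\<Sum>j=i1..<i2. x j)"
  using assms(2)
proof (induction i2 rule: dec_induct)
  case base
  then show ?case by (simp add: trapezoid_area_def tensor_simps)
next
  case (step i)
  have "(\<Sum>j=i0..<i. x j) = (\<Sum>j=i0..<i1. x j) + (\<Sum>j=i1..<i. x j)"
    using assms(1) step(1) by (simp add: sum.atLeastLessThan_concat)
  then show ?case using step assms(1)
    by (simp add: trapezoid_area_def tensor_simps scaleR_add_right algebra_simps)
qed

lemma euler_defect_trapezoid:
  "euler_defect A \<Gamma> e h x i0 i1 = euler_area A e x i0 i1 - trapezoid_area x i0 i1 - (real (i1 - i0) * h) *\<^sub>R \<Gamma>"
  by (simp add: euler_defect_def trapezoid_area_def)

lemma borel_measurable_tensor: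
  fixes f g :: "'a \<Rightarrow> real^'n"
  assumes "f \<in> borel_measurable M" "g \<in> borel_measurable M"
  shows "(\<lambda>\<omega>. tensor (f \<omega>) (g \<omega>)) \<in> borel_measurable M"
  using assms
  by (rule borel_measurable_continuous_Pair)
    (intro bounded_bilinear.continuous_on[OF tensor_bilinear] continuous_intros)

locale langevin_setting = prob_space +
  fixes A :: "real^'n^'n" and W :: "real \<Rightarrow> 'a \<Rightarrow> real^'n" and WW :: "real \<Rightarrow> real \<Rightarrow> 'a \<Rightarrow> real^'n^'n"
    and X P :: "real \<Rightarrow> real \<Rightarrow> 'a \<Rightarrow> real^'n" and T :: real
  assumes T: "T > 0" and ev: "eigenvalues_pos_real_part A" and bm: "brownian_motion M W"
    and sol: "\<And>m. m > 0 \<Longrightarrow> langevin_solution M A W m (X m) (P m)"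
    and area: "stratonovich_area M T W WW"
begin

definition \<xi> :: "nat \<Rightarrow> nat \<Rightarrow> 'a \<Rightarrow> real^'n" where
  "\<xi> N j \<omega> = W (dyadic T N (Suc j)) \<omega> - W (dyadic T N j) \<omega>"

lemma W_measurable: "0 \<le> t \<Longrightarrow> W t \<in> borel_measurable M"
  using bm unfolding brownian_motion_def by blast

lemma dyadic_nonneg: "0 \<le> dyadic T N k"
  using T by (simp add: dyadic_def)

lemma xi_measurable [measurable]: "\<xi> N j \<in> borel_measurable M"
  unfolding \<xi>_def by (intro borel_measurable_diff W_measurable dyadic_nonneg)

lemma xi_noise: "noise_steps M (gauss_const CARD('n)) n (T / 2 ^ N) (\<xi> N)"
  unfolding \<xi>_def dyadic_def by (rule brownian_noise_steps[OF bm]) (use T in simp)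

lemma xi_sum: "i0 \<le> i1 \<Longrightarrow> (\<Sum>j=i0..<i1. \<xi> N j \<omega>) = W (dyadic T N i1) \<omega> - W (dyadic T N i0) \<omega>"
  unfolding \<xi>_def by (rule sum_Suc_diff')

lemma trapezoid_measurable: "(\<lambda>\<omega>. trapezoid_area (\<lambda>j. \<xi> N j \<omega>) i0 i1) \<in> borel_measurable M"
  unfolding trapezoid_area_def
  by (intro borel_measurable_add borel_measurable_scaleR borel_measurable_const borel_measurable_sum
      borel_measurable_tensor xi_measurable)

lemma matrix_entry_measurable: "(\<lambda>X::real^'n^'n. X $ a $ b) \<in> borel_measurable borel"
  by (intro borel_measurable_continuous_onI continuous_intros)

lemma WW_entry_measurable:
  assumes "0 \<le> s" "s \<le> t" "t \<le> T"
  shows "(\<lambda>\<omega>. WW s t \<omega> $ a $ b) \<in> borel_measurable M"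
  using area assms unfolding stratonovich_area_def has_stratonovich_integral_def by blast

text \<open>
  The trapezoidal sums on the dyadic grid are instances of the sums that define the Stratonovich integral.
\<close>

lemma trapezoid_in_probability:
  assumes k: "k \<le> l" "l \<le> 2 ^ n" and \<epsilon>: "\<epsilon> > 0"
  shows "\<exists>N0. \<forall>N\<ge>N0. measure M {\<omega> \<in> space M.
     \<bar>trapezoid_area (\<lambda>j. \<xi> N j \<omega>) (k * 2 ^ (N - n)) (l * 2 ^ (N - n)) $ a $ b
        - WW (dyadic T n k) (dyadic T n l) \<omega> $ a $ b\<bar> > \<epsilon>} < \<epsilon>"
proof -
  define s where "s = dyadic T n k"
  define t where "t = dyadic T n l"
  have st: "0 \<le> s" "s \<le> t" "t \<le> T"
    using dyadic_bounds[OF T, of l n] k dyadic_le[OF T k(1), of n] dyadic_nonneg by (auto simp: s_def t_def)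
  have "has_stratonovich_integral M (\<lambda>r \<omega>. W r \<omega> $ a - W s \<omega> $ a) (\<lambda>r \<omega>. W r \<omega> $ b) s t (\<lambda>\<omega>. WW s t \<omega> $ a $ b)"
    using area st unfolding stratonovich_area_def by blast
  then obtain \<delta> where \<delta>: "\<delta> > 0" "\<And>kk \<tau>. partition_mesh s t \<delta> kk \<tau> \<Longrightarrow>
     measure M {\<omega> \<in> space M.
          \<bar>(\<Sum>i<kk. ((W (\<tau> i) \<omega> $ a - W s \<omega> $ a) + (W (\<tau> (Suc i)) \<omega> $ a - W s \<omega> $ a)) / 2 * (W (\<tau> (Suc i)) \<omega> $ b - W (\<tau> i) \<omega> $ b)) - WW s t \<omega> $ a $ b\<bar> > \<epsilon>}
        < \<epsilon>"
    using \<epsilon> unfolding has_stratonovich_integral_def by blast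
  have "(\<lambda>N. T / 2 ^ N) \<longlonglongrightarrow> 0"
    by (rule dyadic_mesh_tendsto)
  then have "\<forall>\<^sub>F N in sequentially. T / 2 ^ N < \<delta>" using \<delta>(1) by (rule order_tendstoD)
  then have "\<forall>\<^sub>F N in sequentially. T / 2 ^ N < \<delta> \<and> n \<le> N" by (intro eventually_conj eventually_ge_at_top)
  then obtain N0 where N0: "\<And>N. N \<ge> N0 \<Longrightarrow> T / 2 ^ N < \<delta> \<and> n \<le> N" unfolding eventually_sequentially by blast
  show ?thesis
  proof (intro exI[of _ N0] allI impI)
    fix N assume "N0 \<le> N"
    then have N: "T / 2 ^ N < \<delta>" "n \<le> N" using N0 by auto
    define i0 where "i0 = k * 2 ^ (N - n)"
    define i1 where "i1 = l * 2 ^ (N - n)"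
    have i01: "i0 \<le> i1" using k by (simp add: i0_def i1_def)
    have ts: "dyadic T N i0 = s" "dyadic T N i1 = t" by (simp_all add: i0_def i1_def s_def t_def dyadic_refine[OF N(2)])
    define \<tau> where "\<tau> i = dyadic T N (i0 + i)" for i
    have pm: "partition_mesh s t \<delta> (i1 - i0) \<tau>"
      unfolding partition_mesh_def \<tau>_def using i01 ts N(1) dyadic_Suc[of T N "i0 + i" for i]
      by (auto intro!: dyadic_le[OF T])
    have eq: "(\<Sum>i<i1 - i0. ((W (\<tau> i) \<omega> $ a - W s \<omega> $ a) + (W (\<tau> (Suc i)) \<omega> $ a - W s \<omega> $ a)) / 2 * (W (\<tau> (Suc i)) \<omega> $ b - W (\<tau> i) \<omega> $ b))
      = trapezoid_area (\<lambda>j. \<xi> N j \<omega>) i0 i1 $ a $ b" for \<omega>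
    proof -
      let ?g = "\<lambda>i. (\<Sum>j=i0..<i. \<xi> N j \<omega>) $ a * \<xi> N i \<omega> $ b + (1 / 2) * (\<xi> N i \<omega> $ a * \<xi> N i \<omega> $ b)"
      have "trapezoid_area (\<lambda>j. \<xi> N j \<omega>) i0 i1 $ a $ b = (\<Sum>i=i0..<i1. ?g i)"
        by (simp add: trapezoid_area_def tensor_def sum_component sum.distrib sum_distrib_left)
      also have "\<dots> = (\<Sum>i<i1 - i0. ?g (i0 + i))"
        using i01 by (intro sum.reindex_bij_witness[of _ "\<lambda>i. i0 + i" "\<lambda>i. i - i0"]) auto
      also have "\<dots> = (\<Sum>i<i1 - i0. ((W (\<tau> i) \<omega> $ a - W s \<omega> $ a) + (W (\<tau> (Suc i)) \<omega> $ a - W s \<omega> $ a)) / 2 * (W (\<tau> (Suc i)) \<omega> $ b - W (\<tau> i) \<omega> $ b))"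
      proof (rule sum.cong[OF refl])
        fix i
        have "?g (i0 + i) = (W (\<tau> i) \<omega> $ a - W s \<omega> $ a) * (W (\<tau> (Suc i)) \<omega> $ b - W (\<tau> i) \<omega> $ b)
           + (1 / 2) * ((W (\<tau> (Suc i)) \<omega> $ a - W (\<tau> i) \<omega> $ a) * (W (\<tau> (Suc i)) \<omega> $ b - W (\<tau> i) \<omega> $ b))"
          by (simp only: xi_sum[OF le_add1] ts) (simp add: \<xi>_def \<tau>_def)
        then show "?g (i0 + i) = ((W (\<tau> i) \<omega> $ a - W s \<omega> $ a) + (W (\<tau> (Suc i)) \<omega> $ a - W s \<omega> $ a)) / 2 * (W (\<tau> (Suc i)) \<omega> $ b - W (\<tau> i) \<omega> $ b)"
          by (simp add: field_simps)
      qed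
      finally show ?thesis by simp
    qed
    show "measure M {\<omega> \<in> space M.
     \<bar>trapezoid_area (\<lambda>j. \<xi> N j \<omega>) (k * 2 ^ (N - n)) (l * 2 ^ (N - n)) $ a $ b
        - WW (dyadic T n k) (dyadic T n l) \<omega> $ a $ b\<bar> > \<epsilon>} < \<epsilon>"
      using \<delta>(2)[OF pm] unfolding eq by (simp add: i0_def i1_def s_def t_def)
  qed
qed

lemma trapezoid_subseq:
  assumes Q: "finite Q" "\<forall>(k, l)\<in>Q. k \<le> l \<and> l \<le> 2 ^ n"
  shows "\<exists>r. (\<forall>i. i \<le> r i) \<and> (AE \<omega> in M. \<forall>(k, l)\<in>Q.
    (\<lambda>i. trapezoid_area (\<lambda>j. \<xi> (r i) j \<omega>) (k * 2 ^ (r i - n)) (l * 2 ^ (r i - n))) \<longlonglongrightarrow> WW (dyadic T n k) (dyadic T n l) \<omega>)"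
proof -
  define S where "S q N \<omega> = (case q of ((k, l), a, b) \<Rightarrow> trapezoid_area (\<lambda>j. \<xi> N j \<omega>) (k * 2 ^ (N - n)) (l * 2 ^ (N - n)) $ a $ b)"
    for q :: "(nat \<times> nat) \<times> 'n \<times> 'n" and N \<omega>
  define I where "I q \<omega> = (case q of ((k, l), a, b) \<Rightarrow> WW (dyadic T n k) (dyadic T n l) \<omega> $ a $ b)"
    for q :: "(nat \<times> nat) \<times> 'n \<times> 'n" and \<omega>
  have "\<exists>r. (\<forall>i. i \<le> r i) \<and> (AE \<omega> in M. \<forall>q\<in>Q \<times> UNIV. (\<lambda>i. S q (r i) \<omega>) \<longlonglongrightarrow> I q \<omega>)"
  proof (rule in_probability_subseq)
    show "finite (Q \<times> (UNIV :: ('n \<times> 'n) set))" using Q by simp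
  next
    fix q :: "(nat \<times> nat) \<times> 'n \<times> 'n" and N
    obtain k l a b where q: "q = ((k, l), a, b)" by (metis surj_pair)
    show "S q N \<in> borel_measurable M"
      unfolding S_def q by simp (rule measurable_compose[OF trapezoid_measurable matrix_entry_measurable])
  next
    fix q :: "(nat \<times> nat) \<times> 'n \<times> 'n" assume "q \<in> Q \<times> UNIV"
    then obtain k l a b where q: "q = ((k, l), a, b)" "(k, l) \<in> Q" by auto
    have kl: "k \<le> l" "l \<le> 2 ^ n" using Q(2) q(2) by auto
    show "I q \<in> borel_measurable M"
      unfolding I_def q using dyadic_bounds[OF T kl(2)] dyadic_le[OF T kl(1), of n] dyadic_nonneg
      by (simp add: WW_entry_measurable)
    fix \<epsilon> :: real assume \<epsilon>: "\<epsilon> > 0"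
    show "\<exists>N0. \<forall>N\<ge>N0. measure M {\<omega> \<in> space M. \<epsilon> < \<bar>S q N \<omega> - I q \<omega>\<bar>} < \<epsilon>"
      unfolding S_def I_def q using trapezoid_in_probability[OF kl \<epsilon>, of a b] by simp
  qed
  then obtain r where r: "\<forall>i. i \<le> r i" "AE \<omega> in M. \<forall>q\<in>Q \<times> UNIV. (\<lambda>i. S q (r i) \<omega>) \<longlonglongrightarrow> I q \<omega>" by blast
  have "AE \<omega> in M. \<forall>(k, l)\<in>Q.
    (\<lambda>i. trapezoid_area (\<lambda>j. \<xi> (r i) j \<omega>) (k * 2 ^ (r i - n)) (l * 2 ^ (r i - n))) \<longlonglongrightarrow> WW (dyadic T n k) (dyadic T n l) \<omega>"
    using r(2)
  proof eventually_elim
    case (elim \<omega>)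
    show ?case
    proof (intro ballI, clarify, intro vec_tendstoI)
      fix k l a b assume "(k, l) \<in> Q"
      then have "(\<lambda>i. S ((k, l), a, b) (r i) \<omega>) \<longlonglongrightarrow> I ((k, l), a, b) \<omega>" using elim by blast
      then show "(\<lambda>i. trapezoid_area (\<lambda>j. \<xi> (r i) j \<omega>) (k * 2 ^ (r i - n)) (l * 2 ^ (r i - n)) $ a $ b)
          \<longlonglongrightarrow> WW (dyadic T n k) (dyadic T n l) \<omega> $ a $ b" by (simp add: S_def I_def)
    qed
  qed
  then show ?thesis using r(1) by blast
qed

text \<open>
  The Stratonovich integrals over different intervals are versions chosen separately, so Chen's relation holds only
  almost surely for each triple of times. It is inherited from the trapezoidal sums; the dyadic triples are
  countably many, hence there is a common null set.
\<close>

lemma WW_chen: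
  "AE \<omega> in M. \<forall>n i j k. i \<le> j \<longrightarrow> j \<le> k \<longrightarrow> k \<le> 2 ^ n \<longrightarrow>
    WW (dyadic T n i) (dyadic T n k) \<omega> - WW (dyadic T n i) (dyadic T n j) \<omega> - WW (dyadic T n j) (dyadic T n k) \<omega>
    = tensor (W (dyadic T n j) \<omega> - W (dyadic T n i) \<omega>) (W (dyadic T n k) \<omega> - W (dyadic T n j) \<omega>)"
proof -
  have "AE \<omega> in M. i \<le> j \<longrightarrow> j \<le> k \<longrightarrow> k \<le> 2 ^ n \<longrightarrow>
    WW (dyadic T n i) (dyadic T n k) \<omega> - WW (dyadic T n i) (dyadic T n j) \<omega> - WW (dyadic T n j) (dyadic T n k) \<omega>
    = tensor (W (dyadic T n j) \<omega> - W (dyadic T n i) \<omega>) (W (dyadic T n k) \<omega> - W (dyadic T n j) \<omega>)" for n i j k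
  proof (cases "i \<le> j \<and> j \<le> k \<and> k \<le> 2 ^ n")
    case True
    let ?Q = "{(i, k), (i, j), (j, k)}"
    have Qp: "\<forall>(k, l)\<in>?Q. k \<le> l \<and> l \<le> 2 ^ n" using True by auto
    have fin: "finite ?Q" by simp
    from trapezoid_subseq[OF fin Qp]
    obtain r where r: "\<forall>i. i \<le> r i" "AE \<omega> in M. \<forall>(k, l)\<in>?Q.
      (\<lambda>i. trapezoid_area (\<lambda>j. \<xi> (r i) j \<omega>) (k * 2 ^ (r i - n)) (l * 2 ^ (r i - n))) \<longlonglongrightarrow> WW (dyadic T n k) (dyadic T n l) \<omega>"
      by (elim exE conjE) (rule that)
    show ?thesis using r(2)
    proof eventually_elim
      case (elim \<omega>)
      let ?S = "\<lambda>a b q. trapezoid_area (\<lambda>j. \<xi> (r q) j \<omega>) (a * 2 ^ (r q - n)) (b * 2 ^ (r q - n))"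
      have "(\<lambda>q. ?S i k q - ?S i j q - ?S j k q) \<longlonglongrightarrow>
         WW (dyadic T n i) (dyadic T n k) \<omega> - WW (dyadic T n i) (dyadic T n j) \<omega> - WW (dyadic T n j) (dyadic T n k) \<omega>"
        using elim by (intro tendsto_diff) auto
      moreover have "\<forall>\<^sub>F q in sequentially. ?S i k q - ?S i j q - ?S j k q
         = tensor (W (dyadic T n j) \<omega> - W (dyadic T n i) \<omega>) (W (dyadic T n k) \<omega> - W (dyadic T n j) \<omega>)"
        using eventually_ge_at_top[of n]
      proof eventually_elim
        case (elim q)
        then have nq: "n \<le> r q" using r(1) order_trans by blast
        have le: "i * 2 ^ (r q - n) \<le> j * 2 ^ (r q - n)" "j * 2 ^ (r q - n) \<le> k * 2 ^ (r q - n)" using True by auto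
        show ?case unfolding trapezoid_area_chen[OF le] xi_sum[OF le(1)] xi_sum[OF le(2)] dyadic_refine[OF nq] by simp
      qed
      ultimately have "(\<lambda>q. tensor (W (dyadic T n j) \<omega> - W (dyadic T n i) \<omega>) (W (dyadic T n k) \<omega> - W (dyadic T n j) \<omega>)) \<longlonglongrightarrow>
         WW (dyadic T n i) (dyadic T n k) \<omega> - WW (dyadic T n i) (dyadic T n j) \<omega> - WW (dyadic T n j) (dyadic T n k) \<omega>"
        by (rule Lim_transform_eventually)
      then show ?case by (simp add: LIMSEQ_const_iff)
    qed
  qed auto
  then show ?thesis by (simp add: AE_all_countable)
qed

lemma WW_diag: "AE \<omega> in M. \<forall>n k. k \<le> 2 ^ n \<longrightarrow> WW (dyadic T n k) (dyadic T n k) \<omega> = 0"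
  using WW_chen
proof eventually_elim
  case (elim \<omega>)
  show ?case
  proof (intro allI impI)
    fix n k :: nat assume "k \<le> 2 ^ n"
    then have "- WW (dyadic T n k) (dyadic T n k) \<omega> = 0" using elim[rule_format, of k k k n] by (simp add: tensor_simps)
    then show "WW (dyadic T n k) (dyadic T n k) \<omega> = 0" by simp
  qed
qed

end

lemma eventually_dyadic_mesh:
  assumes "e > 0" shows "\<forall>\<^sub>F N in sequentially. T / 2 ^ N < (e::real)"
proof -
  have "(\<lambda>N. T / 2 ^ N) \<longlonglongrightarrow> 0"
    by (rule dyadic_mesh_tendsto)
  then show ?thesis using assms by (rule order_tendstoD)
qed

context langevin_setting
begin

lemma euler_noise_constants:
  obtains c K e0 \<kappa> a where "euler_noise M A (cov_mat A) c K e0 \<kappa> a"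
proof -
  obtain c K e0 where d: "c > 0" "K > 0" "e0 > 0"
    "\<And>e. 0 < e \<Longrightarrow> e \<le> e0 \<Longrightarrow> c * e < 1"
    "\<And>e k x. 0 < e \<Longrightarrow> e \<le> e0 \<Longrightarrow>
        norm (((\<lambda>x. x - e *\<^sub>R (A *v x)) ^^ k) x) \<le> K * (1 - c * e) ^ k * norm x"
    using euler_decay[OF ev] by blast
  obtain \<kappa> where k: "\<kappa> > 0" "\<And>X. norm X \<le> \<kappa> * norm (lyap A X)"
    using lyap_bounded_below[OF ev] by blast
  obtain a1 where a1: "\<And>x. norm (A *v x) \<le> norm x * a1"
    using bounded_linear.bounded[OF matrix_vector_mul_bounded_linear[of A]] by blast
  have bl: "bounded_linear (\<lambda>X::real^'n^'n. A ** X)"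
    by (rule bounded_bilinear.bounded_linear_right[OF bounded_bilinear_matrix_mult])
  obtain a2 where a2: "\<And>X::real^'n^'n. norm (A ** X) \<le> norm X * a2"
    using bounded_linear.bounded[OF bl] by blast
  have bl2: "bounded_linear (\<lambda>X::real^'n^'n. A ** X ** transpose A)"
    by (rule bounded_linear_compose[OF bounded_bilinear.bounded_linear_left[OF bounded_bilinear_matrix_mult] bl])
  obtain a3 where a3: "\<And>X::real^'n^'n. norm (A ** X ** transpose A) \<le> norm X * a3"
    using bounded_linear.bounded[OF bl2] by blast
  define a where "a = \<bar>a1\<bar> + \<bar>a2\<bar> + \<bar>a3\<bar> + 1"
  have le: "x \<le> a * y" if "x \<le> y * b" "b \<in> {a1, a2, a3}" "0 \<le> y" for x y b
  proof -
    have "b \<le> a" using that(2) by (auto simp: a_def)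
    then have "y * b \<le> y * a" using that(3) by (rule mult_left_mono)
    then show ?thesis using that(1) by (simp add: mult.commute)
  qed
  have "euler_noise M A (cov_mat A) c K (min e0 1) \<kappa> a"
    using d k lyap_cov_mat[OF ev] le[OF a1] le[OF a2] le[OF a3]
    by unfold_locales (auto simp: a_def)
  then show ?thesis by (rule that)
qed

lemma W_incr_moment:
  assumes p: "p \<ge> 1"
  shows "moment_bound M p (\<lambda>\<omega>. W (dyadic T n (Suc k)) \<omega> - W (dyadic T n k) \<omega>) (gauss_const CARD('n) p * sqrt (T / 2 ^ n))"
  using noise_stepsD(5)[OF xi_noise[of "Suc k" n], of k p] p by (simp add: \<xi>_def[abs_def])

lemma grid_noise_xi: "langevin_path.grid_noise (\<lambda>t. W t \<omega>) T N = (\<lambda>j. \<xi> N j \<omega>)"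
  if "langevin_path A m a (\<lambda>t. W t \<omega>) P' Y' v'"
  using langevin_path.grid_noise_def[OF that T, of N] by (auto simp: \<xi>_def)

lemma refine_len: "n \<le> N \<Longrightarrow> real (Suc k * 2 ^ (N - n) - k * 2 ^ (N - n)) * (T / 2 ^ N) = T / 2 ^ n"
proof -
  assume "n \<le> N"
  then have "(2::real) ^ N = 2 ^ n * 2 ^ (N - n)" by (simp add: power_add[symmetric])
  then show ?thesis by simp
qed

lemma refine_le: fixes k :: nat shows "n \<le> N \<Longrightarrow> k \<le> 2 ^ n \<Longrightarrow> k * 2 ^ (N - n) \<le> 2 ^ N"
proof -
  assume a: "n \<le> N" "k \<le> 2 ^ n"
  then have "k * 2 ^ (N - n) \<le> 2 ^ n * 2 ^ (N - n)" by simp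
  also have "\<dots> = 2 ^ N" using a by (simp add: power_add[symmetric])
  finally show ?thesis .
qed

text \<open>
  The bounds for the Euler scheme, transported by Fatou's lemma; the grid is refined while \<open>m\<close> stays fixed.
\<close>

lemma P_incr_moment:
  assumes p: "p \<ge> 1"
  shows "\<exists>B>0. \<forall>m n k. 0 < m \<longrightarrow> k < 2 ^ n \<longrightarrow>
     moment_bound M p (\<lambda>\<omega>. P m (dyadic T n (Suc k)) \<omega> - P m (dyadic T n k) \<omega>) (B * sqrt m) \<and>
     moment_bound M p (\<lambda>\<omega>. P m (dyadic T n (Suc k)) \<omega> - P m (dyadic T n k) \<omega>) (B * sqrt (T / 2 ^ n))"
proof -
  obtain c K e0 \<kappa> a where en: "euler_noise M A (cov_mat A) c K e0 \<kappa> a" by (rule euler_noise_constants)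
  interpret E: euler_noise M A "cov_mat A" c K e0 \<kappa> a "gauss_const CARD('n)" by (rule en)
  obtain B where B: "B > 0" "\<And>n h m \<xi> i0 i1. E.regime n h m \<xi> \<Longrightarrow> i0 \<le> i1 \<Longrightarrow> i1 \<le> n \<Longrightarrow>
      moment_bound M p (\<lambda>\<omega>. euler A (h / m) (\<lambda>j. \<xi> j \<omega>) i1 - euler A (h / m) (\<lambda>j. \<xi> j \<omega>) i0) (B * sqrt (real (i1 - i0) * h)) \<and>
      moment_bound M p (\<lambda>\<omega>. euler A (h / m) (\<lambda>j. \<xi> j \<omega>) i1 - euler A (h / m) (\<lambda>j. \<xi> j \<omega>) i0) (B * sqrt m)"
    using E.mom_incr_moment[OF p] by blast
  have "moment_bound M p (\<lambda>\<omega>. P m (dyadic T n (Suc k)) \<omega> - P m (dyadic T n k) \<omega>) (B * sqrt m) \<and>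
     moment_bound M p (\<lambda>\<omega>. P m (dyadic T n (Suc k)) \<omega> - P m (dyadic T n k) \<omega>) (B * sqrt (T / 2 ^ n))"
    if m: "0 < m" and k: "k < 2 ^ n" for m n k
  proof -
    define Z where "Z N \<omega> = euler A (T / 2 ^ N / m) (\<lambda>j. \<xi> N j \<omega>) (Suc k * 2 ^ (N - n)) - euler A (T / 2 ^ N / m) (\<lambda>j. \<xi> N j \<omega>) (k * 2 ^ (N - n))" for N \<omega>
    have Zm: "Z N \<in> borel_measurable M" for N
      unfolding Z_def
      by (intro borel_measurable_diff measurable_past_imp[OF E.mom_past]) auto
    have Zl: "AE \<omega> in M. (\<lambda>N. Z N \<omega>) \<longlonglongrightarrow> P m (dyadic T n (Suc k)) \<omega> - P m (dyadic T n k) \<omega>"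
      using langevin_path_AE[OF sol[OF m] bm m E.pos(6) E.A_vec]
    proof eventually_elim
      case (elim \<omega>)
      show ?case unfolding Z_def
        using langevin_path.euler_tendsto[OF elim T, of k n] langevin_path.euler_tendsto[OF elim T, of "Suc k" n] k
        by (intro tendsto_diff) (simp_all add: grid_noise_xi[OF elim])
    qed
    have "\<forall>\<^sub>F N in sequentially. moment_bound M p (Z N) (B * sqrt m) \<and> moment_bound M p (Z N) (B * sqrt (T / 2 ^ n))"
      using eventually_dyadic_mesh[OF mult_pos_pos[OF E.pos(3) m], of T] eventually_ge_at_top[of n]
    proof eventually_elim
      case (elim N)
      have R: "E.regime (2 ^ N) (T / 2 ^ N) m (\<xi> N)" unfolding E.regime_def using xi_noise elim m by auto
      have le: "k * 2 ^ (N - n) \<le> Suc k * 2 ^ (N - n)" "Suc k * 2 ^ (N - n) \<le> 2 ^ N"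
        using refine_le[OF elim(2), of "Suc k"] k by auto
      show ?case using B(2)[OF R le] unfolding Z_def refine_len[OF elim(2)] by blast
    qed
    then have "\<forall>\<^sub>F N in sequentially. moment_bound M p (Z N) (B * sqrt m)"
      "\<forall>\<^sub>F N in sequentially. moment_bound M p (Z N) (B * sqrt (T / 2 ^ n))"
      by (auto elim: eventually_mono)
    then show ?thesis using moment_bound_fatou[OF Zm _ p Zl] by blast
  qed
  then show ?thesis using B(1) by blast
qed

definition area_error :: "real \<Rightarrow> real \<Rightarrow> real \<Rightarrow> 'a \<Rightarrow> real^'n^'n" where
  "area_error m s t \<omega> = rs_integral (\<lambda>r. A *v X m r \<omega> - A *v X m s \<omega>) (\<lambda>r. A *v X m r \<omega>) s t - corrected_area A WW s t \<omega>"

text \<open>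
  By the Lyapunov equation. The right-hand side is the form in which the drift arises, \<open>I/2\<close> being the difference between
  the Ito and the Stratonovich integral.
\<close>

lemma correction_eq:
  "(1 / 2) *\<^sub>R (A ** cov_mat A - cov_mat A ** transpose A) = A ** cov_mat A - (1 / 2) *\<^sub>R mat 1"
proof -
  have "cov_mat A ** transpose A = mat 1 - A ** cov_mat A"
    using lyap_cov_mat[OF ev] by (simp add: lyap_def algebra_simps)
  then have "A ** cov_mat A - cov_mat A ** transpose A = 2 *\<^sub>R (A ** cov_mat A) - mat 1"
    by (simp add: scaleR_2)
  then show ?thesis by (simp add: scaleR_right_diff_distrib)
qed

text \<open>
  Fatou's lemma along the subsequence on which the trapezoidal sums converge almost surely.
\<close>

lemma area_error_moment:
  assumes p: "p \<ge> 1"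
  shows "\<exists>B>0. \<forall>m n k. 0 < m \<longrightarrow> k < 2 ^ n \<longrightarrow>
     (T / 2 ^ n \<le> m \<longrightarrow> moment_bound M p (area_error m (dyadic T n k) (dyadic T n (Suc k))) (B * (T / 2 ^ n))) \<and>
     (m \<le> T / 2 ^ n \<longrightarrow> moment_bound M p (area_error m (dyadic T n k) (dyadic T n (Suc k))) (B * (sqrt m * sqrt (T / 2 ^ n))))"
proof -
  let ?\<Gamma> = "A ** cov_mat A - (1 / 2) *\<^sub>R mat 1"
  obtain c K e0 \<kappa> a where en: "euler_noise M A (cov_mat A) c K e0 \<kappa> a" by (rule euler_noise_constants)
  interpret E: euler_noise M A "cov_mat A" c K e0 \<kappa> a "gauss_const CARD('n)" by (rule en)
  obtain B1 where B1: "B1 > 0" "\<And>n h m \<xi> i0 i1. E.regime n h m \<xi> \<Longrightarrow> i0 < i1 \<Longrightarrow> i1 \<le> n \<Longrightarrow> real (i1 - i0) * h \<le> m \<Longrightarrow>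
      moment_bound M p (\<lambda>\<omega>. euler_defect A ?\<Gamma> (h / m) h (\<lambda>j. \<xi> j \<omega>) i0 i1) (B1 * (real (i1 - i0) * h))"
    using E.defect_small[OF p] by blast
  obtain B2 where B2: "B2 > 0" "\<And>n h m \<xi> i0 i1. E.regime n h m \<xi> \<Longrightarrow> i0 < i1 \<Longrightarrow> i1 \<le> n \<Longrightarrow> m \<le> real (i1 - i0) * h \<Longrightarrow>
      (h / m)\<^sup>2 * (real (i1 - i0) * h) \<le> m \<Longrightarrow>
      moment_bound M p (\<lambda>\<omega>. euler_defect A ?\<Gamma> (h / m) h (\<lambda>j. \<xi> j \<omega>) i0 i1)
        (B2 * (sqrt m * sqrt (real (i1 - i0) * h)))"
    using E.defect_large[OF p] by blast
  define B where "B = B1 + B2"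
  have main: "moment_bound M p (area_error m (dyadic T n k) (dyadic T n (Suc k))) x"
    if m: "0 < m" and k: "k < 2 ^ n"
      and x: "\<forall>\<^sub>F N in sequentially. moment_bound M p (\<lambda>\<omega>. euler_defect A ?\<Gamma> (T / 2 ^ N / m) (T / 2 ^ N) (\<lambda>j. \<xi> N j \<omega>) (k * 2 ^ (N - n)) (Suc k * 2 ^ (N - n))) x"
    for m n k x
  proof -
    let ?s = "dyadic T n k" and ?t = "dyadic T n (Suc k)"
    have Sk: "Suc k \<le> 2 ^ n" "k \<le> Suc k" using k by auto
    have st: "0 \<le> ?s" "?s \<le> ?t" using dyadic_nonneg dyadic_le[OF T Sk(2)] by auto
    let ?Z = "\<lambda>N \<omega>. euler_defect A ?\<Gamma> (T / 2 ^ N / m) (T / 2 ^ N) (\<lambda>j. \<xi> N j \<omega>) (k * 2 ^ (N - n)) (Suc k * 2 ^ (N - n))"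
    have em: "(\<lambda>\<omega>. euler A e (\<lambda>j. \<xi> N j \<omega>) i) \<in> borel_measurable M" for e N i
      by (rule measurable_past_imp[OF E.mom_past]) auto
    have Avec: "(*v) A \<in> borel_measurable borel"
      by (intro borel_measurable_continuous_onI linear_continuous_on matrix_vector_mul_bounded_linear)
    have Zm: "?Z N \<in> borel_measurable M" for N
      unfolding euler_defect_trapezoid euler_area_def euler_pos_def
      by (intro borel_measurable_diff borel_measurable_sum borel_measurable_tensor trapezoid_measurable
          borel_measurable_const borel_measurable_scaleR em measurable_compose[OF em Avec] xi_measurable)
    have "\<exists>r. (\<forall>i. i \<le> r i) \<and> (AE \<omega> in M. \<forall>(k, l)\<in>{(k, Suc k)}.
      (\<lambda>i. trapezoid_area (\<lambda>j. \<xi> (r i) j \<omega>) (k * 2 ^ (r i - n)) (l * 2 ^ (r i - n))) \<longlonglongrightarrow> WW (dyadic T n k) (dyadic T n l) \<omega>)"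
      by (rule trapezoid_subseq) (use Sk in auto)
    then obtain r where r: "\<And>i. i \<le> r i" "AE \<omega> in M.
      (\<lambda>i. trapezoid_area (\<lambda>j. \<xi> (r i) j \<omega>) (k * 2 ^ (r i - n)) (Suc k * 2 ^ (r i - n))) \<longlonglongrightarrow> WW ?s ?t \<omega>"
      by auto
    have rtop: "filterlim r at_top sequentially"
      by (rule filterlim_at_top_mono[OF filterlim_ident]) (use r(1) in auto)
    have lim: "AE \<omega> in M. (\<lambda>i. ?Z (r i) \<omega>) \<longlonglongrightarrow> area_error m ?s ?t \<omega>"
      using langevin_path_AE[OF sol[OF m] bm m E.pos(6) E.A_vec] r(2)
    proof eventually_elim
      case (elim \<omega>)
      interpret L: langevin_path A m a "\<lambda>t. W t \<omega>" "\<lambda>t. P m t \<omega>" "\<lambda>t. A *v X m t \<omega>" "\<lambda>r. (1 / m) *\<^sub>R (A *v P m r \<omega>)"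
        by (rule elim(1))
      have "(\<lambda>i. euler_area A (T / 2 ^ r i / m) (\<lambda>j. \<xi> (r i) j \<omega>) (k * 2 ^ (r i - n)) (Suc k * 2 ^ (r i - n))) \<longlonglongrightarrow> L.J ?s ?t"
        using filterlim_compose[OF L.euler_area_tendsto[OF T Sk(2,1)] rtop]
        unfolding grid_noise_xi[OF elim(1)] .
      moreover have "(\<lambda>i. (real (Suc k * 2 ^ (r i - n) - k * 2 ^ (r i - n)) * (T / 2 ^ r i)) *\<^sub>R ?\<Gamma>) \<longlonglongrightarrow> (T / 2 ^ n) *\<^sub>R ?\<Gamma>"
      proof (rule tendsto_eventually)
        show "\<forall>\<^sub>F i in sequentially. (real (Suc k * 2 ^ (r i - n) - k * 2 ^ (r i - n)) * (T / 2 ^ r i)) *\<^sub>R ?\<Gamma> = (T / 2 ^ n) *\<^sub>R ?\<Gamma>"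
          using eventually_ge_at_top[of n]
        proof eventually_elim
          case (elim i)
          then have "n \<le> r i" using r(1)[of i] by simp
          then show ?case by (simp only: refine_len)
        qed
      qed
      ultimately have "(\<lambda>i. ?Z (r i) \<omega>) \<longlonglongrightarrow> L.J ?s ?t - WW ?s ?t \<omega> - (T / 2 ^ n) *\<^sub>R ?\<Gamma>"
        unfolding euler_defect_trapezoid using elim(2) by (intro tendsto_diff)
      moreover have "L.J ?s ?t - WW ?s ?t \<omega> - (T / 2 ^ n) *\<^sub>R ?\<Gamma> = area_error m ?s ?t \<omega>"
        unfolding area_error_def corrected_area_def correction_eq L.rs_integral_J[OF st] dyadic_Suc by simp
      ultimately show ?case by simp
    qed
    have xr: "\<forall>\<^sub>F i in sequentially. moment_bound M p (?Z (r i)) x"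
      using eventually_compose_filterlim[OF x rtop] .
    show "moment_bound M p (\<lambda>\<omega>. area_error m ?s ?t \<omega>) x"
      by (rule moment_bound_fatou[OF Zm xr p lim])
  qed
  have "(T / 2 ^ n \<le> m \<longrightarrow> moment_bound M p (area_error m (dyadic T n k) (dyadic T n (Suc k))) (B * (T / 2 ^ n))) \<and>
     (m \<le> T / 2 ^ n \<longrightarrow> moment_bound M p (area_error m (dyadic T n k) (dyadic T n (Suc k))) (B * (sqrt m * sqrt (T / 2 ^ n))))"
    if m: "0 < m" and k: "k < 2 ^ n" for m n k
  proof -
    \<comment> \<open>Steps below \<open>e1\<close> are stable and satisfy the smallness condition of \<open>defect_large\<close> for all times up to \<open>T\<close>.\<close>
    define e1 where "e1 = min (e0 * m) (m * (m / T))"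
    have e1: "e1 > 0" using m T E.pos by (simp add: e1_def)
    have ev: "\<forall>\<^sub>F N in sequentially. E.regime (2 ^ N) (T / 2 ^ N) m (\<xi> N) \<and> (T / 2 ^ N / m)\<^sup>2 * (T / 2 ^ n) \<le> m \<and> n \<le> N"
      using eventually_dyadic_mesh[OF e1, of T] eventually_ge_at_top[of n]
    proof eventually_elim
      case (elim N)
      have R: "E.regime (2 ^ N) (T / 2 ^ N) m (\<xi> N)" unfolding E.regime_def using xi_noise elim(1) m by (auto simp: e1_def)
      define e where "e = T / 2 ^ N / m"
      have e: "0 < e" "e \<le> 1" using E.regimeD[OF R] by (auto simp: e_def)
      have eT: "e \<le> m / T" using elim(1) m T by (simp add: e1_def e_def field_simps)
      have "e\<^sup>2 * (T / 2 ^ n) \<le> e * T"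
      proof (rule mult_mono)
        show "e\<^sup>2 \<le> e" using e by (simp add: power2_eq_square mult_left_le)
        show "T / 2 ^ n \<le> T" using dyadic_bounds[OF T, of 1 n] by (simp add: dyadic_def)
      qed (use e T in auto)
      also have "\<dots> \<le> m / T * T" using eT T by (intro mult_right_mono) auto
      finally show ?case using R elim(2) T by (simp add: e_def)
    qed
    show ?thesis
    proof (intro conjI impI)
      assume tm: "T / 2 ^ n \<le> m"
      show "moment_bound M p (area_error m (dyadic T n k) (dyadic T n (Suc k))) (B * (T / 2 ^ n))"
      proof (rule main[OF m k])
        show "\<forall>\<^sub>F N in sequentially. moment_bound M p (\<lambda>\<omega>. euler_defect A ?\<Gamma> (T / 2 ^ N / m) (T / 2 ^ N) (\<lambda>j. \<xi> N j \<omega>) (k * 2 ^ (N - n)) (Suc k * 2 ^ (N - n))) (B * (T / 2 ^ n))"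
          using ev
        proof eventually_elim
          case (elim N)
          then have nN: "n \<le> N" by simp
          have le: "k * 2 ^ (N - n) < Suc k * 2 ^ (N - n)" "Suc k * 2 ^ (N - n) \<le> 2 ^ N"
            using refine_le[OF nN, of "Suc k"] k by auto
          have "moment_bound M p (\<lambda>\<omega>. euler_defect A ?\<Gamma> (T / 2 ^ N / m) (T / 2 ^ N) (\<lambda>j. \<xi> N j \<omega>) (k * 2 ^ (N - n)) (Suc k * 2 ^ (N - n))) (B1 * (T / 2 ^ n))"
            using B1(2)[of "2 ^ N" "T / 2 ^ N" m "\<xi> N", OF _ le] elim tm unfolding refine_len[OF nN] by blast
          then show ?case by (rule moment_bound_le) (use B2(1) T in \<open>simp add: B_def divide_right_mono mult_right_mono\<close>)
        qed
      qed
    next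
      assume tm: "m \<le> T / 2 ^ n"
      show "moment_bound M p (area_error m (dyadic T n k) (dyadic T n (Suc k))) (B * (sqrt m * sqrt (T / 2 ^ n)))"
      proof (rule main[OF m k])
        show "\<forall>\<^sub>F N in sequentially. moment_bound M p (\<lambda>\<omega>. euler_defect A ?\<Gamma> (T / 2 ^ N / m) (T / 2 ^ N) (\<lambda>j. \<xi> N j \<omega>) (k * 2 ^ (N - n)) (Suc k * 2 ^ (N - n))) (B * (sqrt m * sqrt (T / 2 ^ n)))"
          using ev
        proof eventually_elim
          case (elim N)
          then have nN: "n \<le> N" by simp
          have le: "k * 2 ^ (N - n) < Suc k * 2 ^ (N - n)" "Suc k * 2 ^ (N - n) \<le> 2 ^ N"
            using refine_le[OF nN, of "Suc k"] k by auto
          have "moment_bound M p (\<lambda>\<omega>. euler_defect A ?\<Gamma> (T / 2 ^ N / m) (T / 2 ^ N) (\<lambda>j. \<xi> N j \<omega>) (k * 2 ^ (N - n)) (Suc k * 2 ^ (N - n))) (B2 * (sqrt m * sqrt (T / 2 ^ n)))"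
            using B2(2)[of "2 ^ N" "T / 2 ^ N" m "\<xi> N", OF _ le] elim tm unfolding refine_len[OF nN] by blast
          then show ?case by (rule moment_bound_le) (intro mult_right_mono, use B1(1) m T in \<open>auto simp: B_def\<close>)
        qed
      qed
    qed
  qed
  moreover have "B > 0" using B1(1) B2(1) by (simp add: B_def)
  ultimately show ?thesis by blast
qed

end

section \<open>The rate of convergence\<close>

text \<open>
  From the exponent \<open>2 p\<close> down to \<open>q\<close>, using \<open>u powr q \<le> 1 + u\<^sup>2\<^sup>p\<close> for the majorant divided by \<open>x\<close>.
\<close>

lemma (in prob_space) Lq_norm_le_moment_bound:
  fixes V :: "'a \<Rightarrow> 'b::real_normed_vector"
  assumes V: "moment_bound M p V x" and x: "x > 0" and q: "1 \<le> q" "q \<le> 2 * real p"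
    and f: "AE \<omega> in M. f \<omega> \<le> ennreal (norm (V \<omega>))"
  shows "Lq_norm M q f \<le> ennreal (2 * x)"
proof -
  obtain U where [measurable]: "U \<in> borel_measurable M" and U: "\<And>\<omega>. 0 \<le> U \<omega>" "AE \<omega> in M. norm (V \<omega>) \<le> U \<omega>"
    "(\<integral>\<^sup>+ \<omega>. ennreal (U \<omega> ^ (2 * p)) \<partial>M) \<le> ennreal (x ^ (2 * p))"
    using V unfolding moment_bound_def by blast
  have pw: "u powr q \<le> 1 + u ^ (2 * p)" if "u \<ge> 0" for u :: real
  proof (cases "u \<le> 1")
    case True
    then have "u powr q \<le> 1" using that q by (intro powr_le1) auto
    then show ?thesis using that by (simp add: add_increasing2)
  next
    case False
    then have "u powr q \<le> u powr (real (2 * p))" using q by (intro powr_mono) auto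
    also have "\<dots> = u ^ (2 * p)" using False by (intro powr_realpow) auto
    finally show ?thesis by simp
  qed
  define c where "c = x powr q"
  have c: "c > 0" using x by (simp add: c_def)
  have "(\<integral>\<^sup>+ \<omega>. enn_powr (f \<omega>) q \<partial>M) \<le> (\<integral>\<^sup>+ \<omega>. ennreal c + ennreal (c / x ^ (2 * p)) * ennreal (U \<omega> ^ (2 * p)) \<partial>M)"
  proof (rule nn_integral_mono_AE)
    show "AE \<omega> in M. enn_powr (f \<omega>) q \<le> ennreal c + ennreal (c / x ^ (2 * p)) * ennreal (U \<omega> ^ (2 * p))"
      using f U(2)
    proof eventually_elim
      case (elim \<omega>)
      have fU: "f \<omega> \<le> ennreal (U \<omega>)" using elim by (meson ennreal_leI order_trans)
      then have fin: "f \<omega> \<noteq> \<infinity>" by (auto simp: top_unique)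
      have "enn2real (f \<omega>) \<le> U \<omega>" using enn2real_mono[OF fU] U(1) by simp
      then have "enn2real (f \<omega>) powr q \<le> U \<omega> powr q" using q by (intro powr_mono2) auto
      also have "U \<omega> powr q = c * (U \<omega> / x) powr q" using x U(1)[of \<omega>] by (simp add: c_def powr_divide)
      also have "\<dots> \<le> c * (1 + (U \<omega> / x) ^ (2 * p))" using c x U(1)[of \<omega>] by (intro mult_left_mono pw) auto
      also have "\<dots> = c + c / x ^ (2 * p) * U \<omega> ^ (2 * p)" by (simp add: power_divide algebra_simps)
      finally have "ennreal (enn2real (f \<omega>) powr q) \<le> ennreal (c + c / x ^ (2 * p) * U \<omega> ^ (2 * p))" by (rule ennreal_leI)
      also have "\<dots> = ennreal c + ennreal (c / x ^ (2 * p)) * ennreal (U \<omega> ^ (2 * p))"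
        using c x U(1)[of \<omega>] by (simp add: ennreal_mult[symmetric] ennreal_plus[symmetric] del: ennreal_plus)
      finally show ?case using fin by (simp add: enn_powr_def)
    qed
  qed
  also have "\<dots> = ennreal c + ennreal (c / x ^ (2 * p)) * (\<integral>\<^sup>+ \<omega>. ennreal (U \<omega> ^ (2 * p)) \<partial>M)"
    by (subst nn_integral_add) (auto simp: nn_integral_cmult emeasure_space_1)
  also have "\<dots> \<le> ennreal c + ennreal (c / x ^ (2 * p)) * ennreal (x ^ (2 * p))"
    by (intro add_left_mono mult_left_mono U(3)) auto
  also have "\<dots> = ennreal (2 * c)"
    using c x by (simp add: ennreal_mult[symmetric] ennreal_plus[symmetric] del: ennreal_plus)
  finally have I: "(\<integral>\<^sup>+ \<omega>. enn_powr (f \<omega>) q \<partial>M) \<le> ennreal (2 * c)" .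
  let ?I = "\<integral>\<^sup>+ \<omega>. enn_powr (f \<omega>) q \<partial>M"
  have fin: "?I \<noteq> \<infinity>" using I by (auto simp: top_unique)
  have "enn2real ?I \<le> 2 * c" using enn2real_mono[OF I] c by simp
  then have "enn2real ?I powr (1 / q) \<le> (2 * c) powr (1 / q)" using q by (intro powr_mono2) auto
  also have "\<dots> = 2 powr (1 / q) * x" using x q by (simp add: powr_mult c_def powr_powr)
  also have "\<dots> \<le> 2 powr 1 * x" using x q by (intro mult_right_mono powr_mono) auto
  finally show ?thesis using fin unfolding Lq_norm_def by (simp add: enn_powr_def ennreal_leI)
qed

lemma hoelder_sup_le:
  assumes "\<And>s t. 0 \<le> s \<Longrightarrow> s < t \<Longrightarrow> t \<le> T \<Longrightarrow> norm (R s t) \<le> c * (t - s) powr \<beta>"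
  shows "hoelder_sup T \<beta> R \<le> ennreal c"
  unfolding hoelder_sup_def
proof (rule SUP_least, clarify)
  fix s t :: real assume st: "0 \<le> s" "s < t" "t \<le> T"
  then have "norm (R s t) / \<bar>t - s\<bar> powr \<beta> \<le> c"
    using assms[OF st] by (simp add: divide_le_eq)
  then show "ennreal (norm (R s t) / \<bar>t - s\<bar> powr \<beta>) \<le> ennreal c" by (rule ennreal_leI)
qed

text \<open>
  Together the two bounds say that \<open>sqrt (min m h)\<close> is at most \<open>m powr (1/2 - b) * h powr b\<close>: a power of \<open>h\<close> is traded for a
  power of \<open>m\<close>. The next lemma does the same for the second level.
\<close>

lemma interpolate_sqrt:
  fixes m h b :: real
  assumes "m > 0" "h > 0" "0 \<le> b" "b \<le> 1/2"
  shows "h \<le> m \<Longrightarrow> sqrt h \<le> m powr (1/2 - b) * h powr b"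
    and "m \<le> h \<Longrightarrow> sqrt m \<le> m powr (1/2 - b) * h powr b"
proof -
  assume "h \<le> m"
  have "sqrt h = h powr (1/2 - b) * h powr b" using assms by (simp add: powr_add[symmetric] powr_half_sqrt)
  also have "\<dots> \<le> m powr (1/2 - b) * h powr b" using assms \<open>h \<le> m\<close> by (intro mult_right_mono powr_mono2) auto
  finally show "sqrt h \<le> m powr (1/2 - b) * h powr b" .
next
  assume "m \<le> h"
  have "sqrt m = m powr (1/2 - b) * m powr b" using assms by (simp add: powr_add[symmetric] powr_half_sqrt)
  also have "\<dots> \<le> m powr (1/2 - b) * h powr b" using assms \<open>m \<le> h\<close> by (intro mult_left_mono powr_mono2) auto
  finally show "sqrt m \<le> m powr (1/2 - b) * h powr b" .
qed

lemma interpolate_area: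
  fixes m h b :: real
  assumes "m > 0" "m \<le> 1" "h > 0" "1/4 \<le> b" "b \<le> 1/2"
  shows "h \<le> m \<Longrightarrow> h \<le> m powr (1/2 - b) * h powr (2 * b)"
    and "m \<le> h \<Longrightarrow> sqrt m * sqrt h \<le> m powr (1/2 - b) * h powr (2 * b)"
proof -
  have mm: "m powr (1 - 2 * b) \<le> m powr (1/2 - b)" using assms by (intro powr_mono') auto
  {
    assume "h \<le> m"
    have "h = h powr (1 - 2 * b) * h powr (2 * b)" using assms by (simp add: powr_add[symmetric])
    also have "\<dots> \<le> m powr (1 - 2 * b) * h powr (2 * b)" using assms \<open>h \<le> m\<close> by (intro mult_right_mono powr_mono2) auto
    also have "\<dots> \<le> m powr (1/2 - b) * h powr (2 * b)" using mm by (rule mult_right_mono) simp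
    finally show "h \<le> m powr (1/2 - b) * h powr (2 * b)" .
  next
    assume "m \<le> h"
    have "sqrt m * sqrt h = m powr (1 - 2 * b) * (m powr (2 * b - 1/2) * h powr (1/2))"
      using assms by (simp add: powr_add[symmetric] powr_half_sqrt mult.assoc[symmetric])
    also have "\<dots> \<le> m powr (1 - 2 * b) * (h powr (2 * b - 1/2) * h powr (1/2))"
      using assms \<open>m \<le> h\<close> by (intro mult_left_mono mult_right_mono powr_mono2) auto
    also have "\<dots> = m powr (1 - 2 * b) * h powr (2 * b)" using assms by (simp add: powr_add[symmetric])
    also have "\<dots> \<le> m powr (1/2 - b) * h powr (2 * b)" using mm by (rule mult_right_mono) simp
    finally show "sqrt m * sqrt h \<le> m powr (1/2 - b) * h powr (2 * b)" .
  }
qed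

lemma increment_hoelder:
  fixes f :: "real \<Rightarrow> 'b::real_normed_vector"
  assumes T: "T > 0" and \<alpha>: "\<alpha> > 0" and U: "U \<ge> 0" and f: "continuous_on {0..T} f"
    and step: "\<And>n k. k < 2 ^ n \<Longrightarrow> norm (f (dyadic T n (Suc k)) - f (dyadic T n k)) \<le> U * (T / 2 ^ n) powr \<alpha>"
    and st: "0 \<le> s" "s \<le> t" "t \<le> T"
  shows "norm (f t - f s) \<le> 2 * 2 powr \<alpha> / (1 - 2 powr (- (\<alpha> / 2))) * U * (t - s) powr \<alpha>"
proof (cases "s = t")
  case False
  interpret dyadic_chain "\<lambda>s t. f t - f s" T "\<alpha> / 2" U 0
    using T \<alpha> U step by unfold_locales auto
  let ?S = "{p :: real \<times> real. 0 \<le> fst p \<and> fst p \<le> snd p \<and> snd p \<le> T}"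
  have "continuous_on ?S (\<lambda>p. f (fst p))" "continuous_on ?S (\<lambda>p. f (snd p))"
    by (rule continuous_on_compose2[OF f]; force intro: continuous_intros)+
  then have "continuous_on {(s, t). 0 \<le> s \<and> s \<le> t \<and> t \<le> T} (\<lambda>(s, t). f t - f s)"
    unfolding case_prod_unfold by (intro continuous_intros)
  from hoelder_bound[OF this] show ?thesis using st False by simp
qed simp

context langevin_setting
begin

text \<open>
  The pathwise half of the argument. The defect of additivity of the area error is, by Chen's relation for both second
  levels, the difference of \<open>(w - x) \<otimes> (w' - x')\<close> and \<open>w \<otimes> w'\<close> for increments \<open>w, w'\<close> of \<open>W\<close> and \<open>x, x'\<close> of \<open>P\<close>. Every
  term of it contains an increment of \<open>P\<close>, hence the factor \<open>UP\<close>, which is small with \<open>m\<close>.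
\<close>

lemma rough_dist_pathwise:
  assumes m: "m > 0" and \<alpha>: "\<alpha> > 0"
    and U0: "UP \<ge> 0" "UW \<ge> 0" "UD \<ge> 0"
    and L: "langevin_path A m a (\<lambda>t. W t \<omega>) (\<lambda>t. P m t \<omega>) (\<lambda>t. A *v X m t \<omega>) (\<lambda>r. (1 / m) *\<^sub>R (A *v P m r \<omega>))"
    and chen: "\<forall>n i j k. i \<le> j \<longrightarrow> j \<le> k \<longrightarrow> k \<le> 2 ^ n \<longrightarrow>
      WW (dyadic T n i) (dyadic T n k) \<omega> - WW (dyadic T n i) (dyadic T n j) \<omega> - WW (dyadic T n j) (dyadic T n k) \<omega>
      = tensor (W (dyadic T n j) \<omega> - W (dyadic T n i) \<omega>) (W (dyadic T n k) \<omega> - W (dyadic T n j) \<omega>)"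
    and WW0: "\<forall>n k. k \<le> 2 ^ n \<longrightarrow> WW (dyadic T n k) (dyadic T n k) \<omega> = 0"
    and WWc: "continuous_on {(s, t). 0 \<le> s \<and> s \<le> t \<and> t \<le> T} (\<lambda>(s, t). WW s t \<omega>)"
    and sP: "\<forall>n k. k < 2 ^ n \<longrightarrow> norm (P m (dyadic T n (Suc k)) \<omega> - P m (dyadic T n k) \<omega>) \<le> UP * (T / 2 ^ n) powr \<alpha>"
    and sW: "\<forall>n k. k < 2 ^ n \<longrightarrow> norm (W (dyadic T n (Suc k)) \<omega> - W (dyadic T n k) \<omega>) \<le> UW * (T / 2 ^ n) powr \<alpha>"
    and sD: "\<forall>n k. k < 2 ^ n \<longrightarrow> norm (area_error m (dyadic T n k) (dyadic T n (Suc k)) \<omega>) \<le> UD * (T / 2 ^ n) powr (2 * \<alpha>)"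
    and C1: "C1 = 2 * 2 powr \<alpha> / (1 - 2 powr (- (\<alpha> / 2)))"
    and C2: "C2 = 2 * 2 powr (2 * \<alpha>) / (1 - 2 powr (- \<alpha>))"
  shows "rough_dist T \<alpha> (\<lambda>t. A *v X m t \<omega>) (\<lambda>t. W t \<omega>) (\<lambda>s t. corrected_area A WW s t \<omega>)
    \<le> ennreal (C1 * UP + C2 * (UD + C1\<^sup>2 * (UP * (2 * UW + UP))))"
proof -
  interpret L: langevin_path A m a "\<lambda>t. W t \<omega>" "\<lambda>t. P m t \<omega>" "\<lambda>t. A *v X m t \<omega>" "\<lambda>r. (1 / m) *\<^sub>R (A *v P m r \<omega>)"
    by (rule L)
  let ?Y = "\<lambda>t. A *v X m t \<omega>" and ?P = "\<lambda>t. P m t \<omega>" and ?W = "\<lambda>t. W t \<omega>"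
  let ?\<Gamma> = "A ** cov_mat A - (1 / 2) *\<^sub>R mat 1"
  have "2 powr (- \<alpha>) < (2::real) powr 0" "2 powr (- (\<alpha> / 2)) < (2::real) powr 0" using \<alpha> by (intro powr_less_mono; simp)+
  then have C: "C1 \<ge> 0" "C2 \<ge> 0" unfolding C1 C2 by auto
  have hP: "norm (?P t - ?P s) \<le> C1 * UP * (t - s) powr \<alpha>" if "0 \<le> s" "s \<le> t" "t \<le> T" for s t
    unfolding C1
    by (rule increment_hoelder[OF T \<alpha> U0(1) continuous_on_subset[OF L.contP] _ that]) (use sP in auto)
  have hW: "norm (?W t - ?W s) \<le> C1 * UW * (t - s) powr \<alpha>" if "0 \<le> s" "s \<le> t" "t \<le> T" for s t
    unfolding C1
    by (rule increment_hoelder[OF T \<alpha> U0(2) continuous_on_subset[OF L.contw] _ that]) (use sW in auto)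
  have Yinc: "?Y t - ?Y s = (?W t - ?W s) - (?P t - ?P s)" if "0 \<le> s" "s \<le> t" for s t
    using L.P[of s] L.P[of t] that by simp
  have ae: "area_error m s t \<omega> = L.J s t - WW s t \<omega> - (t - s) *\<^sub>R ?\<Gamma>" if "0 \<le> s" "s \<le> t" for s t
    unfolding area_error_def corrected_area_def correction_eq L.rs_integral_J[OF that] by simp
  define G where "G = C1\<^sup>2 * (UP * (2 * UW + UP))"
  have G: "G \<ge> 0" using U0 by (simp add: G_def)
  interpret D: dyadic_chain "\<lambda>s t. area_error m s t \<omega>" T \<alpha> UD G
  proof
    fix N k :: nat assume k: "k \<le> 2 ^ N"
    show "area_error m (dyadic T N k) (dyadic T N k) \<omega> = 0"
      using WW0 k dyadic_nonneg[of N k] by (simp add: ae L.J_def tensor_simps)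
  next
    fix N i j k :: nat assume ijk: "i \<le> j" "j \<le> k" "k \<le> 2 ^ N"
    define s where "s = dyadic T N i"
    define u where "u = dyadic T N j"
    define t where "t = dyadic T N k"
    have o: "0 \<le> s" "s \<le> u" "u \<le> t" "t \<le> T" "0 \<le> u" "s \<le> t" "u \<le> T"
      using dyadic_nonneg[of N i] dyadic_nonneg[of N j] dyadic_le[OF T ijk(1), of N] dyadic_le[OF T ijk(2), of N] dyadic_bounds[OF T ijk(3)]
      by (auto simp: s_def u_def t_def)
    let ?x = "?P u - ?P s" and ?y = "?P t - ?P u" and ?v = "?W u - ?W s" and ?w = "?W t - ?W u"
    have cw: "WW s t \<omega> - WW s u \<omega> - WW u t \<omega> = tensor ?v ?w" using chen ijk by (simp add: s_def u_def t_def)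
    have "area_error m s t \<omega> - area_error m s u \<omega> - area_error m u t \<omega>
       = (L.J s t - L.J s u - L.J u t) - (WW s t \<omega> - WW s u \<omega> - WW u t \<omega>)"
      using o by (simp add: ae scaleR_left_diff_distrib)
    also have "\<dots> = tensor (?v - ?x) (?w - ?y) - tensor ?v ?w"
      unfolding L.J_chen cw using o by (simp only: Yinc)
    also have "\<dots> = - (tensor ?x ?w + tensor ?v ?y - tensor ?x ?y)"
      by (simp add: tensor_simps)
    finally have eq: "area_error m s t \<omega> - area_error m s u \<omega> - area_error m u t \<omega> = \<dots>" .
    have "norm (area_error m s t \<omega> - area_error m s u \<omega> - area_error m u t \<omega>) \<le> (norm ?x * norm ?w + norm ?v * norm ?y) + norm ?x * norm ?y"
      unfolding eq norm_minus_cancel norm_tensor[symmetric]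
      by (intro order_trans[OF norm_triangle_ineq4] add_mono norm_triangle_ineq order_refl)
    also have "\<dots> \<le> (C1 * UP * (u - s) powr \<alpha> * (C1 * UW * (t - u) powr \<alpha>)
        + C1 * UW * (u - s) powr \<alpha> * (C1 * UP * (t - u) powr \<alpha>))
        + C1 * UP * (u - s) powr \<alpha> * (C1 * UP * (t - u) powr \<alpha>)"
      using o C U0 by (intro add_mono mult_mono hP hW) auto
    also have "\<dots> = G * (u - s) powr \<alpha> * (t - u) powr \<alpha>"
      by (simp add: G_def power2_eq_square algebra_simps)
    finally show "norm (area_error m (dyadic T N i) (dyadic T N k) \<omega> - area_error m (dyadic T N i) (dyadic T N j) \<omega>
        - area_error m (dyadic T N j) (dyadic T N k) \<omega>)
        \<le> G * (dyadic T N j - dyadic T N i) powr \<alpha> * (dyadic T N k - dyadic T N j) powr \<alpha>"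
      by (simp add: s_def u_def t_def)
  qed (use T \<alpha> U0 G sD in auto)
  have cont: "continuous_on {(s, t). 0 \<le> s \<and> s \<le> t \<and> t \<le> T} (\<lambda>(s, t). area_error m s t \<omega>)"
  proof (rule continuous_on_eq)
    show "continuous_on {(s, t). 0 \<le> s \<and> s \<le> t \<and> t \<le> T} (\<lambda>p. (case p of (s, t) \<Rightarrow> L.J s t) - (case p of (s, t) \<Rightarrow> WW s t \<omega>) - (snd p - fst p) *\<^sub>R ?\<Gamma>)"
      by (intro continuous_intros L.J_cont WWc)
  qed (auto simp: ae)
  have "hoelder_sup T \<alpha> (\<lambda>s t. (?Y t - ?Y s) - (?W t - ?W s)) \<le> ennreal (C1 * UP)"
    by (rule hoelder_sup_le) (use hP in \<open>simp add: Yinc norm_minus_commute\<close>)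
  moreover have "hoelder_sup T (2 * \<alpha>) (\<lambda>s t. rs_integral (\<lambda>r. ?Y r - ?Y s) ?Y s t - corrected_area A WW s t \<omega>) \<le> ennreal (C2 * (UD + G))"
    using D.hoelder_bound[OF cont] unfolding area_error_def C2 by (intro hoelder_sup_le)
  ultimately show ?thesis unfolding rough_dist_def G_def[symmetric]
    using C U0 G by (subst ennreal_plus) (auto intro!: add_mono)
qed

text \<open>
  The random constants \<open>UP\<close> and \<open>UD\<close> carry the factor \<open>\<mu> = m powr (1/2 - \<beta>)\<close>, while \<open>UW\<close> does not depend on \<open>m\<close>. First level increments
  are controlled with the exponent \<open>4 p\<close>, because the pathwise bound contains their products.
\<close>

theorem rough_dist_rate:
  assumes \<alpha>: "1/3 < \<alpha>" "\<alpha> < \<beta>" "\<beta> < 1/2" and q: "q \<ge> 1"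
  shows "\<exists>K>0. \<forall>m. 0 < m \<longrightarrow> m \<le> 1 \<longrightarrow>
    Lq_norm M q (\<lambda>\<omega>. rough_dist T \<alpha> (\<lambda>t. A *v X m t \<omega>) (\<lambda>t. W t \<omega>) (\<lambda>s t. corrected_area A WW s t \<omega>))
      \<le> ennreal (K * m powr (1/2 - \<beta>))"
proof -
  define r where "r = 1 / (\<beta> - \<alpha>)"
  have r: "r > 0" using \<alpha> by (simp add: r_def)
  obtain p :: nat where p0: "q + r + 1 < real p" using reals_Archimedean2 by blast
  have p: "p \<ge> 1" "2 * p \<ge> 1" "q \<le> 2 * real p" using p0 r q by auto
  have "r < real p" using p0 q by linarith
  then have "1 / (\<beta> - \<alpha>) < real p" by (simp add: r_def)
  then have p\<beta>: "1 < real p * (\<beta> - \<alpha>)" using \<alpha> by (simp add: field_simps)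
  have chain1: "1 < 2 * real (2 * p) * (\<beta> - \<alpha>)" "1 < 2 * real p * (2 * \<beta> - 2 * \<alpha>)"
    using p\<beta> by (simp_all add: algebra_simps)
  obtain D1 where D1: "D1 > 0" "\<And>(R :: nat \<Rightarrow> nat \<Rightarrow> 'a \<Rightarrow> real^'n) c. 0 \<le> c \<Longrightarrow>
      (\<And>n k. k < 2 ^ n \<Longrightarrow> moment_bound M (2 * p) (R n k) (c * (T / 2 ^ n) powr \<beta>)) \<Longrightarrow>
      (\<exists>U. (\<forall>\<omega>. 0 \<le> U \<omega>) \<and> moment_bound M (2 * p) U (D1 * c) \<and>
         (AE \<omega> in M. \<forall>n k. k < 2 ^ n \<longrightarrow> norm (R n k \<omega>) \<le> U \<omega> * (T / 2 ^ n) powr \<alpha>))"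
    using dyadic_sup_moment[OF T p(2) chain1(1)] by blast
  obtain D2 where D2: "D2 > 0" "\<And>(R :: nat \<Rightarrow> nat \<Rightarrow> 'a \<Rightarrow> real^'n^'n) c. 0 \<le> c \<Longrightarrow>
      (\<And>n k. k < 2 ^ n \<Longrightarrow> moment_bound M p (R n k) (c * (T / 2 ^ n) powr (2 * \<beta>))) \<Longrightarrow>
      (\<exists>U. (\<forall>\<omega>. 0 \<le> U \<omega>) \<and> moment_bound M p U (D2 * c) \<and>
         (AE \<omega> in M. \<forall>n k. k < 2 ^ n \<longrightarrow> norm (R n k \<omega>) \<le> U \<omega> * (T / 2 ^ n) powr (2 * \<alpha>)))"
    using dyadic_sup_moment[OF T p(1) chain1(2)] by blast
  obtain B1 where B1: "B1 > 0" "\<And>m n k. 0 < m \<Longrightarrow> k < 2 ^ n \<Longrightarrow>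
     moment_bound M (2 * p) (\<lambda>\<omega>. P m (dyadic T n (Suc k)) \<omega> - P m (dyadic T n k) \<omega>) (B1 * sqrt m) \<and>
     moment_bound M (2 * p) (\<lambda>\<omega>. P m (dyadic T n (Suc k)) \<omega> - P m (dyadic T n k) \<omega>) (B1 * sqrt (T / 2 ^ n))"
    using P_incr_moment[OF p(2)] by blast
  obtain B3 where B3: "B3 > 0" "\<And>m n k. 0 < m \<Longrightarrow> k < 2 ^ n \<Longrightarrow>
     (T / 2 ^ n \<le> m \<longrightarrow> moment_bound M p (area_error m (dyadic T n k) (dyadic T n (Suc k))) (B3 * (T / 2 ^ n))) \<and>
     (m \<le> T / 2 ^ n \<longrightarrow> moment_bound M p (area_error m (dyadic T n k) (dyadic T n (Suc k))) (B3 * (sqrt m * sqrt (T / 2 ^ n))))"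
    using area_error_moment[OF p(1)] by blast
  define B2 where "B2 = \<bar>gauss_const CARD('n) (2 * p)\<bar> * T powr (1/2 - \<beta>)"
  have B2: "B2 \<ge> 0" by (simp add: B2_def)
  have h: "T / 2 ^ n > 0" "T / 2 ^ n \<le> T" for n
    using T dyadic_bounds[OF T, of 1 n] by (auto simp: dyadic_def)
  obtain UW where UW: "\<And>\<omega>. 0 \<le> UW \<omega>" "moment_bound M (2 * p) UW (D1 * B2)"
     "AE \<omega> in M. \<forall>n k. k < 2 ^ n \<longrightarrow> norm (W (dyadic T n (Suc k)) \<omega> - W (dyadic T n k) \<omega>) \<le> UW \<omega> * (T / 2 ^ n) powr \<alpha>"
  proof -
    have "moment_bound M (2 * p) (\<lambda>\<omega>. W (dyadic T n (Suc k)) \<omega> - W (dyadic T n k) \<omega>) (B2 * (T / 2 ^ n) powr \<beta>)" for n k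
    proof (rule moment_bound_le[OF W_incr_moment[OF p(2)]])
      have "sqrt (T / 2 ^ n) \<le> T powr (1/2 - \<beta>) * (T / 2 ^ n) powr \<beta>"
        using h[of n] T \<alpha> by (intro interpolate_sqrt(1)) auto
      then have "\<bar>gauss_const CARD('n) (2 * p)\<bar> * sqrt (T / 2 ^ n) \<le> \<bar>gauss_const CARD('n) (2 * p)\<bar> * (T powr (1/2 - \<beta>) * (T / 2 ^ n) powr \<beta>)"
        by (rule mult_left_mono) simp
      moreover have "gauss_const CARD('n) (2 * p) * sqrt (T / 2 ^ n) \<le> \<bar>gauss_const CARD('n) (2 * p)\<bar> * sqrt (T / 2 ^ n)"
        using T by (intro mult_right_mono) auto
      ultimately show "gauss_const CARD('n) (2 * p) * sqrt (T / 2 ^ n) \<le> B2 * (T / 2 ^ n) powr \<beta>"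
        by (simp add: B2_def mult.assoc)
    qed
    then show ?thesis using D1(2)[of B2 "\<lambda>n k \<omega>. W (dyadic T n (Suc k)) \<omega> - W (dyadic T n k) \<omega>"] B2 that by blast
  qed
  define C1 where "C1 = 2 * 2 powr \<alpha> / (1 - 2 powr (- (\<alpha> / 2)))"
  define C2 where "C2 = 2 * 2 powr (2 * \<alpha>) / (1 - 2 powr (- \<alpha>))"
  have \<alpha>0: "\<alpha> > 0" using \<alpha> by simp
  have "2 powr (- \<alpha>) < (2::real) powr 0" "2 powr (- (\<alpha> / 2)) < (2::real) powr 0" using \<alpha>0 by (intro powr_less_mono; simp)+
  then have C: "C1 > 0" "C2 > 0" unfolding C1_def C2_def by auto
  define k1 where "k1 = D1 * B1"
  define K where "K = C1 * k1 + C2 * (D2 * B3 + C1\<^sup>2 * (k1 * (2 * (D1 * B2) + k1)))"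
  have k1: "k1 > 0" using D1(1) B1(1) by (simp add: k1_def)
  have K: "K > 0" unfolding K_def using C k1 D1(1) D2(1) B2 B3(1)
    by (intro add_pos_nonneg mult_nonneg_nonneg add_nonneg_nonneg mult_pos_pos) auto
  obtain cc KK e0 \<kappa> a where en: "euler_noise M A (cov_mat A) cc KK e0 \<kappa> a" by (rule euler_noise_constants)
  have a: "a > 0" "\<And>x. norm (A *v x) \<le> a * norm x"
    using en unfolding euler_noise_def euler_noise_axioms_def by blast+
  have "Lq_norm M q (\<lambda>\<omega>. rough_dist T \<alpha> (\<lambda>t. A *v X m t \<omega>) (\<lambda>t. W t \<omega>) (\<lambda>s t. corrected_area A WW s t \<omega>))
      \<le> ennreal (2 * K * m powr (1/2 - \<beta>))" if m: "0 < m" "m \<le> 1" for m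
  proof -
    define \<mu> where "\<mu> = m powr (1/2 - \<beta>)"
    have \<mu>: "0 < \<mu>" "\<mu> \<le> 1" using m \<alpha> by (auto simp: \<mu>_def powr_le1)
    obtain UP where UP: "\<And>\<omega>. 0 \<le> UP \<omega>" "moment_bound M (2 * p) UP (D1 * (B1 * \<mu>))"
       "AE \<omega> in M. \<forall>n k. k < 2 ^ n \<longrightarrow> norm (P m (dyadic T n (Suc k)) \<omega> - P m (dyadic T n k) \<omega>) \<le> UP \<omega> * (T / 2 ^ n) powr \<alpha>"
    proof -
      have "moment_bound M (2 * p) (\<lambda>\<omega>. P m (dyadic T n (Suc k)) \<omega> - P m (dyadic T n k) \<omega>) (B1 * \<mu> * (T / 2 ^ n) powr \<beta>)" if k: "k < 2 ^ n" for n k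
      proof (cases "T / 2 ^ n \<le> m")
        case True
        then have "B1 * sqrt (T / 2 ^ n) \<le> B1 * (m powr (1/2 - \<beta>) * (T / 2 ^ n) powr \<beta>)"
          using interpolate_sqrt(1)[OF m(1) h(1), of \<beta> n] \<alpha> B1(1) by (intro mult_left_mono) auto
        then show ?thesis using moment_bound_le B1(2)[OF m(1) k] unfolding \<mu>_def mult.assoc by blast
      next
        case False
        then have "B1 * sqrt m \<le> B1 * (m powr (1/2 - \<beta>) * (T / 2 ^ n) powr \<beta>)"
          using interpolate_sqrt(2)[OF m(1) h(1), of \<beta> n] \<alpha> B1(1) by (intro mult_left_mono) auto
        then show ?thesis using moment_bound_le B1(2)[OF m(1) k] unfolding \<mu>_def mult.assoc by blast
      qed
      then show ?thesis using D1(2)[of "B1 * \<mu>" "\<lambda>n k \<omega>. P m (dyadic T n (Suc k)) \<omega> - P m (dyadic T n k) \<omega>"] B1(1) \<mu> that by force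
    qed
    obtain UD where UD: "\<And>\<omega>. 0 \<le> UD \<omega>" "moment_bound M p UD (D2 * (B3 * \<mu>))"
       "AE \<omega> in M. \<forall>n k. k < 2 ^ n \<longrightarrow> norm (area_error m (dyadic T n k) (dyadic T n (Suc k)) \<omega>) \<le> UD \<omega> * (T / 2 ^ n) powr (2 * \<alpha>)"
    proof -
      have "moment_bound M p (area_error m (dyadic T n k) (dyadic T n (Suc k))) (B3 * \<mu> * (T / 2 ^ n) powr (2 * \<beta>))" if k: "k < 2 ^ n" for n k
      proof (cases "T / 2 ^ n \<le> m")
        case True
        then have "B3 * (T / 2 ^ n) \<le> B3 * (m powr (1/2 - \<beta>) * (T / 2 ^ n) powr (2 * \<beta>))"
          using interpolate_area(1)[OF m h(1), of \<beta> n] \<alpha> B3(1) by (intro mult_left_mono) auto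
        then show ?thesis using moment_bound_le B3(2)[OF m(1) k] True unfolding \<mu>_def mult.assoc by blast
      next
        case False
        then have F: "m \<le> T / 2 ^ n" by simp
        then have "B3 * (sqrt m * sqrt (T / 2 ^ n)) \<le> B3 * (m powr (1/2 - \<beta>) * (T / 2 ^ n) powr (2 * \<beta>))"
          using interpolate_area(2)[OF m h(1), of \<beta> n] \<alpha> B3(1) by (intro mult_left_mono) auto
        then show ?thesis using moment_bound_le B3(2)[OF m(1) k] F unfolding \<mu>_def mult.assoc by blast
      qed
      then show ?thesis using D2(2)[of "B3 * \<mu>" "\<lambda>n k. area_error m (dyadic T n k) (dyadic T n (Suc k))"] B3(1) \<mu> that by force
    qed
    define V where "V \<omega> = C1 * UP \<omega> + C2 * (UD \<omega> + C1\<^sup>2 * (UP \<omega> * (2 * UW \<omega> + UP \<omega>)))" for \<omega>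
    have V0: "V \<omega> \<ge> 0" for \<omega> using C UP(1)[of \<omega>] UW(1)[of \<omega>] UD(1)[of \<omega>] by (simp add: V_def)
    have mV: "moment_bound M p V (K * \<mu>)"
    proof -
      have sc: "moment_bound M q' (\<lambda>\<omega>. c * Z \<omega>) (c * x)" if "moment_bound M q' Z x" "c \<ge> 0" for q' c Z x
        using moment_bound_scaleR[OF that(1), of c] that(2) by simp
      have pr: "moment_bound M p (\<lambda>\<omega>. UP \<omega> * (2 * UW \<omega> + UP \<omega>)) (D1 * (B1 * \<mu>) * (2 * (D1 * B2) + D1 * (B1 * \<mu>)))"
        by (rule moment_bound_prod[OF UP(2) moment_bound_add[OF sc[OF UW(2)] UP(2) p(2)]]) (auto simp: abs_mult)
      have "moment_bound M p V (C1 * (D1 * (B1 * \<mu>)) + C2 * (D2 * (B3 * \<mu>) + C1\<^sup>2 * (D1 * (B1 * \<mu>) * (2 * (D1 * B2) + D1 * (B1 * \<mu>)))))"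
        unfolding V_def[abs_def] using C
        by (intro moment_bound_add sc UD(2) pr moment_bound_lower[OF UP(2)] p) auto
      then show ?thesis
      proof (rule moment_bound_le)
        have "k1 * \<mu> \<le> k1 * 1" using k1 \<mu> by (intro mult_left_mono) auto
        then have z: "k1 * \<mu> * (2 * (D1 * B2) + k1 * \<mu>) \<le> k1 * \<mu> * (2 * (D1 * B2) + k1)"
          using k1 \<mu> by (intro mult_left_mono) auto
        have "C1 * (k1 * \<mu>) + C2 * (D2 * B3 * \<mu> + C1\<^sup>2 * (k1 * \<mu> * (2 * (D1 * B2) + k1 * \<mu>)))
           \<le> C1 * (k1 * \<mu>) + C2 * (D2 * B3 * \<mu> + C1\<^sup>2 * (k1 * \<mu> * (2 * (D1 * B2) + k1)))"
          by (rule add_left_mono, rule mult_left_mono, rule add_left_mono, rule mult_left_mono[OF z]) (use C in auto)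
        also have "\<dots> = K * \<mu>" by (simp add: K_def algebra_simps)
        finally show "C1 * (D1 * (B1 * \<mu>)) + C2 * (D2 * (B3 * \<mu>) + C1\<^sup>2 * (D1 * (B1 * \<mu>) * (2 * (D1 * B2) + D1 * (B1 * \<mu>)))) \<le> K * \<mu>"
          by (simp add: k1_def mult.assoc)
      qed
    qed
    have WWc: "AE \<omega> in M. continuous_on {(s, t). 0 \<le> s \<and> s \<le> t \<and> t \<le> T} (\<lambda>(s, t). WW s t \<omega>)"
      using area unfolding stratonovich_area_def by blast
    have "AE \<omega> in M. rough_dist T \<alpha> (\<lambda>t. A *v X m t \<omega>) (\<lambda>t. W t \<omega>) (\<lambda>s t. corrected_area A WW s t \<omega>) \<le> ennreal (norm (V \<omega>))"
      using langevin_path_AE[OF sol[OF m(1)] bm m(1) a] WW_chen WW_diag WWc UP(3) UW(3) UD(3)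
    proof eventually_elim
      case (elim \<omega>)
      from rough_dist_pathwise[OF m(1) \<alpha>0 UP(1) UW(1) UD(1) elim C1_def C2_def]
      show ?case using V0[of \<omega>] by (simp add: V_def)
    qed
    then have "Lq_norm M q (\<lambda>\<omega>. rough_dist T \<alpha> (\<lambda>t. A *v X m t \<omega>) (\<lambda>t. W t \<omega>) (\<lambda>s t. corrected_area A WW s t \<omega>)) \<le> ennreal (2 * (K * \<mu>))"
      using K \<mu> q p by (intro Lq_norm_le_moment_bound[OF mV]) auto
    then show ?thesis by (simp add: \<mu>_def mult.assoc)
  qed
  then show ?thesis using K by (intro exI[of _ "2 * K"]) auto
qed

end

theorem theorem1:
  fixes \<Omega> :: "'w measure"
    and M :: "real^'n^'n"
    and W :: "real \<Rightarrow> 'w \<Rightarrow> real^'n"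
    and WW :: "real \<Rightarrow> real \<Rightarrow> 'w \<Rightarrow> real^'n^'n"
    and X P :: "real \<Rightarrow> real \<Rightarrow> 'w \<Rightarrow> real^'n"
    and T q \<alpha> :: real
  assumes "prob_space \<Omega>"
    and "T > 0"
    and "eigenvalues_pos_real_part M"
    and "brownian_motion \<Omega> W"
    and "\<And>m. m > 0 \<Longrightarrow> langevin_solution \<Omega> M W m (X m) (P m)"
    and "stratonovich_area \<Omega> T W WW"
    and "q \<ge> 1"
    and "1/3 < \<alpha>" and "\<alpha> < 1/2"
  shows "((\<lambda>m. Lq_norm \<Omega> q (\<lambda>\<omega>. rough_dist T \<alpha> (\<lambda>t. M *v X m t \<omega>) (\<lambda>t. W t \<omega>)
             (\<lambda>s t. corrected_area M WW s t \<omega>))) \<longlongrightarrow> 0) (at_right 0)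
    \<and> (\<forall>\<eta> < 1/2 - \<alpha>. \<exists>K::real. \<forall>\<^sub>F m in at_right 0.
          Lq_norm \<Omega> q (\<lambda>\<omega>. rough_dist T \<alpha> (\<lambda>t. M *v X m t \<omega>) (\<lambda>t. W t \<omega>)
             (\<lambda>s t. corrected_area M WW s t \<omega>)) \<le> ennreal (K * m powr \<eta>))"
proof -
  interpret langevin_setting \<Omega> M W WW X P T
    using assms by (simp add: langevin_setting_def langevin_setting_axioms_def)
  let ?L = "\<lambda>m. Lq_norm \<Omega> q (\<lambda>\<omega>. rough_dist T \<alpha> (\<lambda>t. M *v X m t \<omega>) (\<lambda>t. W t \<omega>) (\<lambda>s t. corrected_area M WW s t \<omega>))"
  have rate: "\<exists>K>0. \<forall>\<^sub>F m in at_right 0. ?L m \<le> ennreal (K * m powr \<eta>)" if \<eta>: "\<eta> < 1/2 - \<alpha>" for \<eta>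
  proof -
    \<comment> \<open>Strictly between \<open>\<alpha>\<close> and \<open>1/2\<close>, with \<open>1/2 - \<beta> \<ge> \<eta>\<close> and \<open>1/2 - \<beta> > 0\<close>, also for negative \<open>\<eta>\<close>.\<close>
    define \<beta> where "\<beta> = (\<alpha> + min (1/2) (1/2 - \<eta>)) / 2"
    have \<beta>: "\<alpha> < \<beta>" "\<beta> < 1/2" "\<beta> \<le> 1/2 - \<eta>" using \<eta> assms(9) by (auto simp: \<beta>_def min_def field_simps)
    obtain K where K: "K > 0" "\<And>m. 0 < m \<Longrightarrow> m \<le> 1 \<Longrightarrow> ?L m \<le> ennreal (K * m powr (1/2 - \<beta>))"
      using rough_dist_rate[OF assms(8) \<beta>(1,2) assms(7)] by blast
    have "\<forall>\<^sub>F m::real in at_right 0. 0 < m \<and> m < 1"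
      by (intro eventually_conj eventually_at_right_less) (simp add: eventually_at_right_field, metis zero_less_one)
    then have "\<forall>\<^sub>F m in at_right 0. ?L m \<le> ennreal (K * m powr \<eta>)"
    proof eventually_elim
      case (elim m)
      have "m powr (1/2 - \<beta>) \<le> m powr \<eta>" using elim \<beta> by (intro powr_mono') auto
      then have "ennreal (K * m powr (1/2 - \<beta>)) \<le> ennreal (K * m powr \<eta>)"
        using K(1) by (intro ennreal_leI mult_left_mono) auto
      then show ?case using K(2)[of m] elim by (meson less_imp_le order_trans)
    qed
    then show ?thesis using K(1) by blast
  qed
  define \<eta> where "\<eta> = (1/2 - \<alpha>) / 2"
  have \<eta>: "0 < \<eta>" "\<eta> < 1/2 - \<alpha>" using assms(9) by (auto simp: \<eta>_def)
  obtain K where K: "\<forall>\<^sub>F m in at_right 0. ?L m \<le> ennreal (K * m powr \<eta>)" using rate[OF \<eta>(2)] by blast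
  have "((\<lambda>m::real. ennreal (K * m powr \<eta>)) \<longlongrightarrow> ennreal (K * 0)) (at_right 0)"
  proof (intro tendsto_ennrealI tendsto_mult tendsto_const)
    show "((\<lambda>m::real. m powr \<eta>) \<longlongrightarrow> 0) (at_right 0)"
      using \<eta>(1) by (intro tendsto_zero_powrI[where b=\<eta>]) (auto simp: eventually_at_filter)
  qed
  then have "(?L \<longlongrightarrow> 0) (at_right 0)"
    by (intro tendsto_sandwich[of "\<lambda>_. 0" ?L "at_right 0" "\<lambda>m. ennreal (K * m powr \<eta>)"]) (use K in auto)
  then show ?thesis using rate by blast
qed

end
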